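(* There are ten mutation-equivalence classes of Fano polygon with residual basket $\mathcal{B}=\varnothing$. Representative polygons for each mutation-equivalence class are given by the convex hulls of the following ten vertex sets: (1) $(1,0),(0,1),(-1,-1)$; (2) $(1,0),(0,1),(-1,0),(0,-1)$; (3) $(1,0),(0,1),(-1,-1),(0,-1)$; (4) $(1,0),(1,1),(0,1),(-1,-1),(0,-1)$; (5) $(1,0),(1,1),(0,1),(-1,0),(-1,-1),(0,-1)$; (6) $(1,1),(-1,1),(-1,0),(0,-1),(1,-1)$; (7) $(1,1),(-1,1),(-1,-1),(1,-1)$; (8) $(1,1),(-2,1),(1,-2)$; (9) $(1,2),(-1,2),(-1,-2),(1,-2)$; (10) $(1,3),(-2,3),(1,-6)$.
   Context: Let $N=\mathbb{Z}^2$, $N_{\mathbb{Q}}=N\otimes_{\mathbb{Z}}\mathbb{Q}$, $M=\operatorname{Hom}(N,\mathbb{Z})$. A Fano polygon is a convex polygon $P\subset N_{\mathbb{Q}}$ whose vertices are primitive lattice points of $N$ and which contains the origin in its strict interior; polygons are considered up to $GL_2(\mathbb{Z})$-equivalence. For an edge $E$ of $P$ with primitive inner normal $w_E\in M$, the height is $r_E=-w_E(E)>0$ and the width is $k_E=|E\cap N|-1$. The residual basket $\mathcal{B}$ of $P$ is empty if and only if $r_E$ divides $k_E$ for every edge $E$ of $P$ (i.e. the cone over every edge is a $T$-cone). Mutation. Let $w\in M$ be the primitive inner normal vector of an edge $E$ of $P$, let $h_{\min}=\min_{v\in P}w(v)=-r_E<0$ and $h_{\max}=\max_{v\in P}w(v)>0$.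 For $h\in\mathbb{Z}$ let $w_h(P)$ be the (possibly empty) convex hull of $\{v\in P\cap N: w(v)=h\}$. Let $v_E\in N$ be primitive with $w(v_E)=0$ (unique up to sign) and $F=\operatorname{conv}\{0,v_E\}$. Suppose that for every integer $h$ with $h_{\min}\leq h<0$ there is a (possibly empty) lattice polytope $G_h\subset N_{\mathbb{Q}}$ with $\{v \text{ a vertex of } P: w(v)=h\}\subseteq G_h+|h|F\subseteq w_h(P)$ (Minkowski sum, with $\varnothing+Q=\varnothing$). Then the mutation of $P$ is $\operatorname{mut}_w(P,F)=\operatorname{conv}\big(\bigcup_{h=h_{\min}}^{-1}G_h\cup\bigcup_{h=0}^{h_{\max}}(w_h(P)+hF)\big)$. It is again a Fano polygon, is independent of the choice of $\{G_h\}$, and up to $GL_2(\mathbb{Z})$ is independent of the sign of $v_E$. Two Fano polygons are mutation-equivalent if, up to $GL_2(\mathbb{Z})$-equivalence, they are connected by a finite sequence of mutations. *)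

theory Defs
  imports "HOL-Analysis.Analysis"
begin

text \<open>
  Polygons live in \<open>N \<otimes> \<real>\<close>, modelled as \<^typ>\<open>real \<times> real\<close>, with \<open>N\<close> the subset of
  integral points. Every polytope below is the convex hull of lattice points, so working over
  the reals instead of the rationals makes no difference. The dual lattice \<open>M\<close> is
  \<^typ>\<open>int \<times> int\<close>, acting through the dual basis.
\<close>

type_synonym point = "real \<times> real"

definition lattice :: "point set" where
  "lattice = {(of_int a, of_int b) | a b :: int. True}"

definition primitive_points :: "point set" where
  "primitive_points = {(of_int a, of_int b) | a b :: int. coprime a b}"

definition pairing :: "int \<times> int \<Rightarrow> point \<Rightarrow> real" where
  "pairing w v = of_int (fst w) * fst v + of_int (snd w) * snd v"

text \<open>The empty polytope is allowed.\<close>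

definition lattice_polytope :: "point set \<Rightarrow> bool" where
  "lattice_polytope G \<longleftrightarrow> (\<exists>V. finite V \<and> V \<subseteq> lattice \<and> G = convex hull V)"

definition fano_polygon :: "point set \<Rightarrow> bool" where
  "fano_polygon P \<longleftrightarrow>
     polytope P \<and> {v. v extreme_point_of P} \<subseteq> primitive_points \<and> 0 \<in> interior P"

definition GL2Z_equivalent :: "point set \<Rightarrow> point set \<Rightarrow> bool" where
  "GL2Z_equivalent P Q \<longleftrightarrow>
     (\<exists>a b c d :: int. \<bar>a * d - b * c\<bar> = 1 \<and>
        Q = (\<lambda>(x, y). (of_int a * x + of_int b * y, of_int c * x + of_int d * y)) ` P)"

text \<open>
  The last condition, applied to two points of \<open>E\<close>, also says that \<open>w\<close> is constant on \<open>E\<close>.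
  An edge of a Fano polygon has exactly one such \<open>w\<close>.
\<close>

definition primitive_inner_normal :: "point set \<Rightarrow> point set \<Rightarrow> int \<times> int \<Rightarrow> bool" where
  "primitive_inner_normal P E w \<longleftrightarrow>
     coprime (fst w) (snd w) \<and> (\<forall>e\<in>E. \<forall>v\<in>P. pairing w e \<le> pairing w v)"

definition edge_width :: "point set \<Rightarrow> int" where
  "edge_width E = int (card (E \<inter> lattice)) - 1"

text \<open>The integer \<open>r\<close> is the height of the edge \<open>E\<close>.\<close>

definition cone_over_edge_is_T :: "point set \<Rightarrow> point set \<Rightarrow> bool" where
  "cone_over_edge_is_T P E \<longleftrightarrow>
     (\<exists>w r. primitive_inner_normal P E w \<and> (\<forall>v\<in>E. pairing w v = - of_int r) \<and>
        r dvd edge_width E)"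

definition empty_residual_basket :: "point set \<Rightarrow> bool" where
  "empty_residual_basket P \<longleftrightarrow> (\<forall>E. E edge_of P \<longrightarrow> cone_over_edge_is_T P E)"


text \<open>Infimum and supremum are attained, as polytopes are compact.\<close>

definition h_min :: "int \<times> int \<Rightarrow> point set \<Rightarrow> real" where
  "h_min w P = (INF v\<in>P. pairing w v)"

definition h_max :: "int \<times> int \<Rightarrow> point set \<Rightarrow> real" where
  "h_max w P = (SUP v\<in>P. pairing w v)"

definition slice :: "int \<times> int \<Rightarrow> int \<Rightarrow> point set \<Rightarrow> point set" where
  "slice w h P = convex hull {v \<in> P \<inter> lattice. pairing w v = of_int h}"

definition dilate :: "int \<Rightarrow> point set \<Rightarrow> point set" where
  "dilate h F = (\<lambda>v. of_int h *\<^sub>R v) ` F"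

text \<open>Sums of sets, here and below, are Minkowski sums.\<close>

definition mutation_data ::
  "point set \<Rightarrow> int \<times> int \<Rightarrow> point set \<Rightarrow> (int \<Rightarrow> point set) \<Rightarrow> bool" where
  "mutation_data P w F G \<longleftrightarrow>
     (\<forall>h::int. h_min w P \<le> of_int h \<and> h < 0 \<longrightarrow>
        lattice_polytope (G h) \<and>
        {v. v extreme_point_of P \<and> pairing w v = of_int h} \<subseteq> G h + dilate \<bar>h\<bar> F \<and>
        G h + dilate \<bar>h\<bar> F \<subseteq> slice w h P)"

definition mut ::
  "int \<times> int \<Rightarrow> point set \<Rightarrow> point set \<Rightarrow> (int \<Rightarrow> point set) \<Rightarrow> point set" where
  "mut w P F G = convex hull
     ((\<Union>h\<in>{h::int. h_min w P \<le> of_int h \<and> h \<le> -1}. G h) \<union>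
      (\<Union>h\<in>{h::int. 0 \<le> h \<and> of_int h \<le> h_max w P}. slice w h P + dilate h F))"

definition mutation_of :: "point set \<Rightarrow> point set \<Rightarrow> bool" where
  "mutation_of P Q \<longleftrightarrow>
     (\<exists>E w v G. E edge_of P \<and> primitive_inner_normal P E w \<and>
        v \<in> primitive_points \<and> pairing w v = 0 \<and>
        mutation_data P w (convex hull {0, v}) G \<and>
        Q = mut w P (convex hull {0, v}) G)"

definition mutation_step :: "point set \<Rightarrow> point set \<Rightarrow> bool" where
  "mutation_step P Q \<longleftrightarrow>
     fano_polygon P \<and> fano_polygon Q \<and> (GL2Z_equivalent P Q \<or> mutation_of P Q)"

text \<open>
  Steps may be traversed in both directions. Since the inverse of a mutation is again a mutation
  (with respect to \<open>-w\<close>), this is the same as being joined by a directed sequence of steps.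
\<close>

definition mutation_equivalence :: "(point set \<times> point set) set" where
  "mutation_equivalence =
     {(P, Q). fano_polygon P \<and> fano_polygon Q \<and> equivclp mutation_step P Q}"

definition empty_basket_polygons :: "point set set" where
  "empty_basket_polygons = {P. fano_polygon P \<and> empty_residual_basket P}"

definition representatives :: "point set list" where
  "representatives = map (\<lambda>V. convex hull V)
    [{(1,0), (0,1), (-1,-1)},
     {(1,0), (0,1), (-1,0), (0,-1)},
     {(1,0), (0,1), (-1,-1), (0,-1)},
     {(1,0), (1,1), (0,1), (-1,-1), (0,-1)},
     {(1,0), (1,1), (0,1), (-1,0), (-1,-1), (0,-1)},
     {(1,1), (-1,1), (-1,0), (0,-1), (1,-1)},
     {(1,1), (-1,1), (-1,-1), (1,-1)},
     {(1,1), (-2,1), (1,-2)},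
     {(1,2), (-1,2), (-1,-2), (1,-2)},
     {(1,3), (-2,3), (1,-6)}]"

end

(*
A mutation shears the part of a polygon on one side of the kernel of w, so it acts on support
functions by a piecewise linear map of the dual lattice. Hence the number of lattice points of the
polar polygon is an invariant, and so is the property that all edge normals lie in a sublattice of
index two. The former separates the ten representatives except (2) from (3), and the latter
separates these two.

Conversely, an edge with empty residual basket can always be mutated, and if its height exceeds the
maximum of w on the polygon, the number of lattice points drops. This reduces to polygons in which
every edge is matched by a point at least as far on the other side. For an edge of maximal height,
this symmetry together with a lattice point in the polar polygon forces the polygon to be one of
eight triangles or to fit into a strip of width two; in a strip, mutating one side away leaves
finitely many polygons. Explicit chains of mutations join all of these to the representatives.
*)
theory Submission
  imports Defs
begin

text \<open>The vertices of a mutation depend on rounding to lattice points on every level and on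
  the chosen \<open>G\<^sub>h\<close>, so they are never computed for a general polygon. Everything
  is read off instead from the dual map: its two linear halves describe the support function, the
  faces and, through intersections of half-planes, the single levels of the mutation. The levels are
  what lattice points are counted with: level \<open>h\<close> changes by at most \<open>h\<close>
  points, so the sum over the levels from \<open>- r\<close> to \<open>r - 1\<close> is negative,
  which explains why the descent treats exactly the unmatched edges. Maximality of the height gives
  rigidity: an edge whose normal pushes both coordinates of an end of the highest edge outwards
  would be higher than that edge. This pins one side to a vertical line and the remaining normals to
  a quadrant, and the T-cone condition turns the rest into divisibility. The lattice point of the
  polar polygon is needed where the vertical side has distance at least two from the origin; there
  it supplies the third side of the triangle.\<close>

section \<open>Combinatorial mutation as a symmetric relation\<close>

text \<open>A symmetric description of mutation: \<open>mrel w v P Q\<close> amounts to \<open>mrel (-w) v Q P\<close>. The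
  generators of either polygon are only tested for membership in the other one, which suffices to
  determine the support function and the faces of one polygon from those of the other.\<close>

definition mrel :: "point \<Rightarrow> point \<Rightarrow> point set \<Rightarrow> point set \<Rightarrow> bool" where
  "mrel w v P Q \<longleftrightarrow> w \<bullet> v = 0 \<and> (\<exists>X S. P = convex hull X \<and> Q = convex hull S \<and>
     (\<forall>s\<in>S. (w \<bullet> s \<le> 0 \<longrightarrow> s \<in> P \<and> s - (w \<bullet> s) *\<^sub>R v \<in> P) \<and>
        (0 \<le> w \<bullet> s \<longrightarrow> (\<exists>t\<in>{0..1}. s - (t * (w \<bullet> s)) *\<^sub>R v \<in> P))) \<and>
     (\<forall>x\<in>X. (w \<bullet> x \<le> 0 \<longrightarrow> (\<exists>t\<in>{0..1}. x + (t * (w \<bullet> x)) *\<^sub>R v \<in> Q)) \<and>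
        (0 \<le> w \<bullet> x \<longrightarrow> x \<in> Q \<and> x + (w \<bullet> x) *\<^sub>R v \<in> Q)))"

definition minf :: "point \<Rightarrow> point set \<Rightarrow> point set" where
  "minf u P = {z \<in> P. \<forall>x\<in>P. u \<bullet> z \<le> u \<bullet> x}"

lemma minf_iff: "z \<in> minf u P \<longleftrightarrow> z \<in> P \<and> (\<forall>x\<in>P. u \<bullet> z \<le> u \<bullet> x)"
  by (simp add: minf_def)

text \<open>Transfers a statement about a face from generators to their hull: if every generator
  lies strictly inside the half-plane, or on its boundary and in \<open>A\<close>, so does every
  point of the hull. A proper convex combination reaches the boundary only if both points
  do.\<close>

lemma convex_open_halfspace_Un_face:
  assumes "convex A"
  shows "convex ({z. c < u \<bullet> z} \<union> {z \<in> A. u \<bullet> z = (c::real)})"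
proof (rule convexI)
  fix x y and a b :: real
  assume xy: "x \<in> {z. c < u \<bullet> z} \<union> {z \<in> A. u \<bullet> z = c}" "y \<in> {z. c < u \<bullet> z} \<union> {z \<in> A. u \<bullet> z = c}"
    and ab: "0 \<le> a" "0 \<le> b" "a + b = 1"
  have le: "c \<le> u \<bullet> x" "c \<le> u \<bullet> y" using xy by auto
  have u: "u \<bullet> (a *\<^sub>R x + b *\<^sub>R y) = a * (u \<bullet> x) + b * (u \<bullet> y)" by (simp add: inner_add_right)
  have c: "c = a * c + b * c" using ab by (simp flip: distrib_right)
  consider "a = 0" | "b = 0" | "0 < a" "0 < b" using ab by linarith
  then show "a *\<^sub>R x + b *\<^sub>R y \<in> {z. c < u \<bullet> z} \<union> {z \<in> A. u \<bullet> z = c}"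
  proof cases
    case 1 then show ?thesis using ab xy by simp
  next
    case 2 then show ?thesis using ab xy by simp
  next
    case 3
    show ?thesis
    proof (cases "u \<bullet> x = c \<and> u \<bullet> y = c")
      case True
      then have "x \<in> A" "y \<in> A" using xy by auto
      then have "a *\<^sub>R x + b *\<^sub>R y \<in> A" using ab assms by (auto simp: convexD)
      moreover have "u \<bullet> (a *\<^sub>R x + b *\<^sub>R y) = c" using True u c by simp
      ultimately show ?thesis by simp
    next
      case False
      then have "c < u \<bullet> x \<or> c < u \<bullet> y" using le by auto
      then have "a * c + b * c < a * (u \<bullet> x) + b * (u \<bullet> y)"
      proof
        assume "c < u \<bullet> x"
        then show ?thesis using 3 le by (intro add_less_le_mono mult_strict_left_mono mult_left_mono) auto
      next
        assume "c < u \<bullet> y"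
        then show ?thesis using 3 le by (intro add_le_less_mono mult_strict_left_mono mult_left_mono) auto
      qed
      then show ?thesis using u c by auto
    qed
  qed
qed

lemma mrel_sym: "mrel w v P Q \<Longrightarrow> mrel (-w) v Q P"
  unfolding mrel_def
  apply (elim conjE exE)
  subgoal for X S
    apply (intro conjI)
     apply simp
    apply (rule exI[of _ S], rule exI[of _ X])
    apply simp
    done
  done

lemma mrel_orth: "mrel w v P Q \<Longrightarrow> w \<bullet> v = 0"
  by (simp add: mrel_def)

section \<open>Support functions, minimising faces and levels of a mutation\<close>

lemma hull_ge: "(\<And>s. s \<in> S \<Longrightarrow> c \<le> u \<bullet> s) \<Longrightarrow> z \<in> convex hull S \<Longrightarrow> c \<le> u \<bullet> (z::point)"
  using hull_minimal[of S "{z. u \<bullet> z \<ge> c}" convex] convex_halfspace_ge[of c u] by blast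

text \<open>A generator of \<open>Q\<close> above the kernel of \<open>w\<close> arises from a point
  of \<open>P\<close> by adding a nonnegative multiple of \<open>v\<close>, and one below it already
  lies in \<open>P\<close>. If \<open>u\<close> is nonnegative on \<open>v\<close>, neither can
  violate a lower bound of \<open>u\<close> on \<open>P\<close>.\<close>

lemma mrel_dual1:
  assumes "mrel w v P Q" "0 \<le> u \<bullet> v" "\<And>z. z \<in> P \<Longrightarrow> c \<le> u \<bullet> z" "z \<in> Q"
  shows "c \<le> u \<bullet> z"
proof -
  obtain X S where XS: "P = convex hull X" "Q = convex hull S"
    "\<And>s. s \<in> S \<Longrightarrow> w \<bullet> s \<le> 0 \<Longrightarrow> s \<in> P"
    "\<And>s. s \<in> S \<Longrightarrow> 0 \<le> w \<bullet> s \<Longrightarrow> (\<exists>t\<in>{0..1}. s - (t * (w \<bullet> s)) *\<^sub>R v \<in> P)"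
    using assms(1) unfolding mrel_def by blast
  have "c \<le> u \<bullet> s" if s: "s \<in> S" for s
  proof (cases "w \<bullet> s \<le> 0")
    case True then show ?thesis using XS(3)[OF s] assms(3) by blast
  next
    case False
    then obtain t where t: "0 \<le> t" "s - (t * (w \<bullet> s)) *\<^sub>R v \<in> P" using XS(4)[OF s] by auto
    have "c \<le> u \<bullet> (s - (t * (w \<bullet> s)) *\<^sub>R v)" using assms(3) t by blast
    moreover have "0 \<le> t * (w \<bullet> s) * (u \<bullet> v)" using t False assms(2) by simp
    ultimately show ?thesis by (simp add: inner_diff_right)
  qed
  then show ?thesis using hull_ge XS(2) assms(4) by blast
qed

text \<open>The transpose of the shear that sends \<open>z\<close> to
  \<open>z - (w \<bullet> z) v\<close> sends \<open>u\<close> to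
  \<open>u - (u \<bullet> v) w\<close>, so on this half of the dual plane the bound travels through
  the shear. Above the kernel only the fraction \<open>t\<close> of the shear is undone; the
  remaining \<open>1 - t\<close> helps because \<open>u \<bullet> v\<close> is nonpositive.\<close>

lemma mrel_dual2:
  assumes "mrel w v P Q" "u \<bullet> v \<le> 0" "\<And>z. z \<in> P \<Longrightarrow> c \<le> u \<bullet> z" "z \<in> Q"
  shows "c \<le> (u - (u \<bullet> v) *\<^sub>R w) \<bullet> z"
proof -
  obtain X S where XS: "P = convex hull X" "Q = convex hull S"
    "\<And>s. s \<in> S \<Longrightarrow> w \<bullet> s \<le> 0 \<Longrightarrow> s - (w \<bullet> s) *\<^sub>R v \<in> P"
    "\<And>s. s \<in> S \<Longrightarrow> 0 \<le> w \<bullet> s \<Longrightarrow> (\<exists>t\<in>{0..1}. s - (t * (w \<bullet> s)) *\<^sub>R v \<in> P)"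
    using assms(1) unfolding mrel_def by blast
  have "c \<le> (u - (u \<bullet> v) *\<^sub>R w) \<bullet> s" if s: "s \<in> S" for s
  proof (cases "w \<bullet> s \<le> 0")
    case True
    then have "c \<le> u \<bullet> (s - (w \<bullet> s) *\<^sub>R v)" using XS(3)[OF s] assms(3) by blast
    then show ?thesis by (simp add: inner_diff_right inner_diff_left mult.commute)
  next
    case False
    then obtain t where t: "0 \<le> t" "t \<le> 1" "s - (t * (w \<bullet> s)) *\<^sub>R v \<in> P" using XS(4)[OF s] by auto
    have "c \<le> u \<bullet> (s - (t * (w \<bullet> s)) *\<^sub>R v)" using assms(3) t by blast
    moreover have "0 \<le> (1 - t) * ((w \<bullet> s) * (- (u \<bullet> v)))" using t False assms(2)
      by (intro mult_nonneg_nonneg) auto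
    ultimately show ?thesis by (simp add: inner_diff_right inner_diff_left algebra_simps)
  qed
  then show ?thesis using hull_ge XS(2) assms(4) by blast
qed

text \<open>With \<open>u \<bullet> v\<close> strictly positive, a generator that really had to be
  moved along \<open>v\<close> is strictly above the minimum, so the minimising face of
  \<open>Q\<close> is spanned by generators inside \<open>P\<close>.\<close>

lemma mrel_face1_subset:
  assumes m: "mrel w v P Q" and uv: "0 < u \<bullet> v"
  shows "minf u Q \<subseteq> minf u P"
proof
  fix z assume z: "z \<in> minf u Q"
  define c where "c = u \<bullet> z"
  have Qc: "\<And>x. x \<in> Q \<Longrightarrow> c \<le> u \<bullet> x" using z by (auto simp: minf_iff c_def)
  have Pc: "c \<le> u \<bullet> x" if "x \<in> P" for x
    using mrel_dual1[OF mrel_sym[OF m], of u c x] uv Qc that by simp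
  obtain X S where XS: "P = convex hull X" "Q = convex hull S"
    "\<And>s. s \<in> S \<Longrightarrow> w \<bullet> s \<le> 0 \<Longrightarrow> s \<in> P"
    "\<And>s. s \<in> S \<Longrightarrow> 0 \<le> w \<bullet> s \<Longrightarrow> (\<exists>t\<in>{0..1}. s - (t * (w \<bullet> s)) *\<^sub>R v \<in> P)"
    using m unfolding mrel_def by blast
  have "s \<in> {z. c < u \<bullet> z} \<union> {z \<in> P. u \<bullet> z = c}" if s: "s \<in> S" for s
  proof (cases "w \<bullet> s \<le> 0")
    case True then show ?thesis using XS(3)[OF s True] Pc[OF XS(3)[OF s True]] by auto
  next
    case False
    then obtain t where t: "0 \<le> t" "s - (t * (w \<bullet> s)) *\<^sub>R v \<in> P" using XS(4)[OF s] by auto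
    have c: "c \<le> u \<bullet> (s - (t * (w \<bullet> s)) *\<^sub>R v)" using Pc t by blast
    show ?thesis
    proof (cases "t = 0")
      case True then show ?thesis using t c by auto
    next
      case False
      then have "0 < t * (w \<bullet> s) * (u \<bullet> v)" using t \<open>\<not> w \<bullet> s \<le> 0\<close> uv by simp
      then show ?thesis using c by (simp add: inner_diff_right)
    qed
  qed
  then have "Q \<subseteq> {z. c < u \<bullet> z} \<union> {z \<in> P. u \<bullet> z = c}"
    unfolding XS(2) using XS(1) by (intro hull_minimal convex_open_halfspace_Un_face subsetI) auto
  then have "z \<in> P" using z by (auto simp: minf_iff c_def)
  then show "z \<in> minf u P" using Pc by (auto simp: minf_iff c_def)
qed

lemma mrel_face1:
  assumes m: "mrel w v P Q" and uv: "0 < u \<bullet> v"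
  shows "minf u Q = minf u P"
  using mrel_face1_subset[OF m uv] mrel_face1_subset[OF mrel_sym[OF m] uv] by blast

text \<open>The sheared form of the argument for positive \<open>u \<bullet> v\<close>: a generator
  above the kernel can lie on the minimising face only if its shear is undone completely
  (\<open>t = 1\<close>), so this face comes from a face of \<open>P\<close> by the shear.\<close>

lemma mrel_face2_subset:
  assumes m: "mrel w v P Q" and uv: "u \<bullet> v < 0" and z: "z \<in> minf (u - (u \<bullet> v) *\<^sub>R w) Q"
  shows "z - (w \<bullet> z) *\<^sub>R v \<in> minf u P"
proof -
  define u' where "u' = u - (u \<bullet> v) *\<^sub>R w"
  have wv: "w \<bullet> v = 0" using mrel_orth m by blast
  have u'v: "u' \<bullet> v = u \<bullet> v" by (simp add: u'_def inner_diff_left wv)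
  define c where "c = u' \<bullet> z"
  have Qc: "\<And>x. x \<in> Q \<Longrightarrow> c \<le> u' \<bullet> x" using z by (auto simp: minf_iff c_def u'_def)
  have Pc: "c \<le> u \<bullet> x" if "x \<in> P" for x
  proof -
    have "c \<le> (u' - (u' \<bullet> v) *\<^sub>R (- w)) \<bullet> x"
      by (rule mrel_dual2[OF mrel_sym[OF m]]) (use uv u'v Qc that in auto)
    then show ?thesis by (simp add: u'v) (simp add: u'_def)
  qed
  have sh: "u \<bullet> (s - (w \<bullet> s) *\<^sub>R v) = u' \<bullet> s" for s
    by (simp add: u'_def inner_diff_left inner_diff_right)
  obtain X S where XS: "P = convex hull X" "Q = convex hull S"
    "\<And>s. s \<in> S \<Longrightarrow> w \<bullet> s \<le> 0 \<Longrightarrow> s - (w \<bullet> s) *\<^sub>R v \<in> P"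
    "\<And>s. s \<in> S \<Longrightarrow> 0 \<le> w \<bullet> s \<Longrightarrow> (\<exists>t\<in>{0..1}. s - (t * (w \<bullet> s)) *\<^sub>R v \<in> P)"
    using m unfolding mrel_def by blast
  define A where "A = (\<lambda>s. s - (w \<bullet> s) *\<^sub>R v) -` P"
  have lin: "linear (\<lambda>s. s - (w \<bullet> s) *\<^sub>R v)"
    by (intro linearI) (auto simp: inner_add_right algebra_simps)
  have cA: "convex A" unfolding A_def using XS(1) lin
    by (intro convex_linear_vimage) auto
  have "s \<in> {z. c < u' \<bullet> z} \<union> {z \<in> A. u' \<bullet> z = c}" if s: "s \<in> S" for s
  proof (cases "w \<bullet> s \<le> 0")
    case True
    then have p: "s - (w \<bullet> s) *\<^sub>R v \<in> P" using XS(3)[OF s] by blast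
    then have "c \<le> u' \<bullet> s" using Pc[OF p] sh by simp
    then show ?thesis using p by (auto simp: A_def)
  next
    case False
    then obtain t where t: "t \<le> 1" "s - (t * (w \<bullet> s)) *\<^sub>R v \<in> P" using XS(4)[OF s] by auto
    have c: "c \<le> u \<bullet> (s - (t * (w \<bullet> s)) *\<^sub>R v)" using Pc t by blast
    show ?thesis
    proof (cases "t = 1")
      case True then show ?thesis using t c sh[of s] by (auto simp: A_def)
    next
      case False
      then have "0 < (1 - t) * ((w \<bullet> s) * (- (u \<bullet> v)))" using t \<open>\<not> w \<bullet> s \<le> 0\<close> uv
        by (intro mult_pos_pos) auto
      then show ?thesis using c by (simp add: inner_diff_right inner_diff_left u'_def algebra_simps)
    qed
  qed
  then have "Q \<subseteq> {z. c < u' \<bullet> z} \<union> {z \<in> A. u' \<bullet> z = c}"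
    unfolding XS(2) using cA by (intro hull_minimal convex_open_halfspace_Un_face subsetI) auto
  then have "z - (w \<bullet> z) *\<^sub>R v \<in> P" using z by (auto simp: minf_iff c_def A_def u'_def)
  then show ?thesis using Pc sh[of z] by (auto simp: minf_iff c_def)
qed

lemma mrel_face2:
  assumes m: "mrel w v P Q" and uv: "u \<bullet> v < 0"
  shows "minf (u - (u \<bullet> v) *\<^sub>R w) Q = (\<lambda>z. z + (w \<bullet> z) *\<^sub>R v) ` minf u P"
proof -
  have wv: "w \<bullet> v = 0" using mrel_orth m by blast
  have inv: "(z - (w \<bullet> z) *\<^sub>R v) + (w \<bullet> (z - (w \<bullet> z) *\<^sub>R v)) *\<^sub>R v = z" for z
    by (simp add: inner_diff_right wv)
  define u' where "u' = u - (u \<bullet> v) *\<^sub>R w"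
  have u'v: "u' \<bullet> v = u \<bullet> v" by (simp add: u'_def inner_diff_left wv)
  have uu: "u' - (u' \<bullet> v) *\<^sub>R (- w) = u" by (simp add: u'v) (simp add: u'_def)
  have "z - ((- w) \<bullet> z) *\<^sub>R v \<in> minf u' Q" if "z \<in> minf u P" for z
    using mrel_face2_subset[OF mrel_sym[OF m], of u' z] uu uv u'v that by simp
  then have 1: "(\<lambda>z. z + (w \<bullet> z) *\<^sub>R v) ` minf u P \<subseteq> minf u' Q" by auto
  have 2: "minf u' Q \<subseteq> (\<lambda>z. z + (w \<bullet> z) *\<^sub>R v) ` minf u P"
  proof
    fix z assume "z \<in> minf u' Q"
    then have "z - (w \<bullet> z) *\<^sub>R v \<in> minf u P" unfolding u'_def by (rule mrel_face2_subset[OF m uv])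
    from imageI[OF this, of "\<lambda>z. z + (w \<bullet> z) *\<^sub>R v"]
    show "z \<in> (\<lambda>z. z + (w \<bullet> z) *\<^sub>R v) ` minf u P" unfolding inv .
  qed
  from 1 2 show ?thesis unfolding u'_def by blast
qed

lemma ge_all_imp_mem:
  fixes P :: "point set"
  assumes "compact P" "convex P" "\<And>u c. (\<And>x. x \<in> P \<Longrightarrow> c \<le> u \<bullet> x) \<Longrightarrow> c \<le> u \<bullet> z"
  shows "z \<in> P"
proof (rule ccontr)
  assume "z \<notin> P"
  then obtain a b where "a \<bullet> z < b" "\<forall>x\<in>P. b < a \<bullet> x"
    using separating_hyperplane_closed_point[of P z] assms compact_imp_closed by blast
  then show False using assms(3)[of b a] by fastforce
qed

text \<open>Below the kernel of \<open>w\<close>, \<open>Q\<close> is the intersection of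
  \<open>P\<close> with a sheared copy of \<open>P\<close>. Both inclusions are tested on all
  half-planes, the sign of \<open>u \<bullet> v\<close> selecting one of the two dual bounds.
  Lattice points are later counted level by level through this description.\<close>

lemma mrel_lift:
  assumes m: "mrel w v P Q" and P: "compact P" "convex P" and Q: "compact Q" "convex Q"
    and wz: "w \<bullet> z \<le> 0"
  shows "z \<in> Q \<longleftrightarrow> z \<in> P \<and> z - (w \<bullet> z) *\<^sub>R v \<in> P"
proof
  have wv: "w \<bullet> v = 0" using mrel_orth m by blast
  assume zQ: "z \<in> Q"
  show "z \<in> P \<and> z - (w \<bullet> z) *\<^sub>R v \<in> P"
  proof
    show "z \<in> P"
    proof (rule ge_all_imp_mem[OF P])
      fix u c assume uc: "\<And>x. x \<in> P \<Longrightarrow> c \<le> u \<bullet> x"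
      show "c \<le> u \<bullet> z"
      proof (cases "0 \<le> u \<bullet> v")
        case True then show ?thesis using mrel_dual1[OF m _ uc zQ] by blast
      next
        case False
        then have "c \<le> (u - (u \<bullet> v) *\<^sub>R w) \<bullet> z" using mrel_dual2[OF m _ uc zQ] by simp
        moreover have "0 \<le> (u \<bullet> v) * (w \<bullet> z)" using False wz by (simp add: mult_nonpos_nonpos)
        ultimately show ?thesis by (simp add: inner_diff_left)
      qed
    qed
    show "z - (w \<bullet> z) *\<^sub>R v \<in> P"
    proof (rule ge_all_imp_mem[OF P])
      fix u c assume uc: "\<And>x. x \<in> P \<Longrightarrow> c \<le> u \<bullet> x"
      show "c \<le> u \<bullet> (z - (w \<bullet> z) *\<^sub>R v)"
      proof (cases "0 \<le> u \<bullet> v")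
        case True
        then have "c \<le> u \<bullet> z" using mrel_dual1[OF m _ uc zQ] by blast
        moreover have "(w \<bullet> z) * (u \<bullet> v) \<le> 0" using True wz by (simp add: mult_nonpos_nonneg)
        ultimately show ?thesis by (simp add: inner_diff_right)
      next
        case False
        then have "c \<le> (u - (u \<bullet> v) *\<^sub>R w) \<bullet> z" using mrel_dual2[OF m _ uc zQ] by simp
        then show ?thesis by (simp add: inner_diff_left inner_diff_right mult.commute)
      qed
    qed
  qed
next
  have wv: "w \<bullet> v = 0" using mrel_orth m by blast
  assume zP: "z \<in> P \<and> z - (w \<bullet> z) *\<^sub>R v \<in> P"
  show "z \<in> Q"
  proof (rule ge_all_imp_mem[OF Q])
    fix u c assume uc: "\<And>x. x \<in> Q \<Longrightarrow> c \<le> u \<bullet> x"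
    show "c \<le> u \<bullet> z"
    proof (cases "0 \<le> u \<bullet> v")
      case True then show ?thesis using mrel_dual1[OF mrel_sym[OF m] _ uc] zP by blast
    next
      case False
      then have "c \<le> (u - (u \<bullet> v) *\<^sub>R (- w)) \<bullet> (z - (w \<bullet> z) *\<^sub>R v)"
        by (intro mrel_dual2[OF mrel_sym[OF m] _ uc]) (use zP in auto)
      then show ?thesis by (simp add: inner_diff_right inner_add_left wv mult.commute)
    qed
  qed
qed

section \<open>Edges of Fano polygons\<close>

definition pt :: "int \<times> int \<Rightarrow> point" where
  "pt z = (of_int (fst z), of_int (snd z))"

lemma pt_simps [simp]: "fst (pt z) = of_int (fst z)" "snd (pt z) = of_int (snd z)"
  by (simp_all add: pt_def)

lemma pt_inner: "pt w \<bullet> z = of_int (fst w) * fst z + of_int (snd w) * snd z"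
  by (cases z) (simp add: pt_def)

lemma pairing_pt: "pairing w z = pt w \<bullet> z"
  by (simp add: pairing_def pt_inner)

lemma pt_inner_pt: "pt w \<bullet> pt z = of_int (fst w * fst z + snd w * snd z)"
  by (simp add: pt_inner)

lemma inj_pt: "inj pt"
  by (auto simp: inj_def pt_def)

lemma pt_eq_iff [simp]: "pt a = pt b \<longleftrightarrow> a = b"
  using inj_pt by (rule inj_eq)

lemma lattice_eq: "lattice = range pt"
  by (auto simp: lattice_def pt_def image_def)

lemma pt_in_lattice [simp]: "pt z \<in> lattice"
  by (simp add: lattice_eq)

lemma primitive_points_eq: "primitive_points = pt ` {z. coprime (fst z) (snd z)}"
  by (auto simp: primitive_points_def pt_def image_def)

lemma primitive_subset_lattice: "primitive_points \<subseteq> lattice"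
  by (auto simp: primitive_points_eq lattice_eq)

text \<open>\<open>P\<close> has an edge of height \<open>r\<close> and width \<open>k\<close> with primitive inner normal \<open>w\<close>; it starts at
  \<open>p\<close> and runs counterclockwise, that is, in the direction of \<open>w\<close> rotated clockwise.\<close>

definition edat :: "point set \<Rightarrow> int \<times> int \<Rightarrow> int \<Rightarrow> int \<times> int \<Rightarrow> int \<Rightarrow> bool" where
  "edat P w r p k \<longleftrightarrow> coprime (fst w) (snd w) \<and> 0 < r \<and> 0 < k \<and>
     pt w \<bullet> pt p = - of_int r \<and>
     minf (pt w) P = closed_segment (pt p) (pt p + of_int k *\<^sub>R pt (snd w, - fst w))"

lemma fanoD:
  assumes "fano_polygon P"
  shows "polytope P" "compact P" "convex P" "0 \<in> interior P" "0 \<in> P" "polyhedron P" "aff_dim P = 2"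
    "\<And>x. x extreme_point_of P \<Longrightarrow> x \<in> primitive_points"
    "P = convex hull {x. x extreme_point_of P}"
proof -
  show 1: "polytope P" "0 \<in> interior P" "\<And>x. x extreme_point_of P \<Longrightarrow> x \<in> primitive_points"
    using assms by (auto simp: fano_polygon_def)
  then show 2: "compact P" "convex P" "0 \<in> P" "polyhedron P"
    using interior_subset by (auto intro: polytope_imp_compact polytope_imp_convex polytope_imp_polyhedron)
  show "aff_dim P = 2" using 1(2) aff_dim_nonempty_interior[of P] by auto
  show "P = convex hull {x. x extreme_point_of P}" using 2 by (intro Krein_Milman_Minkowski)
qed

lemma fano_pos:
  assumes "fano_polygon P" "u \<noteq> 0"
  shows "\<exists>z\<in>P. u \<bullet> z < 0"
proof -
  obtain e where e: "0 < e" "cball 0 e \<subseteq> P"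
    using fanoD(4)[OF assms(1)] by (meson mem_interior_cball)
  have "- (e / norm u) *\<^sub>R u \<in> P" using e assms(2) by (intro subsetD[OF e(2)]) simp
  moreover have "u \<bullet> (- (e / norm u) *\<^sub>R u) < 0" using e assms(2)
    by (simp add: divide_simps)
  ultimately show ?thesis by blast
qed

lemma coprime_bezout:
  fixes a b :: int
  assumes "coprime a b"
  obtains x y where "a * x + b * y = 1"
proof -
  obtain x y where "x * a + y * b = gcd a b" using bezout_int by blast
  then have "a * x + b * y = 1" using assms by (simp add: mult.commute)
  then show ?thesis using that by blast
qed

lemma orth_prim:
  fixes a b :: int
  assumes "coprime a b" "of_int b * x = of_int a * (y::real)"
  obtains c where "x = c * of_int a" "y = c * of_int b"
proof (cases "a = 0")
  case True
  then have "b \<noteq> 0" using assms(1) by auto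
  then show ?thesis using True assms(2) by (intro that[of "y / of_int b"]) auto
next
  case False
  then show ?thesis using assms(2) by (intro that[of "x / of_int a"]) (auto simp: field_simps)
qed

lemma minf_face:
  assumes "convex P"
  shows "minf u P face_of P"
proof (cases "minf u P = {}")
  case True then show ?thesis by simp
next
  case False
  then obtain z where z: "z \<in> minf u P" by blast
  then have "minf u P = P \<inter> {x. u \<bullet> x = u \<bullet> z}" by (force simp: minf_iff)
  moreover have "\<dots> face_of P"
    using z assms by (intro face_of_Int_supporting_hyperplane_ge) (auto simp: minf_iff)
  ultimately show ?thesis by simp
qed

lemma minf_edge:
  assumes f: "fano_polygon P" and u: "u \<noteq> 0" and xy: "x \<in> minf u P" "y \<in> minf u P" "x \<noteq> y"
  shows "minf u P edge_of P"
  unfolding edge_of_def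
proof
  have c: "convex P" using fanoD(3)[OF f] .
  show face: "minf u P face_of P" by (rule minf_face[OF c])
  have ne: "minf u P \<noteq> P"
  proof
    assume "minf u P = P"
    then have "0 \<in> minf u P" using fanoD(5)[OF f] by simp
    then show False using fano_pos[OF f u] by (force simp: minf_iff)
  qed
  have "aff_dim (minf u P) < 2" using face_of_aff_dim_lt[OF c face ne] fanoD(7)[OF f] by simp
  moreover have "aff_dim {x, y} \<le> aff_dim (minf u P)" using xy by (intro aff_dim_subset) auto
  moreover have "aff_dim {x, y} = 1" using xy by (simp add: aff_dim_2)
  ultimately show "aff_dim (minf u P) = 1" by simp
qed

lemma edge_segment:
  assumes f: "fano_polygon P" and E: "E edge_of P"
  obtains a b where "E = closed_segment a b" "a \<noteq> b" "a extreme_point_of P" "b extreme_point_of P"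
proof -
  have face: "E face_of P" and d: "aff_dim E = 1" using E by (auto simp: edge_of_def)
  have "polytope E" using face fanoD(1)[OF f] face_of_polytope_polytope by blast
  then have "compact E" "convex E" by (auto intro: polytope_imp_compact polytope_imp_convex)
  moreover have "E \<noteq> {}" using d by auto
  moreover have "collinear E" using d by (simp add: collinear_aff_dim)
  ultimately obtain a b where ab: "E = closed_segment a b" using compact_convex_collinear_segment by metis
  moreover have "a \<noteq> b" using d ab by auto
  moreover have "a extreme_point_of P" "b extreme_point_of P"
    using extreme_point_of_face[OF face, of a] extreme_point_of_face[OF face, of b]
      extreme_point_of_segment[of a a b] extreme_point_of_segment[of b a b] ab by simp_all
  ultimately show ?thesis using that by blast
qed

lemma edge_edat:
  assumes f: "fano_polygon P" and E: "E edge_of P"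
  obtains w r p k where "edat P w r p k" "E = minf (pt w) P"
proof -
  obtain a b where ab: "E = closed_segment a b" "a \<noteq> b" "a extreme_point_of P" "b extreme_point_of P"
    using edge_segment[OF f E] .
  have "a \<in> primitive_points" "b \<in> primitive_points" using ab fanoD(8)[OF f] by blast+
  then obtain p q where pq: "a = pt p" "b = pt q" unfolding primitive_points_eq by blast
  have face: "E face_of P" and d: "aff_dim E = 1" using E by (auto simp: edge_of_def)
  then have "E exposed_face_of P" using exposed_face_of_polyhedron[OF fanoD(6)[OF f]] by simp
  then obtain u c where uc: "\<And>x. x \<in> P \<Longrightarrow> u \<bullet> x \<le> c" "E = P \<inter> {x. u \<bullet> x = c}"
    by (auto simp: exposed_face_of_def)
  have u0: "u \<noteq> 0"
  proof
    assume "u = 0"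
    moreover have "a \<in> E" using ab by simp
    ultimately have "E = P" using uc by auto
    then show False using d fanoD(7)[OF f] by simp
  qed
  define g where "g = gcd (fst q - fst p) (snd q - snd p)"
  have "g \<noteq> 0" using ab pq by (auto simp: g_def prod_eq_iff)
  then have g: "0 < g" by (simp add: g_def)
  obtain e1 e2 where e: "fst q - fst p = e1 * g" "snd q - snd p = e2 * g" "coprime e1 e2"
    using gcd_coprime_exists[of "fst q - fst p" "snd q - snd p"] \<open>g \<noteq> 0\<close> unfolding g_def by metis
  have "u \<bullet> a = c" "u \<bullet> b = c" using uc(2) ab by auto
  then have "u \<bullet> (b - a) = 0" by (simp add: inner_diff_right)
  moreover have ba: "b - a = of_int g *\<^sub>R pt (e1, e2)"
  proof -
    have "real_of_int (fst q) - real_of_int (fst p) = of_int e1 * of_int g"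
      "real_of_int (snd q) - real_of_int (snd p) = of_int e2 * of_int g"
      using e(1,2) by (metis of_int_diff of_int_mult)+
    then show ?thesis by (simp add: pq prod_eq_iff)
  qed
  ultimately have "u \<bullet> pt (e1, e2) = 0" using g by simp
  then have "fst u * of_int e1 + snd u * of_int e2 = 0" by (cases u) (simp add: pt_def)
  then have "of_int e2 * snd u = of_int (- e1) * fst u" by (simp add: algebra_simps)
  then obtain m where m: "snd u = m * of_int (- e1)" "fst u = m * of_int e2"
    using orth_prim[of "- e1" e2 "snd u" "fst u"] e(3) by auto
  have um: "u = m *\<^sub>R pt (e2, - e1)" using m by (simp add: prod_eq_iff)
  have m0: "m \<noteq> 0" using u0 um by auto
  have rot: "pt (- w1, - w2) = - pt (w1, w2)" for w1 w2 by (simp add: pt_def)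
  \<comment> \<open>The sign of \<open>m\<close> only decides which end is the starting point in
    counterclockwise direction; \<open>main\<close> treats one orientation and is then applied at
    either end.\<close>
  have main: "\<exists>w r p k. edat P w r p k \<and> E = minf (pt w) P"
    if s: "u = - (m' *\<^sub>R pt (- s2, s1))" "0 < m'" "coprime s1 s2"
      "E = closed_segment (pt p') (pt p' + of_int g *\<^sub>R pt (s1, s2))" for m' s1 s2 p'
  proof -
    define w where "w = (- s2, s1)"
    have uw: "u \<bullet> x = - m' * (pt w \<bullet> x)" for x using s by (simp add: w_def)
    have p'E: "pt p' \<in> E" using s by simp
    then have p': "pt p' \<in> P" "u \<bullet> pt p' = c" using uc by auto
    have Emin: "E = minf (pt w) P"
    proof -
      have "x \<in> E \<longleftrightarrow> x \<in> minf (pt w) P" for x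
      proof
        assume "x \<in> E"
        then have "x \<in> P" "u \<bullet> x = c" using uc by auto
        moreover have "pt w \<bullet> x \<le> pt w \<bullet> y" if "y \<in> P" for y
        proof -
          have "u \<bullet> y \<le> u \<bullet> x" using uc that \<open>u \<bullet> x = c\<close> by auto
          then show ?thesis using s(2) by (simp add: uw)
        qed
        ultimately show "x \<in> minf (pt w) P" by (simp add: minf_iff)
      next
        assume x: "x \<in> minf (pt w) P"
        then have "pt w \<bullet> x \<le> pt w \<bullet> pt p'" "x \<in> P" using p' by (auto simp: minf_iff)
        then have "u \<bullet> pt p' \<le> u \<bullet> x" using s(2) by (simp add: uw)
        then have "u \<bullet> x = c" using p' uc \<open>x \<in> P\<close> by (meson antisym)
        then show "x \<in> E" using uc \<open>x \<in> P\<close> by auto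
      qed
      then show ?thesis by blast
    qed
    define r where "r = - (fst w * fst p' + snd w * snd p')"
    have r: "pt w \<bullet> pt p' = - of_int r" by (simp add: r_def pt_inner_pt del: of_int_add of_int_mult)
    have cw: "coprime (fst w) (snd w)" using s by (simp add: w_def coprime_commute)
    then have "pt w \<noteq> 0" by (auto simp: pt_def prod_eq_iff)
    then obtain z where z: "z \<in> P" "pt w \<bullet> z < 0" using fano_pos[OF f] by blast
    moreover have "pt w \<bullet> pt p' \<le> pt w \<bullet> z" using p'E Emin z by (auto simp: minf_iff)
    ultimately have "0 < r" using r by simp
    moreover have "(snd w, - fst w) = (s1, s2)" by (simp add: w_def)
    ultimately have "edat P w r p' g" using cw r g Emin s(4) by (simp add: edat_def)
    then show ?thesis using Emin by blast
  qed
  have b1: "b = a + of_int g *\<^sub>R pt (e1, e2)" using ba by (metis add.commute diff_add_cancel)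
  have a1: "a = b + of_int g *\<^sub>R pt (- e1, - e2)" using ba rot[of e1 e2]
    by (metis add_uminus_conv_diff diff_diff_eq2 add_diff_cancel_left' scaleR_minus_right)
  have "\<exists>w r p k. edat P w r p k \<and> E = minf (pt w) P"
  proof (cases "m < 0")
    case True
    have "E = closed_segment b (b + of_int g *\<^sub>R pt (- e1, - e2))"
      using ab(1) a1 by (metis closed_segment_commute)
    then show ?thesis using e(3) um pq True
      by (intro main[where m'="- m" and ?s1.0="- e1" and ?s2.0="- e2" and p'=q]) auto
  next
    case False
    then have "0 < m" using m0 by simp
    moreover have "u = - (m *\<^sub>R pt (- e2, e1))" using um rot[of e2 "- e1"] by simp
    moreover have "E = closed_segment a (a + of_int g *\<^sub>R pt (e1, e2))"
      using ab(1) b1 by simp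
    ultimately show ?thesis using e(3) pq by (intro main[where m'=m and ?s1.0=e1 and ?s2.0=e2 and p'=p]) auto
  qed
  then show ?thesis using that by blast
qed

lemma edat_start: "edat P w r p k \<Longrightarrow> pt p \<in> minf (pt w) P"
  by (simp add: edat_def)

lemma edat_ge:
  assumes "edat P w r p k" "z \<in> P"
  shows "- of_int r \<le> pt w \<bullet> z"
proof -
  have "pt w \<bullet> pt p = - of_int r" using assms(1) by (simp add: edat_def)
  then show ?thesis using edat_start[OF assms(1)] assms(2) minf_iff by metis
qed

lemma edat_minf_iff:
  assumes "edat P w r p k"
  shows "z \<in> minf (pt w) P \<longleftrightarrow> z \<in> P \<and> pt w \<bullet> z = - of_int r"
proof -
  have p: "pt p \<in> P" "\<And>x. x \<in> P \<Longrightarrow> pt w \<bullet> pt p \<le> pt w \<bullet> x" and r: "pt w \<bullet> pt p = - of_int r"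
    using edat_start[OF assms] assms by (auto simp: edat_def minf_iff)
  show ?thesis
  proof
    assume "z \<in> minf (pt w) P"
    then have "z \<in> P" "pt w \<bullet> z \<le> pt w \<bullet> pt p" using p(1) by (auto simp: minf_iff)
    then show "z \<in> P \<and> pt w \<bullet> z = - of_int r" using p(2)[of z] r by auto
  next
    assume "z \<in> P \<and> pt w \<bullet> z = - of_int r"
    then show "z \<in> minf (pt w) P" using p r by (auto simp: minf_iff)
  qed
qed

lemma edat_param:
  assumes "edat P w r p k"
  shows "z \<in> P \<and> pt w \<bullet> z = - of_int r \<longleftrightarrow>
    (\<exists>t. 0 \<le> t \<and> t \<le> of_int k \<and> z = pt p + t *\<^sub>R pt (snd w, - fst w))"
proof -
  have k: "0 < k" using assms by (simp add: edat_def)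
  have "z \<in> P \<and> pt w \<bullet> z = - of_int r \<longleftrightarrow>
      z \<in> closed_segment (pt p) (pt p + of_int k *\<^sub>R pt (snd w, - fst w))"
    using edat_minf_iff[OF assms] assms by (simp add: edat_def)
  also have "\<dots> \<longleftrightarrow> (\<exists>u. 0 \<le> u \<and> u \<le> 1 \<and> z = pt p + (u * of_int k) *\<^sub>R pt (snd w, - fst w))"
  proof -
    have "(1 - u) *\<^sub>R pt p + u *\<^sub>R (pt p + of_int k *\<^sub>R pt (snd w, - fst w)) =
        pt p + (u * of_int k) *\<^sub>R pt (snd w, - fst w)" for u
      by (simp add: algebra_simps)
    then show ?thesis by (simp add: in_segment)
  qed
  also have "\<dots> \<longleftrightarrow> (\<exists>t. 0 \<le> t \<and> t \<le> of_int k \<and> z = pt p + t *\<^sub>R pt (snd w, - fst w))"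
  proof
    assume "\<exists>u. 0 \<le> u \<and> u \<le> 1 \<and> z = pt p + (u * of_int k) *\<^sub>R pt (snd w, - fst w)"
    then obtain u where "0 \<le> u" "u \<le> 1" "z = pt p + (u * of_int k) *\<^sub>R pt (snd w, - fst w)" by blast
    then show "\<exists>t. 0 \<le> t \<and> t \<le> of_int k \<and> z = pt p + t *\<^sub>R pt (snd w, - fst w)"
      using k by (intro exI[of _ "u * of_int k"]) (auto intro: mult_left_le_one_le)
  next
    assume "\<exists>t. 0 \<le> t \<and> t \<le> of_int k \<and> z = pt p + t *\<^sub>R pt (snd w, - fst w)"
    then obtain t where "0 \<le> t" "t \<le> of_int k" "z = pt p + t *\<^sub>R pt (snd w, - fst w)" by blast
    then show "\<exists>u. 0 \<le> u \<and> u \<le> 1 \<and> z = pt p + (u * of_int k) *\<^sub>R pt (snd w, - fst w)"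
      using k by (intro exI[of _ "t / of_int k"]) auto
  qed
  finally show ?thesis .
qed

lemma edat_end:
  assumes "edat P w r p k" "0 \<le> j" "j \<le> k"
  shows "pt (fst p + j * snd w, snd p - j * fst w) \<in> P"
    "pt w \<bullet> pt (fst p + j * snd w, snd p - j * fst w) = - of_int r"
proof -
  have "pt (fst p + j * snd w, snd p - j * fst w) = pt p + of_int j *\<^sub>R pt (snd w, - fst w)"
    by (simp add: pt_def)
  then have "pt (fst p + j * snd w, snd p - j * fst w) \<in> P \<and>
      pt w \<bullet> pt (fst p + j * snd w, snd p - j * fst w) = - of_int r"
    using assms(2,3) unfolding edat_param[OF assms(1)] by (intro exI[of _ "of_int j"]) auto
  then show "pt (fst p + j * snd w, snd p - j * fst w) \<in> P"
    "pt w \<bullet> pt (fst p + j * snd w, snd p - j * fst w) = - of_int r" by auto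
qed

lemma edat_lattice:
  assumes "edat P w r p k"
  shows "minf (pt w) P \<inter> lattice = (\<lambda>j. pt (fst p + j * snd w, snd p - j * fst w)) ` {0..k}"
proof
  show "(\<lambda>j. pt (fst p + j * snd w, snd p - j * fst w)) ` {0..k} \<subseteq> minf (pt w) P \<inter> lattice"
  proof (intro image_subsetI IntI)
    fix j assume "j \<in> {0..k}"
    then show "pt (fst p + j * snd w, snd p - j * fst w) \<in> minf (pt w) P"
      unfolding edat_minf_iff[OF assms] using edat_end[OF assms, of j] by simp
  qed simp
  show "minf (pt w) P \<inter> lattice \<subseteq> (\<lambda>j. pt (fst p + j * snd w, snd p - j * fst w)) ` {0..k}"
  proof
    fix z assume "z \<in> minf (pt w) P \<inter> lattice"
    then have z: "z \<in> P \<and> pt w \<bullet> z = - of_int r" and "z \<in> lattice"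
      using edat_minf_iff[OF assms] by auto
    then obtain q where q: "z = pt q" by (auto simp: lattice_eq)
    obtain t where t: "0 \<le> t" "t \<le> of_int k" "z = pt p + t *\<^sub>R pt (snd w, - fst w)"
      using z unfolding edat_param[OF assms] by blast
    have 1: "t * of_int (snd w) = of_int (fst q - fst p)" "t * of_int (fst w) = of_int (snd p - snd q)"
      using arg_cong[OF t(3), of fst] arg_cong[OF t(3), of snd] q by auto
    have "coprime (fst w) (snd w)" using assms by (simp add: edat_def)
    \<comment> \<open>The parameter \<open>t\<close> is an integer: it is the combination, with
      Bezout coefficients of \<open>w\<close>, of the integers \<open>t * fst w\<close> and
      \<open>t * snd w\<close>.\<close>
    then obtain x y where xy: "fst w * x + snd w * y = 1" by (rule coprime_bezout)
    have "t = t * of_int (fst w * x + snd w * y)" by (simp add: xy)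
    also have "\<dots> = (t * of_int (fst w)) * of_int x + (t * of_int (snd w)) * of_int y"
      by (simp add: algebra_simps)
    also have "\<dots> = of_int ((snd p - snd q) * x + (fst q - fst p) * y)" unfolding 1 by simp
    finally obtain j where j: "t = of_int j" by blast
    then have "0 \<le> j" "j \<le> k" using t by auto
    moreover have "z = pt (fst p + j * snd w, snd p - j * fst w)" using t j by (simp add: pt_def)
    ultimately show "z \<in> (\<lambda>j. pt (fst p + j * snd w, snd p - j * fst w)) ` {0..k}" by auto
  qed
qed

lemma edat_width:
  assumes "edat P w r p k"
  shows "edge_width (minf (pt w) P) = k"
proof -
  have k: "0 < k" and w: "coprime (fst w) (snd w)" using assms by (auto simp: edat_def)
  have "inj_on (\<lambda>j. pt (fst p + j * snd w, snd p - j * fst w)) {0..k}"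
    using w by (auto simp: inj_on_def)
  then show ?thesis using k by (simp add: edge_width_def edat_lattice[OF assms] card_image)
qed

text \<open>Being constant on two lattice points of the edge makes \<open>w'\<close> proportional to
  \<open>w\<close>, hence equal to \<open>w\<close> or \<open>- w\<close> as both are primitive. The
  origin, a point of \<open>P\<close> off the edge, excludes the negative sign.\<close>

lemma edat_normal_unique:
  assumes f: "fano_polygon P" and e: "edat P w r p k" and n: "primitive_inner_normal P (minf (pt w) P) w'"
  shows "w' = w"
proof -
  have k: "0 < k" and w: "coprime (fst w) (snd w)" and r: "0 < r" using e by (auto simp: edat_def)
  have c: "coprime (fst w') (snd w')"
    and le: "\<And>x y. x \<in> minf (pt w) P \<Longrightarrow> y \<in> P \<Longrightarrow> pt w' \<bullet> x \<le> pt w' \<bullet> y"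
    using n by (auto simp: primitive_inner_normal_def pairing_pt)
  have 0: "pt p \<in> minf (pt w) P" "pt (fst p + 1 * snd w, snd p - 1 * fst w) \<in> minf (pt w) P"
    using edat_end[OF e, of 1] edat_start[OF e] edat_minf_iff[OF e] k by auto
  then have "pt w' \<bullet> pt p = pt w' \<bullet> pt (fst p + 1 * snd w, snd p - 1 * fst w)"
    using le by (meson antisym minf_iff)
  then have "real_of_int (fst w' * snd w) = of_int (snd w' * fst w)"
    by (simp add: pt_inner algebra_simps)
  then have eq: "fst w' * snd w = snd w' * fst w" by linarith
  have "fst w dvd fst w'" using eq w by (metis coprime_dvd_mult_left_iff dvd_triv_right)
  moreover have "fst w' dvd fst w" using eq c by (metis coprime_dvd_mult_right_iff dvd_triv_left)
  moreover have "snd w dvd snd w'" using eq w by (metis coprime_dvd_mult_left_iff coprime_commute dvd_triv_right)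
  moreover have "snd w' dvd snd w" using eq c by (metis coprime_dvd_mult_right_iff coprime_commute dvd_triv_left)
  ultimately have "\<bar>fst w\<bar> = \<bar>fst w'\<bar>" "\<bar>snd w\<bar> = \<bar>snd w'\<bar>" by (auto intro: zdvd_antisym_abs)
  then have "w' = w \<or> w' = - w"
    using eq w by (cases w; cases w') (auto simp: abs_if split: if_splits)
  moreover have "w' \<noteq> - w"
  proof
    assume "w' = - w"
    then have "pt w' = - pt w" by (simp add: pt_def)
    then have "- (pt w \<bullet> pt p) \<le> 0" using le[OF 0(1) fanoD(5)[OF f]] by simp
    then show False using e r by (simp add: edat_def)
  qed
  ultimately show ?thesis by blast
qed

lemma edat_unique:
  assumes f: "fano_polygon P" and e: "edat P w r p k" and e': "edat P w r' p' k'"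
  shows "r = r'" "k = k'" "p = p'"
proof -
  show k: "k = k'" using edat_width[OF e] edat_width[OF e'] by simp
  have s: "pt p' \<in> minf (pt w) P" "pt p \<in> minf (pt w) P" using edat_start e e' by auto
  show r: "r = r'" using s edat_minf_iff[OF e] e' by (auto simp: edat_def)
  have k0: "0 < k" using e by (simp add: edat_def)
  obtain t where t: "0 \<le> t" "t \<le> of_int k" "pt p' = pt p + t *\<^sub>R pt (snd w, - fst w)"
    using edat_param[OF e, of "pt p'"] s edat_minf_iff[OF e] by auto
  obtain t' where t': "0 \<le> t'" "t' \<le> of_int k" "pt p = pt p' + t' *\<^sub>R pt (snd w, - fst w)"
    using edat_param[OF e', of "pt p"] s edat_minf_iff[OF e'] k by auto
  have "(t + t') *\<^sub>R pt (snd w, - fst w) = 0" using t(3) t'(3) by (simp add: algebra_simps)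
  moreover have "pt (snd w, - fst w) \<noteq> 0"
    using e by (auto simp: edat_def pt_def prod_eq_iff)
  ultimately have "t = 0" using t t' by simp
  then show "p = p'" using t by simp
qed

lemma edat_edge: 
  assumes f: "fano_polygon P" and e: "edat P w r p k"
  shows "minf (pt w) P edge_of P"
proof (rule minf_edge[OF f])
  have k: "0 < k" and w: "coprime (fst w) (snd w)" using e by (auto simp: edat_def)
  then show "pt w \<noteq> 0" by (auto simp: pt_def prod_eq_iff)
  show "pt p \<in> minf (pt w) P" "pt (fst p + k * snd w, snd p - k * fst w) \<in> minf (pt w) P"
    using edat_end[OF e, of k] edat_start[OF e] edat_minf_iff[OF e] k by auto
  show "pt p \<noteq> pt (fst p + k * snd w, snd p - k * fst w)" using k w by (cases p) auto
qed

lemma edat_T: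
  assumes f: "fano_polygon P" and b: "empty_residual_basket P" and e: "edat P w r p k"
  shows "r dvd k"
proof -
  have "cone_over_edge_is_T P (minf (pt w) P)" using edat_edge[OF f e] b by (simp add: empty_residual_basket_def)
  then obtain w' r' where w': "primitive_inner_normal P (minf (pt w) P) w'"
      "\<forall>v\<in>minf (pt w) P. pairing w' v = - of_int r'" "r' dvd edge_width (minf (pt w) P)"
    unfolding cone_over_edge_is_T_def by blast
  have "w' = w" by (rule edat_normal_unique[OF f e w'(1)])
  then have "r' = r" using w'(2) edat_start[OF e] e by (force simp: pairing_pt edat_def)
  then show ?thesis using w'(3) edat_width[OF e] by simp
qed

lemma edat_inner_normal:
  assumes "edat P w r p k"
  shows "primitive_inner_normal P (minf (pt w) P) w"
proof -
  have "coprime (fst w) (snd w)" using assms by (simp add: edat_def)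
  moreover have "pt w \<bullet> e \<le> pt w \<bullet> v" if "e \<in> minf (pt w) P" "v \<in> P" for e v
    using that by (simp add: minf_iff)
  ultimately show ?thesis unfolding primitive_inner_normal_def pairing_pt by (intro conjI ballI)
qed

lemma basketI:
  assumes f: "fano_polygon P" and d: "\<And>w r p k. edat P w r p k \<Longrightarrow> r dvd k"
  shows "empty_residual_basket P"
  unfolding empty_residual_basket_def
proof (intro allI impI)
  fix E assume "E edge_of P"
  then obtain w r p k where e: "edat P w r p k" "E = minf (pt w) P" using edge_edat[OF f] by blast
  show "cone_over_edge_is_T P E"
    unfolding cone_over_edge_is_T_def
    using e edat_inner_normal[OF e(1)] d[OF e(1)] edat_width[OF e(1)] edat_minf_iff[OF e(1)]
    by (intro exI[of _ w] exI[of _ r]) (auto simp: pairing_pt)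
qed

text \<open>Otherwise the segment from the origin to \<open>z\<close> meets the boundary before
  \<open>z\<close>, in a point of some edge. There \<open>w\<close> has already dropped to
  \<open>- r\<close>, so it would be smaller still at \<open>z\<close>.\<close>

lemma fano_halfspaces:
  assumes f: "fano_polygon P"
    and z: "\<And>w r p k. edat P w r p k \<Longrightarrow> - of_int r \<le> pt w \<bullet> z"
  shows "z \<in> P"
proof (rule ccontr)
  assume zP: "z \<notin> P"
  have "closed_segment 0 z \<inter> frontier P \<noteq> {}"
    using fanoD(5)[OF f] zP by (intro connected_Int_frontier) auto
  then obtain y where y: "y \<in> closed_segment 0 z" "y \<in> frontier P" by blast
  obtain t where t: "0 \<le> t" "t \<le> 1" "y = t *\<^sub>R z" using y(1) by (auto simp: in_segment)
  have yP: "y \<in> P" using y(2) fanoD(2)[OF f] by (meson compact_imp_closed frontier_subset_closed subsetD)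
  have "interior P \<noteq> {}" using fanoD(4)[OF f] by blast
  then have "rel_frontier P = frontier P"
    by (simp add: rel_frontier_def frontier_def rel_interior_nonempty_interior)
  then obtain E where E: "E facet_of P" "y \<in> E"
    using y rel_frontier_of_polyhedron[OF fanoD(6)[OF f]] by auto
  then have "E edge_of P" using fanoD(7)[OF f] by (simp add: facet_of_def edge_of_def)
  then obtain w r p k where e: "edat P w r p k" "E = minf (pt w) P" using edge_edat[OF f] by blast
  then have "pt w \<bullet> y = - of_int r" using E edat_minf_iff by blast
  then have *: "t * (pt w \<bullet> z) = - of_int r" using t by simp
  have "t \<noteq> 1" using t yP zP by auto
  have "0 < r" using e by (simp add: edat_def)
  have "t * - of_int r \<le> t * (pt w \<bullet> z)" using z[OF e(1)] t by (intro mult_left_mono) auto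
  then have "of_int r \<le> t * of_int r" using * by simp
  moreover have "t * of_int r < 1 * of_int r" using t \<open>t \<noteq> 1\<close> \<open>0 < r\<close> by (intro mult_strict_right_mono) auto
  ultimately show False by simp
qed

lemma finite_normals:
  assumes f: "fano_polygon P"
  shows "finite {w. \<exists>r p k. edat P w r p k}"
proof (rule finite_imageD)
  show "finite ((\<lambda>w. minf (pt w) P) ` {w. \<exists>r p k. edat P w r p k})"
    using minf_face[OF fanoD(3)[OF f]]
    by (intro finite_subset[OF _ finite_polytope_faces[OF fanoD(1)[OF f]]] image_subsetI CollectI)
  show "inj_on (\<lambda>w. minf (pt w) P) {w. \<exists>r p k. edat P w r p k}"
  proof (rule inj_onI)
    fix w w' assume w: "w \<in> {w. \<exists>r p k. edat P w r p k}" "w' \<in> {w. \<exists>r p k. edat P w r p k}"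
      "minf (pt w) P = minf (pt w') P"
    then obtain r p k r' p' k' where e: "edat P w r p k" "edat P w' r' p' k'" by blast
    show "w = w'" using edat_normal_unique[OF f e(1), of w'] edat_inner_normal[OF e(2), folded w(3)] by simp
  qed
qed

text \<open>There are only finitely many edge inequalities. If all those that are tight at
  \<open>z\<close> were nondecreasing along \<open>d\<close>, every inequality would survive a small
  step in direction \<open>d\<close>, and the step would stay in \<open>P\<close>. This is how the
  next edge at a vertex is found.\<close>

lemma exists_tight_edge:
  assumes f: "fano_polygon P" and z: "z \<in> P" and d: "\<And>e. 0 < e \<Longrightarrow> z + e *\<^sub>R d \<notin> P"
  obtains w r p k where "edat P w r p k" "pt w \<bullet> z = - of_int r" "pt w \<bullet> d < 0"
proof -
  have "\<exists>w r p k. edat P w r p k \<and> pt w \<bullet> z = - of_int r \<and> pt w \<bullet> d < 0"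
  proof (rule ccontr)
    assume no: "\<not> ?thesis"
    define W where "W = {w. \<exists>r p k. edat P w r p k}"
    have "\<forall>w\<in>W. eventually (\<lambda>e. \<forall>r p k. edat P w r p k \<longrightarrow> - of_int r \<le> pt w \<bullet> (z + e *\<^sub>R d)) (at_right 0)"
    proof
      fix w assume "w \<in> W"
      then obtain r p k where e: "edat P w r p k" by (auto simp: W_def)
      have "eventually (\<lambda>e. - of_int r \<le> pt w \<bullet> (z + e *\<^sub>R d)) (at_right 0)"
      proof (cases "pt w \<bullet> z = - of_int r")
        case True
        then have "0 \<le> pt w \<bullet> d" using no e by (meson not_le)
        then have "- of_int r \<le> pt w \<bullet> (z + e *\<^sub>R d)" if "0 < e" for e
          using that True by (simp add: inner_add_right)
        then show ?thesis by (auto simp: eventually_at_right_field intro!: exI[of _ 1])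
      next
        case False
        then have lt: "- of_int r < pt w \<bullet> z" using edat_ge[OF e z] by simp
        have "((\<lambda>e. pt w \<bullet> (z + e *\<^sub>R d)) \<longlongrightarrow> pt w \<bullet> (z + 0 *\<^sub>R d)) (at_right 0)"
          by (intro tendsto_intros)
        then have "eventually (\<lambda>e. - of_int r < pt w \<bullet> (z + e *\<^sub>R d)) (at_right 0)"
          using lt by (intro order_tendstoD(1)) auto
        then show ?thesis by (rule eventually_mono) simp
      qed
      then show "eventually (\<lambda>e. \<forall>r p k. edat P w r p k \<longrightarrow> - of_int r \<le> pt w \<bullet> (z + e *\<^sub>R d)) (at_right 0)"
        by (rule eventually_mono) (use edat_unique(1)[OF f e] in blast)
    qed
    then have "eventually (\<lambda>e. \<forall>w\<in>W. \<forall>r p k. edat P w r p k \<longrightarrow> - of_int r \<le> pt w \<bullet> (z + e *\<^sub>R d)) (at_right 0)"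
      using finite_normals[OF f] by (intro eventually_ball_finite) (auto simp: W_def)
    moreover have "eventually (\<lambda>e::real. 0 < e) (at_right 0)" by (simp add: eventually_at_right_less)
    ultimately have "eventually (\<lambda>e. 0 < e \<and> (\<forall>w\<in>W. \<forall>r p k. edat P w r p k \<longrightarrow> - of_int r \<le> pt w \<bullet> (z + e *\<^sub>R d))) (at_right 0)"
      by eventually_elim auto
    then obtain e where e: "0 < e" "\<forall>w\<in>W. \<forall>r p k. edat P w r p k \<longrightarrow> - of_int r \<le> pt w \<bullet> (z + e *\<^sub>R d)"
      using eventually_happens'[of "at_right (0::real)"] by force
    then have "z + e *\<^sub>R d \<in> P" unfolding W_def by (intro fano_halfspaces[OF f]) blast
    then show False using d e by blast
  qed
  then show ?thesis using that by blast
qed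

lemma edat_of_minf:
  assumes f: "fano_polygon P" and c: "coprime (fst w) (snd w)"
    and xy: "x \<in> minf (pt w) P" "y \<in> minf (pt w) P" "x \<noteq> y"
  obtains r p k where "edat P w r p k" "k = edge_width (minf (pt w) P)"
proof -
  have "pt w \<noteq> 0" using c by (auto simp: pt_def prod_eq_iff)
  then have "minf (pt w) P edge_of P" using minf_edge[OF f _ xy] by blast
  then obtain w' r p k where e: "edat P w' r p k" "minf (pt w) P = minf (pt w') P"
    using edge_edat[OF f] by blast
  have "primitive_inner_normal P (minf (pt w') P) w"
    unfolding primitive_inner_normal_def pairing_pt e(2)[symmetric] using c by (simp add: minf_iff)
  then have "w = w'" using edat_normal_unique[OF f e(1)] by blast
  then show ?thesis using that e edat_width[OF e(1)] by blast
qed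

lemma edat_two:
  assumes "edat P w r p k"
  obtains x y where "x \<in> minf (pt w) P" "y \<in> minf (pt w) P" "x \<noteq> y"
proof -
  have k: "0 < k" and w: "coprime (fst w) (snd w)" using assms by (auto simp: edat_def)
  have "pt (fst p + k * snd w, snd p - k * fst w) \<in> minf (pt w) P"
    using edat_end[OF assms, of k] edat_minf_iff[OF assms] k by auto
  moreover have "pt p \<noteq> pt (fst p + k * snd w, snd p - k * fst w)" using k w by (cases p) auto
  ultimately show ?thesis using that edat_start[OF assms] by blast
qed

lemma edge_width_image:
  assumes "inj f" "\<And>z. f z \<in> lattice \<longleftrightarrow> z \<in> lattice"
  shows "edge_width (f ` E) = edge_width E"
proof -
  have "f ` E \<inter> lattice = f ` (E \<inter> lattice)" using assms(2) by blast
  then show ?thesis using assms(1) by (simp add: edge_width_def card_image inj_on_subset)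
qed

lemma finite_lattice_bounded:
  assumes "bounded B"
  shows "finite (B \<inter> lattice)"
proof -
  obtain K where K: "\<And>z. z \<in> B \<Longrightarrow> norm z \<le> K" using assms by (auto simp: bounded_iff)
  define N where "N = \<lceil>K\<rceil>"
  have "B \<inter> lattice \<subseteq> pt ` ({-N..N} \<times> {-N..N})"
  proof
    fix z assume z: "z \<in> B \<inter> lattice"
    then obtain q where q: "z = pt q" by (auto simp: lattice_eq)
    have "norm (fst z) \<le> K" "norm (snd z) \<le> K"
      using K[of z] z norm_fst_le[of "fst z" "snd z"] norm_snd_le[of "snd z" "fst z"] by auto
    then have "\<bar>of_int (fst q)\<bar> \<le> (of_int N :: real)" "\<bar>of_int (snd q)\<bar> \<le> (of_int N :: real)"
      using le_of_int_ceiling[of K] unfolding q N_def by (simp_all, linarith+)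
    then have "\<bar>fst q\<bar> \<le> N" "\<bar>snd q\<bar> \<le> N" by (metis of_int_abs of_int_le_iff)+
    then have "q \<in> {-N..N} \<times> {-N..N}" by (cases q) auto
    then show "z \<in> pt ` ({-N..N} \<times> {-N..N})" using q by blast
  qed
  then show ?thesis by (rule finite_subset) simp
qed

section \<open>Unimodular transformations\<close>

definition gl :: "int \<Rightarrow> int \<Rightarrow> int \<Rightarrow> int \<Rightarrow> point \<Rightarrow> point" where
  "gl a b c d z = (of_int a * fst z + of_int b * snd z, of_int c * fst z + of_int d * snd z)"

text \<open>The same matrix on integer pairs. Exchanging \<open>b\<close> and \<open>c\<close> gives
  the transpose, through which normals are pulled back.\<close>

definition gli :: "int \<Rightarrow> int \<Rightarrow> int \<Rightarrow> int \<Rightarrow> int \<times> int \<Rightarrow> int \<times> int" where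
  "gli a b c d z = (a * fst z + b * snd z, c * fst z + d * snd z)"

lemma gl_pt [simp]: "gl a b c d (pt z) = pt (gli a b c d z)"
  by (simp add: gl_def gli_def pt_def)

lemma GL2Z_gl: "GL2Z_equivalent P Q \<longleftrightarrow> (\<exists>a b c d. \<bar>a * d - b * c\<bar> = 1 \<and> Q = gl a b c d ` P)"
  by (simp add: GL2Z_equivalent_def gl_def case_prod_unfold)

lemma linear_gl: "linear (gl a b c d)"
  by (intro linearI) (auto simp: gl_def algebra_simps)

lemma gl_inner: "pt w \<bullet> gl a b c d z = pt (gli a c b d w) \<bullet> z"
  by (simp add: pt_inner gl_def gli_def algebra_simps)

text \<open>The determinant \<open>D\<close> is 1 or -1, so the inverse matrix is \<open>D\<close>
  times the adjugate.\<close>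

lemma gl_inverse:
  fixes a b c d :: int
  assumes "\<bar>a * d - b * c\<bar> = 1"
  defines "D \<equiv> a * d - b * c"
  shows "gl (D * d) (- D * b) (- D * c) (D * a) (gl a b c d z) = z"
    "gl a b c d (gl (D * d) (- D * b) (- D * c) (D * a) z) = z"
    "gli (D * d) (- D * b) (- D * c) (D * a) (gli a b c d q) = q"
    "gli a b c d (gli (D * d) (- D * b) (- D * c) (D * a) q) = q"
    "\<bar>(D * d) * (D * a) - (- D * b) * (- D * c)\<bar> = 1"
proof -
  have "D = 1 \<or> D = - 1" using assms(1) unfolding D_def by linarith
  then have D: "D * D = 1" by auto
  then have D2: "real_of_int D * real_of_int D = 1" by (metis of_int_1 of_int_mult)
  have D1: "real_of_int D = of_int a * of_int d - of_int b * of_int c" by (simp add: D_def)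
  have 1: "of_int D * (of_int a * of_int d - of_int b * of_int c) * x = (x::real)" for x
    using D2 unfolding D1[symmetric] by simp
  have 2: "D * (a * d - b * c) * x = x" for x using D by (simp add: D_def)
  show "gl (D * d) (- D * b) (- D * c) (D * a) (gl a b c d z) = z"
    "gl a b c d (gl (D * d) (- D * b) (- D * c) (D * a) z) = z"
    using 1[of "fst z"] 1[of "snd z"] by (auto simp: gl_def prod_eq_iff algebra_simps)
  show "gli (D * d) (- D * b) (- D * c) (D * a) (gli a b c d q) = q"
    "gli a b c d (gli (D * d) (- D * b) (- D * c) (D * a) q) = q"
    using 2[of "fst q"] 2[of "snd q"] by (auto simp: gli_def prod_eq_iff algebra_simps)
  have "(D * d) * (D * a) - (- D * b) * (- D * c) = (D * D) * D" by (simp add: D_def algebra_simps)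
  then show "\<bar>(D * d) * (D * a) - (- D * b) * (- D * c)\<bar> = 1" using D assms by simp
qed

lemma bij_gl: "\<bar>a * d - b * c\<bar> = 1 \<Longrightarrow> bij (gl a b c d)"
  using gl_inverse(1,2)[of a d b c] by (intro o_bij[where g = "gl _ _ _ _"]) (auto simp: fun_eq_iff)

lemma inj_gl: "\<bar>a * d - b * c\<bar> = 1 \<Longrightarrow> inj (gl a b c d)"
  using bij_gl bij_is_inj by blast

lemma gl_lattice: "\<bar>a * d - b * c\<bar> = 1 \<Longrightarrow> gl a b c d z \<in> lattice \<longleftrightarrow> z \<in> lattice"
proof
  assume d: "\<bar>a * d - b * c\<bar> = 1" and "gl a b c d z \<in> lattice"
  then obtain q where q: "gl a b c d z = pt q" by (auto simp: lattice_eq)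
  show "z \<in> lattice" using gl_inverse(1)[OF d, of z] q by (metis gl_pt pt_in_lattice)
qed (auto simp: lattice_eq)

lemma gli_coprime:
  assumes d: "\<bar>a * d - b * c\<bar> = 1" and q: "coprime (fst q) (snd q)"
  shows "coprime (fst (gli a b c d q)) (snd (gli a b c d q))"
proof (rule coprimeI)
  define D where "D = a * d - b * c"
  fix e assume e: "e dvd fst (gli a b c d q)" "e dvd snd (gli a b c d q)"
  have "fst q = D * d * fst (gli a b c d q) + (- D * b) * snd (gli a b c d q)"
    "snd q = (- D * c) * fst (gli a b c d q) + D * a * snd (gli a b c d q)"
    using gl_inverse(3)[OF d, of q] unfolding D_def[symmetric]
    by (metis gli_def fst_conv snd_conv)+
  then have "e dvd fst q" "e dvd snd q" using e by (metis dvd_add dvd_mult)+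
  then show "is_unit e" using q by (meson coprime_common_divisor)
qed

lemma minf_gl:
  "minf (pt w) (gl a b c d ` P) = gl a b c d ` minf (pt (gli a c b d w)) P"
  by (auto simp: minf_def gl_inner)

lemma fano_gl:
  assumes d: "\<bar>a * d - b * c\<bar> = 1" and f: "fano_polygon P"
  shows "fano_polygon (gl a b c d ` P)"
  unfolding fano_polygon_def
proof (intro conjI subsetI)
  show "polytope (gl a b c d ` P)" using fanoD(1)[OF f] linear_gl by (rule polytope_linear_image[rotated])
  have "gl a b c d 0 \<in> gl a b c d ` interior P" using fanoD(4)[OF f] by blast
  then show "0 \<in> interior (gl a b c d ` P)"
    using interior_bijective_linear_image[OF linear_gl bij_gl[OF d], of P] linear_0[OF linear_gl] by simp
  fix x assume "x \<in> {v. v extreme_point_of gl a b c d ` P}"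
  then have x: "{x} face_of gl a b c d ` P" by (simp add: face_of_singleton)
  then obtain y where y: "x = gl a b c d y" using face_of_imp_subset[OF x] by blast
  have "gl a b c d ` {y} face_of gl a b c d ` P" using x y by simp
  then have "{y} face_of P" using face_of_linear_image[OF linear_gl inj_gl[OF d]] by blast
  then have "y extreme_point_of P" by (simp add: face_of_singleton)
  then have "y \<in> primitive_points" using fanoD(8)[OF f] by blast
  then show "x \<in> primitive_points" using y gli_coprime[OF d] by (auto simp: primitive_points_eq)
qed

text \<open>The starting point is left open, since a matrix of determinant -1 reverses the
  orientation and makes the edge start at its other end.\<close>

lemma edat_gl:
  assumes d: "\<bar>a * d - b * c\<bar> = 1" and f: "fano_polygon P" and e: "edat (gl a b c d ` P) w r p k"
  obtains p' where "edat P (gli a c b d w) r p' k"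
proof -
  define w' where "w' = gli a c b d w"
  have m: "minf (pt w) (gl a b c d ` P) = gl a b c d ` minf (pt w') P" by (simp add: minf_gl w'_def)
  have d': "\<bar>a * d - c * b\<bar> = 1" using d by (simp add: mult.commute)
  have "coprime (fst w) (snd w)" using e by (simp add: edat_def)
  then have c: "coprime (fst w') (snd w')" unfolding w'_def by (rule gli_coprime[OF d'])
  obtain x y where xy: "x \<in> minf (pt w') P" "y \<in> minf (pt w') P" "x \<noteq> y"
    using edat_two[OF e] unfolding m by blast
  obtain r' p' k' where e': "edat P w' r' p' k'" "k' = edge_width (minf (pt w') P)"
    using edat_of_minf[OF f c xy] .
  have "k = edge_width (minf (pt w) (gl a b c d ` P))" using edat_width[OF e] by simp
  then have k: "k' = k" unfolding m e'(2) using edge_width_image[of "gl a b c d" "minf (pt w') P", OF inj_gl[OF d] gl_lattice[OF d]]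
    by simp
  have "gl a b c d x \<in> minf (pt w) (gl a b c d ` P)" using xy m by blast
  then have "pt w \<bullet> gl a b c d x = - of_int r" using edat_minf_iff[OF e] by blast
  moreover have "pt w' \<bullet> x = - of_int r'" using xy edat_minf_iff[OF e'(1)] by blast
  ultimately have "r = r'" by (simp add: gl_inner w'_def)
  then show ?thesis using that e' k by (simp add: w'_def)
qed

lemma basket_gl:
  assumes d: "\<bar>a * d - b * c\<bar> = 1" and f: "fano_polygon P" and b: "empty_residual_basket P"
  shows "empty_residual_basket (gl a b c d ` P)"
proof (rule basketI[OF fano_gl[OF d f]])
  fix w r p k assume e: "edat (gl a b c d ` P) w r p k"
  obtain p' where "edat P (gli a c b d w) r p' k" using edat_gl[OF d f e] .
  then show "r dvd k" by (rule edat_T[OF f b])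
qed

section \<open>Existence of mutations\<close>

text \<open>The lattice points of the mutation of \<open>P\<close> when every \<open>G\<^sub>h\<close> is chosen as large as possible.\<close>

definition mgen :: "int \<times> int \<Rightarrow> int \<times> int \<Rightarrow> point set \<Rightarrow> point set" where
  "mgen w v P = {z \<in> lattice.
     (pt w \<bullet> z \<le> 0 \<longrightarrow> z \<in> P \<and> z - (pt w \<bullet> z) *\<^sub>R pt v \<in> P) \<and>
     (0 \<le> pt w \<bullet> z \<longrightarrow> z \<in> P \<or> z - (pt w \<bullet> z) *\<^sub>R pt v \<in> P)}"

definition mutc :: "int \<times> int \<Rightarrow> int \<times> int \<Rightarrow> point set \<Rightarrow> point set" where
  "mutc w v P = convex hull (mgen w v P)"

lemma lattice_shift: "z \<in> lattice \<Longrightarrow> z + of_int h *\<^sub>R pt v \<in> lattice"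
proof -
  assume "z \<in> lattice"
  then obtain q where "z = pt q" by (auto simp: lattice_eq)
  then have "z + of_int h *\<^sub>R pt v = pt (fst q + h * fst v, snd q + h * snd v)" by (simp add: pt_def)
  then show ?thesis by simp
qed

lemma lattice_value: "z \<in> lattice \<Longrightarrow> \<exists>h::int. pt w \<bullet> z = of_int h"
  by (auto simp: lattice_eq pt_inner_pt simp del: of_int_add of_int_mult)

lemma finite_mgen:
  assumes P: "compact P" and wv: "pt w \<bullet> pt v = 0"
  shows "finite (mgen w v P)"
proof -
  define f where "f = (\<lambda>z. z + (pt w \<bullet> z) *\<^sub>R pt v)"
  have "bounded P" using P by (rule compact_imp_bounded)
  have "continuous_on P f" unfolding f_def by (intro continuous_intros)
  then have "bounded (f ` P)" using P compact_continuous_image compact_imp_bounded by blast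
  moreover have "mgen w v P \<subseteq> (P \<union> f ` P) \<inter> lattice"
  proof
    fix z assume z: "z \<in> mgen w v P"
    have fg: "f (z - (pt w \<bullet> z) *\<^sub>R pt v) = z" using wv by (simp add: f_def inner_diff_right)
    have "z \<in> f ` P" if "z - (pt w \<bullet> z) *\<^sub>R pt v \<in> P" using imageI[OF that, of f] fg by simp
    then show "z \<in> (P \<union> f ` P) \<inter> lattice" using z linear[of "pt w \<bullet> z" 0]
      unfolding mgen_def by blast
  qed
  moreover have "finite ((P \<union> f ` P) \<inter> lattice)"
    using calculation(1) \<open>bounded P\<close> by (intro finite_lattice_bounded) simp
  ultimately show ?thesis using finite_subset by blast
qed

lemma slice_plus_segment:
  "convex hull A + dilate h (convex hull {0, v}) = convex hull (A + {0, of_int h *\<^sub>R v})"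
proof -
  have "dilate h (convex hull {0, v}) = convex hull ((\<lambda>x. of_int h *\<^sub>R x) ` {0, v})"
    unfolding dilate_def by (rule convex_hull_scaling[symmetric])
  then show ?thesis by (simp add: convex_hull_set_plus)
qed

text \<open>The assumption \<open>slope\<close> is what makes an admissible family
  \<open>G\<^sub>h\<close> exist: a vertex on a level \<open>h < 0\<close> is one end of a segment
  of length \<open>|h|\<close> along \<open>v\<close> inside \<open>P\<close>. It speaks of vertices
  only, so that it can be derived for an edge of a general polygon and also be tested on an explicit
  list of vertices.\<close>

locale mutable =
  fixes P :: "point set" and w v :: "int \<times> int"
  assumes f: "fano_polygon P"
    and cv: "coprime (fst v) (snd v)"
    and wv: "pt w \<bullet> pt v = 0"
    and slope: "\<And>x. x extreme_point_of P \<Longrightarrow> pt w \<bullet> x < 0 \<Longrightarrow>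
      x - (pt w \<bullet> x) *\<^sub>R pt v \<in> P \<or> x + (pt w \<bullet> x) *\<^sub>R pt v \<in> P"
begin

definition lev :: "int \<Rightarrow> point set" where
  "lev h = {z \<in> P \<inter> lattice. pt w \<bullet> z = of_int h}"

text \<open>The lattice points of the largest admissible \<open>G\<^sub>h\<close>; for negative
  \<open>h\<close> the subtraction moves \<open>z\<close> by \<open>|h|\<close> in direction
  \<open>v\<close>.\<close>

definition below :: "int \<Rightarrow> point set" where
  "below h = {z \<in> lev h. z - of_int h *\<^sub>R pt v \<in> P}"

lemma ext_lattice: "x extreme_point_of P \<Longrightarrow> x \<in> P \<inter> lattice"
  using fanoD(8)[OF f] primitive_subset_lattice extreme_point_of_def by blast

lemma slice_lev: "slice w h P = convex hull (lev h)"
  by (simp add: slice_def lev_def pairing_pt)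

lemma finite_below: "finite (below h)"
  using finite_lattice_bounded[OF compact_imp_bounded[OF fanoD(2)[OF f]]]
  by (rule finite_subset[rotated]) (auto simp: below_def lev_def)

lemma mutation_data: "mutation_data P w (convex hull {0, pt v}) (\<lambda>h. convex hull (below h))"
  unfolding mutation_data_def
proof (intro allI impI, elim conjE, intro conjI)
  fix h :: int assume h: "h < 0"
  have G: "convex hull (below h) + dilate \<bar>h\<bar> (convex hull {0, pt v}) =
      convex hull (below h + {0, of_int (- h) *\<^sub>R pt v})"
    using h by (subst slice_plus_segment) simp
  show "lattice_polytope (convex hull below h)"
    unfolding lattice_polytope_def using finite_below[of h]
    by (intro exI[of _ "below h"]) (auto simp: below_def lev_def)
  have "below h + {0, of_int (- h) *\<^sub>R pt v} \<subseteq> lev h"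
  proof
    fix y assume "y \<in> below h + {0, of_int (- h) *\<^sub>R pt v}"
    then obtain z where z: "z \<in> below h" "y = z \<or> y = z + of_int (- h) *\<^sub>R pt v"
      by (auto simp: set_plus_def)
    then show "y \<in> lev h"
      using lattice_shift[of z "- h" v] wv by (auto simp: below_def lev_def inner_diff_right)
  qed
  then show "convex hull (below h) + dilate \<bar>h\<bar> (convex hull {0, pt v}) \<subseteq> slice w h P"
    unfolding G slice_lev by (rule hull_mono)
  show "{x. x extreme_point_of P \<and> pairing w x = of_int h}
      \<subseteq> convex hull (below h) + dilate \<bar>h\<bar> (convex hull {0, pt v})"
    unfolding G pairing_pt
  proof
    fix x assume "x \<in> {x. x extreme_point_of P \<and> pt w \<bullet> x = of_int h}"
    then have x: "x extreme_point_of P" "pt w \<bullet> x = of_int h" by auto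
    have "x \<in> below h + {0, of_int (- h) *\<^sub>R pt v}"
    proof (cases "x - of_int h *\<^sub>R pt v \<in> P")
      case True
      then have "x \<in> below h" using x ext_lattice by (auto simp: below_def lev_def)
      then have "x + 0 \<in> below h + {0, of_int (- h) *\<^sub>R pt v}" by (intro set_plus_intro) auto
      then show ?thesis by simp
    next
      case False
      then have *: "x + of_int h *\<^sub>R pt v \<in> P" using slope[OF x(1)] x h by simp
      have "x + of_int h *\<^sub>R pt v \<in> below h"
        using * x ext_lattice[OF x(1)] lattice_shift[of x h v] wv
        by (auto simp: below_def lev_def inner_add_right)
      then have "(x + of_int h *\<^sub>R pt v) + of_int (- h) *\<^sub>R pt v \<in> below h + {0, of_int (- h) *\<^sub>R pt v}"
        by (intro set_plus_intro) auto
      then show ?thesis by simp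
    qed
    then show "x \<in> convex hull (below h + {0, of_int (- h) *\<^sub>R pt v})" by (rule hull_inc)
  qed
qed

lemma bounds:
  assumes "z \<in> P"
  shows "h_min w P \<le> pt w \<bullet> z" "pt w \<bullet> z \<le> h_max w P"
proof -
  have "continuous_on P (pairing w)" unfolding pairing_pt by (intro continuous_intros)
  then have "bounded (pairing w ` P)"
    using fanoD(2)[OF f] compact_continuous_image compact_imp_bounded by blast
  then have "bdd_below (pairing w ` P)" "bdd_above (pairing w ` P)"
    by (auto intro: bounded_imp_bdd_below bounded_imp_bdd_above)
  then show "h_min w P \<le> pt w \<bullet> z" "pt w \<bullet> z \<le> h_max w P"
    using assms unfolding h_min_def h_max_def
    by (auto simp flip: pairing_pt intro: cINF_lower cSUP_upper)
qed

lemma mut_eq: "mut w P (convex hull {0, pt v}) (\<lambda>h. convex hull (below h)) = mutc w v P"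
proof
  let ?Gs = "(\<Union>h\<in>{h::int. h_min w P \<le> of_int h \<and> h \<le> -1}. convex hull (below h))"
  let ?Ss = "(\<Union>h\<in>{h::int. 0 \<le> h \<and> of_int h \<le> h_max w P}.
     slice w h P + dilate h (convex hull {0, pt v}))"
  have "convex hull (below h) \<subseteq> mutc w v P" if "h \<le> -1" for h
    unfolding mutc_def using that by (intro hull_mono) (auto simp: below_def lev_def mgen_def)
  moreover have "slice w h P + dilate h (convex hull {0, pt v}) \<subseteq> mutc w v P" if "0 \<le> h" for h
    unfolding mutc_def slice_lev slice_plus_segment
  proof (intro hull_mono subsetI)
    fix y assume "y \<in> lev h + {0, of_int h *\<^sub>R pt v}"
    then obtain z where z: "z \<in> lev h" "y = z \<or> y = z + of_int h *\<^sub>R pt v"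
      by (auto simp: set_plus_def)
    then have "pt w \<bullet> y = of_int h" "y \<in> lattice"
      using lattice_shift[of z h v] wv by (auto simp: lev_def inner_add_right)
    moreover have "z \<in> P" using z by (simp add: lev_def)
    ultimately show "y \<in> mgen w v P" using z that by (auto simp: mgen_def)
  qed
  ultimately have "?Gs \<union> ?Ss \<subseteq> mutc w v P" by (intro Un_least UN_least) auto
  then show "mut w P (convex hull {0, pt v}) (\<lambda>h. convex hull (below h)) \<subseteq> mutc w v P"
    unfolding mut_def by (rule hull_minimal) (simp add: mutc_def)
  have "mgen w v P \<subseteq> ?Gs \<union> ?Ss"
  proof
    fix z assume z: "z \<in> mgen w v P"
    then have zl: "z \<in> lattice" by (simp add: mgen_def)
    then obtain h where h: "pt w \<bullet> z = of_int h" using lattice_value by blast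
    show "z \<in> ?Gs \<union> ?Ss"
    proof (cases "h < 0")
      case True
      then have "z \<in> below h" using z h by (auto simp: mgen_def below_def lev_def)
      moreover have "h_min w P \<le> of_int h" using bounds(1)[of z] z h True by (auto simp: mgen_def)
      ultimately have "z \<in> ?Gs" using True by (intro UN_I[of h]) (auto intro: hull_inc)
      then show ?thesis by simp
    next
      case False
      then obtain y where y: "y \<in> P" "z = y + 0 \<or> z = y + of_int h *\<^sub>R pt v"
      proof (cases "z \<in> P")
        case True then show ?thesis using that by simp
      next
        case nz: False
        then have "z - of_int h *\<^sub>R pt v \<in> P" using z h False by (simp add: mgen_def)
        then show ?thesis using that[of "z - of_int h *\<^sub>R pt v"] by simp
      qed
      have yl: "y \<in> lev h"
      proof -
        have "y \<in> lattice" using y(2) zl lattice_shift[of z "- h" v] by auto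
        moreover have "pt w \<bullet> y = of_int h" using y(2) h wv by (auto simp: inner_add_right)
        ultimately show ?thesis using y by (simp add: lev_def)
      qed
      have "z \<in> lev h + {0, of_int h *\<^sub>R pt v}" 
      proof -
        have "y + 0 \<in> lev h + {0, of_int h *\<^sub>R pt v}" "y + of_int h *\<^sub>R pt v \<in> lev h + {0, of_int h *\<^sub>R pt v}"
          using yl by (auto intro!: set_plus_intro simp del: add_0_right)
        then show ?thesis using y(2) by auto
      qed
      then have "z \<in> slice w h P + dilate h (convex hull {0, pt v})"
        unfolding slice_lev slice_plus_segment by (rule hull_inc)
      moreover have "of_int h \<le> h_max w P" using bounds(2)[OF y(1)] yl by (simp add: lev_def)
      ultimately have "z \<in> ?Ss" using False by (intro UN_I[of h]) auto
      then show ?thesis by simp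
    qed
  qed
  then show "mutc w v P \<subseteq> mut w P (convex hull {0, pt v}) (\<lambda>h. convex hull (below h))"
    unfolding mut_def mutc_def by (rule hull_mono)
qed

lemma mutation_of_mutc:
  assumes "edat P w r p k"
  shows "mutation_of P (mutc w v P)"
  unfolding mutation_of_def
  using edat_edge[OF f assms] edat_inner_normal[OF assms] cv wv mutation_data mut_eq
  by (intro exI[of _ "minf (pt w) P"] exI[of _ w] exI[of _ "pt v"] exI[of _ "\<lambda>h. convex hull (below h)"])
    (auto simp: primitive_points_eq pairing_pt)

text \<open>Here the fractions \<open>t\<close> can be taken to be 0 or 1: each lattice point of the
  mutation and each vertex of \<open>P\<close> is either left in place or moved by the full
  shear.\<close>

lemma mrel_mutc: "mrel (pt w) (pt v) P (mutc w v P)"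
  unfolding mrel_def
proof (intro conjI exI)
  show "pt w \<bullet> pt v = 0" by (rule wv)
  show "P = convex hull {x. x extreme_point_of P}" by (rule fanoD(9)[OF f])
  show "mutc w v P = convex hull (mgen w v P)" by (rule mutc_def)
  show "\<forall>s\<in>mgen w v P. (pt w \<bullet> s \<le> 0 \<longrightarrow> s \<in> P \<and> s - (pt w \<bullet> s) *\<^sub>R pt v \<in> P) \<and>
        (0 \<le> pt w \<bullet> s \<longrightarrow> (\<exists>t\<in>{0..1}. s - (t * (pt w \<bullet> s)) *\<^sub>R pt v \<in> P))"
  proof (intro ballI conjI impI)
    fix s assume s: "s \<in> mgen w v P" "0 \<le> pt w \<bullet> s"
    then consider "s \<in> P" | "s - (pt w \<bullet> s) *\<^sub>R pt v \<in> P" by (auto simp: mgen_def)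
    then show "\<exists>t\<in>{0..1}. s - (t * (pt w \<bullet> s)) *\<^sub>R pt v \<in> P"
    proof cases
      case 1 then show ?thesis by (intro bexI[of _ 0]) auto
    next
      case 2 then show ?thesis by (intro bexI[of _ 1]) auto
    qed
  qed (auto simp: mgen_def)
  show "\<forall>x\<in>{x. x extreme_point_of P}.
      (pt w \<bullet> x \<le> 0 \<longrightarrow> (\<exists>t\<in>{0..1}. x + (t * (pt w \<bullet> x)) *\<^sub>R pt v \<in> mutc w v P)) \<and>
        (0 \<le> pt w \<bullet> x \<longrightarrow> x \<in> mutc w v P \<and> x + (pt w \<bullet> x) *\<^sub>R pt v \<in> mutc w v P)"
  proof (intro ballI)
    fix x assume "x \<in> {x. x extreme_point_of P}"
    then have x: "x extreme_point_of P" by simp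
    then have xP: "x \<in> P" "x \<in> lattice" using ext_lattice by auto
    obtain h where h: "pt w \<bullet> x = of_int h" using lattice_value[OF xP(2)] by blast
    have sh: "x + of_int h *\<^sub>R pt v \<in> lattice" "pt w \<bullet> (x + of_int h *\<^sub>R pt v) = of_int h"
      using xP lattice_shift[of x h v] wv h by (auto simp: inner_add_right)
    have ge: "x \<in> mgen w v P \<and> x + of_int h *\<^sub>R pt v \<in> mgen w v P" if "0 \<le> h"
      using that xP h sh by (auto simp: mgen_def)
    have neg: "\<exists>t\<in>{0..1}. x + (t * of_int h) *\<^sub>R pt v \<in> mgen w v P" if "h < 0"
    proof (cases "x - of_int h *\<^sub>R pt v \<in> P")
      case True
      then have "x \<in> mgen w v P" using that xP h by (auto simp: mgen_def)
      then show ?thesis by (intro bexI[of _ 0]) auto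
    next
      case False
      then have "x + of_int h *\<^sub>R pt v \<in> P" using slope[OF x] h that by simp
      then have "x + of_int h *\<^sub>R pt v \<in> mgen w v P" using that xP h sh by (auto simp: mgen_def)
      then show ?thesis by (intro bexI[of _ 1]) auto
    qed
    have "\<exists>t\<in>{0..1}. x + (t * of_int h) *\<^sub>R pt v \<in> mgen w v P" if "h \<le> 0"
    proof (cases "h = 0")
      case True then show ?thesis using ge by (intro bexI[of _ 0]) auto
    next
      case False then show ?thesis using neg that by simp
    qed
    then show "(pt w \<bullet> x \<le> 0 \<longrightarrow> (\<exists>t\<in>{0..1}. x + (t * (pt w \<bullet> x)) *\<^sub>R pt v \<in> mutc w v P)) \<and>
        (0 \<le> pt w \<bullet> x \<longrightarrow> x \<in> mutc w v P \<and> x + (pt w \<bullet> x) *\<^sub>R pt v \<in> mutc w v P)"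
      unfolding mutc_def h using ge by (simp, meson hull_inc)
  qed
qed

end

section \<open>The mutation is again a Fano polygon\<close>

lemma convex_supporting_0:
  fixes Q :: "point set"
  assumes "convex Q" "0 \<notin> interior Q"
  obtains u where "u \<noteq> 0" "\<And>z. z \<in> Q \<Longrightarrow> 0 \<le> u \<bullet> z"
proof (cases "interior Q = {}")
  case True
  then obtain a b where ab: "a \<noteq> 0" "Q \<subseteq> {x. a \<bullet> x = b}"
    using empty_interior_subset_hyperplane[OF assms(1)] by metis
  show ?thesis
  proof (cases "0 \<le> b")
    case True then show ?thesis using ab by (intro that[of a]) auto
  next
    case False then show ?thesis using ab by (intro that[of "- a"]) auto
  qed
next
  case False
  obtain a where a: "a \<noteq> 0" "\<forall>x\<in>interior Q. 0 \<le> a \<bullet> x"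
    using separating_hyperplane_set_0[of "interior Q"] assms by (auto simp: convex_interior)
  have "interior Q \<subseteq> {x. 0 \<le> a \<bullet> x}" using a by auto
  then have "closure (interior Q) \<subseteq> {x. 0 \<le> a \<bullet> x}" by (rule closure_minimal) (rule closed_halfspace_ge)
  moreover have "Q \<subseteq> closure (interior Q)"
    using convex_closure_interior[OF assms(1) False] closure_subset by blast
  ultimately show ?thesis using a by (intro that[of a]) auto
qed

text \<open>The shear does not change the value of \<open>w\<close>, so a common divisor of the new
  coordinates divides \<open>h\<close>, and then the old coordinates as well.\<close>

lemma shear_coprime:
  assumes wv: "fst w * fst v + snd w * snd v = 0" and c: "coprime (fst p) (snd p)"
  defines "h \<equiv> fst w * fst p + snd w * snd p"
  shows "coprime (fst p + h * fst v) (snd p + h * snd (v::int \<times> int))"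
proof (rule coprimeI)
  fix d assume d: "d dvd fst p + h * fst v" "d dvd snd p + h * snd v"
  have "d dvd fst w * (fst p + h * fst v) + snd w * (snd p + h * snd v)" using d by simp
  also have "\<dots> = h + h * (fst w * fst v + snd w * snd v)" by (simp add: h_def algebra_simps)
  finally have "d dvd h" using wv by simp
  then have "d dvd h * fst v" "d dvd h * snd v" by simp_all
  then have "d dvd fst p" "d dvd snd p" using d by (simp_all add: dvd_add_left_iff)
  then show "is_unit d" using c by (meson coprime_common_divisor)
qed

text \<open>The minimising faces of a mutation are described only for functionals that do not vanish
  on \<open>v\<close>. If the functional separating \<open>x\<close> from the other points is
  orthogonal to \<open>v\<close>, a small multiple of \<open>v\<close> can be added to it without
  destroying the strict gap.\<close>

lemma extreme_unique_min:
  assumes S: "finite S" and x: "x extreme_point_of convex hull S" and v: "v \<noteq> 0"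
  obtains u where "minf u (convex hull S) = {x}" "u \<bullet> v \<noteq> (0::real)"
proof -
  have xS: "x \<in> S" using x by (rule extreme_point_of_convex_hull)
  have xQ: "x \<in> convex hull S" using xS by (rule hull_inc)
  have cvx: "convex (convex hull S - {x})"
    using x extreme_point_of_stillconvex[OF convex_convex_hull] by blast
  have "convex hull (S - {x}) \<subseteq> convex hull S - {x}"
    by (intro hull_minimal cvx) (auto intro: hull_inc)
  then have "x \<notin> convex hull (S - {x})" by blast
  moreover have "closed (convex hull (S - {x}))" using S
    by (simp add: compact_imp_closed finite_imp_compact_convex_hull)
  ultimately obtain a b where ab: "a \<bullet> x < b" "\<forall>y\<in>convex hull (S - {x}). b < a \<bullet> y"
    using separating_hyperplane_closed_point[of "convex hull (S - {x})" x] by auto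
  then have gap: "b < a \<bullet> y" if "y \<in> S" "y \<noteq> x" for y using that by (auto intro: hull_inc)
  have "\<exists>u. u \<bullet> v \<noteq> 0 \<and> (\<forall>y\<in>S - {x}. u \<bullet> x < u \<bullet> y)"
  proof (cases "a \<bullet> v = 0")
    case False
    then show ?thesis using ab(1) gap by (intro exI[of _ a]) force
  next
    case True
    define M where "M = Max ((\<lambda>y. \<bar>v \<bullet> (y - x)\<bar>) ` S)"
    have M: "\<bar>v \<bullet> (y - x)\<bar> \<le> M" if "y \<in> S" for y
      unfolding M_def using S that by (intro Max_ge imageI finite_imageI)
    have M0: "0 \<le> M" using M[OF xS] by simp
    \<comment> \<open>Chosen so that \<open>e * M\<close> stays below the gap
      \<open>b - a \<bullet> x\<close>; the summand 1 avoids a zero denominator.\<close>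
    define e where "e = (b - a \<bullet> x) / (M + 1)"
    have e: "0 < e" using ab(1) M0 by (simp add: e_def)
    have eM: "e * M < b - a \<bullet> x"
    proof -
      have "e * M < e * (M + 1)" using e by simp
      also have "\<dots> = b - a \<bullet> x" using M0 by (simp add: e_def)
      finally show ?thesis .
    qed
    show ?thesis
    proof (intro exI[of _ "a + e *\<^sub>R v"] conjI ballI)
      show "(a + e *\<^sub>R v) \<bullet> v \<noteq> 0" using True e v by (simp add: inner_add_left)
      fix y assume y: "y \<in> S - {x}"
      have "e * (v \<bullet> (x - y)) \<le> e * M"
        using M[of y] y e by (intro mult_left_mono) (auto simp: inner_diff_right abs_le_iff)
      moreover have "b < a \<bullet> y" using gap y by blast
      ultimately show "(a + e *\<^sub>R v) \<bullet> x < (a + e *\<^sub>R v) \<bullet> y" using eM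
        by (simp add: inner_add_left inner_diff_right right_diff_distrib)
    qed
  qed
  then obtain u where u: "u \<bullet> v \<noteq> 0" "\<And>y. y \<in> S \<Longrightarrow> y \<noteq> x \<Longrightarrow> u \<bullet> x < u \<bullet> y" by blast
  have "S \<subseteq> {z. u \<bullet> x < u \<bullet> z} \<union> {z \<in> {x}. u \<bullet> z = u \<bullet> x}" using u(2) by auto
  then have sub: "convex hull S \<subseteq> {z. u \<bullet> x < u \<bullet> z} \<union> {z \<in> {x}. u \<bullet> z = u \<bullet> x}"
    by (rule hull_minimal) (rule convex_open_halfspace_Un_face, simp)
  have "minf u (convex hull S) = {x}"
  proof
    show "minf u (convex hull S) \<subseteq> {x}"
    proof
      fix z assume z: "z \<in> minf u (convex hull S)"
      then have "u \<bullet> z \<le> u \<bullet> x" "z \<in> convex hull S" using xQ by (simp_all add: minf_iff)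
      then show "z \<in> {x}" using subsetD[OF sub, of z] by auto
    qed
    show "{x} \<subseteq> minf u (convex hull S)"
    proof -
      have "u \<bullet> x \<le> u \<bullet> y" if "y \<in> convex hull S" for y using subsetD[OF sub that] by auto
      then show ?thesis using xQ by (simp add: minf_iff)
    qed
  qed
  then show ?thesis using that u(1) by blast
qed

context mutable
begin

text \<open>A nonzero functional that is nonnegative on the mutation would yield one on
  \<open>P\<close>, so the origin stays inside. A vertex of the mutation is a minimising face
  consisting of one point, hence a vertex of \<open>P\<close> or the shear of one, and the shear
  preserves primitivity.\<close>

lemma fano_mutc: "fano_polygon (mutc w v P)"
  unfolding fano_polygon_def
proof (intro conjI subsetI)
  have fin: "finite (mgen w v P)" by (rule finite_mgen[OF fanoD(2)[OF f] wv])
  show "polytope (mutc w v P)" unfolding mutc_def polytope_def using fin by blast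
  have v0: "pt v \<noteq> 0" using cv by (auto simp: pt_def prod_eq_iff)
  note m = mrel_mutc
  show "0 \<in> interior (mutc w v P)"
  proof (rule ccontr)
    assume "0 \<notin> interior (mutc w v P)"
    then obtain u where u: "u \<noteq> 0" "\<And>z. z \<in> mutc w v P \<Longrightarrow> 0 \<le> u \<bullet> z"
      using convex_supporting_0[of "mutc w v P"] by (auto simp: mutc_def)
    show False
    proof (cases "0 \<le> u \<bullet> pt v")
      case True
      then show False
        using fano_pos[OF f u(1)] mrel_dual1[OF mrel_sym[OF m] True u(2)] by force
    next
      case False
      define u' where "u' = u - (u \<bullet> pt v) *\<^sub>R (- pt w)"
      have "u' \<bullet> pt v = u \<bullet> pt v" using wv by (simp add: u'_def inner_add_left)
      then have "u' \<noteq> 0" using False by auto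
      then obtain z where z: "z \<in> P" "u' \<bullet> z < 0" using fano_pos[OF f] by blast
      have "0 \<le> u' \<bullet> z" unfolding u'_def
        by (rule mrel_dual2[OF mrel_sym[OF m] _ u(2) z(1)]) (use False in simp_all)
      then show False using z by simp
    qed
  qed
  fix x assume "x \<in> {x. x extreme_point_of mutc w v P}"
  then have x: "x extreme_point_of convex hull (mgen w v P)" by (simp add: mutc_def)
  obtain u where u: "minf u (mutc w v P) = {x}" "u \<bullet> pt v \<noteq> 0"
    using extreme_unique_min[OF fin x v0] unfolding mutc_def by blast
  have ext: "y \<in> primitive_points" if "minf u P = {y}" for u y
  proof -
    have "{y} face_of P" using minf_face[OF fanoD(3)[OF f], of u] that by simp
    then show ?thesis using fanoD(8)[OF f] by (simp add: face_of_singleton)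
  qed
  show "x \<in> primitive_points"
  proof (cases "0 < u \<bullet> pt v")
    case True
    then show ?thesis using ext mrel_face1[OF m True] u by simp
  next
    case False
    define u0 where "u0 = u + (u \<bullet> pt v) *\<^sub>R pt w"
    have u0v: "u0 \<bullet> pt v = u \<bullet> pt v" using wv by (simp add: u0_def inner_add_left)
    then have neg: "u0 \<bullet> pt v < 0" using False u(2) by simp
    have "u0 - (u0 \<bullet> pt v) *\<^sub>R pt w = u" unfolding u0v by (simp add: u0_def)
    then have img: "(\<lambda>z. z + (pt w \<bullet> z) *\<^sub>R pt v) ` minf u0 P = {x}"
      using mrel_face2[OF m neg] u(1) by simp
    have inj: "inj (\<lambda>z. z + (pt w \<bullet> z) *\<^sub>R pt v)"
    proof (rule injI)
      fix a b assume ab: "a + (pt w \<bullet> a) *\<^sub>R pt v = b + (pt w \<bullet> b) *\<^sub>R pt v"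
      have "pt w \<bullet> a = pt w \<bullet> b" using arg_cong[OF ab, of "\<lambda>z. pt w \<bullet> z"] wv
        by (simp add: inner_add_right)
      then show "a = b" using ab by simp
    qed
    have "card (minf u0 P) = 1" using img card_image[OF inj_on_subset[OF inj subset_UNIV], of "minf u0 P"] by simp
    then obtain y where y: "minf u0 P = {y}" by (meson card_1_singletonE)
    then have xy: "x = y + (pt w \<bullet> y) *\<^sub>R pt v" using img by auto
    obtain q where q: "y = pt q" "coprime (fst q) (snd q)" using ext[OF y] by (auto simp: primitive_points_eq)
    have w0: "fst w * fst v + snd w * snd v = 0" using wv by (simp add: pt_inner_pt del: of_int_add of_int_mult)
    define h where "h = fst w * fst q + snd w * snd q"
    have "x = pt (fst q + h * fst v, snd q + h * snd v)"
      using xy q by (simp add: h_def pt_inner prod_eq_iff)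
    then show ?thesis using shear_coprime[OF w0 q(2)] by (auto simp: primitive_points_eq h_def)
  qed
qed

end

text \<open>The part of \<open>P\<close> on the nonnegative side of \<open>w\<close> is contained in
  \<open>Q\<close>, while the dual bound for \<open>- w\<close> shows that \<open>Q\<close> rises no
  higher than \<open>P\<close>; so both have the same top level.\<close>

lemma mrel_max:
  assumes m: "mrel w v P Q" and P: "compact P" "convex P" "P \<noteq> {}" and Q: "compact Q" "convex Q"
    and z: "z \<in> Q" "0 \<le> w \<bullet> z" "\<And>y. y \<in> Q \<Longrightarrow> w \<bullet> y \<le> w \<bullet> z"
  obtains x where "x \<in> P" "w \<bullet> x = w \<bullet> z"
proof -
  have wv: "w \<bullet> v = 0" using mrel_orth m by blast
  have "continuous_on P (\<lambda>x. w \<bullet> x)" by (intro continuous_intros)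
  then obtain x where x: "x \<in> P" "\<And>y. y \<in> P \<Longrightarrow> w \<bullet> y \<le> w \<bullet> x"
    using continuous_attains_sup[OF P(1) P(3)] by blast
  have "- (w \<bullet> x) \<le> (- w) \<bullet> z"
    by (rule mrel_dual1[OF m _ _ z(1)]) (use x wv in auto)
  then have le: "w \<bullet> z \<le> w \<bullet> x" by simp
  then have "x \<in> Q"
    using mrel_lift[OF mrel_sym[OF m] Q P(1,2), of x] z(2) x by simp
  then have "w \<bullet> x \<le> w \<bullet> z" by (rule z(3))
  then have "w \<bullet> x = w \<bullet> z" using le by simp
  then show ?thesis using that x(1) by blast
qed

lemma orth_coprime_unique:
  fixes a b c d :: int
  assumes "coprime a b" "coprime c d" "a * d = b * c"
  shows "(a, b) = (c, d) \<or> (a, b) = (- c, - d)"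
proof -
  have "a dvd c" using assms by (metis coprime_dvd_mult_right_iff dvd_triv_left)
  moreover have "c dvd a" using assms by (metis coprime_dvd_mult_left_iff dvd_triv_right)
  moreover have "b dvd d" using assms by (metis coprime_dvd_mult_right_iff coprime_commute dvd_triv_left)
  moreover have "d dvd b" using assms by (metis coprime_dvd_mult_left_iff coprime_commute dvd_triv_right)
  ultimately have "\<bar>a\<bar> = \<bar>c\<bar>" "\<bar>b\<bar> = \<bar>d\<bar>" by (auto intro: zdvd_antisym_abs)
  then show ?thesis using assms(3) by (auto simp: abs_if split: if_splits)
qed

text \<open>A finite convex set of integers is an interval. With \<open>m\<close> the distance of a
  level from the kernel, the two counts express what that level loses or gains in a
  mutation.\<close>

lemma card_int_shift:
  fixes J :: "int set"
  assumes fin: "finite J" and conv: "\<And>x y z. x \<in> J \<Longrightarrow> z \<in> J \<Longrightarrow> x \<le> y \<Longrightarrow> y \<le> z \<Longrightarrow> y \<in> J"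
    and m: "0 \<le> m"
  shows "int (card J) - m \<le> int (card {j \<in> J. j + m \<in> J})"
    "m \<le> int (card J) \<Longrightarrow> int (card {j \<in> J. j + m \<in> J}) = int (card J) - m"
proof -
  have "int (card J) - m \<le> int (card {j \<in> J. j + m \<in> J}) \<and>
    (m \<le> int (card J) \<longrightarrow> int (card {j \<in> J. j + m \<in> J}) = int (card J) - m)"
  proof (cases "J = {}")
    case True then show ?thesis using m by simp
  next
    case False
    define a b where "a = Min J" and "b = Max J"
    have J: "J = {a..b}"
    proof
      show "J \<subseteq> {a..b}" using Min_le[OF fin] Max_ge[OF fin] by (auto simp: a_def b_def)
      have "a \<in> J" "b \<in> J" using Min_in[OF fin False] Max_in[OF fin False] by (simp_all add: a_def b_def)
      then show "{a..b} \<subseteq> J" using conv[of a b] by auto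
    qed
    have "a \<le> b" using J False by auto
    have "{j \<in> J. j + m \<in> J} = {a..b - m}" unfolding J using m by auto
    then show ?thesis using m \<open>a \<le> b\<close> by (simp add: J)
  qed
  then show "int (card J) - m \<le> int (card {j \<in> J. j + m \<in> J})"
    "m \<le> int (card J) \<Longrightarrow> int (card {j \<in> J. j + m \<in> J}) = int (card J) - m" by auto
qed

text \<open>The range contains \<open>- n\<close> but not \<open>n\<close>. This asymmetry is the
  source of the drop of the number of lattice points at an edge that is not matched on the other
  side.\<close>

lemma sum_symmetric: "(\<Sum>h\<in>{- int n..<int n}. h) = - int n"
proof (induction n)
  case (Suc n)
  have "{- int (Suc n)..<int (Suc n)} = insert (- int (Suc n)) (insert (int n) {- int n..<int n})" by auto
  then show ?case using Suc by simp
qed simp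

section \<open>Mutations at an edge that is at least as wide as high\<close>

locale edge_mutation =
  fixes P :: "point set" and w :: "int \<times> int" and r :: int and p :: "int \<times> int" and k :: int
  assumes f: "fano_polygon P" and e: "edat P w r p k" and rk: "r \<le> k"
begin

abbreviation v :: "int \<times> int" where "v \<equiv> (snd w, - fst w)"

lemma cw: "coprime (fst w) (snd w)" and r0: "0 < r" and wp: "pt w \<bullet> pt p = - of_int r"
  using e by (auto simp: edat_def)

lemma cv: "coprime (fst v) (snd v)"
  using cw by (simp add: coprime_commute)

lemma v0: "pt v \<noteq> 0" using cw by (auto simp: pt_def prod_eq_iff)

lemma wv: "pt w \<bullet> pt v = 0"
  by (simp add: pt_inner)

lemma line_param:
  assumes "pt w \<bullet> z = 0"
  obtains t where "z = t *\<^sub>R pt v"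
proof -
  have "of_int (- fst w) * fst z = of_int (snd w) * snd z" using assms by (simp add: pt_inner)
  then obtain t where "fst z = t * of_int (snd w)" "snd z = t * of_int (- fst w)"
    using orth_prim[of "snd w" "- fst w" "fst z" "snd z"] cv by auto
  then have "z = t *\<^sub>R pt v" by (simp add: prod_eq_iff)
  then show ?thesis by (rule that)
qed

text \<open>The triangle over the edge with apex at the origin has on level \<open>h\<close> a
  segment of length \<open>- h * k / r\<close>, which is at least \<open>- h\<close> because
  \<open>r \<le> k\<close>.\<close>

lemma level_segment:
  assumes h: "- of_int r \<le> h" "h \<le> 0" and t: "0 \<le> t" "t \<le> - h"
  shows "(- h / of_int r) *\<^sub>R pt p + t *\<^sub>R pt v \<in> P"
proof (cases "h = 0")
  case True then show ?thesis using t fanoD(5)[OF f] by simp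
next
  case False
  define s where "s = - h / of_int r"
  have s: "0 < s" "s \<le> 1" "s * of_int r = - h" using h False r0 by (auto simp: s_def field_simps)
  have "t / s \<le> of_int r" using t(2) s by (simp add: field_simps)
  also have "\<dots> \<le> of_int k" using rk by simp
  finally have ts: "t / s \<le> of_int k" .
  have "0 \<le> t / s" using t s by simp
  then have "pt p + (t / s) *\<^sub>R pt v \<in> P" using edat_param[OF e, of "pt p + (t / s) *\<^sub>R pt v"] ts by blast
  then have "(1 - s) *\<^sub>R 0 + s *\<^sub>R (pt p + (t / s) *\<^sub>R pt v) \<in> P"
    using s fanoD(3,5)[OF f] by (intro convexD) auto
  moreover have "s *\<^sub>R ((t / s) *\<^sub>R pt v) = t *\<^sub>R pt v" using s by simp
  ultimately have "s *\<^sub>R pt p + t *\<^sub>R pt v \<in> P" by (simp only: scaleR_add_right scaleR_zero_right add_0)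
  then show ?thesis by (simp only: s_def)
qed

sublocale mutable P w v
proof
  show "fano_polygon P" by (rule f)
  show "coprime (fst v) (snd v)" by (rule cv)
  show "pt w \<bullet> pt v = 0" by (rule wv)
  fix x assume x: "x extreme_point_of P" "pt w \<bullet> x < 0"
  define h where "h = pt w \<bullet> x"
  have xP: "x \<in> P" using x by (simp add: extreme_point_of_def)
  have hr: "- of_int r \<le> h" unfolding h_def by (rule edat_ge[OF e xP])
  \<comment> \<open>On the level of \<open>x\<close> the triangle over the edge contains the segment
    from \<open>a\<close> to \<open>a - h v\<close>; below, \<open>t\<close> is the position of
    \<open>x\<close> measured from \<open>a\<close>.\<close>
  define a where "a = (- h / of_int r) *\<^sub>R pt p"
  have "pt w \<bullet> a = h" using r0 wp by (simp add: a_def)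
  then have "pt w \<bullet> (x - a) = 0" by (simp add: h_def inner_diff_right)
  then obtain t where "x - a = t *\<^sub>R pt v" using line_param by blast
  then have xa: "x = a + t *\<^sub>R pt v" by (metis add.commute diff_add_cancel)
  have seg: "a + s *\<^sub>R pt v \<in> P" if "0 \<le> s" "s \<le> - h" for s
    using level_segment[OF hr _ that] x(2) by (simp add: a_def h_def)
  have hneg: "h < 0" using x(2) by (simp add: h_def)
  have mid: "a + s *\<^sub>R pt v \<in> P" if "t \<le> s" "s \<le> s'" "a + s' *\<^sub>R pt v \<in> P" for s s'
  proof (cases "s' = t")
    case True then show ?thesis using that by (metis antisym)
  next
    case False
    define l where "l = (s - t) / (s' - t)"
    have lb: "0 \<le> l" "l \<le> 1" using that False by (auto simp: l_def divide_simps)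
    have "(1 - l) * t + l * s' = t + l * (s' - t)" by (simp add: algebra_simps)
    also have "\<dots> = s" using False by (simp add: l_def)
    finally have s: "s = (1 - l) * t + l * s'" by simp
    have "(1 - l) *\<^sub>R x + l *\<^sub>R (a + s' *\<^sub>R pt v) \<in> P"
      using lb that xP fanoD(3)[OF f] by (intro convexD) auto
    also have "(1 - l) *\<^sub>R x + l *\<^sub>R (a + s' *\<^sub>R pt v) = a + s *\<^sub>R pt v"
      unfolding xa s by (simp add: algebra_simps)
    finally show ?thesis .
  qed
  have mid': "a + s *\<^sub>R pt v \<in> P" if "s \<le> t" "s' \<le> s" "a + s' *\<^sub>R pt v \<in> P" for s s'
  proof (cases "s' = t")
    case True then show ?thesis using that by (metis antisym)
  next
    case False
    define l where "l = (t - s) / (t - s')"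
    have lb: "0 \<le> l" "l \<le> 1" using that False by (auto simp: l_def divide_simps)
    have "(1 - l) * t + l * s' = t - l * (t - s')" by (simp add: algebra_simps)
    also have "\<dots> = s" using False by (simp add: l_def)
    finally have s: "s = (1 - l) * t + l * s'" by simp
    have "(1 - l) *\<^sub>R x + l *\<^sub>R (a + s' *\<^sub>R pt v) \<in> P"
      using lb that xP fanoD(3)[OF f] by (intro convexD) auto
    also have "(1 - l) *\<^sub>R x + l *\<^sub>R (a + s' *\<^sub>R pt v) = a + s *\<^sub>R pt v"
      unfolding xa s by (simp add: algebra_simps)
    finally show ?thesis .
  qed
  \<comment> \<open>A vertex at an end of the segment or beyond it has a stretch of length
    \<open>- h\<close> inside \<open>P\<close> in front of it, towards the segment. Strictly inside
    the segment it would not be extreme.\<close>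
  consider "t \<le> 0" | "- h \<le> t" | "0 < t" "t < - h" by linarith
  then show "x - (pt w \<bullet> x) *\<^sub>R pt v \<in> P \<or> x + (pt w \<bullet> x) *\<^sub>R pt v \<in> P"
  proof cases
    case 1
    have "a + (t - h) *\<^sub>R pt v \<in> P" using mid[of "t - h" "- h"] seg[of "- h"] 1 hneg by auto
    moreover have "a + (t - h) *\<^sub>R pt v = x - h *\<^sub>R pt v" by (simp add: xa algebra_simps)
    ultimately show ?thesis by (simp add: h_def)
  next
    case 2
    have "a + (t + h) *\<^sub>R pt v \<in> P" using mid'[of "t + h" 0] seg[of 0] 2 hneg by auto
    moreover have "a + (t + h) *\<^sub>R pt v = x + h *\<^sub>R pt v" by (simp add: xa algebra_simps)
    ultimately show ?thesis by (simp add: h_def)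
  next
    case 3
    have "x \<in> open_segment (a + 0 *\<^sub>R pt v) (a + (- h) *\<^sub>R pt v)"
      unfolding in_segment
    proof (intro conjI exI[of _ "t / (- h)"])
      show "a + 0 *\<^sub>R pt v \<noteq> a + (- h) *\<^sub>R pt v" using v0 hneg by simp
      show "0 < t / - h" "t / - h < 1" using 3 hneg by (auto simp: field_simps)
      have "(t / (- h)) *\<^sub>R ((- h) *\<^sub>R pt v) = t *\<^sub>R pt v" using hneg by simp
      moreover have "(1 - s) *\<^sub>R (a + 0 *\<^sub>R b) + s *\<^sub>R (a + b) = a + s *\<^sub>R b" for s and b :: point
        by (simp add: algebra_simps)
      ultimately show "x = (1 - t / (- h)) *\<^sub>R (a + 0 *\<^sub>R pt v) + (t / (- h)) *\<^sub>R (a + (- h) *\<^sub>R pt v)"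
        unfolding xa by (metis scaleR_zero_left)
    qed
    then show ?thesis using x(1) seg[of 0] seg[of "- h"] hneg unfolding extreme_point_of_def
      by (metis less_eq_real_def neg_0_less_iff_less order_refl)
  qed
qed

abbreviation Q :: "point set" where "Q \<equiv> mutc w v P"

lemma compactQ: "compact Q" "convex Q"
  using fanoD(2,3)[OF fano_mutc] by auto

lemmas lift = mrel_lift[OF mrel_mutc fanoD(2,3)[OF f] compactQ]

lemma lift': "0 \<le> pt w \<bullet> z \<Longrightarrow> z \<in> P \<longleftrightarrow> z \<in> Q \<and> z + (pt w \<bullet> z) *\<^sub>R pt v \<in> Q"
  using mrel_lift[OF mrel_sym[OF mrel_mutc] compactQ fanoD(2,3)[OF f], of z] by simp

lemma Q_mono: "pt w \<bullet> z \<le> 0 \<Longrightarrow> z \<in> Q \<Longrightarrow> z \<in> P"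
  using lift by blast

lemma step: "mutation_step P Q"
  unfolding mutation_step_def using f fano_mutc mutation_of_mutc[OF e] by blast

lemma bottom_lattice:
  "{z \<in> Q \<inter> lattice. pt w \<bullet> z = - of_int r} =
    (\<lambda>j. pt (fst p + j * snd w, snd p - j * fst w)) ` {0..k - r}"
proof -
  have shift: "pt (fst p + j * snd w, snd p - j * fst w) + of_int r *\<^sub>R pt v =
    pt (fst p + (j + r) * snd w, snd p - (j + r) * fst w)" for j
    by (simp add: pt_def algebra_simps)
  have inj: "pt (fst p + j * snd w, snd p - j * fst w) = pt (fst p + j' * snd w, snd p - j' * fst w) \<longleftrightarrow> j = j'" for j j'
    using cw by auto
  have lat: "z \<in> P \<and> z \<in> lattice \<and> pt w \<bullet> z = - of_int r \<longleftrightarrow>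
      (\<exists>j\<in>{0..k}. z = pt (fst p + j * snd w, snd p - j * fst w))" for z
    using edat_lattice[OF e] edat_minf_iff[OF e, of z] by blast
  have mem: "pt (fst p + j * snd w, snd p - j * fst w) \<in> P \<longleftrightarrow> 0 \<le> j \<and> j \<le> k" for j
  proof -
    have "pt w \<bullet> pt (fst p + j * snd w, snd p - j * fst w) = - of_int r"
      using wp by (simp add: pt_inner algebra_simps)
    then show ?thesis using lat[of "pt (fst p + j * snd w, snd p - j * fst w)"] inj by auto
  qed
  show ?thesis
  proof (intro set_eqI iffI)
    fix z assume z: "z \<in> {z \<in> Q \<inter> lattice. pt w \<bullet> z = - of_int r}"
    then have "z \<in> P \<and> z + of_int r *\<^sub>R pt v \<in> P" using lift[of z] r0 by simp
    moreover obtain j where j: "j \<in> {0..k}" "z = pt (fst p + j * snd w, snd p - j * fst w)"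
      using z calculation lat[of z] by auto
    ultimately have "0 \<le> j + r \<and> j + r \<le> k" using shift[of j] mem[of "j + r"] by simp
    then show "z \<in> (\<lambda>j. pt (fst p + j * snd w, snd p - j * fst w)) ` {0..k - r}" using j by auto
  next
    fix z assume "z \<in> (\<lambda>j. pt (fst p + j * snd w, snd p - j * fst w)) ` {0..k - r}"
    then obtain j where j: "0 \<le> j" "j \<le> k - r" "z = pt (fst p + j * snd w, snd p - j * fst w)" by auto
    then have "z \<in> P" "pt w \<bullet> z = - of_int r" using mem[of j] r0 lat[of z] by auto
    moreover have "z + of_int r *\<^sub>R pt v \<in> P" using j shift[of j] mem[of "j + r"] r0 by simp
    ultimately show "z \<in> {z \<in> Q \<inter> lattice. pt w \<bullet> z = - of_int r}" using lift[of z] r0 j by simp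
  qed
qed

text \<open>The bottom edge loses \<open>r\<close> unit segments, the top edge of height \<open>b\<close> gains \<open>b\<close> of them.\<close>

lemma basket_mutc:
  assumes b: "empty_residual_basket P"
  shows "empty_residual_basket Q"
proof (rule basketI[OF fano_mutc])
  fix u s q l assume u: "edat Q u s q l"
  have cu: "coprime (fst u) (snd u)" and s0: "0 < s" using u by (auto simp: edat_def)
  obtain x y where xy: "x \<in> minf (pt u) Q" "y \<in> minf (pt u) Q" "x \<noteq> y" using edat_two[OF u] .
  define c where "c = fst u * fst v + snd u * snd v"
  have uv: "pt u \<bullet> pt v = of_int c" by (simp add: c_def pt_inner_pt del: of_int_add of_int_mult)
  \<comment> \<open>An edge on which \<open>v\<close> is not constant keeps its height and width,
    directly or through the shear. Only \<open>u = w\<close> and \<open>u = - w\<close> require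
    counting lattice points.\<close>
  consider "0 < c" | "c < 0" | "c = 0" by linarith
  then show "s dvd l"
  proof cases
    case 1
    then have m: "minf (pt u) Q = minf (pt u) P" by (intro mrel_face1[OF mrel_mutc]) (simp add: uv)
    obtain s' q' l' where u': "edat P u s' q' l'" "l' = edge_width (minf (pt u) P)"
      using edat_of_minf[OF f cu] xy unfolding m by metis
    then have "l' = l" using edat_width[OF u] m by simp
    moreover have "s' = s" using xy(1) edat_minf_iff[OF u, of x] edat_minf_iff[OF u'(1), of x] m by simp
    ultimately show ?thesis using edat_T[OF f b u'(1)] by simp
  next
    case 2
    define u0 where "u0 = (fst u + c * fst w, snd u + c * snd w)"
    have pu0: "pt u0 = pt u + of_int c *\<^sub>R pt w" by (simp add: u0_def pt_def)
    have u0v: "pt u0 \<bullet> pt v = of_int c" using uv wv by (simp add: pu0 inner_add_left)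
    have cu0: "coprime (fst u0) (snd u0)"
      using shear_coprime[of v w u] cu wv unfolding u0_def c_def by (simp add: mult.commute)
    define sh where "sh = (\<lambda>z. z + (pt w \<bullet> z) *\<^sub>R pt v)"
    have "pt u0 - (pt u0 \<bullet> pt v) *\<^sub>R pt w = pt u" unfolding u0v by (simp add: pu0)
    then have m: "minf (pt u) Q = sh ` minf (pt u0) P"
      using mrel_face2[OF mrel_mutc, of "pt u0"] u0v 2 by (simp add: sh_def)
    have unsh: "sh z - (pt w \<bullet> sh z) *\<^sub>R pt v = z" for z using wv by (simp add: sh_def inner_add_right)
    then have inj: "inj sh" by (metis injI)
    have lat: "sh z \<in> lattice \<longleftrightarrow> z \<in> lattice" for z
    proof
      assume z: "sh z \<in> lattice"
      then obtain h where "pt w \<bullet> sh z = of_int h" using lattice_value by blast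
      then show "z \<in> lattice" using lattice_shift[OF z, of "- h" v] unsh[of z] by simp
    next
      assume z: "z \<in> lattice"
      then obtain h where "pt w \<bullet> z = of_int h" using lattice_value by blast
      then show "sh z \<in> lattice" using lattice_shift[OF z, of h v] by (simp add: sh_def)
    qed
    obtain x' y' where x': "x = sh x'" "x' \<in> minf (pt u0) P" and y': "y = sh y'" "y' \<in> minf (pt u0) P"
      using xy m by auto
    then have "x' \<noteq> y'" using xy by auto
    then obtain s' q' l' where u': "edat P u0 s' q' l'" "l' = edge_width (minf (pt u0) P)"
      using edat_of_minf[OF f cu0 x'(2) y'(2)] by metis
    have "l' = l" using edat_width[OF u] u'(2) edge_width_image[OF inj lat] by (simp add: m)
    moreover have "s' = s"
    proof -
      have "pt u \<bullet> x = - of_int s" using xy edat_minf_iff[OF u] by blast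
      moreover have "pt u0 \<bullet> x' = - of_int s'" using x' edat_minf_iff[OF u'(1)] by blast
      moreover have "pt u \<bullet> sh x' = pt u0 \<bullet> x'"
        by (simp add: sh_def pu0 inner_add_left inner_add_right uv mult.commute)
      ultimately show ?thesis using x' by simp
    qed
    ultimately show ?thesis using edat_T[OF f b u'(1)] by simp
  next
    case 3
    then have "fst u * snd w = snd u * fst w" by (simp add: c_def)
    then have "u = w \<or> u = - w"
      using orth_coprime_unique[OF cu cw] by (cases u; cases w) auto
    then show ?thesis
    proof
      assume uw: "u = w"
      have "pt (fst p + 0 * snd w, snd p - 0 * fst w) \<in> {z \<in> Q \<inter> lattice. pt w \<bullet> z = - of_int r}"
        unfolding bottom_lattice using rk by (intro imageI) simp
      then have "pt p \<in> Q" by simp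
      then have "- of_int s \<le> pt w \<bullet> pt p" using edat_ge[OF u] uw by blast
      then have "r \<le> s" using wp by simp
      moreover have "s \<le> r"
      proof -
        have "x \<in> Q" "pt w \<bullet> x = - of_int s" using xy(1) edat_minf_iff[OF u] uw by auto
        moreover from this have "x \<in> P" using Q_mono s0 by simp
        ultimately show ?thesis using edat_ge[OF e, of x] by simp
      qed
      ultimately have sr: "s = r" by simp
      have "minf (pt u) Q \<inter> lattice = {z \<in> Q \<inter> lattice. pt w \<bullet> z = - of_int r}"
        using edat_minf_iff[OF u] sr uw by auto
      then have "minf (pt u) Q \<inter> lattice = (\<lambda>j. pt (fst p + j * snd w, snd p - j * fst w)) ` {0..k - r}"
        using bottom_lattice by simp
      moreover have "inj_on (\<lambda>j. pt (fst p + j * snd w, snd p - j * fst w)) {0..k - r}"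
        using cw by (auto simp: inj_on_def)
      ultimately have "card (minf (pt u) Q \<inter> lattice) = nat (k - r + 1)" by (simp add: card_image)
      then have "l = k - r" using edat_width[OF u] rk by (simp add: edge_width_def)
      then show ?thesis using sr edat_T[OF f b e] by simp
    next
      assume uw: "u = - w"
      have pu: "pt u = - pt w" by (simp add: uw pt_def)
      have xQ: "x \<in> Q" "pt w \<bullet> x = of_int s" using xy(1) edat_minf_iff[OF u] pu by auto
      have Qle: "pt w \<bullet> y \<le> of_int s" if "y \<in> Q" for y using edat_ge[OF u that] pu by simp
      obtain x' where x': "x' \<in> P" "pt w \<bullet> x' = of_int s"
        using mrel_max[OF mrel_mutc fanoD(2,3)[OF f] _ compactQ xQ(1)] xQ s0 Qle fanoD(5)[OF f] by auto
      have Ple: "pt w \<bullet> y \<le> of_int s" if "y \<in> P" for y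
        using that Qle lift'[of y] s0 by (cases "0 \<le> pt w \<bullet> y") auto
      have mP: "z \<in> minf (pt u) P \<longleftrightarrow> z \<in> P \<and> pt w \<bullet> z = of_int s" for z
      proof
        assume "z \<in> minf (pt u) P"
        then have "z \<in> P" "pt u \<bullet> z \<le> pt u \<bullet> x'" using x' by (auto simp: minf_iff)
        then show "z \<in> P \<and> pt w \<bullet> z = of_int s" using Ple[of z] x' by (simp add: pu)
      next
        assume "z \<in> P \<and> pt w \<bullet> z = of_int s"
        then show "z \<in> minf (pt u) P" using Ple by (simp add: minf_iff pu)
      qed
      define g where "g = (\<lambda>j. pt (fst q - j * snd w, snd q + j * fst w))"
      have gl: "minf (pt u) Q \<inter> lattice = g ` {0..l}"
        using edat_lattice[OF u] by (simp add: g_def uw)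
      have wg: "pt w \<bullet> g j = of_int s" for j
      proof -
        have "pt w \<bullet> pt q = of_int s" using u pu by (simp add: edat_def)
        then show ?thesis by (simp add: g_def pt_inner algebra_simps)
      qed
      have gj: "g i = g j \<longleftrightarrow> i = j" for i j using cw by (auto simp: g_def)
      have gQ: "g j \<in> Q \<longleftrightarrow> 0 \<le> j \<and> j \<le> l" for j
      proof -
        have "g j \<in> Q \<longleftrightarrow> g j \<in> minf (pt u) Q \<inter> lattice"
          using edat_minf_iff[OF u] wg pu by (simp add: g_def)
        then show ?thesis unfolding gl using gj by auto
      qed
      have gshift: "g j + of_int s *\<^sub>R pt v = g (j - s)" for j by (simp add: g_def pt_def algebra_simps)
      have gP: "g j \<in> P \<longleftrightarrow> s \<le> j \<and> j \<le> l" for j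
        using lift'[of "g j"] wg s0 gshift gQ by auto
      have latP: "minf (pt u) P \<inter> lattice = g ` {s..l}"
      proof (intro set_eqI iffI)
        fix z assume z: "z \<in> minf (pt u) P \<inter> lattice"
        then have "z \<in> P" "pt w \<bullet> z = of_int s" using mP by auto
        then have "z \<in> Q" using lift'[of z] s0 by simp
        then have "z \<in> g ` {0..l}" using gl z \<open>pt w \<bullet> z = of_int s\<close> edat_minf_iff[OF u, of z] pu by auto
        then show "z \<in> g ` {s..l}" using gP \<open>z \<in> P\<close> by auto
      next
        fix z assume "z \<in> g ` {s..l}"
        then show "z \<in> minf (pt u) P \<inter> lattice" using gP mP wg by (auto simp: g_def)
      qed
      have face: "minf (pt u) P face_of P" by (rule minf_face[OF fanoD(3)[OF f]])
      have ne: "\<exists>y \<in> lattice. y \<in> minf (pt u) P"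
      proof -
        have "minf (pt u) P \<noteq> {}" using x' mP by blast
        moreover have "polytope (minf (pt u) P)"
          using face fanoD(1)[OF f] face_of_polytope_polytope by blast
        ultimately obtain y where "y extreme_point_of minf (pt u) P"
          using extreme_point_exists_convex[of "minf (pt u) P"] polytope_imp_compact polytope_imp_convex by blast
        then show ?thesis using extreme_point_of_face[OF face] ext_lattice by blast
      qed
      then have sl: "s \<le> l" using latP by (metis Int_iff atLeastatMost_empty_iff2 empty_iff image_empty linorder_not_le)
      have cards: "card (minf (pt u) P \<inter> lattice) = nat (l - s + 1)"
        unfolding latP using gj by (subst card_image) (auto simp: inj_on_def)
      show ?thesis
      \<comment> \<open>If \<open>l = s\<close>, then \<open>P\<close> has just a vertex on its top
        level, and the whole edge of \<open>Q\<close> there, of width equal to its height, is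
        created by the mutation.\<close>
      proof (cases "l = s")
        case True then show ?thesis by simp
      next
        case False
        have "g s \<in> minf (pt u) P" "g l \<in> minf (pt u) P" "g s \<noteq> g l"
          using sl gP mP wg gj False by auto
        then obtain s' q' l' where u': "edat P u s' q' l'" "l' = edge_width (minf (pt u) P)"
          using edat_of_minf[OF f cu] by metis
        have "l' = l - s" using u'(2) cards sl by (simp add: edge_width_def)
        moreover have "s' = s"
          using \<open>g s \<in> minf (pt u) P\<close> edat_minf_iff[OF u'(1)] wg[of s] pu by simp
        ultimately show ?thesis using edat_T[OF f b u'(1)] by (simp add: dvd_diff_right_iff) (metis dvd_diff_commute dvd_refl dvd_add_right_iff diff_add_cancel)
      qed
    qed
  qed
qed

text \<open>A level \<open>h < 0\<close> loses exactly \<open>- h\<close> lattice points and a level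
  \<open>h \<ge> 0\<close> gains at most \<open>h\<close>. All levels of both polygons lie in
  \<open>{- r..<r}\<close>, so the total change is at most \<open>- r\<close>.\<close>

lemma card_mutc:
  assumes top: "\<And>z. z \<in> P \<Longrightarrow> pt w \<bullet> z < of_int r"
  shows "card (Q \<inter> lattice) < card (P \<inter> lattice)"
proof -
  obtain y1 y2 where y: "fst w * y1 + snd w * y2 = 1" using coprime_bezout[OF cw] .
  \<comment> \<open>Lattice coordinates adapted to \<open>w\<close>: the level \<open>h\<close> and
    the position \<open>j\<close> along \<open>v\<close>.\<close>
  define g where "g = (\<lambda>(h, j). pt (h * y1 + j * snd w, h * y2 - j * fst w))"
  have wg: "pt w \<bullet> g (h, j) = of_int h" for h j
  proof -
    have "fst w * (h * y1 + j * snd w) + snd w * (h * y2 - j * fst w) = h * (fst w * y1 + snd w * y2)"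
      by (simp add: algebra_simps)
    then show ?thesis using y by (simp add: g_def pt_inner_pt del: of_int_add of_int_mult of_int_diff)
  qed
  have ginj: "inj g"
  proof (rule injI)
    fix a b assume ab: "g a = g b"
    obtain h j h' j' where hj: "a = (h, j)" "b = (h', j')" by (metis surj_pair)
    have "h = h'" using wg[of h j] wg[of h' j'] ab hj by simp
    then show "a = b" using ab hj cw by (auto simp: g_def)
  qed
  have glat: "\<exists>h j. z = g (h, j)" if zl: "z \<in> lattice" for z
  proof -
    obtain q where q: "z = pt q" using zl by (auto simp: lattice_eq)
    define h where "h = fst w * fst q + snd w * snd q"
    define j where "j = fst q * y2 - snd q * y1"
    have "h * y1 + j * snd w = fst q * (fst w * y1 + snd w * y2)"
      "h * y2 - j * fst w = snd q * (fst w * y1 + snd w * y2)"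
      by (simp_all add: h_def j_def algebra_simps)
    then have "z = g (h, j)" using y q by (simp add: g_def)
    then show ?thesis by blast
  qed
  have gl: "g x \<in> lattice" for x by (cases x) (simp add: g_def)
  have gshift: "g (h, j) + of_int c *\<^sub>R pt v = g (h, j + c)" for h j c
    by (simp add: g_def pt_def algebra_simps)
  define J where "J = (\<lambda>S h. {j. g (h, j) \<in> S})"
  have finJ: "finite (J S h)" if "bounded S" for S h
  proof -
    have "(\<lambda>j. g (h, j)) ` J S h \<subseteq> S \<inter> lattice" using gl by (auto simp: J_def)
    then have "finite ((\<lambda>j. g (h, j)) ` J S h)" using finite_lattice_bounded[OF that] finite_subset by blast
    moreover have "inj_on (\<lambda>j. g (h, j)) (J S h)" using ginj by (auto simp: inj_on_def inj_def)
    ultimately show ?thesis using finite_imageD by blast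
  qed
  have convJ: "b \<in> J S h" if S: "convex S" and abc: "a \<in> J S h" "c \<in> J S h" "a \<le> b" "b \<le> c" for S h a b c
  proof (cases "a = c")
    case True then show ?thesis using that by (metis antisym)
  next
    case False
    define l where "l = of_int (b - a) / (of_int (c - a) :: real)"
    have lb: "0 \<le> l" "l \<le> 1" using abc False by (auto simp: l_def divide_simps)
    have lc: "l * of_int (c - a) = of_int (b - a)" using False by (simp add: l_def)
    have gc: "g (h, c) = g (h, a) + of_int (c - a) *\<^sub>R pt v" using gshift[of h a "c - a"] by simp
    have gb: "g (h, b) = g (h, a) + of_int (b - a) *\<^sub>R pt v" using gshift[of h a "b - a"] by simp
    have "(1 - l) *\<^sub>R g (h, a) + l *\<^sub>R g (h, c) \<in> S"
      using lb abc S by (intro convexD) (auto simp: J_def)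
    also have "(1 - l) *\<^sub>R g (h, a) + l *\<^sub>R g (h, c) = g (h, a) + (l * of_int (c - a)) *\<^sub>R pt v"
      unfolding gc by (simp add: algebra_simps)
    also have "\<dots> = g (h, b)" unfolding lc gb ..
    finally show ?thesis by (simp add: J_def)
  qed
  have bP: "bounded P" "bounded Q" using fanoD(2)[OF f] compactQ(1) compact_imp_bounded by auto
  have cP: "convex P" "convex Q" using fanoD(3)[OF f] compactQ(2) by auto
  have Qtop: "pt w \<bullet> z < of_int r" if z: "z \<in> Q" for z
  proof -
    have "continuous_on P (\<lambda>x. pt w \<bullet> x)" by (intro continuous_intros)
    then obtain x where x: "x \<in> P" "\<And>y. y \<in> P \<Longrightarrow> pt w \<bullet> y \<le> pt w \<bullet> x"
      using continuous_attains_sup[OF fanoD(2)[OF f]] fanoD(5)[OF f] by blast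
    have "- (pt w \<bullet> x) \<le> (- pt w) \<bullet> z"
      by (rule mrel_dual1[OF mrel_mutc _ _ z]) (use x wv in auto)
    then show ?thesis using top[OF x(1)] by simp
  qed
  have Qbot: "- of_int r \<le> pt w \<bullet> z" if z: "z \<in> Q" for z
    using edat_ge[OF e Q_mono[OF _ z]] r0 by (cases "pt w \<bullet> z \<le> 0") auto
  define H where "H = {- r..<r}"
  have cardS: "card (S \<inter> lattice) = (\<Sum>h\<in>H. card (J S h))"
    if S: "bounded S" "\<And>z. z \<in> S \<Longrightarrow> - of_int r \<le> pt w \<bullet> z" "\<And>z. z \<in> S \<Longrightarrow> pt w \<bullet> z < of_int r" for S
  proof -
    have "S \<inter> lattice = g ` (SIGMA h:H. J S h)"
    proof (intro set_eqI iffI)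
      fix z assume z: "z \<in> S \<inter> lattice"
      then obtain h j where hj: "z = g (h, j)" using glat by blast
      then have "h \<in> H" using S(2,3)[of z] z wg[of h j] by (auto simp: H_def)
      then show "z \<in> g ` (SIGMA h:H. J S h)" using hj z by (auto simp: J_def)
    qed (auto simp: J_def gl)
    then have "card (S \<inter> lattice) = card (SIGMA h:H. J S h)"
      using card_image[OF inj_on_subset[OF ginj subset_UNIV]] by simp
    also have "\<dots> = (\<Sum>h\<in>H. card (J S h))" by (rule card_SigmaI) (auto simp: H_def finJ S)
    finally show ?thesis .
  qed
  obtain j0 where j0: "pt p = g (- r, j0)"
  proof -
    obtain h j where hj: "pt p = g (h, j)" using glat[of "pt p"] by auto
    then have "h = - r" using wg[of h j] wp by simp
    then show ?thesis using that hj by simp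
  qed
  have many: "- h \<le> int (card (J P h))" if h: "- r \<le> h" "h < 0" for h
  proof -
    \<comment> \<open>The position at which the segment of length \<open>- h\<close> begins on this
      level. A closed real interval of that length contains at least \<open>- h\<close> integers,
      counted from the ceiling of \<open>a\<close>.\<close>
    define a where "a = - of_int h * of_int j0 / (of_int r :: real)"
    have eq: "(- of_int h / of_int r) *\<^sub>R pt p + (of_int j - a) *\<^sub>R pt v = g (h, j)" for j :: int
    proof -
      have "p = (- r * y1 + j0 * snd w, - r * y2 - j0 * fst w)" using j0 by (simp add: g_def)
      then have p: "real_of_int (fst p) = - of_int r * of_int y1 + of_int j0 * of_int (snd w)"
        "real_of_int (snd p) = - of_int r * of_int y2 - of_int j0 * of_int (fst w)" by simp_all
      show ?thesis using r0 by (simp add: g_def pt_def p a_def field_simps)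
    qed
    have "{\<lceil>a\<rceil>..<\<lceil>a\<rceil> - h} \<subseteq> J P h"
    proof
      fix j assume j: "j \<in> {\<lceil>a\<rceil>..<\<lceil>a\<rceil> - h}"
      then have "a \<le> of_int j" by (simp add: ceiling_le_iff)
      moreover have "j - \<lceil>a\<rceil> + 1 \<le> - h" using j by auto
      then have "real_of_int j - of_int \<lceil>a\<rceil> + 1 \<le> - of_int h" by linarith
      then have "of_int j - a \<le> - of_int h" using ceiling_correct[of a] by linarith
      ultimately have "(- of_int h / of_int r) *\<^sub>R pt p + (of_int j - a) *\<^sub>R pt v \<in> P"
        using h by (intro level_segment) auto
      then have "g (h, j) \<in> P" by (simp only: eq)
      then show "j \<in> J P h" by (simp add: J_def)
    qed
    then have "card {\<lceil>a\<rceil>..<\<lceil>a\<rceil> - h} \<le> card (J P h)" using finJ[OF bP(1)] by (rule card_mono[rotated])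
    then show ?thesis using h by simp
  qed
  have level: "int (card (J Q h)) - int (card (J P h)) \<le> h" if h: "h \<in> H" for h
  proof (cases "h < 0")
    case True
    have hr: "- r \<le> h" using h by (simp add: H_def)
    have "g (h, j) \<in> Q \<longleftrightarrow> g (h, j) \<in> P \<and> g (h, j + - h) \<in> P" for j
      using lift[of "g (h, j)"] True gshift[of h j "- h"] by (simp add: wg)
    then have "J Q h = {j \<in> J P h. j + - h \<in> J P h}" by (simp add: J_def)
    moreover have "int (card {j \<in> J P h. j + - h \<in> J P h}) = int (card (J P h)) - (- h)"
      by (rule card_int_shift(2)[OF finJ[OF bP(1)] convJ[OF cP(1)]]) (use True many[OF hr True] in auto)
    ultimately show ?thesis by simp
  next
    case False
    have "g (h, j) \<in> P \<longleftrightarrow> g (h, j) \<in> Q \<and> g (h, j + h) \<in> Q" for j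
      using lift'[of "g (h, j)"] False gshift[of h j h] by (simp add: wg)
    then have "J P h = {j \<in> J Q h. j + h \<in> J Q h}" by (simp add: J_def)
    moreover have "int (card (J Q h)) - h \<le> int (card {j \<in> J Q h. j + h \<in> J Q h})"
      by (rule card_int_shift(1)[OF finJ[OF bP(2)] convJ[OF cP(2)]]) (use False in auto)
    ultimately show ?thesis by simp
  qed
  have "int (card (Q \<inter> lattice)) - int (card (P \<inter> lattice)) = (\<Sum>h\<in>H. int (card (J Q h)) - int (card (J P h)))"
    using cardS[OF bP(1) edat_ge[OF e] top] cardS[OF bP(2) Qbot Qtop] by (simp add: sum_subtractf)
  also have "\<dots> \<le> (\<Sum>h\<in>H. h)" by (rule sum_mono) (rule level)
  also have "\<dots> = - r" using sum_symmetric[of "nat r"] r0 by (simp add: H_def)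
  finally show ?thesis using r0 by simp
qed

end

section \<open>Two mutation invariants\<close>

text \<open>When the residual basket is empty, there are as many of these points as the degree plus one.\<close>

definition polar :: "point set \<Rightarrow> (int \<times> int) set" where
  "polar P = {u. \<forall>z\<in>P. - 1 \<le> pt u \<bullet> z}"

text \<open>All edge normals of \<open>P\<close> lie in a common sublattice of index two.\<close>

definition even_normals :: "point set \<Rightarrow> bool" where
  "even_normals P \<longleftrightarrow> (\<exists>c. \<not> (even (fst c) \<and> even (snd c)) \<and>
     (\<forall>u x y. x \<in> minf (pt u) P \<and> y \<in> minf (pt u) P \<and> x \<noteq> y \<longrightarrow>
        even (fst u * fst c + snd u * snd c)))"

lemma polar_gl:
  assumes d: "\<bar>a * d - b * c\<bar> = 1"
  shows "card (polar (gl a b c d ` P)) = card (polar P)"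
proof -
  have d': "\<bar>a * d - c * b\<bar> = 1" using d by (simp add: mult.commute)
  have "polar P = gli a c b d ` polar (gl a b c d ` P)"
  proof (intro set_eqI iffI)
    fix u assume u: "u \<in> polar P"
    define D where "D = a * d - c * b"
    define u' where "u' = gli (D * d) (- D * c) (- D * b) (D * a) u"
    have uu: "gli a c b d u' = u" unfolding u'_def D_def by (rule gl_inverse(4)[OF d'])
    then have "u' \<in> polar (gl a b c d ` P)" using u by (auto simp: polar_def gl_inner)
    then show "u \<in> gli a c b d ` polar (gl a b c d ` P)" using uu by (metis image_eqI)
  qed (auto simp: polar_def gl_inner)
  moreover have "inj (gli a c b d)" by (rule inj_on_inverseI) (rule gl_inverse(3)[OF d'])
  ultimately show ?thesis by (simp add: card_image inj_on_subset)
qed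

lemma even_normals_gl:
  assumes d: "\<bar>a * d - b * c\<bar> = 1" and e: "even_normals P"
  shows "even_normals (gl a b c d ` P)"
proof -
  obtain v where v: "\<not> (even (fst v) \<and> even (snd v))"
    "\<And>u x y. x \<in> minf (pt u) P \<Longrightarrow> y \<in> minf (pt u) P \<Longrightarrow> x \<noteq> y \<Longrightarrow> even (fst u * fst v + snd u * snd v)"
    using e unfolding even_normals_def by blast
  define v' where "v' = gli a b c d v"
  have "even (fst u * fst v' + snd u * snd v')"
    if xy: "x \<in> minf (pt u) (gl a b c d ` P)" "y \<in> minf (pt u) (gl a b c d ` P)" "x \<noteq> y" for u x y
  proof -
    obtain x' y' where x': "x = gl a b c d x'" "x' \<in> minf (pt (gli a c b d u)) P"
      and y': "y = gl a b c d y'" "y' \<in> minf (pt (gli a c b d u)) P" using xy unfolding minf_gl by blast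
    then have "even (fst (gli a c b d u) * fst v + snd (gli a c b d u) * snd v)" using v(2) xy(3) by blast
    then show ?thesis by (simp add: v'_def gli_def algebra_simps)
  qed
  moreover have "\<not> (even (fst v') \<and> even (snd v'))"
  proof
    define D where "D = a * d - b * c"
    assume "even (fst v') \<and> even (snd v')"
    then have "even (fst (gli (D * d) (- D * b) (- D * c) (D * a) v'))"
      "even (snd (gli (D * d) (- D * b) (- D * c) (D * a) v'))" by (simp_all add: gli_def)
    then show False using gl_inverse(3)[OF d, of v] v(1) unfolding v'_def D_def by simp
  qed
  ultimately show ?thesis unfolding even_normals_def by blast
qed

text \<open>Both halves of the dual map preserve \<open>u \<bullet> v\<close>. Hence
  \<open>\<phi>\<close> and \<open>\<psi>\<close> fall into the same case and are mutually inverse;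
  they act on the dual lattice because \<open>w\<close> and \<open>v\<close> are integral.\<close>

lemma mrel_polar:
  assumes m: "mrel (pt w) (pt v) P Q"
  shows "card (polar Q) = card (polar P)"
proof -
  have wv: "fst w * fst v + snd w * snd v = 0"
    using mrel_orth[OF m] by (simp add: pt_inner_pt del: of_int_add of_int_mult)
  define dot where "dot = (\<lambda>u :: int \<times> int. fst u * fst v + snd u * snd v)"
  have uv: "pt u \<bullet> pt v = of_int (dot u)" for u
    by (simp add: dot_def pt_inner_pt del: of_int_add of_int_mult)
  define \<phi> where "\<phi> = (\<lambda>u. if 0 \<le> dot u then u else (fst u - dot u * fst w, snd u - dot u * snd w))"
  define \<psi> where "\<psi> = (\<lambda>u. if 0 \<le> dot u then u else (fst u + dot u * fst w, snd u + dot u * snd w))"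
  have dotm: "dot (fst u - dot u * fst w, snd u - dot u * snd w) = dot u"
    "dot (fst u + dot u * fst w, snd u + dot u * snd w) = dot u" for u
  proof -
    have "dot (fst u - dot u * fst w, snd u - dot u * snd w) = dot u - dot u * (fst w * fst v + snd w * snd v)"
      "dot (fst u + dot u * fst w, snd u + dot u * snd w) = dot u + dot u * (fst w * fst v + snd w * snd v)"
      by (simp_all add: dot_def algebra_simps)
    then show "dot (fst u - dot u * fst w, snd u - dot u * snd w) = dot u"
      "dot (fst u + dot u * fst w, snd u + dot u * snd w) = dot u" using wv by auto
  qed
  have inv: "\<psi> (\<phi> u) = u" "\<phi> (\<psi> u) = u" for u using dotm[of u] by (auto simp: \<phi>_def \<psi>_def)
  have pm: "pt (fst u - dot u * fst w, snd u - dot u * snd w) = pt u - (pt u \<bullet> pt v) *\<^sub>R pt w"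
    "pt (fst u + dot u * fst w, snd u + dot u * snd w) = pt u - (pt u \<bullet> pt v) *\<^sub>R (- pt w)" for u
    by (simp_all add: uv) (simp_all add: pt_def)
  have 1: "\<phi> u \<in> polar Q" if u: "u \<in> polar P" for u
  proof (cases "0 \<le> dot u")
    case True
    then show ?thesis using mrel_dual1[OF m, of "pt u" "-1"] u by (auto simp: \<phi>_def polar_def uv)
  next
    case False
    then have "- 1 \<le> (pt u - (pt u \<bullet> pt v) *\<^sub>R pt w) \<bullet> z" if "z \<in> Q" for z
      using mrel_dual2[OF m _ _ that, of "pt u" "-1"] u by (simp add: polar_def uv)
    then show ?thesis using False by (simp add: \<phi>_def polar_def pm)
  qed
  have 2: "\<psi> u \<in> polar P" if u: "u \<in> polar Q" for u
  proof (cases "0 \<le> dot u")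
    case True
    then show ?thesis using mrel_dual1[OF mrel_sym[OF m], of "pt u" "-1"] u by (auto simp: \<psi>_def polar_def uv)
  next
    case False
    then have "- 1 \<le> (pt u - (pt u \<bullet> pt v) *\<^sub>R (- pt w)) \<bullet> z" if "z \<in> P" for z
      using mrel_dual2[OF mrel_sym[OF m] _ _ that, of "pt u" "-1"] u by (simp add: polar_def uv)
    then show ?thesis using False by (simp add: \<psi>_def polar_def pm)
  qed
  have "bij_betw \<phi> (polar P) (polar Q)"
    by (rule bij_betw_byWitness[where f' = \<psi>]) (use inv 1 2 in auto)
  then show ?thesis using bij_betw_same_card by metis
qed

text \<open>A normal of \<open>Q\<close> that is not proportional to \<open>w\<close> is a normal of
  \<open>P\<close> changed by an integer multiple of \<open>w\<close>, and by the assumption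
  \<open>two\<close> the vector \<open>w\<close> is itself normal to an edge of \<open>P\<close>. So
  the same \<open>c\<close> works for \<open>Q\<close>.\<close>

lemma mrel_even_normals:
  assumes m: "mrel (pt w) (pt v) P Q" and cw: "coprime (fst w) (snd w)" and cv: "coprime (fst v) (snd v)"
    and two: "x0 \<in> minf (pt w) P" "y0 \<in> minf (pt w) P" "x0 \<noteq> y0"
    and e: "even_normals P"
  shows "even_normals Q"
proof -
  obtain c where c: "\<not> (even (fst c) \<and> even (snd c))"
    "\<And>u x y. x \<in> minf (pt u) P \<Longrightarrow> y \<in> minf (pt u) P \<Longrightarrow> x \<noteq> y \<Longrightarrow> even (fst u * fst c + snd u * snd c)"
    using e unfolding even_normals_def by blast
  have wc: "even (fst w * fst c + snd w * snd c)" by (rule c(2)[OF two])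
  have wv: "fst w * fst v + snd w * snd v = 0"
    using mrel_orth[OF m] by (simp add: pt_inner_pt del: of_int_add of_int_mult)
  have "even (fst u * fst c + snd u * snd c)"
    if xy: "x \<in> minf (pt u) Q" "y \<in> minf (pt u) Q" "x \<noteq> y" for u x y
  proof -
    define d where "d = fst u * fst v + snd u * snd v"
    have uv: "pt u \<bullet> pt v = of_int d" by (simp add: d_def pt_inner_pt del: of_int_add of_int_mult)
    consider "0 < d" | "d < 0" | "d = 0" by linarith
    then show ?thesis
    proof cases
      case 1
      then have "minf (pt u) Q = minf (pt u) P" by (intro mrel_face1[OF m]) (simp add: uv)
      then show ?thesis using c(2) xy by simp
    next
      case 2
      define u0 where "u0 = (fst u + d * fst w, snd u + d * snd w)"
      have pu0: "pt u0 = pt u + of_int d *\<^sub>R pt w" by (simp add: u0_def pt_def)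
      have u0v: "pt u0 \<bullet> pt v = of_int d" using uv mrel_orth[OF m] by (simp add: pu0 inner_add_left)
      have "pt u0 - (pt u0 \<bullet> pt v) *\<^sub>R pt w = pt u" unfolding u0v by (simp add: pu0)
      then have "minf (pt u) Q = (\<lambda>z. z + (pt w \<bullet> z) *\<^sub>R pt v) ` minf (pt u0) P"
        using mrel_face2[OF m, of "pt u0"] u0v 2 by simp
      then have im: "x \<in> (\<lambda>z. z + (pt w \<bullet> z) *\<^sub>R pt v) ` minf (pt u0) P"
        "y \<in> (\<lambda>z. z + (pt w \<bullet> z) *\<^sub>R pt v) ` minf (pt u0) P" using xy by simp_all
      obtain x' where x': "x = x' + (pt w \<bullet> x') *\<^sub>R pt v" "x' \<in> minf (pt u0) P" using im(1) by (rule imageE)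
      obtain y' where y': "y = y' + (pt w \<bullet> y') *\<^sub>R pt v" "y' \<in> minf (pt u0) P" using im(2) by (rule imageE)
      have "x' \<noteq> y'" using x' y' xy(3) by metis
      then have "even (fst u0 * fst c + snd u0 * snd c)" using c(2) x' y' by metis
      also have "fst u0 * fst c + snd u0 * snd c = (fst u * fst c + snd u * snd c) + d * (fst w * fst c + snd w * snd c)"
        by (simp add: u0_def algebra_simps)
      finally show ?thesis using wc by simp
    next
      case 3
      have e: "fst u * fst v = - (snd u * snd v)" "fst w * fst v = - (snd w * snd v)" using 3 wv by (auto simp: d_def)
      have "(fst u * snd w - snd u * fst w) * fst v = (fst u * fst v) * snd w - snd u * (fst w * fst v)"
        by (simp add: algebra_simps)
      also have "\<dots> = 0" unfolding e by (simp add: algebra_simps)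
      finally have *: "(fst u * snd w - snd u * fst w) * fst v = 0" .
      have "(fst u * snd w - snd u * fst w) * snd v = fst w * (- (snd u * snd v)) - fst u * (- (snd w * snd v))"
        by (simp add: algebra_simps)
      also have "\<dots> = 0" unfolding e[symmetric] by (simp add: algebra_simps)
      finally have **: "(fst u * snd w - snd u * fst w) * snd v = 0" .
      have "fst v \<noteq> 0 \<or> snd v \<noteq> 0" using cv by auto
      then have eq: "fst u * snd w = snd u * fst w" using * ** by auto
      obtain s t where st: "fst w * s + snd w * t = 1" using coprime_bezout[OF cw] .
      define k where "k = fst u * s + snd u * t"
      have "fst u = fst u * (fst w * s + snd w * t)" using st by simp
      also have "\<dots> = fst w * (fst u * s) + t * (fst u * snd w)" by (simp add: algebra_simps)
      also have "\<dots> = k * fst w" unfolding eq by (simp add: k_def algebra_simps)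
      finally have k1: "fst u = k * fst w" .
      have "snd u = snd u * (fst w * s + snd w * t)" using st by simp
      also have "\<dots> = s * (snd u * fst w) + snd w * (snd u * t)" by (simp add: algebra_simps)
      also have "\<dots> = k * snd w" unfolding eq[symmetric] by (simp add: k_def algebra_simps)
      finally have k2: "snd u = k * snd w" .
      have "fst u * fst c + snd u * snd c = k * (fst w * fst c + snd w * snd c)"
        unfolding k1 k2 by (simp add: algebra_simps)
      then show ?thesis using wc by simp
    qed
  qed
  then show ?thesis unfolding even_normals_def using c(1) by blast
qed

text \<open>Covers every admissible family \<open>G\<close>, not just the largest one. The last
  clause holds even if \<open>P\<close> has only a vertex on top: the highest slice is widened by a
  segment along \<open>v\<close>, so \<open>- w\<close> is normal to an edge of \<open>Q\<close>,
  and the parity argument can be reversed.\<close>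

lemma mutation_of_mrel:
  assumes f: "fano_polygon P" and mut: "mutation_of P Q"
  obtains w v where "mrel (pt w) (pt v) P Q" "coprime (fst w) (snd w)" "coprime (fst v) (snd v)"
    "\<exists>x y. x \<in> minf (pt w) P \<and> y \<in> minf (pt w) P \<and> x \<noteq> y"
    "\<exists>x y. x \<in> minf (- pt w) Q \<and> y \<in> minf (- pt w) Q \<and> x \<noteq> y"
proof -
  obtain E w v0 G where m: "E edge_of P" "primitive_inner_normal P E w" "v0 \<in> primitive_points"
    "pairing w v0 = 0" "mutation_data P w (convex hull {0, v0}) G"
    "Q = mut w P (convex hull {0, v0}) G"
    using mut unfolding mutation_of_def by blast
  obtain v where v: "v0 = pt v" "coprime (fst v) (snd v)" using m(3) by (auto simp: primitive_points_eq)
  have cw: "coprime (fst w) (snd w)" using m(2) by (simp add: primitive_inner_normal_def)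
  have wv: "pt w \<bullet> pt v = 0" using m(4) v by (simp add: pairing_pt)
  have v0: "pt v \<noteq> 0" using v by (auto simp: pt_def prod_eq_iff)
  obtain a b where ab: "E = closed_segment a b" "a \<noteq> b" using edge_segment[OF f m(1)] by blast
  have aE: "a \<in> minf (pt w) P" "b \<in> minf (pt w) P"
    using m(2) ab edge_of_imp_subset[OF m(1)] unfolding primitive_inner_normal_def pairing_pt minf_def by auto
  define S where "S = (\<Union>h\<in>{h::int. h_min w P \<le> of_int h \<and> h \<le> -1}. G h) \<union>
      (\<Union>h\<in>{h::int. 0 \<le> h \<and> of_int h \<le> h_max w P}. slice w h P + dilate h (convex hull {0, pt v}))"
  have Q: "Q = convex hull S" unfolding m(6) mut_def S_def v(1) ..
  have "continuous_on P (pairing w)" unfolding pairing_pt by (intro continuous_intros)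
  then have "bounded (pairing w ` P)"
    using fanoD(2)[OF f] compact_continuous_image compact_imp_bounded by blast
  then have bdd: "bdd_below (pairing w ` P)" "bdd_above (pairing w ` P)"
    by (auto intro: bounded_imp_bdd_below bounded_imp_bdd_above)
  have hmin: "h_min w P \<le> pt w \<bullet> z" and hmax: "pt w \<bullet> z \<le> h_max w P" if "z \<in> P" for z
    using bdd that unfolding h_min_def h_max_def
    by (auto simp flip: pairing_pt intro: cINF_lower cSUP_upper)
  have slice: "z \<in> P \<and> pt w \<bullet> z = of_int h" if "z \<in> slice w h P" for z h
  proof -
    have "convex (P \<inter> {z. pt w \<bullet> z = of_int h})" using fanoD(3)[OF f] by (simp add: convex_Int convex_hyperplane)
    moreover have "{v \<in> P \<inter> lattice. pairing w v = of_int h} \<subseteq> P \<inter> {z. pt w \<bullet> z = of_int h}"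
      by (auto simp: pairing_pt)
    ultimately have "slice w h P \<subseteq> P \<inter> {z. pt w \<bullet> z = of_int h}"
      unfolding slice_def by (intro hull_minimal)
    then show ?thesis using that by auto
  qed
  have seg: "y \<in> dilate h (convex hull {0, pt v}) \<longleftrightarrow> (\<exists>t\<in>{0..1}. y = (t * of_int h) *\<^sub>R pt v)" for y h
  proof -
    have hull: "convex hull {0, pt v} = (\<lambda>t. t *\<^sub>R pt v) ` {0..1}"
    proof -
      have "convex hull {0, pt v} = closed_segment 0 (pt v)" by (simp add: segment_convex_hull)
      also have "\<dots> = (\<lambda>t. t *\<^sub>R pt v) ` {0..1}" by (simp add: closed_segment_image_interval)
      finally show ?thesis .
    qed
    have "dilate h (convex hull {0, pt v}) = (\<lambda>t. (t * of_int h) *\<^sub>R pt v) ` {0..1}"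
      unfolding dilate_def hull image_image by (simp add: mult.commute)
    then show ?thesis by blast
  qed
  have G: "\<And>h. h_min w P \<le> of_int h \<Longrightarrow> h < 0 \<Longrightarrow>
        {x. x extreme_point_of P \<and> pairing w x = of_int h} \<subseteq> G h + dilate \<bar>h\<bar> (convex hull {0, pt v}) \<and>
        G h + dilate \<bar>h\<bar> (convex hull {0, pt v}) \<subseteq> slice w h P"
    using m(5) v unfolding mutation_data_def by blast
  have Gin: "g \<in> P \<and> g - of_int h *\<^sub>R pt v \<in> P \<and> pt w \<bullet> g = of_int h"
    if "h_min w P \<le> of_int h" "h < 0" "g \<in> G h" for g h
  proof -
    have "g + (t * of_int \<bar>h\<bar>) *\<^sub>R pt v \<in> slice w h P" if "t \<in> {0..1}" for t
      using G[of h] \<open>h_min w P \<le> of_int h\<close> \<open>h < 0\<close> \<open>g \<in> G h\<close> that seg by (blast intro: set_plus_intro)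
    from this[of 0] this[of 1] show ?thesis using slice that(2) by (auto simp: abs_if)
  qed
  have rel: "mrel (pt w) (pt v) P Q"
    unfolding mrel_def
  proof (intro conjI exI)
    show "pt w \<bullet> pt v = 0" by (rule wv)
    show "P = convex hull {x. x extreme_point_of P}" by (rule fanoD(9)[OF f])
    show "Q = convex hull S" by (rule Q)
    show "\<forall>s\<in>S. (pt w \<bullet> s \<le> 0 \<longrightarrow> s \<in> P \<and> s - (pt w \<bullet> s) *\<^sub>R pt v \<in> P) \<and>
        (0 \<le> pt w \<bullet> s \<longrightarrow> (\<exists>t\<in>{0..1}. s - (t * (pt w \<bullet> s)) *\<^sub>R pt v \<in> P))"
    proof
      fix s assume "s \<in> S"
      then consider h where "h_min w P \<le> of_int h" "h \<le> -1" "s \<in> G h"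
        | h where "0 \<le> h" "s \<in> slice w h P + dilate h (convex hull {0, pt v})"
        unfolding S_def by blast
      then show "(pt w \<bullet> s \<le> 0 \<longrightarrow> s \<in> P \<and> s - (pt w \<bullet> s) *\<^sub>R pt v \<in> P) \<and>
        (0 \<le> pt w \<bullet> s \<longrightarrow> (\<exists>t\<in>{0..1}. s - (t * (pt w \<bullet> s)) *\<^sub>R pt v \<in> P))"
      proof cases
        case 1
        then show ?thesis using Gin[of h s] by simp
      next
        case 2
        then obtain z y where zy: "z \<in> slice w h P" "y \<in> dilate h (convex hull {0, pt v})" "s = z + y"
          by (auto simp: set_plus_def)
        then obtain t where t: "t \<in> {0..1}" "y = (t * of_int h) *\<^sub>R pt v" using seg by blast
        have z: "z \<in> P" "pt w \<bullet> z = of_int h" using slice zy by auto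
        have ws: "pt w \<bullet> s = of_int h" using z zy t wv by (simp add: inner_add_right)
        have "s - (t * (pt w \<bullet> s)) *\<^sub>R pt v \<in> P" using ws z zy t by simp
        moreover have "s \<in> P \<and> s - (pt w \<bullet> s) *\<^sub>R pt v \<in> P" if "h = 0" using that ws z zy t by simp
        ultimately show ?thesis using t ws 2 by auto
      qed
    qed
    show "\<forall>x\<in>{x. x extreme_point_of P}.
       (pt w \<bullet> x \<le> 0 \<longrightarrow> (\<exists>t\<in>{0..1}. x + (t * (pt w \<bullet> x)) *\<^sub>R pt v \<in> Q)) \<and>
        (0 \<le> pt w \<bullet> x \<longrightarrow> x \<in> Q \<and> x + (pt w \<bullet> x) *\<^sub>R pt v \<in> Q)"
    proof (intro ballI)
      fix x assume "x \<in> {x. x extreme_point_of P}"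
      then have x: "x extreme_point_of P" by simp
      then have xP: "x \<in> P" "x \<in> lattice"
        using fanoD(8)[OF f x] primitive_subset_lattice x by (auto simp: extreme_point_of_def)
      obtain h where h: "pt w \<bullet> x = of_int h" using lattice_value[OF xP(2)] by blast
      have ge: "x + (t * of_int h) *\<^sub>R pt v \<in> Q" if "0 \<le> h" "t \<in> {0..1}" for t
      proof -
        have "x \<in> slice w h P" unfolding slice_def using xP h by (intro hull_inc) (simp add: pairing_pt)
        then have "x + (t * of_int h) *\<^sub>R pt v \<in> slice w h P + dilate h (convex hull {0, pt v})"
          using seg that by (blast intro: set_plus_intro)
        moreover have "of_int h \<le> h_max w P" using hmax[OF xP(1)] h by simp
        ultimately have "x + (t * of_int h) *\<^sub>R pt v \<in> S" unfolding S_def using that by blast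
        then show ?thesis unfolding Q by (rule hull_inc)
      qed
      have neg: "\<exists>t\<in>{0..1}. x + (t * of_int h) *\<^sub>R pt v \<in> Q" if "h < 0"
      proof -
        have hm: "h_min w P \<le> of_int h" using hmin[OF xP(1)] h by simp
        then have "x \<in> G h + dilate \<bar>h\<bar> (convex hull {0, pt v})"
          using G[OF hm that] x h by (auto simp: pairing_pt)
        then obtain g y where gy: "x = g + y" "g \<in> G h" "y \<in> dilate \<bar>h\<bar> (convex hull {0, pt v})"
          by (rule set_plus_elim)
        then obtain t where t: "t \<in> {0..1}" "y = (t * of_int \<bar>h\<bar>) *\<^sub>R pt v" using seg by blast
        have g: "g \<in> G h" "t \<in> {0..1}" "x = g + (t * of_int \<bar>h\<bar>) *\<^sub>R pt v" using gy t by simp_all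
        have "g \<in> S" unfolding S_def using g(1) hm that by auto
        then have "g \<in> Q" unfolding Q by (rule hull_inc)
        then show ?thesis using g that by (intro bexI[of _ t]) (auto simp: abs_if)
      qed
      show "(pt w \<bullet> x \<le> 0 \<longrightarrow> (\<exists>t\<in>{0..1}. x + (t * (pt w \<bullet> x)) *\<^sub>R pt v \<in> Q)) \<and>
        (0 \<le> pt w \<bullet> x \<longrightarrow> x \<in> Q \<and> x + (pt w \<bullet> x) *\<^sub>R pt v \<in> Q)"
        unfolding h using ge[of 0] ge[of 1] neg by (cases "h < 0") (auto intro: bexI[of _ 0])
    qed
  qed
  have top: "\<exists>x y. x \<in> minf (- pt w) Q \<and> y \<in> minf (- pt w) Q \<and> x \<noteq> y"
  proof -
    have fin: "finite {x. x extreme_point_of P}"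
      using finite_polyhedron_extreme_points[OF fanoD(6)[OF f]] .
    have ne: "{x. x extreme_point_of P} \<noteq> {}" using fanoD(5,9)[OF f] by (metis convex_hull_empty empty_iff)
    define c where "c = Max ((\<lambda>x. pt w \<bullet> x) ` {x. x extreme_point_of P})"
    have "c \<in> (\<lambda>x. pt w \<bullet> x) ` {x. x extreme_point_of P}" unfolding c_def using fin ne by (intro Max_in) auto
    then obtain x where x: "x extreme_point_of P" "pt w \<bullet> x = c" by auto
    have le: "pt w \<bullet> y \<le> c" if "y extreme_point_of P" for y
      unfolding c_def using fin that by (intro Max_ge) auto
    have leP: "- c \<le> (- pt w) \<bullet> y" if "y \<in> P" for y
    proof (rule hull_ge)
      show "y \<in> convex hull {x. x extreme_point_of P}" using that fanoD(9)[OF f] by simp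
    qed (use le in auto)
    have leQ: "- c \<le> (- pt w) \<bullet> y" if "y \<in> Q" for y
      by (rule mrel_dual1[OF rel _ leP that]) (use wv in auto)
    have c0: "0 < c"
    proof -
      have "- pt w \<noteq> 0" using cw by (auto simp: pt_def prod_eq_iff)
      then obtain z where "z \<in> P" "(- pt w) \<bullet> z < 0" using fano_pos[OF f] by blast
      then show ?thesis using leP[of z] by simp
    qed
    have xP: "x \<in> P" "x \<in> lattice"
      using fanoD(8)[OF f x(1)] primitive_subset_lattice x(1) by (auto simp: extreme_point_of_def)
    obtain h where h: "c = of_int h" using lattice_value[OF xP(2), of w] x(2) by auto
    have h0: "0 < h" using h c0 by simp
    have ge: "x + (t * of_int h) *\<^sub>R pt v \<in> Q" if "t \<in> {0..1}" for t
    proof -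
      have "x \<in> slice w h P" unfolding slice_def using xP h x by (intro hull_inc) (simp add: pairing_pt)
      then have "x + (t * of_int h) *\<^sub>R pt v \<in> slice w h P + dilate h (convex hull {0, pt v})"
        using seg that by (blast intro: set_plus_intro)
      moreover have "of_int h \<le> h_max w P" using hmax[OF xP(1)] h x by simp
      ultimately have "x + (t * of_int h) *\<^sub>R pt v \<in> S" unfolding S_def using h0 by auto
      then show ?thesis unfolding Q by (rule hull_inc)
    qed
    have "x \<in> minf (- pt w) Q" using ge[of 0] leQ x by (auto simp: minf_iff)
    moreover have "x + of_int h *\<^sub>R pt v \<in> minf (- pt w) Q" using ge[of 1] leQ x wv
      by (auto simp: minf_iff inner_add_right)
    moreover have "x \<noteq> x + of_int h *\<^sub>R pt v" using h0 v0 by simp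
    ultimately show ?thesis by blast
  qed
  show ?thesis using that[OF rel cw v(2)] aE ab top by blast
qed

lemma step_invariants:
  assumes "mutation_step P Q"
  shows "card (polar P) = card (polar Q)" "even_normals P \<longleftrightarrow> even_normals Q"
proof -
  have f: "fano_polygon P" "fano_polygon Q" and "GL2Z_equivalent P Q \<or> mutation_of P Q"
    using assms by (auto simp: mutation_step_def)
  then have "card (polar P) = card (polar Q) \<and> (even_normals P \<longleftrightarrow> even_normals Q)"
  proof (elim disjE)
    assume "GL2Z_equivalent P Q"
    then obtain a b c d where d: "\<bar>a * d - b * c\<bar> = 1" and Q: "Q = gl a b c d ` P" unfolding GL2Z_gl by blast
    define D where "D = a * d - b * c"
    have P: "P = gl (D * d) (- D * b) (- D * c) (D * a) ` Q"
      unfolding Q image_image D_def gl_inverse(1)[OF d] by simp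
    have "even_normals P" if "even_normals Q"
      by (subst P, rule even_normals_gl[OF _ that]) (use gl_inverse(5)[OF d] in \<open>simp add: D_def\<close>)
    then show ?thesis using polar_gl[OF d, of P] even_normals_gl[OF d, of P] Q by auto
  next
    assume "mutation_of P Q"
    then obtain w v where m: "mrel (pt w) (pt v) P Q" "coprime (fst w) (snd w)" "coprime (fst v) (snd v)"
      "\<exists>x y. x \<in> minf (pt w) P \<and> y \<in> minf (pt w) P \<and> x \<noteq> y"
      "\<exists>x y. x \<in> minf (- pt w) Q \<and> y \<in> minf (- pt w) Q \<and> x \<noteq> y"
      using mutation_of_mrel[OF f(1)] by blast
    have neg: "- pt w = pt (- fst w, - snd w)" by (simp add: pt_def)
    have "mrel (pt (- fst w, - snd w)) (pt v) Q P" using mrel_sym[OF m(1)] neg by simp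
    then have "even_normals Q \<Longrightarrow> even_normals P"
      using mrel_even_normals[of "(- fst w, - snd w)" v Q P] m(2,3,5) unfolding neg by auto
    moreover have "even_normals P \<Longrightarrow> even_normals Q" using mrel_even_normals[OF m(1-3)] m(4) by blast
    ultimately show ?thesis using mrel_polar[OF m(1)] by auto
  qed
  then show "card (polar P) = card (polar Q)" "even_normals P \<longleftrightarrow> even_normals Q" by auto
qed

lemma equivalence_invariants:
  assumes "equivclp mutation_step P Q"
  shows "card (polar P) = card (polar Q)" "even_normals P \<longleftrightarrow> even_normals Q"
proof -
  have "card (polar P) = card (polar Q) \<and> (even_normals P \<longleftrightarrow> even_normals Q)"
    using assms by (induction rule: equivclp_induct) (auto dest: step_invariants)
  then show "card (polar P) = card (polar Q)" "even_normals P \<longleftrightarrow> even_normals Q" by auto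
qed

section \<open>Lattice points of the polar polygon\<close>

lemma edat_ends_extreme:
  assumes f: "fano_polygon P" and e: "edat P w r p k"
  shows "pt p extreme_point_of P" "pt (fst p + k * snd w, snd p - k * fst w) extreme_point_of P"
proof -
  have face: "minf (pt w) P face_of P" by (rule minf_face[OF fanoD(3)[OF f]])
  have q: "pt (fst p + k * snd w, snd p - k * fst w) = pt p + of_int k *\<^sub>R pt (snd w, - fst w)"
    by (simp add: pt_def)
  show "pt p extreme_point_of P"
    using extreme_point_of_face[OF face, of "pt p"] e by (simp add: edat_def extreme_point_of_segment)
  show "pt (fst p + k * snd w, snd p - k * fst w) extreme_point_of P"
    using extreme_point_of_face[OF face, of "pt p + of_int k *\<^sub>R pt (snd w, - fst w)"] e
    unfolding q by (simp add: edat_def extreme_point_of_segment)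
qed

lemma edat_ends_coprime:
  assumes f: "fano_polygon P" and e: "edat P w r p k"
  shows "coprime (fst p) (snd p)" "coprime (fst p + k * snd w) (snd p - k * fst w)"
  using edat_ends_extreme[OF f e, THEN fanoD(8)[OF f]] by (auto simp: primitive_points_eq)

lemma dot_pt: "pt w \<bullet> pt p = - of_int r \<longleftrightarrow> fst w * fst p + snd w * snd p = - r"
proof -
  have "pt w \<bullet> pt p = - of_int r \<longleftrightarrow> real_of_int (fst w * fst p + snd w * snd p) = of_int (- r)"
    by (simp add: pt_inner_pt)
  then show ?thesis by (simp only: of_int_eq_iff)
qed

lemma edat_dot: "edat P w r p k \<Longrightarrow> fst w * fst p + snd w * snd p = - r"
  by (simp add: edat_def dot_pt)

lemma orth_multiple:
  fixes q1 q2 a b :: int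
  assumes c: "coprime q1 q2" and o: "a * q1 + b * q2 = 0"
  obtains m where "a = - m * q2" "b = m * q1"
proof -
  obtain s t where st: "q1 * s + q2 * t = 1" using coprime_bezout[OF c] .
  have o': "a * q1 = - (b * q2)" "b * q2 = - (a * q1)" using o by auto
  have "a = a * (q1 * s + q2 * t)" using st by simp
  also have "\<dots> = (a * q1) * s + a * q2 * t" by (simp add: algebra_simps)
  also have "\<dots> = - (b * s - a * t) * q2" unfolding o'(1) by (simp add: algebra_simps)
  finally have 1: "a = - (b * s - a * t) * q2" .
  have "b = b * (q1 * s + q2 * t)" using st by simp
  also have "\<dots> = b * q1 * s + (b * q2) * t" by (simp add: algebra_simps)
  also have "\<dots> = (b * s - a * t) * q1" unfolding o'(2) by (simp add: algebra_simps)
  finally have 2: "b = (b * s - a * t) * q1" .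
  show ?thesis by (rule that[OF 1 2])
qed

lemma frac_shift: "frac (x + of_int m) = frac (x :: real)"
  by (simp add: frac_def)

text \<open>Each edge meets the boundary of the polar polygon in a corner \<open>w / r\<close>. Measured along the
  dual edge of either end point the fractional part of its position is the same, because for a T-cone
  the two dual lines are related by a unimodular shear fixing the corner. Without lattice points on
  the boundary that fractional part would strictly decrease from edge to edge.\<close>

lemma exists_polar_point:
  assumes f: "fano_polygon P" and b: "empty_residual_basket P"
  obtains u where "u \<in> polar P" "u \<noteq> (0, 0)"
proof -
  have "\<exists>u\<in>polar P. u \<noteq> (0, 0)"
  proof (rule ccontr)
    assume no: "\<not> ?thesis"
    define W where "W = {w. \<exists>r p k. edat P w r p k}"
    have finW: "finite W" unfolding W_def by (rule finite_normals[OF f])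
    have neW: "W \<noteq> {}"
    proof
      assume "W = {}"
      then have "z \<in> P" for z by (intro fano_halfspaces[OF f]) (auto simp: W_def)
      then have "P = UNIV" by blast
      then show False using fanoD(2)[OF f] compact_imp_bounded not_bounded_UNIV by blast
    qed
    define dot where "dot = (\<lambda>u v :: int \<times> int. fst u * fst v + snd u * snd v)"
    \<comment> \<open>The dual line of \<open>p\<close> consists of the \<open>u\<close> with
      \<open>dot u p = -1\<close>. Any lattice point on it may serve as origin, since another choice
      shifts the position of the corner \<open>w / r\<close> by an integer.\<close>
    define pos where "pos = (\<lambda>w p r. frac (- of_int (dot (SOME u. dot u p = -1) (snd w, - fst w)) / of_int r :: real))"
    define lam where "lam = (\<lambda>w. pos w (SOME p. \<exists>r k. edat P w r p k) (SOME r. \<exists>p k. edat P w r p k))"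
    have some: "\<exists>u. dot u p = -1" if cp: "coprime (fst p) (snd p)" for p
    proof -
      obtain s t where "fst p * s + snd p * t = 1" using coprime_bezout[OF cp] .
      then have "dot (- s, - t) p = -1" by (simp add: dot_def mult.commute)
      then show ?thesis by blast
    qed
    have lam_eq: "lam w = pos w p r" if "edat P w r p k" for w r p k
    proof -
      have "(SOME p. \<exists>r k. edat P w r p k) = p" "(SOME r. \<exists>p k. edat P w r p k) = r"
        using that edat_unique[OF f that] by (blast intro: some_equality)+
      then show ?thesis by (simp add: lam_def)
    qed
    have diff: "\<exists>m. dot u (snd w, - fst w) = dot u' (snd w, - fst w) + m * r"
      if q: "coprime (fst q) (snd q)" "dot w q = - r" and u: "dot u q = -1" "dot u' q = -1" for w q r u u'
    proof -
      have "(fst u - fst u') * fst q + (snd u - snd u') * snd q = 0" using u by (simp add: dot_def algebra_simps)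
      then obtain m where "fst u - fst u' = - m * snd q" "snd u - snd u' = m * fst q"
        using orth_multiple[OF q(1)] by blast
      then have m: "fst u = fst u' - m * snd q" "snd u = snd u' + m * fst q" by simp_all
      have "dot u (snd w, - fst w) = dot u' (snd w, - fst w) - m * dot w q"
        by (simp add: dot_def m algebra_simps)
      then show ?thesis using q(2) by auto
    qed
    have lam_start: "lam w = frac (- of_int (dot u (snd w, - fst w)) / of_int r)"
      if e: "edat P w r p k" and u: "dot u p = -1" for w r p k u
    proof -
      define u' where "u' = (SOME u. dot u p = -1)"
      have u': "dot u' p = -1" unfolding u'_def using some[OF edat_ends_coprime(1)[OF f e]] by (rule someI_ex)
      have wp: "dot w p = - r" using edat_dot[OF e] by (simp add: dot_def)
      have r: "0 < r" using e by (simp add: edat_def)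
      obtain m where m: "dot u' (snd w, - fst w) = dot u (snd w, - fst w) + m * r"
        using diff[OF edat_ends_coprime(1)[OF f e] wp u' u] by blast
      have "- of_int (dot u' (snd w, - fst w)) / of_int r =
          - of_int (dot u (snd w, - fst w)) / (of_int r :: real) + of_int (- m :: int)"
        using r by (simp add: m field_simps)
      then show ?thesis unfolding lam_eq[OF e] pos_def u'_def[symmetric] using frac_shift by metis
    qed
    have lam_end: "lam w = frac (- of_int (dot u (snd w, - fst w)) / of_int r)"
      if e: "edat P w r p k" and u: "dot u (fst p + k * snd w, snd p - k * fst w) = -1" for w r p k u
    proof -
      obtain u0 where u0: "dot u0 p = -1" using some[OF edat_ends_coprime(1)[OF f e]] by blast
      have wp: "dot w p = - r" using edat_dot[OF e] by (simp add: dot_def)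
      have r: "0 < r" using e by (simp add: edat_def)
      obtain n where n: "k = r * n" using edat_T[OF f b e] by blast
      define c where "c = dot u0 (snd w, - fst w)"
      \<comment> \<open>For a T-cone \<open>n = k / r\<close> is an integer. Adding
        \<open>n * c * w\<close> carries the lattice point \<open>u0\<close> from the dual line of
        the starting point to that of the end point and leaves its pairing with the edge direction
        unchanged.\<close>
      define u1 where "u1 = (fst u0 + n * c * fst w, snd u0 + n * c * snd w)"
      have "dot u1 (fst p + k * snd w, snd p - k * fst w) = dot u0 p + k * c + n * c * dot w p"
        by (simp add: u1_def dot_def c_def algebra_simps)
      then have u1: "dot u1 (fst p + k * snd w, snd p - k * fst w) = -1"
        by (simp add: u0 wp n algebra_simps)
      have we: "dot w (fst p + k * snd w, snd p - k * fst w) = - r" using wp by (simp add: dot_def algebra_simps)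
      obtain m where m: "dot u (snd w, - fst w) = dot u1 (snd w, - fst w) + m * r"
        using diff[OF _ we u u1] edat_ends_coprime(2)[OF f e] by auto
      have "dot u1 (snd w, - fst w) = c" by (simp add: u1_def dot_def c_def algebra_simps)
      then have "- of_int (dot u (snd w, - fst w)) / of_int r = - of_int c / (of_int r :: real) + of_int (- m)"
        using r by (simp add: m field_simps)
      then show ?thesis using lam_start[OF e u0] frac_shift unfolding c_def by metis
    qed
    \<comment> \<open>Minimality of the fractional part will contradict its strict decrease from
      this edge to the next one, \<open>w2\<close>.\<close>
    obtain w where w: "w \<in> W" "\<And>w'. w' \<in> W \<Longrightarrow> lam w \<le> lam w'"
      using finW neW by (metis arg_min_if_finite(1) arg_min_least)
    obtain r p k where e: "edat P w r p k" using w(1) by (auto simp: W_def)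
    have r: "0 < r" "0 < k" using e by (auto simp: edat_def)
    define q where "q = (fst p + k * snd w, snd p - k * fst w)"
    have qP: "pt q \<in> P" "pt w \<bullet> pt q = - of_int r" using edat_end[OF e, of k] r by (auto simp: q_def)
    define d where "d = (snd w, - fst w)"
    have dne: "pt d \<noteq> 0" using e by (auto simp: edat_def d_def pt_def prod_eq_iff)
    have qd: "pt q = pt p + of_int k *\<^sub>R pt d" by (simp add: q_def d_def pt_def)
    have out: "pt q + \<epsilon> *\<^sub>R pt d \<notin> P" if "0 < \<epsilon>" for \<epsilon>
    proof
      assume "pt q + \<epsilon> *\<^sub>R pt d \<in> P"
      moreover have "pt w \<bullet> (pt q + \<epsilon> *\<^sub>R pt d) = - of_int r"
        using qP by (simp add: inner_add_right d_def pt_inner)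
      ultimately obtain t where t: "t \<le> of_int k" "pt q + \<epsilon> *\<^sub>R pt d = pt p + t *\<^sub>R pt d"
        using edat_param[OF e] unfolding d_def by blast
      then have "(of_int k + \<epsilon> - t) *\<^sub>R pt d = 0" by (simp add: qd algebra_simps)
      then show False using dne t that by simp
    qed
    obtain w2 r2 p2 k2 where e2: "edat P w2 r2 p2 k2" "pt w2 \<bullet> pt q = - of_int r2" "pt w2 \<bullet> pt d < 0"
      using exists_tight_edge[OF f qP(1) out] by blast
    have r2: "0 < r2" using e2 by (auto simp: edat_def)
    have p2: "p2 = q"
    proof -
      obtain t where t: "0 \<le> t" "pt q = pt p2 + t *\<^sub>R pt (snd w2, - fst w2)"
        using edat_param[OF e2(1), of "pt q"] qP e2(2) by blast
      have "- of_int r \<le> pt w \<bullet> pt p2" using edat_ge[OF e] edat_start[OF e2(1)] by (simp add: minf_iff)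
      also have "pt p2 = pt q - t *\<^sub>R pt (snd w2, - fst w2)" using t by simp
      also have "pt w \<bullet> \<dots> = - of_int r - t * (pt w \<bullet> pt (snd w2, - fst w2))"
        using qP by (simp add: inner_diff_right)
      finally have "t * (pt w \<bullet> pt (snd w2, - fst w2)) \<le> 0" by simp
      moreover have "pt w \<bullet> pt (snd w2, - fst w2) = - (pt w2 \<bullet> pt d)"
        by (simp add: pt_inner d_def algebra_simps)
      ultimately have "t \<le> 0" using e2(3) by (auto simp: zero_le_mult_iff)
      then show ?thesis using t by simp
    qed
    have cq: "coprime (fst q) (snd q)" using edat_ends_coprime(2)[OF f e] by (simp add: q_def)
    obtain u where u: "dot u q = -1" using some[OF cq] by blast
    define d2 where "d2 = (snd w2, - fst w2)"
    \<comment> \<open>Positions of the corners \<open>w / r\<close> and \<open>w2 / r2\<close> on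
      the dual line of their common vertex \<open>q\<close>. The side of the polar polygon dual to
      \<open>q\<close> runs between them.\<close>
    define x1 x2 :: real where "x1 = - of_int (dot u d) / of_int r" and "x2 = - of_int (dot u d2) / of_int r2"
    have lam1: "lam w = frac x1" using lam_end[OF e] u by (simp add: q_def x1_def d_def)
    have lam2: "lam w2 = frac x2" using lam_start[OF e2(1)] u by (simp add: p2 x2_def d2_def)
    have wq: "dot w q = - r" "dot w2 q = - r2"
      using qP(2) e2(2) dot_pt unfolding dot_def by auto
    have dec: "fst w = r * fst u + dot u d * snd q" "snd w = r * snd u - dot u d * fst q"
      if "dot w q = - r" "d = (snd w, - fst w)" for w r d
    proof -
      have r: "r = - dot w q" using that by simp
      have "r * fst u + dot u d * snd q = - fst w * dot u q" "r * snd u - dot u d * fst q = - snd w * dot u q"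
        unfolding r that(2) by (simp_all add: dot_def algebra_simps)
      then show "fst w = r * fst u + dot u d * snd q" "snd w = r * snd u - dot u d * fst q" using u by auto
    qed
    define A B :: "point \<Rightarrow> real" where "A = (\<lambda>z. pt u \<bullet> z)" and "B = (\<lambda>z. - of_int (snd q) * fst z + of_int (fst q) * snd z)"
    have ev: "pt w \<bullet> z = of_int r * A z - of_int (dot u d) * B z" if "dot w q = - r" "d = (snd w, - fst w)" for w r d z
      by (simp add: pt_inner dec[OF that] A_def B_def algebra_simps)
    have ge1: "- 1 \<le> A z + x1 * B z" if "z \<in> P" for z
    proof -
      have "- of_int r \<le> of_int r * A z - of_int (dot u d) * B z"
        using edat_ge[OF e that] ev[OF wq(1) d_def] by simp
      then show ?thesis using r by (simp add: x1_def field_simps)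
    qed
    have ge2: "- 1 \<le> A z + x2 * B z" if "z \<in> P" for z
    proof -
      have "- of_int r2 \<le> of_int r2 * A z - of_int (dot u d2) * B z"
        using edat_ge[OF e2(1) that] ev[OF wq(2) d2_def] by simp
      then show ?thesis using r2 by (simp add: x2_def field_simps)
    qed
    have lt: "x2 < x1"
    proof -
      have Bd: "B (pt d) = of_int r"
      proof -
        have "- snd q * fst d + fst q * snd d = r" using wq(1) by (simp add: d_def dot_def algebra_simps)
        moreover have "B (pt d) = of_int (- snd q * fst d + fst q * snd d)" by (simp add: B_def)
        ultimately show ?thesis by simp
      qed
      have "pt w2 \<bullet> pt d = of_int r2 * A (pt d) - of_int (dot u d2) * B (pt d)" by (rule ev[OF wq(2) d2_def])
      also have "A (pt d) = of_int (dot u d)" by (simp add: A_def dot_def pt_inner)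
      finally have "of_int r2 * of_int (dot u d) < of_int (dot u d2) * (of_int r :: real)" using e2(3) Bd by simp
      then show ?thesis using r r2 by (simp add: x1_def x2_def field_simps)
    qed
    \<comment> \<open>An integer position between \<open>x2\<close> and \<open>x1\<close> gives a
      lattice point \<open>U\<close> on this side. If there is none, both positions have the same
      floor and the fractional parts compare like the positions.\<close>
    define m where "m = \<lfloor>x1\<rfloor>"
    have m1: "of_int m \<le> x1" by (simp add: m_def)
    show False
    proof (cases "x2 \<le> of_int m")
      case True
      define U where "U = (fst u - m * snd q, snd u + m * fst q)"
      have "- 1 \<le> pt U \<bullet> z" if z: "z \<in> P" for z
      proof -
        have "pt U \<bullet> z = A z + of_int m * B z" by (simp add: U_def A_def B_def pt_inner algebra_simps)
        moreover have "- 1 \<le> A z + of_int m * B z"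
        proof (cases "0 \<le> B z")
          case True
          then have "x2 * B z \<le> of_int m * B z" using \<open>x2 \<le> of_int m\<close> by (intro mult_right_mono)
          then show ?thesis using ge2[OF z] by simp
        next
          case False
          then have "x1 * B z \<le> of_int m * B z" using m1 by (intro mult_right_mono_neg) auto
          then show ?thesis using ge1[OF z] by simp
        qed
        ultimately show ?thesis by simp
      qed
      then have "U \<in> polar P" by (simp add: polar_def)
      moreover have "dot U q = -1" using u by (simp add: U_def dot_def algebra_simps)
      then have "U \<noteq> (0, 0)" by (auto simp: dot_def)
      ultimately show False using no by blast
    next
      case False
      have "x1 < of_int m + 1" using floor_correct[of x1] by (simp add: m_def)
      then have "\<lfloor>x2\<rfloor> = m" using lt False by (intro floor_unique) auto
      then have "frac x2 < frac x1" using lt by (simp add: frac_def m_def)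
      moreover have "w2 \<in> W" unfolding W_def using e2(1) by blast
      ultimately show False using w(2)[of w2] lam1 lam2 by simp
    qed
  qed
  then show ?thesis using that by blast
qed

section \<open>Polygons whose highest edge is not beaten from the opposite side\<close>

definition unbeaten :: "point set \<Rightarrow> bool" where
  "unbeaten P \<longleftrightarrow> (\<forall>w r p k. edat P w r p k \<longrightarrow> (\<exists>z\<in>P. of_int r \<le> pt w \<bullet> z))"

definition hull2 :: "(int \<times> int) list \<Rightarrow> point set" where
  "hull2 V = convex hull (pt ` set V)"

text \<open>Each list has the form \<open>(b, h)\<close>, \<open>(b - n * h, h)\<close>,
  \<open>(b, h - m * b)\<close>: a corner and the far ends of a horizontal and a vertical side. The
  first one has a highest edge of height one, the next two have \<open>b = 2\<close>, and the other
  five are the solutions with \<open>b = 1\<close> and \<open>h \<ge> 2\<close>.\<close>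

definition triangles :: "(int \<times> int) list list" where
  "triangles =
     [[(1,1), (-2,1), (1,-2)],
      [(2,3), (-4,3), (2,-3)], [(2,5), (-3,5), (2,-5)],
      [(1,3), (-2,3), (1,-3)], [(1,3), (-2,3), (1,-6)], [(1,4), (-3,4), (1,-4)],
      [(1,2), (-3,2), (1,-2)], [(1,3), (-5,3), (1,-3)]]"

lemma edat_ge_pt:
  assumes "edat P w r p k" "pt q \<in> P"
  shows "- r \<le> fst w * fst q + snd w * snd q"
proof -
  have "of_int (- r) \<le> (of_int (fst w * fst q + snd w * snd q) :: real)"
    using edat_ge[OF assms] by (simp add: pt_inner_pt)
  then show ?thesis by (simp only: of_int_le_iff)
qed

lemma fano_halfspaces_pt:
  assumes "fano_polygon P" "\<And>w r p k. edat P w r p k \<Longrightarrow> - r \<le> fst w * fst q + snd w * snd q"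
  shows "pt q \<in> P"
proof (rule fano_halfspaces[OF assms(1)])
  fix w r p k assume "edat P w r p k"
  then have "- r \<le> fst w * fst q + snd w * snd q" by (rule assms(2))
  then have "of_int (- r) \<le> (of_int (fst w * fst q + snd w * snd q) :: real)" by (simp only: of_int_le_iff)
  then show "- of_int r \<le> pt w \<bullet> pt q" by (simp add: pt_inner_pt)
qed

lemma not_all_right:
  assumes "fano_polygon P"
  shows "\<exists>c\<ge>0. (c, 0) \<notin> P"
proof (rule ccontr)
  assume "\<not> ?thesis"
  then have all: "(c, 0) \<in> P" if "0 \<le> c" for c using that by blast
  obtain B where B: "\<And>z. z \<in> P \<Longrightarrow> norm z \<le> B"
    using compact_imp_bounded[OF fanoD(2)[OF assms]] by (auto simp: bounded_iff)
  have "norm ((\<bar>B\<bar> + 1, 0) :: point) \<le> B" by (rule B[OF all]) simp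
  then show False by (simp add: norm_Pair)
qed

lemma corner_triangle:
  fixes z :: point
  assumes "0 < N" "0 < M" "fst z \<le> x0" "snd z \<le> y0" "(x0 - fst z) / N + (y0 - snd z) / M \<le> 1"
  shows "z \<in> convex hull {(x0, y0), (x0 - N, y0), (x0, y0 - M)}"
proof -
  define s t where "s = (x0 - fst z) / N" and "t = (y0 - snd z) / M"
  have "0 \<le> s" "0 \<le> t" "s + t \<le> 1" using assms by (auto simp: s_def t_def)
  moreover have "z = (1 - s - t) *\<^sub>R (x0, y0) + s *\<^sub>R (x0 - N, y0) + t *\<^sub>R (x0, y0 - M)"
  proof -
    have "s * N = x0 - fst z" "t * M = y0 - snd z" using assms by (auto simp: s_def t_def)
    then show ?thesis by (simp add: prod_eq_iff algebra_simps)
  qed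
  ultimately show ?thesis unfolding convex_hull_3
    by (intro CollectI exI[of _ "1 - s - t"] exI[of _ s] exI[of _ t]) auto
qed

text \<open>Here \<open>s, t\<close> is the inner normal of the third side, cut off at height \<open>r\<close>.\<close>

lemma corner_triangle_eq:
  assumes f: "fano_polygon P" and NM: "0 < N" "0 < M" and st: "0 < s" "0 < t"
    and s: "s * (x0 - N) + t * y0 = - r" and t: "s * x0 + t * (y0 - M) = - r"
    and le: "\<And>z. z \<in> P \<Longrightarrow> fst z \<le> of_int x0 \<and> snd z \<le> of_int y0 \<and>
      - of_int r \<le> of_int s * fst z + of_int t * snd z"
    and mem: "pt (x0, y0) \<in> P" "pt (x0 - N, y0) \<in> P" "pt (x0, y0 - M) \<in> P"
  shows "P = hull2 [(x0, y0), (x0 - N, y0), (x0, y0 - M)]"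
proof
  have hull: "hull2 [(x0, y0), (x0 - N, y0), (x0, y0 - M)] =
     convex hull {(of_int x0, of_int y0), (of_int x0 - of_int N, of_int y0), (of_int x0, of_int y0 - of_int M)}"
    by (simp add: hull2_def pt_def)
  show "hull2 [(x0, y0), (x0 - N, y0), (x0, y0 - M)] \<subseteq> P"
    unfolding hull2_def using mem fanoD(3)[OF f] by (intro hull_minimal) auto
  show "P \<subseteq> hull2 [(x0, y0), (x0 - N, y0), (x0, y0 - M)]"
  proof
    fix z assume z: "z \<in> P"
    define D where "D = s * x0 + t * y0 + r"
    have D: "D = s * N" "D = t * M" using s t by (auto simp: D_def algebra_simps)
    have D0: "0 < D" using D NM st by simp
    have 1: "(of_int x0 - fst z) / of_int N = of_int s * (of_int x0 - fst z) / of_int D"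
      unfolding D(1) using st by simp
    have 2: "(of_int y0 - snd z) / of_int M = of_int t * (of_int y0 - snd z) / of_int D"
      unfolding D(2) using st by simp
    have "of_int s * (of_int x0 - fst z) + of_int t * (of_int y0 - snd z) \<le> of_int D"
      using le[OF z] by (simp add: D_def algebra_simps)
    then have "(of_int x0 - fst z) / of_int N + (of_int y0 - snd z) / of_int M \<le> 1"
      unfolding 1 2 using D0 by (simp flip: add_divide_distrib)
    then show "z \<in> hull2 [(x0, y0), (x0 - N, y0), (x0, y0 - M)]"
      unfolding hull using NM le[OF z] by (intro corner_triangle) auto
  qed
qed

text \<open>The highest edge lies on the line \<open>y = h\<close>, and \<open>(p, - q)\<close> is a lattice point at least as far
  on the other side; \<open>p > 0\<close> is achieved by a reflection.\<close>

locale top_edge =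
  fixes P :: "point set" and h b n q p :: int
  assumes f: "fano_polygon P" and T: "empty_residual_basket P"
    and heights: "\<And>w r p k. edat P w r p k \<Longrightarrow> r \<le> h"
    and top: "edat P (0, -1) h (b, h) (n * h)"
    and b0: "0 < b" and a0: "b - n * h < 0"
    and bottom: "pt (p, - q) \<in> P" and p0: "1 \<le> p" and qh: "h \<le> q"
begin

section \<open>Normals and sides of a polygon below its highest edge\<close>

lemma h0: "1 \<le> h" and n0: "1 \<le> n"
proof -
  show h: "1 \<le> h" using top by (simp add: edat_def)
  have "0 < n * h" using top by (simp add: edat_def)
  then show "1 \<le> n" using h by (simp add: zero_less_mult_iff)
qed

lemma right_end: "pt (b, h) \<in> P"
  using edat_start[OF top] by (simp add: minf_iff)

lemma left_end: "pt (b - n * h, h) \<in> P"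
  using edat_end(1)[OF top, of "n * h"] top by (simp add: edat_def)

lemma top_le: "z \<in> P \<Longrightarrow> snd z \<le> of_int h"
  using edat_ge[OF top] by (fastforce simp: pt_inner)

text \<open>With a negative second entry the value of \<open>w\<close> at the right end of the top
  edge is at most \<open>- 1 - h\<close>, and with a positive one its value at the bottom point is
  at most \<open>- 1 - q\<close>. Either way the edge would be higher than \<open>h\<close>, so only
  the vertical direction remains.\<close>

lemma right_normals:
  assumes e: "edat P w r p' k" and w: "fst w < 0"
  shows "w = (-1, 0)"
proof -
  have r: "r \<le> h" by (rule heights[OF e])
  have 1: "- r \<le> fst w * b + snd w * h" using edat_ge_pt[OF e right_end] by simp
  have 2: "- r \<le> fst w * p - snd w * q" using edat_ge_pt[OF e bottom] by simp
  have wb: "fst w * b \<le> - 1" "fst w * p \<le> - 1"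
    using w b0 p0 mult_le_mono1 by (smt (verit) mult_less_0_iff)+
  have "0 \<le> snd w"
  proof (rule ccontr)
    assume "\<not> 0 \<le> snd w"
    then have "snd w * h \<le> - 1 * h" using h0 by (intro mult_right_mono) auto
    then show False using 1 wb r by linarith
  qed
  moreover have "\<not> 0 < snd w"
  proof
    assume "0 < snd w"
    then have "1 * q \<le> snd w * q" using h0 qh by (intro mult_right_mono) auto
    then show False using 2 wb r qh by linarith
  qed
  ultimately have "snd w = 0" by simp
  moreover have "coprime (fst w) (snd w)" using e by (simp add: edat_def)
  ultimately have "\<bar>fst w\<bar> = 1" by simp
  then have "fst w = -1" using w by linarith
  then show ?thesis using \<open>snd w = 0\<close> by (simp add: prod_eq_iff)
qed

lemma left_normals:
  assumes e: "edat P w r p' k" and w: "0 < fst w"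
  shows "0 \<le> snd w"
proof (rule ccontr)
  assume "\<not> 0 \<le> snd w"
  then have "snd w * h \<le> - 1 * h" using h0 by (intro mult_right_mono) auto
  moreover have "fst w * (b - n * h) \<le> - 1" using w a0 by (smt (verit) mult_less_0_iff)
  moreover have "- r \<le> fst w * (b - n * h) + snd w * h" using edat_ge_pt[OF e left_end] by simp
  ultimately show False using heights[OF e] by linarith
qed

lemma normals:
  assumes e: "edat P w r p' k"
  shows "w = (-1, 0) \<or> w = (0, -1) \<or> (0 \<le> fst w \<and> 0 \<le> snd w)"
proof -
  consider "fst w < 0" | "fst w = 0" | "0 < fst w" by linarith
  then show ?thesis
  proof cases
    case 1 then show ?thesis using right_normals[OF e] by simp
  next
    case 2
    moreover have "coprime (fst w) (snd w)" using e by (simp add: edat_def)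
    ultimately have "\<bar>snd w\<bar> = 1" by simp
    then have "snd w = 1 \<or> snd w = -1" by linarith
    then show ?thesis using 2 by (auto simp: prod_eq_iff)
  next
    case 3 then show ?thesis using left_normals[OF e] by simp
  qed
qed

text \<open>Boundedness provides a vertical right side. Apart from it and the top edge all normals
  lie in the closed first quadrant, so moving right or up stays in \<open>P\<close> until one of
  these two sides is reached. Hence the corner is the right end of the top edge, and the bottom
  point can be pushed onto the vertical side, whose length is therefore at least
  \<open>h + q\<close>.\<close>

lemma right_edge:
  obtains m where "edat P (-1, 0) b (b, h - m * b) (m * b)" "b \<le> h" "2 * h \<le> m * b" "1 \<le> m"
proof -
  obtain c where c: "0 \<le> c" "(c, 0) \<notin> P" using not_all_right[OF f] by blast
  have "\<exists>r q k. edat P (-1, 0) r q k"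
  proof (rule ccontr)
    assume no: "\<not> ?thesis"
    have "(c, 0) \<in> P"
    proof (rule fano_halfspaces[OF f])
      fix w r p' k assume e: "edat P w r p' k"
      then have "0 < r" by (simp add: edat_def)
      moreover have "0 \<le> fst w"
      proof (rule ccontr)
        assume "\<not> 0 \<le> fst w"
        then have "w = (-1, 0)" using right_normals[OF e] by simp
        then show False using no e by blast
      qed
      ultimately show "- of_int r \<le> pt w \<bullet> (c, 0)" using c
        by (simp add: pt_inner) (meson le_minus_iff mult_nonneg_nonneg of_int_0_le_iff order_trans neg_le_0_iff_le less_imp_le)
    qed
    then show False using c by blast
  qed
  then obtain \<beta> s k where e: "edat P (-1, 0) \<beta> s k" by blast
  have \<beta>: "\<beta> \<le> h" "0 < \<beta>" "0 < k" using heights[OF e] e by (auto simp: edat_def)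
  have s1: "fst s = \<beta>" using edat_dot[OF e] by simp
  have C: "pt (\<beta>, h) \<in> P"
  proof (rule fano_halfspaces_pt[OF f])
    fix w r p' k assume e': "edat P w r p' k"
    then have r: "0 < r" by (simp add: edat_def)
    from normals[OF e'] show "- r \<le> fst w * fst (\<beta>, h) + snd w * snd (\<beta>, h)"
    proof (elim disjE)
      assume "w = (-1, 0)"
      then show ?thesis using edat_unique(1)[OF f e] e' by auto
    next
      assume "w = (0, -1)"
      then show ?thesis using edat_unique(1)[OF f top] e' by auto
    next
      assume w: "0 \<le> fst w \<and> 0 \<le> snd w"
      then have "0 \<le> fst w * \<beta> + snd w * h" using \<beta> h0 by simp
      then show ?thesis using r by simp
    qed
  qed
  have "\<beta> = b"
  proof (rule antisym)
    have "- \<beta> \<le> - b" using edat_ge_pt[OF e right_end] by simp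
    then show "b \<le> \<beta>" by simp
    have "pt (0, -1) \<bullet> pt (\<beta>, h) = - of_int h" by (simp add: pt_inner)
    then obtain t where t: "0 \<le> t" "pt (\<beta>, h) = pt (b, h) + t *\<^sub>R pt (snd (0 :: int, -1 :: int), - fst (0 :: int, -1 :: int))"
      using edat_param[OF top, of "pt (\<beta>, h)"] C by blast
    have "of_int \<beta> = of_int b - t" using arg_cong[OF t(2), of fst] by simp
    then show "\<beta> \<le> b" using t(1) by linarith
  qed
  have up: "snd s + k = h"
  proof (rule antisym)
    have "pt (fst s + k * 0, snd s - k * (-1)) \<in> P" using edat_end(1)[OF e, of k] \<beta> by simp
    then show "snd s + k \<le> h" using edat_ge_pt[OF top] by fastforce
    have "pt (-1, 0) \<bullet> pt (\<beta>, h) = - of_int \<beta>" by (simp add: pt_inner)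
    then obtain t where t: "t \<le> of_int k" "pt (\<beta>, h) = pt s + t *\<^sub>R pt (snd (-1 :: int, 0 :: int), - fst (-1 :: int, 0 :: int))"
      using edat_param[OF e, of "pt (\<beta>, h)"] C by blast
    have "of_int h = of_int (snd s) + t" using arg_cong[OF t(2), of snd] by simp
    then show "h \<le> snd s + k" using t(1) by linarith
  qed
  have low: "pt (\<beta>, - q) \<in> P"
  proof (rule fano_halfspaces_pt[OF f])
    fix w r p' k assume e': "edat P w r p' k"
    then have r: "0 < r" by (simp add: edat_def)
    have pb: "p \<le> \<beta>" using edat_ge_pt[OF e bottom] by simp
    from normals[OF e'] show "- r \<le> fst w * fst (\<beta>, - q) + snd w * snd (\<beta>, - q)"
    proof (elim disjE)
      assume "w = (-1, 0)"
      then show ?thesis using edat_unique(1)[OF f e] e' by auto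
    next
      assume "w = (0, -1)"
      then show ?thesis using r qh h0 by simp
    next
      assume w: "0 \<le> fst w \<and> 0 \<le> snd w"
      then have "fst w * p \<le> fst w * \<beta>" using pb by (intro mult_left_mono) auto
      then show ?thesis using edat_ge_pt[OF e' bottom] by simp
    qed
  qed
  have sq: "snd s \<le> - q"
  proof -
    have "pt (-1, 0) \<bullet> pt (\<beta>, - q) = - of_int \<beta>" by (simp add: pt_inner)
    then obtain t where t: "0 \<le> t" "pt (\<beta>, - q) = pt s + t *\<^sub>R pt (snd (-1 :: int, 0 :: int), - fst (-1 :: int, 0 :: int))"
      using edat_param[OF e, of "pt (\<beta>, - q)"] low by blast
    have "of_int (- q) = of_int (snd s) + t" using arg_cong[OF t(2), of snd] by simp
    then show ?thesis using t(1) by linarith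
  qed
  obtain m where m: "k = b * m" using edat_T[OF f T e] \<open>\<beta> = b\<close> by blast
  then have "0 < b * m" using \<beta> by simp
  then have m1: "1 \<le> m" using b0 by (simp add: zero_less_mult_iff)
  have "s = (b, h - m * b)" using s1 up m \<open>\<beta> = b\<close> by (simp add: prod_eq_iff mult.commute)
  then have "edat P (-1, 0) b (b, h - m * b) (m * b)" using e m \<open>\<beta> = b\<close> by (simp add: mult.commute)
  moreover have "2 * h \<le> m * b" using sq up m qh by (simp add: mult.commute)
  ultimately show ?thesis using that \<beta> \<open>\<beta> = b\<close> m1 by blast
qed

lemma right_le:
  assumes z: "z \<in> P"
  shows "fst z \<le> of_int b"
proof -
  obtain m where "edat P (-1, 0) b (b, h - m * b) (m * b)" using right_edge by blast
  then have "- of_int b \<le> pt (-1, 0) \<bullet> z" by (rule edat_ge[OF _ z])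
  then show ?thesis by (simp add: pt_inner)
qed

text \<open>A point of \<open>P\<close> can be raised to the line \<open>y = h\<close> without
  leaving \<open>P\<close>, since only the normal of the top edge has a negative second entry. On
  that line the top edge bounds it.\<close>

lemma left_ge:
  assumes z: "z \<in> P"
  shows "of_int (b - n * h) \<le> fst z"
proof -
  have "(fst z, of_int h) \<in> P"
  proof (rule fano_halfspaces[OF f])
    fix w r p' k assume e': "edat P w r p' k"
    then have r: "0 < r" by (simp add: edat_def)
    from normals[OF e'] show "- of_int r \<le> pt w \<bullet> (fst z, of_int h)"
    proof (elim disjE)
      assume w: "w = (-1, 0)"
      then show ?thesis using edat_ge[OF e' z] by (simp add: pt_inner)
    next
      assume "w = (0, -1)"
      then show ?thesis using edat_unique(1)[OF f top] e' by (auto simp: pt_inner)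
    next
      assume w: "0 \<le> fst w \<and> 0 \<le> snd w"
      then have "of_int (snd w) * snd z \<le> of_int (snd w) * of_int h" using top_le[OF z]
        by (intro mult_left_mono) auto
      then show ?thesis using edat_ge[OF e' z] by (simp add: pt_inner)
    qed
  qed
  moreover have "pt (0, -1) \<bullet> (fst z, of_int h) = - of_int h" by (simp add: pt_inner)
  ultimately obtain t where t: "t \<le> of_int (n * h)"
    "(fst z, of_int h) = pt (b, h) + t *\<^sub>R pt (snd (0 :: int, -1 :: int), - fst (0 :: int, -1 :: int))"
    using edat_param[OF top, of "(fst z, of_int h)"] by blast
  have "fst z = of_int b - t" using arg_cong[OF t(2), of fst] by simp
  then show ?thesis using t(1) by simp
qed

text \<open>No point of \<open>P\<close> lies further left than the left end of the top edge, so an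
  edge with \<open>s > 0\<close> is tight there and starts there. Its other end does not pass the
  vertical side, whence \<open>t * k \<le> n * h\<close>.\<close>

lemma left_edge:
  obtains s t \<rho> k where "edat P (s, t) \<rho> (b - n * h, h) k" "0 < s" "0 \<le> t" "\<rho> \<le> h"
    "s * (n * h - b) = t * h + \<rho>" "t * k \<le> n * h"
    "\<forall>\<tau>. 0 \<le> \<tau> \<and> \<tau> \<le> k \<longrightarrow> pt (b - n * h + \<tau> * t, h - \<tau> * s) \<in> P"
proof -
  have out: "pt (b - n * h, h) + \<epsilon> *\<^sub>R (-1, 0) \<notin> P" if "0 < \<epsilon>" for \<epsilon>
    using left_ge[of "pt (b - n * h, h) + \<epsilon> *\<^sub>R (-1, 0)"] that by auto
  obtain w \<rho> s0 k where e: "edat P w \<rho> s0 k" "pt w \<bullet> pt (b - n * h, h) = - of_int \<rho>" "pt w \<bullet> (-1, 0) < 0"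
    using exists_tight_edge[OF f left_end out] by blast
  define s t where "s = fst w" and "t = snd w"
  have w: "w = (s, t)" by (simp add: s_def t_def)
  have s: "0 < s" using e(3) by (simp add: pt_inner s_def)
  have t: "0 \<le> t" using left_normals[OF e(1)] s by (simp add: s_def t_def)
  have eq: "s * (b - n * h) + t * h = - \<rho>" using e(2) dot_pt by (simp add: w)
  obtain \<tau> where \<tau>: "0 \<le> \<tau>" "pt (b - n * h, h) = pt s0 + \<tau> *\<^sub>R pt (snd w, - fst w)"
    using edat_param[OF e(1), of "pt (b - n * h, h)"] left_end e(2) by blast
  have "pt s0 \<in> P" using edat_start[OF e(1)] by (simp add: minf_iff)
  then have "of_int (snd s0) \<le> (of_int h :: real)" using top_le by fastforce
  moreover have "of_int h = of_int (snd s0) - \<tau> * of_int s" using arg_cong[OF \<tau>(2), of snd] by (simp add: w)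
  ultimately have "\<tau> * of_int s \<le> 0" by simp
  then have "\<tau> = 0" using s \<tau>(1) by (simp add: mult_le_0_iff)
  then have s0: "s0 = (b - n * h, h)" using \<tau>(2) by simp
  have pts: "pt (b - n * h + \<tau> * t, h - \<tau> * s) \<in> P" if "0 \<le> \<tau>" "\<tau> \<le> k" for \<tau>
    using edat_end(1)[OF e(1) that] by (simp add: w s0)
  have k: "0 < k" using e(1) by (simp add: edat_def)
  have "b - n * h + k * t \<le> b"
  proof -
    have "pt (b - n * h + k * t, h - k * s) \<in> P" using pts[of k] k by simp
    from right_le[OF this] have "real_of_int (b - n * h + k * t) \<le> of_int b" by simp
    then show ?thesis by (simp only: of_int_le_iff)
  qed
  then have tk: "t * k \<le> n * h" by (simp add: mult.commute)
  show ?thesis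
  proof (rule that[of s t \<rho> k])
    show "edat P (s, t) \<rho> (b - n * h, h) k" using e(1) w s0 by simp
    show "\<rho> \<le> h" by (rule heights[OF e(1)])
    show "s * (n * h - b) = t * h + \<rho>" using eq by (simp add: algebra_simps)
  qed (use s t tk pts in auto)
qed

end

lemma arith_large:
  fixes b h n m l q u1 u2 :: int
  assumes b: "2 \<le> b" "b < h" and c: "coprime b h" and l: "b \<le> l" and q: "h \<le> q"
    and nh: "n * h = l + b" and mb: "m * b = q + h" and u: "0 < u1" "0 < u2"
    and 1: "u1 * l \<le> 1 + u2 * h" and 2: "u2 * q \<le> 1 + u1 * b"
  shows "(b, h, n, m, u1, u2) = (2, 3, 2, 3, 1, 1) \<or> (b, h, n, m, u1, u2) = (2, 5, 1, 5, 2, 1)"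
proof -
  have n1: "0 < n"
  proof -
    have "0 < n * h" using nh b l by simp
    then show ?thesis using b by (simp add: zero_less_mult_iff)
  qed
  have lb: "b + 1 \<le> l"
  proof (rule ccontr)
    assume "\<not> b + 1 \<le> l"
    then have nh: "n * h = 2 * b" using l nh by simp
    have "n < 2"
    proof (rule ccontr)
      assume "\<not> n < 2"
      then have "2 * h \<le> n * h" using b by (intro mult_right_mono) auto
      then show False using nh b by simp
    qed
    then have "n = 1" using n1 by simp
    then have "h = 2 * b" using nh by simp
    then have "b dvd h" by simp
    then have "is_unit b" using c by (meson coprime_common_divisor dvd_refl)
    then show False using b by simp
  qed
  \<comment> \<open>In the application \<open>(- l, h)\<close> and \<open>(b, - q)\<close> are the
    far ends of the top and the right side and \<open>(u1, u2)\<close> is a lattice point of the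
    polar polygon. The sum of its two inequalities leaves few cases, as \<open>l > b\<close> and
    \<open>q \<ge> h\<close>.\<close>
  have sum: "u1 * (l - b) + u2 * (q - h) \<le> 2" using 1 2 by (simp add: algebra_simps)
  have Y1: "u1 \<le> u1 * (l - b)" "l - b \<le> u1 * (l - b)"
    using u lb mult_left_mono[of 1 "l - b" u1] mult_right_mono[of 1 u1 "l - b"] by auto
  have Y2: "0 \<le> u2 * (q - h)" using u q by simp
  show ?thesis
  proof (cases "q = h")
    case False
    then have Z: "u2 \<le> u2 * (q - h)" "q - h \<le> u2 * (q - h)"
      using u q mult_left_mono[of 1 "q - h" u2] mult_right_mono[of 1 u2 "q - h"] by auto
    then have "u1 = 1" "u2 = 1" "q = h + 1" using sum Y1 u lb False q by linarith+
    then show ?thesis using 2 b by simp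
  next
    case True
    then have "b dvd 2 * h" using mb by (metis dvd_triv_right mult_2)
    then have "b dvd 2" using c by (simp add: coprime_dvd_mult_left_iff)
    then have b2: "b = 2" using b zdvd_imp_le[of b 2] by simp
    have mh: "m = h" using mb b2 True by simp
    have u1: "u1 = 1 \<or> u1 = 2" using sum Y1 Y2 u by linarith
    have u2h: "u2 * h \<le> 1 + 2 * u1" using 2 True b2 by simp
    have h3: "3 \<le> h" using b b2 by simp
    have "h \<le> u2 * h" using u h3 mult_right_mono[of 1 u2 h] by simp
    then have h5: "h \<le> 5" using u2h u1 by auto
    have u21: "u2 = 1"
    proof (rule ccontr)
      assume "u2 \<noteq> 1"
      then have "2 * h \<le> u2 * h" using u h3 by (intro mult_right_mono) auto
      then have "2 * h \<le> 5" using u2h u1 by linarith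
      then show False using h3 by linarith
    qed
    have h_odd: "h \<noteq> 4" using c b2 by auto
    have "h = 3 \<or> h = 5" using h3 h5 h_odd by presburger
    then show ?thesis
    proof
      assume h: "h = 3"
      have "l \<le> 4" using u1 1 u21 h by auto
      then show ?thesis using h nh b2 lb u21 mh u1 1 by auto
    next
      assume h: "h = 5"
      then have "u1 = 2" using u2h u21 u1 by auto
      moreover from this have "l = 3" using 1 u21 h b2 lb by auto
      ultimately show ?thesis using h nh b2 u21 mh by auto
    qed
  qed
qed

text \<open>Eliminates \<open>s\<close>: multiply \<open>s \<ge> t * h - \<rho> + e\<close> by
  \<open>n * h - 1\<close> and insert the equation for \<open>s * (n * h - 1)\<close>. The slack
  \<open>e\<close> is 0 if the line of the left side passes through the foot of the vertical side,
  and 1 if it does not.\<close>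

lemma arith_slope:
  fixes h n s t \<rho> q e :: int
  assumes "0 \<le> t" "h \<le> q" "1 \<le> n * h" "s * (n * h - 1) = t * h + \<rho>" "t * q - s \<le> \<rho> - e"
  shows "h * (t * (n * h - 2)) + e * (n * h - 1) \<le> h * (n * \<rho>)"
proof -
  have "t * h \<le> t * q" using assms by (intro mult_left_mono)
  then have "(t * h - \<rho> + e) * (n * h - 1) \<le> s * (n * h - 1)" using assms by (intro mult_right_mono) auto
  then show ?thesis using assms(4) by (simp add: algebra_simps)
qed

text \<open>For \<open>n \<ge> 3\<close> the equation forces \<open>t \<ge> 2\<close>, and then
  \<open>2 * (n * h - 2) \<le> n * h\<close> contradicts \<open>n * h \<ge> 6\<close>.\<close>

lemma arith_n_le_2:
  fixes h n s t \<rho> :: int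
  assumes h: "2 \<le> h" and s: "1 \<le> s" and \<rho>: "\<rho> \<le> h" and eq: "s * (n * h - 1) = t * h + \<rho>"
    and le: "h * (t * (n * h - 2)) \<le> h * (n * \<rho>)"
  shows "n \<le> 2"
proof (rule ccontr)
  assume "\<not> n \<le> 2"
  then have n: "3 \<le> n" by simp
  have "3 * h \<le> n * h" using n h by (intro mult_right_mono) auto
  then have nh: "6 \<le> n * h" using h by linarith
  have "1 * (n * h - 1) \<le> s * (n * h - 1)" using s nh h by (intro mult_right_mono) auto
  then have "(n - 1) * h < (t + 1) * h" using eq \<rho> h by (simp add: algebra_simps)
  then have t: "2 \<le> t" using h n by (simp add: mult_less_cancel_right)
  have "t * (n * h - 2) \<le> n * \<rho>" using le h by simp
  also have "\<dots> \<le> n * h" using n \<rho> by (intro mult_left_mono) auto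
  finally have 1: "t * (n * h - 2) \<le> n * h" .
  have "2 * (n * h - 2) \<le> t * (n * h - 2)" using t nh h by (intro mult_right_mono) auto
  from order_trans[OF this 1] have "2 * (n * h) - 4 \<le> n * h" by simp
  then show False using nh by linarith
qed

text \<open>The left side, with normal \<open>(s, t)\<close>, height \<open>\<rho>\<close> and width
  \<open>\<rho> * c\<close>, closes a triangle. For \<open>h \<ge> 5\<close> the estimate gives
  \<open>t = 1\<close> and \<open>\<rho> = h - 2\<close> or \<open>\<rho> = h - 1\<close>, which
  cannot divide \<open>n * h\<close>; for \<open>h \<le> 4\<close> it leaves a short list of
  quadruples \<open>(n, h, t, \<rho>)\<close>.\<close>

lemma arith_tight:
  fixes h n s t \<rho> q k c :: int
  assumes h: "2 \<le> h" and n: "1 \<le> n" and nh: "3 \<le> n * h" and s: "1 \<le> s" and t: "1 \<le> t"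
    and \<rho>: "1 \<le> \<rho>" "\<rho> \<le> h" and q: "h \<le> q"
    and eq: "s * (n * h - 1) = t * h + \<rho>" and tq: "t * q - s = \<rho>" and cst: "coprime s t"
    and tk: "t * k = n * h" and k: "k = \<rho> * c"
  shows "(h, n, s, t, \<rho>, q) \<in> {(3,1,2,1,1,3), (3,1,3,1,3,6), (4,1,2,1,2,4), (2,2,1,1,1,2), (3,2,1,1,2,3)}"
proof -
  have F: "h * (t * (n * h - 2)) \<le> h * (n * \<rho>)" using arith_slope[of t h q n s \<rho> 0] assms by simp
  then have F1: "t * (n * h - 2) \<le> n * \<rho>" using h by simp
  have "n \<le> 2" by (rule arith_n_le_2[OF h s \<rho>(2) eq F])
  then have n12: "n = 1 \<or> n = 2" using n by linarith
  have c1: "1 \<le> c"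
  proof -
    have "0 < t * k" using tk nh by simp
    then have "0 < \<rho> * c" using t k by (simp add: zero_less_mult_iff)
    then show ?thesis using \<rho> by (simp add: zero_less_mult_iff)
  qed
  have h4: "h \<le> 4"
  proof (rule ccontr)
    assume "\<not> h \<le> 4"
    then have h5: "5 \<le> h" by simp
    have t1: "t = 1"
    proof (rule ccontr)
      assume "t \<noteq> 1"
      then have "2 * (n * h - 2) \<le> t * (n * h - 2)" using t nh by (intro mult_right_mono) auto
      then show False using F1 n12 h5 \<rho> by auto
    qed
    show False using n12
    proof
      assume n: "n = 1"
      have \<rho>2: "h - 2 \<le> \<rho>" using F1 n t1 by simp
      have e: "s * (h - 1) = h + \<rho>" using eq n t1 by simp
      have "s \<le> 2"
      proof (rule ccontr)
        assume "\<not> s \<le> 2"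
        then have "3 * (h - 1) \<le> s * (h - 1)" using h by (intro mult_right_mono) auto
        then show False using e \<rho> h5 by simp
      qed
      then have "s = 1 \<or> s = 2" using s by linarith
      then have \<rho>e: "\<rho> = h - 2" using e \<rho> by auto
      have kh: "(h - 2) * c = h" using tk t1 n k \<rho>e by simp
      have "c \<noteq> 1" using kh by auto
      then have "(h - 2) * 2 \<le> (h - 2) * c" using c1 h5 by (intro mult_left_mono) auto
      then show False using kh h5 by simp
    next
      assume n: "n = 2"
      have e: "s * (2 * h - 1) = h + \<rho>" using eq n t1 by simp
      have "s \<le> 1"
      proof (rule ccontr)
        assume "\<not> s \<le> 1"
        then have "2 * (2 * h - 1) \<le> s * (2 * h - 1)" using h by (intro mult_right_mono) auto
        then show False using e \<rho> h5 by simp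
      qed
      then have \<rho>e: "\<rho> = h - 1" using e s by (simp add: order.antisym)
      have kh: "(h - 1) * c = 2 * h" using tk t1 n k \<rho>e by simp
      have "c \<noteq> 1" "c \<noteq> 2" using kh h5 by auto
      then have "(h - 1) * 3 \<le> (h - 1) * c" using c1 h5 by (intro mult_left_mono) auto
      then show False using kh h5 by simp
    qed
  qed
  have hs: "h = 2 \<or> h = 3 \<or> h = 4" using h h4 by linarith
  have "(n, h, t, \<rho>) \<in> {(1,3,1,1), (1,3,1,2), (1,3,2,2), (1,3,1,3), (1,3,2,3), (1,3,3,3),
      (1,4,1,2), (1,4,1,3), (1,4,1,4), (1,4,2,4), (2,2,1,1), (2,2,1,2), (2,2,2,2),
      (2,3,1,2), (2,3,1,3), (2,4,1,3), (2,4,1,4)}"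
    using n12
  proof
    assume n: "n = 1"
    have "h \<noteq> 2" using nh n by simp
    with hs show ?thesis
    proof (elim disjE)
      assume hh: "h = 3"
      then have "t \<le> \<rho>" "\<rho> \<le> 3" using F1 n \<rho> by auto
      then show ?thesis using t \<rho>(1) n hh by simp presburger
    next
      assume hh: "h = 4"
      then have "t * 2 \<le> \<rho>" "\<rho> \<le> 4" using F1 n \<rho> by auto
      then show ?thesis using t \<rho>(1) n hh by simp presburger
    qed auto
  next
    assume n: "n = 2"
    from hs show ?thesis
    proof (elim disjE)
      assume hh: "h = 2"
      then have "t \<le> \<rho>" "\<rho> \<le> 2" using F1 n \<rho> by auto
      then show ?thesis using t \<rho>(1) n hh by simp presburger
    next
      assume hh: "h = 3"
      then have "t * 2 \<le> \<rho>" "\<rho> \<le> 3" using F1 n \<rho> by auto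
      then show ?thesis using t \<rho>(1) n hh by simp presburger
    next
      assume hh: "h = 4"
      then have "t * 3 \<le> \<rho>" "\<rho> \<le> 4" using F1 n \<rho> by auto
      then show ?thesis using t \<rho>(1) n hh by simp presburger
    qed
  qed
  moreover have "t * (\<rho> * c) = n * h" using tk k by simp
  ultimately show ?thesis using eq tq cst
    by (elim insertE emptyE) (simp_all, presburger+)
qed

text \<open>The estimate with slack one leaves a single numerical candidate, which the width of the
  left side later rules out.\<close>

lemma arith_strict:
  fixes h n s t \<rho> q :: int
  assumes h: "2 \<le> h" and n: "1 \<le> n" and nh: "3 \<le> n * h" and s: "1 \<le> s" and t: "1 \<le> t"
    and \<rho>: "1 \<le> \<rho>" "\<rho> \<le> h" and q: "h \<le> q"
    and eq: "s * (n * h - 1) = t * h + \<rho>" and tq: "t * q - s < \<rho>"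
  shows "(h, n, s, t, \<rho>) = (3, 1, 3, 1, 3)"
proof -
  have F: "h * (t * (n * h - 2)) + (n * h - 1) \<le> h * (n * \<rho>)" using arith_slope[of t h q n s \<rho> 1] assms by simp
  then have F0: "h * (t * (n * h - 2)) \<le> h * (n * \<rho>)" using nh by simp
  have "n \<le> 2" by (rule arith_n_le_2[OF h s \<rho>(2) eq F0])
  then have n12: "n = 1 \<or> n = 2" using n by linarith
  then show ?thesis
  proof
    assume n: "n = 2"
    have F1: "h * (t * (2 * h - 2)) + (2 * h - 1) \<le> h * (2 * \<rho>)" using F n by simp
    have le: "h * (2 * \<rho>) \<le> h * (2 * h)" using \<rho> h by (intro mult_left_mono) auto
    have "t = 1"
    proof (rule ccontr)
      assume "t \<noteq> 1"
      then have "h * (2 * (2 * h - 2)) \<le> h * (t * (2 * h - 2))" using t h by (intro mult_left_mono mult_right_mono) auto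
      then have "h * (2 * (2 * h - 2)) + (2 * h - 1) \<le> h * (2 * h)" using F1 le by linarith
      then have "h * h + h * h \<le> 1 + h * 2" by (simp add: algebra_simps)
      moreover have "h * 2 \<le> h * h" using h by (intro mult_left_mono) auto
      ultimately show False using h by linarith
    qed
    have "\<rho> = h"
    proof (rule ccontr)
      assume "\<rho> \<noteq> h"
      then have "h * (2 * \<rho>) \<le> h * (2 * (h - 1))" using \<rho> h by (intro mult_left_mono) auto
      then show False using F1 \<open>t = 1\<close> h by (simp add: algebra_simps)
    qed
    then have e: "s * (2 * h - 1) = 2 * h" using eq n \<open>t = 1\<close> by simp
    show ?thesis
    proof (cases "s = 1")
      case True then show ?thesis using e by simp
    next
      case False
      then have "2 * (2 * h - 1) \<le> s * (2 * h - 1)" using s h by (intro mult_right_mono) auto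
      then show ?thesis using e h by simp
    qed
  next
    assume n: "n = 1"
    then have h3: "3 \<le> h" using nh by simp
    have F1: "h * (t * (h - 2)) + (h - 1) \<le> h * \<rho>" using F n by simp
    have le: "h * \<rho> \<le> h * h" using \<rho> h by (intro mult_left_mono) auto
    have e: "s * (h - 1) = t * h + \<rho>" using eq n by simp
    show ?thesis
    proof (cases "t = 1")
      case False
      then have "h * (2 * (h - 2)) \<le> h * (t * (h - 2))" using t h by (intro mult_left_mono mult_right_mono) auto
      then have A: "h * (2 * (h - 2)) + (h - 1) \<le> h * h" using F1 le by linarith
      have "h = 3"
      proof (rule ccontr)
        assume "h \<noteq> 3"
        then have "h * 4 \<le> h * h" using h3 by (intro mult_left_mono) auto
        moreover have "h * h \<le> 1 + h * 3" using A by (simp add: algebra_simps)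
        ultimately show False using h3 by linarith
      qed
      then have "t = 2" using F1 \<rho> t False by simp
      then have "\<rho> = 3" using F1 \<rho> \<open>h = 3\<close> by simp
      then have "s * 2 = 9" using e \<open>h = 3\<close> \<open>t = 2\<close> by simp
      then have False by presburger
      then show ?thesis ..
    next
      case True
      have "h - 1 \<le> \<rho>"
      proof (rule ccontr)
        assume "\<not> h - 1 \<le> \<rho>"
        then have 1: "h * \<rho> \<le> h * (h - 2)" using h by (intro mult_left_mono) auto
        have "h * (h - 2) + (h - 1) \<le> h * \<rho>" using F1 True by simp
        from order_trans[OF this 1] show False using h by simp
      qed
      then have \<rho>h: "\<rho> = h - 1 \<or> \<rho> = h" using \<rho> by linarith
      have "s \<le> 3"
      proof (rule ccontr)
        assume "\<not> s \<le> 3"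
        then have "4 * (h - 1) \<le> s * (h - 1)" using h by (intro mult_right_mono) auto
        then show False using e True \<rho> h3 by simp
      qed
      then have "s = 1 \<or> s = 2 \<or> s = 3" using s by linarith
      then show ?thesis using e True \<rho>h n h3 by auto
    qed
  qed
qed

section \<open>Triangles below the highest edge\<close>

context top_edge
begin

lemma coprime_b_h: "coprime b h"
  using edat_ends_coprime(1)[OF f top] by simp

lemma polar_ge: "u \<in> polar P \<Longrightarrow> pt z \<in> P \<Longrightarrow> - 1 \<le> fst u * fst z + snd u * snd z"
proof -
  assume "u \<in> polar P" "pt z \<in> P"
  then have "- 1 \<le> pt u \<bullet> pt z" by (simp add: polar_def)
  then have "of_int (- 1) \<le> (of_int (fst u * fst z + snd u * snd z) :: real)" by (simp add: pt_inner_pt)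
  then show ?thesis by (simp only: of_int_le_iff)
qed

text \<open>A nonzero lattice point \<open>u\<close> of the polar polygon has two positive
  coordinates, or it would fall below -1 at one of the three corners. The arithmetic then makes
  \<open>u\<close> equal to -1 at the far ends of both sides, so its half-plane cuts
  \<open>P\<close> down to a triangle.\<close>

lemma large_case:
  assumes ub: "unbeaten P" and b2: "2 \<le> b"
  shows "\<exists>V\<in>set triangles. P = hull2 V"
proof -
  obtain m where m: "edat P (-1, 0) b (b, h - m * b) (m * b)" "b \<le> h" "2 * h \<le> m * b" "1 \<le> m"
    by (rule right_edge)
  have "h \<noteq> b"
  proof
    assume "h = b"
    then have "is_unit b" using coprime_b_h by simp
    then show False using b2 by simp
  qed
  then have bh: "b < h" using m(2) by simp
  \<comment> \<open>A point matching the right side, which has distance \<open>b\<close>, forces the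
    left end of the top edge to reach at least as far: \<open>b - n * h \<le> - b\<close>.\<close>
  obtain z where z: "z \<in> P" "of_int b \<le> pt (-1, 0) \<bullet> z" using ub m(1) unfolding unbeaten_def by blast
  then have "of_int (b - n * h) \<le> - (of_int b :: real)" using left_ge[OF z(1)] by (simp add: pt_inner)
  then have "of_int (b - n * h) \<le> (of_int (- b) :: real)" by simp
  then have l: "b \<le> n * h - b" by (simp only: of_int_le_iff)
  have B: "pt (b, h - m * b) \<in> P" using edat_start[OF m(1)] by (simp add: minf_iff)
  have q: "h \<le> m * b - h" using m(3) by simp
  obtain u where u: "u \<in> polar P" "u \<noteq> (0, 0)" by (rule exists_polar_point[OF f T])
  define u1 u2 where "u1 = fst u" and "u2 = snd u"
  have gC: "- 1 \<le> u1 * b + u2 * h" and gA: "- 1 \<le> u1 * (b - n * h) + u2 * h" and gB: "- 1 \<le> u1 * b + u2 * (h - m * b)"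
    using polar_ge[OF u(1) right_end] polar_ge[OF u(1) left_end] polar_ge[OF u(1) B] by (simp_all add: u1_def u2_def)
  have un0: "u1 \<noteq> 0 \<or> u2 \<noteq> 0" using u(2) by (auto simp: u1_def u2_def prod_eq_iff)
  have neg: "c * x \<le> - x" if "c < 0" "0 \<le> x" for c x :: int
    using mult_right_mono[of c "-1" x] that by simp
  have pos: "0 < u1 \<and> 0 < u2"
  proof -
    consider "0 < u1" "0 < u2" | "u1 \<le> 0" "u2 \<le> 0" | "0 < u1" "u2 \<le> 0" | "u1 \<le> 0" "0 < u2" by linarith
    then show ?thesis
    proof cases
      case 2
      have "u1 * b \<le> 0" "u2 * h \<le> 0" using 2 b2 bh by (auto simp: mult_nonpos_nonneg)
      moreover have "u1 * b \<le> - b \<or> u2 * h \<le> - h" using un0 2 neg[of u1 b] neg[of u2 h] b2 bh by force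
      ultimately have False using gC b2 bh by linarith
      then show ?thesis ..
    next
      case 3
      have "u1 * (b - n * h) \<le> 1 * (b - n * h)" using 3 a0 by (intro mult_right_mono_neg) auto
      moreover have "u2 * h \<le> 0" using 3 bh b2 by (simp add: mult_nonpos_nonneg)
      ultimately have "- 1 \<le> b - n * h" using gA by simp
      then have False using l b2 by linarith
      then show ?thesis ..
    next
      case 4
      have "u2 * (h - m * b) \<le> 1 * (h - m * b)" using 4 q h0 by (intro mult_right_mono_neg) auto
      moreover have "u1 * b \<le> 0" using 4 b2 by (simp add: mult_nonpos_nonneg)
      ultimately have "- 1 \<le> h - m * b" using gB by simp
      then have False using q b2 bh by linarith
      then show ?thesis ..
    qed simp
  qed
  have sol: "(b, h, n, m, u1, u2) = (2, 3, 2, 3, 1, 1) \<or> (b, h, n, m, u1, u2) = (2, 5, 1, 5, 2, 1)"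
  proof (rule arith_large[OF b2 bh coprime_b_h l q])
    show "n * h = (n * h - b) + b" "m * b = m * b - h + h" by simp_all
    show "0 < u1" "0 < u2" using pos by auto
    show "u1 * (n * h - b) \<le> 1 + u2 * h" using gA by (simp add: algebra_simps)
    show "u2 * (m * b - h) \<le> 1 + u1 * b" using gB by (simp add: algebra_simps)
  qed
  have eq: "P = hull2 [(b, h), (b - n * h, h), (b, h - m * b)]"
  proof (rule corner_triangle_eq[OF f, where s = u1 and t = u2 and r = 1])
    show "0 < n * h" "0 < m * b" "0 < u1" "0 < u2" "u1 * (b - n * h) + u2 * h = - 1" "u1 * b + u2 * (h - m * b) = - 1"
      using sol by auto
    show "pt (b, h) \<in> P" "pt (b - n * h, h) \<in> P" "pt (b, h - m * b) \<in> P" by (rule right_end left_end B)+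
    fix z assume z: "z \<in> P"
    have "- 1 \<le> pt u \<bullet> z" using u(1) z by (simp add: polar_def)
    then show "fst z \<le> of_int b \<and> snd z \<le> of_int h \<and> - of_int 1 \<le> of_int u1 * fst z + of_int u2 * snd z"
      using right_le[OF z] top_le[OF z] by (simp add: pt_inner u1_def u2_def)
  qed
  have "[(b, h), (b - n * h, h), (b, h - m * b)] \<in> set triangles"
    using sol unfolding triangles_def by (elim disjE) simp_all
  then show ?thesis using eq by (intro bexI)
qed

lemma small_case:
  assumes b1: "b = 1" and nh: "3 \<le> n * h"
    and hyp: "2 \<le> h \<and> unbeaten P \<or>
      h = 1 \<and> 2 \<le> q \<and> (\<forall>w p k. edat P w 1 p k \<longrightarrow> k \<le> n)"
  shows "\<exists>V\<in>set triangles. P = hull2 V"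
proof -
  obtain m where m: "edat P (-1, 0) b (b, h - m * b) (m * b)" "b \<le> h" "2 * h \<le> m * b" "1 \<le> m"
    by (rule right_edge)
  have e1: "edat P (-1, 0) 1 (1, h - m) m" using m(1) b1 by simp
  have B: "pt (1, h - m) \<in> P" using edat_start[OF e1] by (simp add: minf_iff)
  have low: "- (m - h) \<le> y" if yP: "pt (1, y) \<in> P" for y
  proof -
    have "pt (-1, 0) \<bullet> pt (1, y) = - of_int 1" by (simp add: pt_inner)
    then obtain t where t: "0 \<le> t" "pt (1, y) = pt (1, h - m) + t *\<^sub>R pt (snd (-1 :: int, 0 :: int), - fst (-1 :: int, 0 :: int))"
      using edat_param[OF e1, of "pt (1, y)"] yP by blast
    have "of_int y = of_int (h - m) + t" using arg_cong[OF t(2), of snd] by simp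
    then show ?thesis using t(1) by linarith
  qed
  have q: "h \<le> m - h" using m(3) b1 by simp
  obtain s t \<rho> k where L: "edat P (s, t) \<rho> (b - n * h, h) k" "0 < s" "0 \<le> t" "\<rho> \<le> h"
    "s * (n * h - b) = t * h + \<rho>" "t * k \<le> n * h"
    and pts: "\<forall>\<tau>. 0 \<le> \<tau> \<and> \<tau> \<le> k \<longrightarrow> pt (b - n * h + \<tau> * t, h - \<tau> * s) \<in> P"
    by (rule left_edge)
  have eq: "s * (n * h - 1) = t * h + \<rho>" using L(5) b1 by simp
  have \<rho>: "1 \<le> \<rho>" "0 < k" and cst: "coprime s t" using L(1) by (auto simp: edat_def)
  obtain c where c: "k = \<rho> * c" using edat_T[OF f T L(1)] by blast
  \<comment> \<open>For \<open>t = 0\<close> the left side would be vertical at distance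
    \<open>n * h - 1 \<ge> 2\<close>. The right side at distance 1 does not match it, and for
    \<open>h = 1\<close> it is higher than the highest edge.\<close>
  have t1: "1 \<le> t"
  proof (rule ccontr)
    assume "\<not> 1 \<le> t"
    then have t0: "t = 0" using L(3) by simp
    then have s1: "s = 1" using cst L(2) by simp
    then have \<rho>e: "\<rho> = n * h - 1" using eq t0 by simp
    from hyp show False
    proof
      assume "2 \<le> h \<and> unbeaten P"
      then obtain z where z: "z \<in> P" "of_int \<rho> \<le> pt (s, t) \<bullet> z" using L(1) unfolding unbeaten_def by blast
      then have "of_int \<rho> \<le> (1 :: real)" using right_le[OF z(1)] b1 by (simp add: pt_inner s1 t0)
      then have "\<rho> \<le> 1" by simp
      then show False using \<rho>e nh by simp
    next
      assume "h = 1 \<and> 2 \<le> q \<and> (\<forall>w p k. edat P w 1 p k \<longrightarrow> k \<le> n)"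
      then show False using \<rho>e L(4) nh by simp
    qed
  qed
  have Bge: "- \<rho> \<le> s + t * (h - m)" using edat_ge_pt[OF L(1) B] by simp
  then have tq: "t * (m - h) - s \<le> \<rho>" by (simp add: algebra_simps)
  have tri: "P = hull2 [(1, h), (1 - n * h, h), (1, h - m)]" if tight: "t * (m - h) - s = \<rho>"
  proof (rule corner_triangle_eq[OF f, where s = s and t = t and r = \<rho>])
    show "0 < n * h" "0 < m" "0 < s" "0 < t" using nh m(4) L(2) t1 by auto
    show "s * (1 - n * h) + t * h = - \<rho>" using eq by (simp add: algebra_simps)
    show "s * 1 + t * (h - m) = - \<rho>" using tight by (simp add: algebra_simps)
    show "pt (1, h) \<in> P" "pt (1 - n * h, h) \<in> P" "pt (1, h - m) \<in> P"
      using right_end left_end B b1 by simp_all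
    fix z assume z: "z \<in> P"
    show "fst z \<le> of_int 1 \<and> snd z \<le> of_int h \<and> - of_int \<rho> \<le> of_int s * fst z + of_int t * snd z"
      using right_le[OF z] top_le[OF z] edat_ge[OF L(1) z] b1 by (simp add: pt_inner)
  qed
  from hyp show ?thesis
  proof
    assume H: "2 \<le> h \<and> unbeaten P"
    show ?thesis
    proof (cases "t * (m - h) - s = \<rho>")
      case True
      have tk: "t * k = n * h"
      proof (rule antisym[OF L(6)])
        have w: "pt (s, t) \<bullet> pt (1, h - m) = - of_int \<rho>" using True by (subst dot_pt) (simp add: algebra_simps)
        obtain \<tau> where \<tau>: "\<tau> \<le> of_int k" "pt (1, h - m) = pt (b - n * h, h) + \<tau> *\<^sub>R pt (snd (s, t), - fst (s, t))"
          using edat_param[OF L(1), of "pt (1, h - m)"] B w by blast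
        have "of_int (n * h) = \<tau> * of_int t" using arg_cong[OF \<tau>(2), of fst] b1 by simp
        also have "\<dots> \<le> of_int k * of_int t" using \<tau>(1) t1 by (intro mult_right_mono) auto
        finally have "real_of_int (n * h) \<le> of_int (t * k)" by (simp add: mult.commute)
        then show "n * h \<le> t * k" by (simp only: of_int_le_iff)
      qed
      have "(h, n, s, t, \<rho>, m - h) \<in> {(3,1,2,1,1,3), (3,1,3,1,3,6), (4,1,2,1,2,4), (2,2,1,1,1,2), (3,2,1,1,2,3)}"
        by (rule arith_tight[OF _ n0 nh _ t1 \<rho>(1) L(4) q eq True cst tk c]) (use H L(2) in auto)
      then have "(h, n, m) \<in> {(3,1,6), (3,1,9), (4,1,8), (2,2,4), (3,2,6)}" by auto
      then have "[(1, h), (1 - n * h, h), (1, h - m)] \<in> set triangles"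
        unfolding triangles_def by (elim insertE emptyE) simp_all
      then show ?thesis using tri[OF True] by (intro bexI)
    next
      case False
      then have "(h, n, s, t, \<rho>) = (3, 1, 3, 1, 3)"
        using arith_strict[OF _ n0 nh _ t1 \<rho>(1) L(4) q eq] tq H L(2) by simp
      then have v: "h = 3" "n = 1" "s = 3" "t = 1" "\<rho> = 3" by auto
      \<comment> \<open>The width of the left side is a positive multiple of
        \<open>\<rho> = 3\<close>, so three unit segments along it lead from \<open>(- 2, 3)\<close>
        to \<open>(1, - 6)\<close>. By the strict inequality the foot of the right side lies above
        that point.\<close>
      have "0 < c" using c \<rho>(2) v by simp
      then have "3 \<le> k" using c v by simp
      then have "pt (1, - 6) \<in> P" using pts[rule_format, of 3] b1 v by simp
      then have "- (m - h) \<le> - 6" by (rule low)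
      then show ?thesis using tq False v by simp
    qed
  next
    assume H: "h = 1 \<and> 2 \<le> q \<and> (\<forall>w p k. edat P w 1 p k \<longrightarrow> k \<le> n)"
    then have h1: "h = 1" by simp
    have \<rho>1: "\<rho> = 1" using \<rho> L(4) h1 by simp
    have n3: "3 \<le> n" using nh h1 by simp
    have "pt (1, - q) \<in> P"
    proof (rule fano_halfspaces_pt[OF f])
      fix w r p' k' assume e': "edat P w r p' k'"
      then have r: "0 < r" by (simp add: edat_def)
      have "p \<le> b" using right_le[OF bottom] by simp
      then have p1: "p = 1" using b1 p0 by simp
      show "- r \<le> fst w * fst (1 :: int, - q) + snd w * snd (1 :: int, - q)"
        using edat_ge_pt[OF e' bottom] p1 by simp
    qed
    then have "- (m - h) \<le> - q" by (rule low)
    then have m3: "2 \<le> m - 1" using H h1 by simp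
    have e: "s * (n - 1) = t + 1" using eq h1 \<rho>1 by simp
    \<comment> \<open>The depth \<open>m - 1 \<ge> 2\<close> gives \<open>s \<ge> 2 * t - 1\<close>.
      Together with \<open>s * (n - 1) = t + 1\<close> and \<open>n \<ge> 3\<close> this leaves only
      \<open>s = t = 1\<close> and \<open>n = m = 3\<close>.\<close>
    have "t * 2 \<le> t * (m - 1)" using m3 t1 by (intro mult_left_mono) auto
    then have "t * 2 - 1 \<le> s" using tq h1 \<rho>1 by simp
    then have "(t * 2 - 1) * (n - 1) \<le> t + 1" using e n3 mult_right_mono[of "t * 2 - 1" s "n - 1"] by simp
    moreover have "(t * 2 - 1) * 2 \<le> (t * 2 - 1) * (n - 1)" using n3 t1 by (intro mult_left_mono) auto
    ultimately have t: "t = 1" using t1 by simp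
    then have "s * 2 \<le> 2" using e n3 mult_left_mono[of 2 "n - 1" s] L(2) by simp
    then have s: "s = 1" using L(2) by simp
    have n: "n = 3" using e s t by simp
    have "m = 3" using m3 tq t s \<rho>1 h1 by simp
    moreover have "t * (m - h) - s = \<rho>" using \<open>m = 3\<close> t s \<rho>1 h1 by simp
    moreover have "[(1, h), (1 - n * h, h), (1, h - m)] \<in> set triangles"
      unfolding triangles_def using n h1 \<open>m = 3\<close> by simp
    ultimately show ?thesis using tri by (intro bexI)
  qed
qed

end

section \<open>Bringing the highest edge into standard position\<close>

lemma GL2Z_equivalentI: "\<bar>a * d - b * c\<bar> = 1 \<Longrightarrow> GL2Z_equivalent P (gl a b c d ` P)"
  by (auto simp: GL2Z_gl)

lemma GL2Z_equivalent_refl: "GL2Z_equivalent P P"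
proof -
  have "gl 1 0 0 1 = id" by (auto simp: gl_def fun_eq_iff)
  then show ?thesis using GL2Z_equivalentI[of 1 1 0 0 P] by simp
qed

lemma GL2Z_equivalent_trans: "GL2Z_equivalent P Q \<Longrightarrow> GL2Z_equivalent Q R \<Longrightarrow> GL2Z_equivalent P R"
proof -
  assume "GL2Z_equivalent P Q" "GL2Z_equivalent Q R"
  then obtain a b c d a' b' c' d' where d: "\<bar>a * d - b * c\<bar> = 1" "\<bar>a' * d' - b' * c'\<bar> = 1"
    and Q: "Q = gl a b c d ` P" "R = gl a' b' c' d' ` Q" unfolding GL2Z_gl by blast
  have "gl a' b' c' d' (gl a b c d z) = gl (a' * a + b' * c) (a' * b + b' * d) (c' * a + d' * c) (c' * b + d' * d) z" for z
    by (simp add: gl_def algebra_simps)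
  then have R: "R = gl (a' * a + b' * c) (a' * b + b' * d) (c' * a + d' * c) (c' * b + d' * d) ` P"
    unfolding Q image_image by simp
  have "(a' * a + b' * c) * (c' * b + d' * d) - (a' * b + b' * d) * (c' * a + d' * c) = (a' * d' - b' * c') * (a * d - b * c)"
    by (simp add: algebra_simps)
  then show ?thesis unfolding R using d by (intro GL2Z_equivalentI) (simp add: abs_mult)
qed

definition strip_or_triangle :: "point set \<Rightarrow> bool" where
  "strip_or_triangle P \<longleftrightarrow> (\<forall>z\<in>P. \<bar>fst z\<bar> \<le> 1) \<or> (\<exists>V\<in>set triangles. P = hull2 V)"

lemma unbeaten_gl:
  assumes d: "\<bar>a * d - b * c\<bar> = 1" and f: "fano_polygon P" and u: "unbeaten P"
  shows "unbeaten (gl a b c d ` P)"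
  unfolding unbeaten_def
proof (intro allI impI)
  fix w r p k assume "edat (gl a b c d ` P) w r p k"
  then obtain p' where "edat P (gli a c b d w) r p' k" by (rule edat_gl[OF d f])
  then obtain z where "z \<in> P" "of_int r \<le> pt (gli a c b d w) \<bullet> z" using u unfolding unbeaten_def by blast
  then show "\<exists>z\<in>gl a b c d ` P. of_int r \<le> pt w \<bullet> z" by (intro bexI[of _ "gl a b c d z"]) (auto simp: gl_inner)
qed

text \<open>Determinant 1 preserves the counterclockwise direction, so here the starting point is
  mapped to the starting point.\<close>

lemma edat_gl_pos:
  assumes d: "a * d - b * c = 1" and e: "edat P (gli a c b d w) r p k"
  shows "edat (gl a b c d ` P) w r (gli a b c d p) k"
  unfolding edat_def
proof (intro conjI)
  have co: "coprime (fst (gli a c b d w)) (snd (gli a c b d w))" using e by (simp add: edat_def)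
  show "coprime (fst w) (snd w)"
  proof (rule coprimeI)
    fix x assume "x dvd fst w" "x dvd snd w"
    then have "x dvd fst (gli a c b d w)" "x dvd snd (gli a c b d w)" by (auto simp: gli_def)
    then show "is_unit x" using co by (meson coprime_common_divisor)
  qed
  show "0 < r" "0 < k" using e by (auto simp: edat_def)
  show "pt w \<bullet> pt (gli a b c d p) = - of_int r" using e
    unfolding gl_pt[symmetric] gl_inner by (simp add: edat_def)
  have dir: "gl a b c d (pt (snd (gli a c b d w), - fst (gli a c b d w))) = pt (snd w, - fst w)"
  proof -
    have "gli a b c d (snd (gli a c b d w), - fst (gli a c b d w)) = ((a * d - b * c) * snd w, - (a * d - b * c) * fst w)"
      by (simp add: gli_def algebra_simps)
    then show ?thesis unfolding gl_pt using d by simp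
  qed
  have "minf (pt w) (gl a b c d ` P) = gl a b c d ` closed_segment (pt p) (pt p + of_int k *\<^sub>R pt (snd (gli a c b d w), - fst (gli a c b d w)))"
    using e by (simp add: minf_gl edat_def)
  also have "\<dots> = closed_segment (gl a b c d (pt p)) (gl a b c d (pt p + of_int k *\<^sub>R pt (snd (gli a c b d w), - fst (gli a c b d w))))"
    by (rule closed_segment_linear_image[OF linear_gl, symmetric])
  finally show "minf (pt w) (gl a b c d ` P) =
      closed_segment (pt (gli a b c d p)) (pt (gli a b c d p) + of_int k *\<^sub>R pt (snd w, - fst w))"
    using linear_gl[of a b c d] dir by (simp add: linear_add linear_scale)
qed

lemma edat_reflect:
  assumes e: "edat P (0, -1) h (b, h) k"
  shows "edat (gl (-1) 0 0 1 ` P) (0, -1) h (k - b, h) k"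
  unfolding edat_def
proof (intro conjI)
  show "coprime (fst (0 :: int, -1 :: int)) (snd (0 :: int, -1 :: int))" by simp
  show "0 < h" "0 < k" using e by (auto simp: edat_def)
  show "pt (0, -1) \<bullet> pt (k - b, h) = - of_int h" by (simp add: pt_inner)
  have "minf (pt (0, -1)) (gl (-1) 0 0 1 ` P) = gl (-1) 0 0 1 ` minf (pt (0, -1)) P"
    by (simp add: minf_gl gli_def)
  also have "\<dots> = gl (-1) 0 0 1 ` closed_segment (pt (b, h)) (pt (b - k, h))"
    using e by (simp add: edat_def pt_def)
  also have "\<dots> = closed_segment (gl (-1) 0 0 1 (pt (b, h))) (gl (-1) 0 0 1 (pt (b - k, h)))"
    by (rule closed_segment_linear_image[OF linear_gl, symmetric])
  also have "\<dots> = closed_segment (pt (k - b, h)) (pt (- b, h))"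
    by (subst closed_segment_commute) (simp add: gl_def pt_def)
  finally show "minf (pt (0, -1)) (gl (-1) 0 0 1 ` P) = closed_segment (pt (k - b, h))
     (pt (k - b, h) + of_int k *\<^sub>R pt (snd (0 :: int, -1 :: int), - fst (0 :: int, -1 :: int)))"
    by (simp add: pt_def)
qed

context top_edge
begin

lemma conclusion:
  assumes "2 \<le> h \<and> unbeaten P \<or> h = 1 \<and> 2 \<le> q \<and> (\<forall>w p k. edat P w 1 p k \<longrightarrow> k \<le> n)"
  shows "strip_or_triangle P"
proof (cases "2 \<le> b")
  case True
  obtain m where "b \<le> h" by (rule right_edge) blast
  then have "unbeaten P" using assms True by auto
  then show ?thesis using large_case[OF _ True] unfolding strip_or_triangle_def by blast
next
  case False
  then have b1: "b = 1" using b0 by simp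
  then have "2 \<le> n * h" using a0 by simp
  \<comment> \<open>For \<open>b = 1\<close> a top edge of length two confines \<open>P\<close> to
    the strip; a longer one leads to a triangle.\<close>
  then consider "n * h = 2" | "3 \<le> n * h" by linarith
  then show ?thesis
  proof cases
    case 1
    have "\<bar>fst z\<bar> \<le> 1" if "z \<in> P" for z using right_le[OF that] left_ge[OF that] b1 1 by simp
    then show ?thesis unfolding strip_or_triangle_def by blast
  next
    case 2
    then show ?thesis using small_case[OF b1 2 assms] unfolding strip_or_triangle_def by blast
  qed
qed

end

lemma fano_hull_ge:
  assumes f: "fano_polygon P" and z: "z \<in> P" and le: "\<And>x. x extreme_point_of P \<Longrightarrow> c \<le> u \<bullet> x"
  shows "c \<le> u \<bullet> z"
proof (rule hull_ge)
  show "z \<in> convex hull {x. x extreme_point_of P}" by (rule subst[OF fanoD(9)[OF f]]) (rule z)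
qed (use le in simp)

text \<open>Replaces a real point beyond a line by a primitive lattice point: a lower bound that
  holds at all vertices holds on \<open>P\<close>, and integrality at the vertices allows the bound
  \<open>c + 1\<close>.\<close>

lemma extreme_le:
  assumes f: "fano_polygon P" and z: "z \<in> P" "pt u \<bullet> z \<le> of_int c"
  obtains q where "pt q extreme_point_of P" "coprime (fst q) (snd q)" "fst u * fst q + snd u * snd q \<le> c"
proof -
  have "\<exists>q. pt q extreme_point_of P \<and> coprime (fst q) (snd q) \<and> fst u * fst q + snd u * snd q \<le> c"
  proof (rule ccontr)
    assume no: "\<not> ?thesis"
    have "of_int (c + 1) \<le> pt u \<bullet> x" if x: "x extreme_point_of P" for x
    proof -
      have "x \<in> primitive_points" using x fanoD(8)[OF f] by blast
      then obtain q where q: "x = pt q" "coprime (fst q) (snd q)" unfolding primitive_points_eq by blast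
      have ext: "pt q extreme_point_of P" using x q(1) by simp
      have "\<not> fst u * fst q + snd u * snd q \<le> c"
      proof
        assume "fst u * fst q + snd u * snd q \<le> c"
        then have "\<exists>q. pt q extreme_point_of P \<and> coprime (fst q) (snd q) \<and> fst u * fst q + snd u * snd q \<le> c"
          using ext q(2) by (intro exI[of _ q] conjI)
        then show False using no by contradiction
      qed
      then have "c + 1 \<le> fst u * fst q + snd u * snd q" by simp
      then have "of_int (c + 1) \<le> (of_int (fst u * fst q + snd u * snd q) :: real)" by (simp only: of_int_le_iff)
      then show ?thesis using q by (simp add: pt_inner_pt)
    qed
    then have "of_int (c + 1) \<le> pt u \<bullet> z" by (rule fano_hull_ge[OF f z(1)])
    then show False using z(2) by simp
  qed
  then show ?thesis using that by blast
qed

lemma to_top: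
  assumes f: "fano_polygon P" and e: "edat P w h p k"
  obtains a b c d x where "a * d - b * c = 1" "edat (gl a b c d ` P) (0, -1) h (x, h) k"
proof -
  have "coprime (fst w) (snd w)" using e by (simp add: edat_def)
  then obtain s t where st: "fst w * s + snd w * t = 1" by (rule coprime_bezout)
  have d: "(- t) * (- snd w) - s * (- fst w) = 1" using st by (simp add: algebra_simps)
  have "gli (- t) (- fst w) s (- snd w) (0, -1) = w" by (simp add: gli_def)
  then have e': "edat (gl (- t) s (- fst w) (- snd w) ` P) (0, -1) h (gli (- t) s (- fst w) (- snd w) p) k"
    using e by (intro edat_gl_pos[OF d]) simp
  obtain x y where xy: "gli (- t) s (- fst w) (- snd w) p = (x, y)" by fastforce
  have "y = h" using edat_dot[OF e'] by (simp add: xy)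
  then show ?thesis using that[OF d] e' xy by simp
qed

lemma normalise_top:
  assumes f: "fano_polygon P" and T: "empty_residual_basket P"
    and top: "edat P (0, -1) h (b, h) (n * h)" and b: "0 < b" "b - n * h < 0"
    and heights: "\<And>w r p k. edat P w r p k \<Longrightarrow> r \<le> h"
    and x: "pt (p, - q) \<in> P" "p \<noteq> 0" "h \<le> q"
    and hyp: "2 \<le> h \<and> unbeaten P \<or> h = 1 \<and> 2 \<le> q \<and> (\<forall>w p k. edat P w 1 p k \<longrightarrow> k \<le> n)"
  shows "\<exists>Q. GL2Z_equivalent P Q \<and> strip_or_triangle Q"
proof (cases "0 < p")
  case True
  interpret top_edge P h b n q p
    using assms True by unfold_locales auto
  show ?thesis using conclusion[OF hyp] GL2Z_equivalent_refl by blast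
next
  case False
  define Q where "Q = gl (-1) 0 0 1 ` P"
  have d: "\<bar>(-1) * 1 - 0 * 0\<bar> = (1 :: int)" by simp
  have eQ: "\<exists>p'. edat P (gli (-1) 0 0 1 w) r p' k" if eQ: "edat Q w r p k" for w r p k
    using edat_gl[OF d f] eQ unfolding Q_def by blast
  have ubQ: "unbeaten P \<Longrightarrow> unbeaten Q" unfolding Q_def by (rule unbeaten_gl[OF d f])
  interpret top_edge Q h "n * h - b" n q "- p"
  proof
    show "fano_polygon Q" unfolding Q_def by (rule fano_gl[OF d f])
    show "empty_residual_basket Q" unfolding Q_def by (rule basket_gl[OF d f T])
    show "r \<le> h" if "edat Q w r p k" for w r p k using eQ[OF that] heights by blast
    show "edat Q (0, -1) h (n * h - b, h) (n * h)" unfolding Q_def by (rule edat_reflect[OF top])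
    show "0 < n * h - b" "n * h - b - n * h < 0" using b by auto
    have "gl (-1) 0 0 1 (pt (p, - q)) \<in> Q" unfolding Q_def using x by blast
    then show "pt (- p, - q) \<in> Q" by (simp add: gli_def)
    show "1 \<le> - p" "h \<le> q" using x False by auto
  qed
  have "2 \<le> h \<and> unbeaten Q \<or> h = 1 \<and> 2 \<le> q \<and> (\<forall>w p k. edat Q w 1 p k \<longrightarrow> k \<le> n)"
    using hyp
  proof
    assume "2 \<le> h \<and> unbeaten P"
    then show ?thesis using ubQ by simp
  next
    assume "h = 1 \<and> 2 \<le> q \<and> (\<forall>w p k. edat P w 1 p k \<longrightarrow> k \<le> n)"
    then show ?thesis using eQ by blast
  qed
  then show ?thesis using conclusion GL2Z_equivalentI[OF d, of P] unfolding Q_def by blast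
qed

text \<open>A horizontal shear moves the right end of the top edge to abscissa
  \<open>x mod h\<close>, which is nonzero as the end is primitive and \<open>h \<ge> 2\<close>. The
  left end becomes negative because the length is a positive multiple of \<open>h\<close>. A vertex
  at depth at least \<open>h \<ge> 2\<close> is primitive and hence not on the vertical
  axis.\<close>

lemma tall_case:
  assumes f: "fano_polygon P" and T: "empty_residual_basket P" and ub: "unbeaten P"
    and e: "edat P w h p k" and h: "2 \<le> h" and heights: "\<And>w r p k. edat P w r p k \<Longrightarrow> r \<le> h"
  shows "\<exists>Q. GL2Z_equivalent P Q \<and> strip_or_triangle Q"
proof -
  obtain a b c d x where d: "a * d - b * c = 1" and e1: "edat (gl a b c d ` P) (0, -1) h (x, h) k"
    by (rule to_top[OF f e])
  define Q where "Q = gl a b c d ` P"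
  have d': "\<bar>a * d - b * c\<bar> = 1" using d by simp
  define j where "j = - (x div h)"
  define R where "R = gl 1 j 0 1 ` Q"
  have dj: "1 * 1 - j * 0 = 1" "\<bar>1 * 1 - j * 0\<bar> = 1" by auto
  have fQ: "fano_polygon Q" unfolding Q_def by (rule fano_gl[OF d' f])
  have fR: "fano_polygon R" unfolding R_def by (rule fano_gl[OF dj(2) fQ])
  have TR: "empty_residual_basket R" unfolding R_def Q_def
    by (intro basket_gl fano_gl dj d' f T)
  have ubR: "unbeaten R" unfolding R_def Q_def by (intro unbeaten_gl fano_gl dj d' f ub)
  have gR: "GL2Z_equivalent P R" using GL2Z_equivalentI[OF d'] GL2Z_equivalentI[OF dj(2)] GL2Z_equivalent_trans unfolding Q_def R_def by blast
  have hR: "r \<le> h" if eR: "edat R w r p k" for w r p k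
  proof -
    obtain p' where "edat Q (gli 1 0 j 1 w) r p' k" using edat_gl[OF dj(2) fQ] eR unfolding R_def by blast
    then obtain p'' where "edat P (gli a c b d (gli 1 0 j 1 w)) r p'' k" using edat_gl[OF d' f] unfolding Q_def by blast
    then show ?thesis by (rule heights)
  qed
  have "edat R (0, -1) h (gli 1 j 0 1 (x, h)) k" unfolding R_def
    by (rule edat_gl_pos[OF dj(1)]) (use e1 in \<open>simp add: gli_def Q_def\<close>)
  moreover have "x + j * h = x mod h" by (simp add: j_def minus_div_mult_eq_mod)
  ultimately have eR: "edat R (0, -1) h (x mod h, h) k" by (simp add: gli_def)
  obtain n where n: "k = n * h" using edat_T[OF fR TR eR] by (metis dvd_def mult.commute)
  have k0: "0 < k" using eR by (simp add: edat_def)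
  have n1: "1 \<le> n"
  proof -
    have "0 < n * h" using n k0 by simp
    then show ?thesis using h by (simp add: zero_less_mult_iff)
  qed
  have "coprime (x mod h) h" using edat_ends_coprime(1)[OF fR eR] by simp
  then have "x mod h \<noteq> 0" using h by auto
  then have b: "0 < x mod h" "x mod h < h" using h pos_mod_sign[of h x] pos_mod_bound[of h x] by linarith+
  have "1 * h \<le> n * h" using n1 h by (intro mult_right_mono) auto
  then have b': "x mod h - n * h < 0" using b(2) by linarith
  obtain z where z: "z \<in> R" "of_int h \<le> pt (0, -1) \<bullet> z" using ubR eR unfolding unbeaten_def by blast
  then have z2: "pt (0, 1) \<bullet> z \<le> of_int (- h)" by (simp add: pt_inner)
  obtain y where y: "pt y extreme_point_of R" "coprime (fst y) (snd y)"
    "fst (0 :: int, 1 :: int) * fst y + snd (0 :: int, 1 :: int) * snd y \<le> - h"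
    by (rule extreme_le[OF fR z(1) z2])
  define q where "q = - snd y"
  have q: "h \<le> q" using y(3) by (simp add: q_def)
  have "fst y \<noteq> 0" using y(2) q h by (auto simp: q_def)
  moreover have "pt (fst y, - q) \<in> R" using y(1) by (simp add: q_def extreme_point_of_def)
  moreover have "edat R (0, -1) h (x mod h, h) (n * h)" using eR n by simp
  ultimately have "\<exists>S. GL2Z_equivalent R S \<and> strip_or_triangle S"
    using q h ubR b b' hR by (intro normalise_top[OF fR TR, where p = "fst y" and q = q and n = n and b = "x mod h"]) auto
  then show ?thesis using GL2Z_equivalent_trans[OF gR] by blast
qed

text \<open>All heights being one, a longest edge is placed on top with right end
  \<open>(1, 1)\<close>. A vertex at depth 2 or more is off the vertical axis and allows the
  analysis below the top edge. Otherwise \<open>P\<close> lies between the lines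
  \<open>y = -1\<close> and \<open>y = 1\<close>, and exchanging the coordinates gives a
  strip.\<close>

lemma wide_case:
  assumes f: "fano_polygon P" and T: "empty_residual_basket P"
    and e: "edat P w 1 p n" and n: "2 \<le> n"
    and heights: "\<And>w r p k. edat P w r p k \<Longrightarrow> r = 1 \<and> k \<le> n"
  shows "\<exists>Q. GL2Z_equivalent P Q \<and> strip_or_triangle Q"
proof -
  obtain a b c d x where d: "a * d - b * c = 1" and e1: "edat (gl a b c d ` P) (0, -1) 1 (x, 1) n"
    by (rule to_top[OF f e])
  define Q where "Q = gl a b c d ` P"
  have d': "\<bar>a * d - b * c\<bar> = 1" using d by simp
  define j where "j = 1 - x"
  define R where "R = gl 1 j 0 1 ` Q"
  have dj: "1 * 1 - j * 0 = 1" "\<bar>1 * 1 - j * 0\<bar> = 1" by auto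
  have fQ: "fano_polygon Q" unfolding Q_def by (rule fano_gl[OF d' f])
  have fR: "fano_polygon R" unfolding R_def by (rule fano_gl[OF dj(2) fQ])
  have TR: "empty_residual_basket R" unfolding R_def Q_def
    by (intro basket_gl fano_gl dj d' f T)
  have gR: "GL2Z_equivalent P R" using GL2Z_equivalentI[OF d'] GL2Z_equivalentI[OF dj(2)] GL2Z_equivalent_trans unfolding Q_def R_def by blast
  have hR: "r = 1 \<and> k \<le> n" if eR: "edat R w r p k" for w r p k
  proof -
    obtain p' where "edat Q (gli 1 0 j 1 w) r p' k" using edat_gl[OF dj(2) fQ] eR unfolding R_def by blast
    then obtain p'' where "edat P (gli a c b d (gli 1 0 j 1 w)) r p'' k" using edat_gl[OF d' f] unfolding Q_def by blast
    then show ?thesis by (rule heights)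
  qed
  have "edat R (0, -1) 1 (gli 1 j 0 1 (x, 1)) n" unfolding R_def
    by (rule edat_gl_pos[OF dj(1)]) (use e1 in \<open>simp add: gli_def Q_def\<close>)
  then have eR: "edat R (0, -1) 1 (1, 1) (n * 1)" by (simp add: gli_def j_def)
  show ?thesis
  proof (cases "\<exists>z\<in>R. snd z \<le> - 2")
    case True
    then obtain z where "z \<in> R" "snd z \<le> - 2" by blast
    then have z: "z \<in> R" "pt (0, 1) \<bullet> z \<le> of_int (- 2)" by (simp_all add: pt_inner)
    obtain y where y: "pt y extreme_point_of R" "coprime (fst y) (snd y)"
      "fst (0 :: int, 1 :: int) * fst y + snd (0 :: int, 1 :: int) * snd y \<le> - 2"
      by (rule extreme_le[OF fR z])
    define q where "q = - snd y"
    have q: "2 \<le> q" using y(3) by (simp add: q_def)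
    have "fst y \<noteq> 0" using y(2) q by (auto simp: q_def)
    moreover have "pt (fst y, - q) \<in> R" using y(1) by (simp add: q_def extreme_point_of_def)
    moreover have "\<forall>w p k. edat R w 1 p k \<longrightarrow> k \<le> n" using hR by blast
    moreover have "r \<le> 1" if eR': "edat R w r p k" for w r p k using hR[OF eR'] by simp
    ultimately have "\<exists>S. GL2Z_equivalent R S \<and> strip_or_triangle S"
      using q n by (intro normalise_top[OF fR TR eR, where p = "fst y" and q = q]) simp_all
    then show ?thesis using GL2Z_equivalent_trans[OF gR] by blast
  next
    case False
    have low: "- 1 \<le> snd z" if z: "z \<in> R" for z
    proof -
      have "of_int (- 1) \<le> pt (0, 1) \<bullet> x" if x: "x extreme_point_of R" for x
      proof -
        have "x \<in> primitive_points" "x \<in> R" using x fanoD(8)[OF fR] by (auto simp: extreme_point_of_def)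
        then obtain y where y: "x = pt y" "pt y \<in> R" by (auto simp: primitive_points_eq)
        then have "- 2 < real_of_int (snd y)" using False by force
        then have "- 1 \<le> snd y" by linarith
        then show ?thesis using y by (simp add: pt_inner)
      qed
      then have "of_int (- 1) \<le> pt (0, 1) \<bullet> z" by (rule fano_hull_ge[OF fR z])
      then show ?thesis by (simp add: pt_inner)
    qed
    have up: "snd z \<le> 1" if "z \<in> R" for z using edat_ge[OF eR that] by (simp add: pt_inner)
    have "\<bar>fst (gl 0 1 1 0 z)\<bar> \<le> 1" if "z \<in> R" for z
      using low[OF that] up[OF that] by (simp add: gl_def abs_le_iff)
    then have "strip_or_triangle (gl 0 1 1 0 ` R)" unfolding strip_or_triangle_def by blast
    moreover have "GL2Z_equivalent R (gl 0 1 1 0 ` R)" by (rule GL2Z_equivalentI) simp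
    ultimately show ?thesis using GL2Z_equivalent_trans[OF gR] by blast
  qed
qed

section \<open>Polygons whose edges all have height and width one\<close>

lemma ray_leaves:
  assumes f: "fano_polygon P" and z: "z \<noteq> 0"
  obtains w r p k where "edat P w r p k" "pt w \<bullet> z < 0"
proof -
  have "\<exists>w r p k. edat P w r p k \<and> pt w \<bullet> z < 0"
  proof (rule ccontr)
    assume no: "\<not> ?thesis"
    obtain B where B: "\<And>z. z \<in> P \<Longrightarrow> norm z \<le> B"
      using compact_imp_bounded[OF fanoD(2)[OF f]] by (auto simp: bounded_iff)
    define c where "c = (\<bar>B\<bar> + 1) / norm z"
    have c: "0 \<le> c" by (simp add: c_def)
    have "c *\<^sub>R z \<in> P"
    proof (rule fano_halfspaces[OF f])
      fix w r p k assume e: "edat P w r p k"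
      then have "0 \<le> pt w \<bullet> z" using no by (meson not_le)
      then have "0 \<le> pt w \<bullet> (c *\<^sub>R z)" using c by simp
      moreover have "0 < r" using e by (simp add: edat_def)
      ultimately show "- of_int r \<le> pt w \<bullet> (c *\<^sub>R z)" by (smt (verit) of_int_0_less_iff)
    qed
    then have "norm (c *\<^sub>R z) \<le> B" by (rule B)
    moreover have "norm (c *\<^sub>R z) = \<bar>B\<bar> + 1" using z by (simp add: c_def)
    ultimately show False by simp
  qed
  then show ?thesis using that by blast
qed

lemma not_extreme_combination:
  fixes x y :: point
  assumes "x \<in> P" "y \<in> P" "x \<noteq> y" "0 < t" "t < 1" "z = (1 - t) *\<^sub>R x + t *\<^sub>R y"
  shows "\<not> z extreme_point_of P"
proof -
  have "z \<in> open_segment x y" unfolding in_segment using assms by blast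
  then show ?thesis using assms(1,2) unfolding extreme_point_of_def by blast
qed

text \<open>The bounded expression is the determinant of \<open>y\<close> and \<open>q\<close>. A
  change of basis that sends \<open>q\<close> to \<open>(0, 1)\<close> turns it into the first
  coordinate.\<close>

lemma strip_of_vertex:
  assumes f: "fano_polygon P" and q: "coprime (fst q) (snd q)"
    and le: "\<And>y. pt y extreme_point_of P \<Longrightarrow> \<bar>fst y * snd q - snd y * fst q\<bar> \<le> 1"
  shows "\<exists>Q. GL2Z_equivalent P Q \<and> (\<forall>z\<in>Q. \<bar>fst z\<bar> \<le> 1)"
proof -
  obtain s t where st: "fst q * s + snd q * t = 1" using coprime_bezout[OF q] .
  have d: "\<bar>snd q * t - (- fst q) * s\<bar> = 1" using st by (simp add: algebra_simps)
  have "\<bar>fst (gl (snd q) (- fst q) s t z)\<bar> \<le> 1" if z: "z \<in> P" for z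
  proof -
    have b: "- 1 \<le> pt (snd q, - fst q) \<bullet> x \<and> - 1 \<le> pt (- snd q, fst q) \<bullet> x" if x: "x extreme_point_of P" for x
    proof -
      have "x \<in> primitive_points" by (rule fanoD(8)[OF f x])
      then obtain y where y: "x = pt y" unfolding primitive_points_eq by blast
      then have "\<bar>fst y * snd q - snd y * fst q\<bar> \<le> 1" using le x by simp
      then have "of_int \<bar>fst y * snd q - snd y * fst q\<bar> \<le> (of_int 1 :: real)" by (simp only: of_int_le_iff)
      then show ?thesis unfolding y by (simp add: pt_inner abs_le_iff algebra_simps)
    qed
    have "- 1 \<le> pt (snd q, - fst q) \<bullet> z" "- 1 \<le> pt (- snd q, fst q) \<bullet> z"
      using fano_hull_ge[OF f z] b by blast+
    then show ?thesis by (simp add: gl_def pt_inner abs_le_iff)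
  qed
  then show ?thesis using GL2Z_equivalentI[OF d, of P] by (intro exI[of _ "gl (snd q) (- fst q) s t ` P"]) auto
qed

text \<open>These are the polygons of the smooth toric del Pezzo surfaces: the cone over every edge
  is generated by a basis of the lattice.\<close>

locale smooth =
  fixes P
  assumes f: "fano_polygon P" and smooth: "\<And>w r p k. edat P w r p k \<Longrightarrow> r = 1 \<and> k = 1"
begin

lemma lattice_edge:
  assumes e: "edat P w r p k" and z: "pt z \<in> P" "fst w * fst z + snd w * snd z = - 1"
  shows "z = p \<or> z = (fst p + snd w, snd p - fst w)" "pt z extreme_point_of P"
proof -
  have rk: "r = 1" "k = 1" using smooth[OF e] by auto
  have "pt w \<bullet> pt z = - of_int r" using z(2) rk by (subst dot_pt) simp
  then have "pt z \<in> minf (pt w) P \<inter> lattice" using edat_minf_iff[OF e] z(1) by simp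
  then obtain j where j: "j \<in> {0..k}" "pt z = pt (fst p + j * snd w, snd p - j * fst w)"
    unfolding edat_lattice[OF e] by blast
  then have "j = 0 \<or> j = 1" using rk by auto
  then show "z = p \<or> z = (fst p + snd w, snd p - fst w)" using j(2) by auto
  then show "pt z extreme_point_of P" using edat_ends_extreme[OF f e] rk by auto
qed

text \<open>Some edge normal is negative at a nonzero lattice point, hence equal to -1 there as all
  heights are one. So the point lies on that edge, and the only lattice points of an edge of width
  one are its ends.\<close>

lemma lattice_extreme:
  assumes z: "pt z \<in> P" "z \<noteq> (0, 0)"
  shows "pt z extreme_point_of P"
proof -
  have "pt z \<noteq> 0" using z(2) by (cases z) (auto simp: pt_def prod_eq_iff)
  then obtain w r p k where e: "edat P w r p k" "pt w \<bullet> pt z < 0" by (rule ray_leaves[OF f])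
  have r: "r = 1" using smooth[OF e(1)] by simp
  have "real_of_int (fst w * fst z + snd w * snd z) < 0" using e(2) by (simp add: pt_inner_pt)
  then have "fst w * fst z + snd w * snd z < 0" by linarith
  moreover have "- r \<le> fst w * fst z + snd w * snd z" by (rule edat_ge_pt[OF e(1) z(1)])
  ultimately have "fst w * fst z + snd w * snd z = - 1" using r by simp
  then show ?thesis using lattice_edge(2)[OF e(1) z(1)] by blast
qed

lemma lattice_coprime:
  assumes "pt z \<in> P" "z \<noteq> (0, 0)"
  shows "coprime (fst z) (snd z)"
  using fanoD(8)[OF f lattice_extreme[OF assms]] by (auto simp: primitive_points_eq)

text \<open>Otherwise contracting \<open>z\<close> by the factor \<open>1 / |fst z|\<close> towards
  a suitable point \<open>(0, \<eta>)\<close> between the two given points yields a nonzero lattice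
  point of \<open>P\<close> that is not a vertex.\<close>

lemma antipodal_vertical:
  assumes "pt (0, 1) \<in> P" "pt (0, -1) \<in> P" and z: "pt z \<in> P"
  shows "\<bar>fst z\<bar> \<le> 1"
proof (rule ccontr)
  assume "\<not> \<bar>fst z\<bar> \<le> 1"
  then have d2: "2 \<le> \<bar>fst z\<bar>" by simp
  define d where "d = \<bar>fst z\<bar>"
  define s where "s = sgn (fst z)"
  have xs: "fst z = s * d" by (simp add: d_def s_def sgn_mult_abs)
  have s0: "s \<noteq> 0" using d2 by (auto simp: s_def sgn_if)
  \<comment> \<open>With this rounding \<open>d * j\<close> is the least multiple of
    \<open>d\<close> that is at least \<open>snd z\<close>, so \<open>d * j - snd z\<close> is at
    most \<open>d - 1\<close> and \<open>\<eta>\<close> lies between 0 and 1.\<close>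
  define j where "j = (snd z + d - 1) div d"
  have dm: "d * j + (snd z + d - 1) mod d = snd z + d - 1" by (simp add: j_def)
  have "0 \<le> (snd z + d - 1) mod d" "(snd z + d - 1) mod d < d" using d2 by (auto simp: d_def)
  then have j: "snd z \<le> d * j" "d * j \<le> snd z + d - 1" using dm by linarith+
  define \<eta> where "\<eta> = (of_int (d * j - snd z) :: real) / of_int (d - 1)"
  have "of_int 0 \<le> (of_int (d * j - snd z) :: real)" "of_int (d * j - snd z) \<le> (of_int (d - 1) :: real)"
    using j by (simp_all only: of_int_le_iff)
  moreover have "0 < real_of_int (d - 1)" using d2 by (simp add: d_def)
  ultimately have \<eta>: "0 \<le> \<eta>" "\<eta> \<le> 1" unfolding \<eta>_def by (simp_all del: of_int_diff of_int_mult)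
  have "(0, \<eta>) = ((1 + \<eta>) / 2) *\<^sub>R pt (0, 1) + ((1 - \<eta>) / 2) *\<^sub>R pt (0, -1)"
    by (simp add: pt_def field_simps)
  moreover have "\<dots> \<in> P" using fanoD(3)[OF f] assms \<eta> by (intro convexD) (auto simp: field_simps)
  ultimately have yP: "(0, \<eta>) \<in> P" by simp
  define t where "t = 1 / (of_int d :: real)"
  have t: "0 < t" "t < 1" using d2 by (auto simp: t_def d_def)
  have dr: "of_int d \<noteq> (0 :: real)" "of_int d - 1 \<noteq> (0 :: real)" using d2 by (auto simp: d_def)
  have e\<eta>: "(1 - t) * \<eta> = (of_int d * of_int j - of_int (snd z)) / of_int d"
  proof -
    have "1 - t = (of_int d - 1) / of_int d" using dr by (simp add: t_def field_simps)
    then show ?thesis using dr by (simp add: \<eta>_def)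
  qed
  have comb: "pt (s, j) = (1 - t) *\<^sub>R (0, \<eta>) + t *\<^sub>R pt z"
  proof -
    have "of_int j = (of_int d * of_int j - of_int (snd z)) / of_int d + t * of_int (snd z)"
      using dr by (simp add: t_def field_simps)
    moreover have "of_int s = t * of_int (fst z)" using dr by (simp add: t_def xs)
    ultimately show ?thesis by (simp add: prod_eq_iff e\<eta>)
  qed
  have ne: "(0, \<eta>) \<noteq> pt z" using d2 by (auto simp: prod_eq_iff)
  have "pt (s, j) \<in> P" unfolding comb using fanoD(3)[OF f] yP z t by (intro convexD) auto
  then have "pt (s, j) extreme_point_of P" by (rule lattice_extreme) (use s0 in simp)
  then show False using not_extreme_combination[OF yP z ne t comb] by contradiction
qed

text \<open>The midpoint would be a nonzero lattice point of \<open>P\<close>, hence a vertex, but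
  the midpoint of two distinct points of \<open>P\<close> is not extreme.\<close>

lemma no_congruent_pair:
  assumes xy: "pt x \<in> P" "pt y \<in> P" "x \<noteq> y" and n: "fst x \<noteq> - fst y \<or> snd x \<noteq> - snd y"
    and e: "even (fst x - fst y)" "even (snd x - snd y)"
  shows False
proof -
  obtain a b where ab: "fst x - fst y = 2 * a" "snd x - snd y = 2 * b" using e by (elim evenE)
  define m where "m = (fst y + a, snd y + b)"
  have comb: "pt m = (1 - 1 / 2) *\<^sub>R pt x + (1 / 2) *\<^sub>R pt y"
  proof -
    have "real_of_int (fst x) = of_int (fst y + 2 * a)" "real_of_int (snd x) = of_int (snd y + 2 * b)"
      using ab by (simp_all add: algebra_simps)
    then show ?thesis by (simp add: m_def prod_eq_iff add_divide_distrib)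
  qed
  have "m \<noteq> (0, 0)" using ab n by (auto simp: m_def)
  moreover have "pt m \<in> P" unfolding comb using fanoD(3)[OF f] xy by (intro convexD) auto
  ultimately have "pt m extreme_point_of P" using lattice_extreme by blast
  then show False using not_extreme_combination[OF xy(1,2) _ _ _ comb] xy(3) by simp
qed

end

text \<open>An antipodal pair of lattice points gives a strip at once. Without one, distinct nonzero
  lattice points of \<open>P\<close> are incongruent modulo 2, and primitivity leaves only three
  classes. So the ends of two adjacent edges are all the vertices, and the outer two each form a
  basis with the common one.\<close>

lemma smooth_case:
  assumes f: "fano_polygon P" and smooth: "\<And>w r p k. edat P w r p k \<Longrightarrow> r = 1 \<and> k = 1"
  shows "\<exists>Q. GL2Z_equivalent P Q \<and> (\<forall>z\<in>Q. \<bar>fst z\<bar> \<le> 1)"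
proof (cases "\<exists>q. q \<noteq> (0, 0) \<and> pt q \<in> P \<and> pt (- fst q, - snd q) \<in> P")
  case True
  then obtain q where q: "q \<noteq> (0, 0)" "pt q \<in> P" "pt (- fst q, - snd q) \<in> P" by blast
  interpret sm: smooth P using f smooth by unfold_locales auto
  have cq: "coprime (fst q) (snd q)" by (rule sm.lattice_coprime[OF q(2,1)])
  obtain s t where st: "fst q * s + snd q * t = 1" using coprime_bezout[OF cq] .
  have d: "\<bar>snd q * t - (- fst q) * s\<bar> = 1" using st by (simp add: algebra_simps)
  define Q where "Q = gl (snd q) (- fst q) s t ` P"
  have fQ: "fano_polygon Q" unfolding Q_def by (rule fano_gl[OF d f])
  interpret smQ: smooth Q
  proof
    show "fano_polygon Q" by (rule fQ)
    fix w r p k assume "edat Q w r p k"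
    then obtain p' where "edat P (gli (snd q) s (- fst q) t w) r p' k" unfolding Q_def by (rule edat_gl[OF d f])
    then show "r = 1 \<and> k = 1" by (rule smooth)
  qed
  have img: "pt (gli (snd q) (- fst q) s t x) \<in> Q" if "pt x \<in> P" for x
    unfolding Q_def gl_pt[symmetric] using that by (rule imageI)
  have "gli (snd q) (- fst q) s t q = (0, 1)" using st by (simp add: gli_def mult.commute)
  then have 1: "pt (0, 1) \<in> Q" using img[OF q(2)] by simp
  have "gli (snd q) (- fst q) s t (- fst q, - snd q) = (0, - (fst q * s + snd q * t))"
    by (simp add: gli_def algebra_simps)
  then have 2: "pt (0, -1) \<in> Q" using img[OF q(3)] st by simp
  have "\<bar>fst y * snd (0 :: int, 1 :: int) - snd y * fst (0 :: int, 1 :: int)\<bar> \<le> 1" if "pt y extreme_point_of Q" for y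
    using smQ.antipodal_vertical[OF 1 2, of y] that by (simp add: extreme_point_of_def)
  then obtain R where "GL2Z_equivalent Q R" "\<forall>z\<in>R. \<bar>fst z\<bar> \<le> 1"
    using strip_of_vertex[OF fQ, of "(0, 1)"] by auto
  then show ?thesis using GL2Z_equivalent_trans[OF GL2Z_equivalentI[OF d, of P, folded Q_def]] by blast
next
  case False
  interpret sm: smooth P using f smooth by unfold_locales auto
  obtain w r p k where e: "edat P w r p k" by (rule ray_leaves[OF f, of "(1, 0)"]) (auto simp: zero_prod_def)
  have rk: "r = 1" "k = 1" using smooth[OF e] by auto
  define q where "q = (fst p + snd w, snd p - fst w)"
  have ext: "pt p extreme_point_of P" "pt q extreme_point_of P"
    using edat_ends_extreme[OF f e] rk by (simp_all add: q_def)
  have pq: "pt p \<in> P" "pt q \<in> P" using ext by (auto simp: extreme_point_of_def)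
  have wp: "fst w * fst p + snd w * snd p = - 1" using edat_dot[OF e] rk by simp
  then have wq: "fst w * fst q + snd w * snd q = - 1" by (simp add: q_def algebra_simps)
  have p0: "p \<noteq> (0, 0)" and q0: "q \<noteq> (0, 0)" using wp wq by auto
  have cq: "coprime (fst q) (snd q)" by (rule sm.lattice_coprime[OF pq(2) q0])
  have dpq: "fst p * snd q - snd p * fst q = 1" using wp by (simp add: q_def algebra_simps)
  have "pt q + \<epsilon> *\<^sub>R pt (snd w, - fst w) \<notin> P" if \<epsilon>: "0 < \<epsilon>" for \<epsilon>
  proof
    assume "pt q + \<epsilon> *\<^sub>R pt (snd w, - fst w) \<in> P"
    moreover have "pt w \<bullet> (pt q + \<epsilon> *\<^sub>R pt (snd w, - fst w)) = - of_int r"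
      using wq rk unfolding inner_add_right by (subst (asm) dot_pt[symmetric]) (simp add: pt_inner)
    ultimately obtain t where t: "t \<le> of_int k" "pt q + \<epsilon> *\<^sub>R pt (snd w, - fst w) = pt p + t *\<^sub>R pt (snd w, - fst w)"
      using edat_param[OF e] by blast
    have "pt q = pt p + 1 *\<^sub>R pt (snd w, - fst w)" by (simp add: q_def pt_def)
    then have "(1 + \<epsilon> - t) *\<^sub>R pt (snd w, - fst w) = 0" using t(2) by (simp add: algebra_simps)
    moreover have "pt (snd w, - fst w) \<noteq> 0" using e by (auto simp: edat_def pt_def prod_eq_iff)
    ultimately show False using t(1) rk \<epsilon> by simp
  qed
  then obtain w2 r2 p2 k2 where e2: "edat P w2 r2 p2 k2" "pt w2 \<bullet> pt q = - of_int r2" "pt w2 \<bullet> pt (snd w, - fst w) < 0"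
    using exists_tight_edge[OF f pq(2)] by blast
  have rk2: "r2 = 1" "k2 = 1" using smooth[OF e2(1)] by auto
  have w2q: "fst w2 * fst q + snd w2 * snd q = - 1" using e2(2) unfolding dot_pt rk2 .
  define p3 where "p3 = (fst p2 + snd w2, snd p2 - fst w2)"
  have q23: "q = p2 \<or> q = p3" using sm.lattice_edge(1)[OF e2(1) pq(2) w2q] by (simp add: p3_def)
  have ext2: "pt p2 extreme_point_of P" "pt p3 extreme_point_of P"
    using edat_ends_extreme[OF f e2(1)] rk2 by (simp_all add: p3_def)
  have w2p2: "fst w2 * fst p2 + snd w2 * snd p2 = - 1" using edat_dot[OF e2(1)] rk2 by simp
  have d23: "fst p2 * snd p3 - snd p2 * fst p3 = 1" using w2p2 by (simp add: p3_def algebra_simps)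
  have w2p3: "fst w2 * fst p3 + snd w2 * snd p3 = - 1" using w2p2 by (simp add: p3_def algebra_simps)
  define x where "x = (if q = p2 then p3 else p2)"
  have x: "pt x extreme_point_of P" "x \<noteq> q" "\<bar>fst x * snd q - snd x * fst q\<bar> = 1"
    "fst w2 * fst x + snd w2 * snd x = - 1"
    using q23 ext2 d23 w2p2 w2p3 by (auto simp: x_def algebra_simps)
  have xP: "pt x \<in> P" "x \<noteq> (0, 0)" using x by (auto simp: extreme_point_of_def)
  have xp: "x \<noteq> p"
  proof
    assume "x = p"
    then have "fst w2 * fst p + snd w2 * snd p = fst w2 * fst q + snd w2 * snd q" using x(4) w2q by simp
    then have "fst w2 * snd w - snd w2 * fst w = 0" by (simp add: q_def algebra_simps)
    then have "pt w2 \<bullet> pt (snd w, - fst w) = 0" using dot_pt[of w2 "(snd w, - fst w)" 0] by simp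
    then show False using e2(3) by simp
  qed
  have cong: "y = z" if "pt y \<in> P" "pt z \<in> P" "z \<noteq> (0, 0)" "even (fst y - fst z)" "even (snd y - snd z)" for y z
  proof (rule ccontr)
    assume ne: "y \<noteq> z"
    have "fst y \<noteq> - fst z \<or> snd y \<noteq> - snd z"
    proof (rule ccontr)
      assume "\<not> ?thesis"
      then have "y = (- fst z, - snd z)" by (simp add: prod_eq_iff)
      then show False using False that by blast
    qed
    then show False using sm.no_congruent_pair[OF that(1,2) ne _ that(4,5)] by blast
  qed
  have prim: "odd (fst y) \<or> odd (snd y)" if "pt y \<in> P" "y \<noteq> (0, 0)" for y
    using sm.lattice_coprime[OF that] by (metis coprime_common_divisor odd_one)
  have third: "y = p \<or> y = q \<or> y = x" if y: "pt y \<in> P" "y \<noteq> (0, 0)" for y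
  proof (rule ccontr)
    assume n: "\<not> ?thesis"
    have "odd (fst p * snd q - snd p * fst q)" using dpq by simp
    moreover have "\<not> (even (fst y - fst z) \<and> even (snd y - snd z))" if "z \<in> {p, q, x}" for z
      using cong[OF y(1), of z] n that pq xP p0 q0 by auto
    moreover have "\<not> (even (fst x - fst z) \<and> even (snd x - snd z))" if "z \<in> {p, q}" for z
      using cong[OF xP(1), of z] xp x(2) that pq p0 q0 by auto
    ultimately show False using prim[OF y] prim[OF xP] prim[OF pq(1) p0] prim[OF pq(2) q0]
      by simp blast
  qed
  have "\<bar>fst y * snd q - snd y * fst q\<bar> \<le> 1" if y: "pt y extreme_point_of P" for y
  proof -
    have "pt y \<in> P" "coprime (fst y) (snd y)"
      using y fanoD(8)[OF f y] by (auto simp: extreme_point_of_def primitive_points_eq)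
    moreover from this have "y \<noteq> (0, 0)" by auto
    ultimately have "y = p \<or> y = q \<or> y = x" using third by blast
    then show ?thesis using dpq x(3) by (auto simp: mult.commute)
  qed
  then show ?thesis by (rule strip_of_vertex[OF f cq])
qed

lemma exists_max:
  fixes S :: "int set"
  assumes "finite S" "S \<noteq> {}"
  obtains m where "m \<in> S" "\<And>x. x \<in> S \<Longrightarrow> x \<le> m"
  using assms Max_in Max_ge by metis

text \<open>The cases are governed by the maximal height \<open>h\<close> and, if
  \<open>h = 1\<close>, by the maximal width \<open>n\<close>. Both maxima exist because there are
  finitely many edges and each normal determines its height and width.\<close>

theorem unbeaten_normal_form:
  assumes f: "fano_polygon P" and T: "empty_residual_basket P" and ub: "unbeaten P"
  shows "\<exists>Q. GL2Z_equivalent P Q \<and> strip_or_triangle Q"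
proof -
  define W where "W = {w. \<exists>r p k. edat P w r p k}"
  have finW: "finite W" unfolding W_def by (rule finite_normals[OF f])
  obtain w0 r0 p0 k0 where e0: "edat P w0 r0 p0 k0" by (rule ray_leaves[OF f, of "(1, 0)"]) (auto simp: zero_prod_def)
  define Rs where "Rs = {r. \<exists>w p k. edat P w r p k}"
  have "Rs \<subseteq> (\<lambda>w. SOME r. \<exists>p k. edat P w r p k) ` W"
  proof
    fix r assume "r \<in> Rs"
    then obtain w p k where e: "edat P w r p k" unfolding Rs_def by blast
    then have "\<exists>r p k. edat P w r p k" by blast
    then have "\<exists>p k. edat P w (SOME r. \<exists>p k. edat P w r p k) p k" by (rule someI_ex)
    then have "r = (SOME r. \<exists>p k. edat P w r p k)" using edat_unique(1)[OF f e] by blast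
    moreover have "w \<in> W" unfolding W_def using e by blast
    ultimately show "r \<in> (\<lambda>w. SOME r. \<exists>p k. edat P w r p k) ` W" by (rule image_eqI)
  qed
  then have "finite Rs" using finW finite_subset by blast
  moreover have "Rs \<noteq> {}" unfolding Rs_def using e0 by blast
  ultimately obtain h where h: "h \<in> Rs" "\<And>r. r \<in> Rs \<Longrightarrow> r \<le> h" using exists_max[of Rs] by blast
  obtain w p k where e: "edat P w h p k" using h(1) unfolding Rs_def by blast
  have hts: "r \<le> h" if "edat P w r p k" for w r p k using h(2) that unfolding Rs_def by blast
  show ?thesis
  proof (cases "2 \<le> h")
    case True
    then show ?thesis by (rule tall_case[OF f T ub e _ hts])
  next
    case False
    have r1: "r = 1" if "edat P w r p k" for w r p k
    proof -
      have "0 < r" using that by (simp add: edat_def)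
      then show ?thesis using hts[OF that] False by simp
    qed
    define Ks where "Ks = {k. \<exists>w r p. edat P w r p k}"
    have "Ks \<subseteq> (\<lambda>w. edge_width (minf (pt w) P)) ` W"
    proof
      fix k assume "k \<in> Ks"
      then obtain w r p where e: "edat P w r p k" unfolding Ks_def by blast
      then have "k = edge_width (minf (pt w) P)" using edat_width by simp
      moreover have "w \<in> W" unfolding W_def using e by blast
      ultimately show "k \<in> (\<lambda>w. edge_width (minf (pt w) P)) ` W" by (rule image_eqI)
    qed
    then have "finite Ks" using finW finite_subset by blast
    moreover have "Ks \<noteq> {}" unfolding Ks_def using e0 by blast
    ultimately obtain n where n: "n \<in> Ks" "\<And>k. k \<in> Ks \<Longrightarrow> k \<le> n" using exists_max[of Ks] by blast
    have kn: "r = 1 \<and> k \<le> n" if "edat P w r p k" for w r p k using n(2) r1[OF that] that unfolding Ks_def by blast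
    obtain w r p where e: "edat P w r p n" using n(1) unfolding Ks_def by blast
    then have e1: "edat P w 1 p n" using r1[OF e] by simp
    show ?thesis
    proof (cases "2 \<le> n")
      case True
      show ?thesis by (rule wide_case[OF f T e1 True kn])
    next
      case False
      have "r = 1 \<and> k = 1" if "edat P w r p k" for w r p k
      proof -
        have "0 < k" using that by (simp add: edat_def)
        then show ?thesis using kn[OF that] False by simp
      qed
      then show ?thesis using smooth_case[OF f] unfolding strip_or_triangle_def by blast
    qed
  qed
qed

section \<open>Descent and polygons in a strip\<close>

abbreviation mut_equiv :: "point set \<Rightarrow> point set \<Rightarrow> bool" where
  "mut_equiv \<equiv> equivclp mutation_step"

definition tpolygon :: "point set \<Rightarrow> bool" where
  "tpolygon P \<longleftrightarrow> fano_polygon P \<and> empty_residual_basket P"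

lemma mut_equiv_trans: "mut_equiv P Q \<Longrightarrow> mut_equiv Q R \<Longrightarrow> mut_equiv P R"
  by (rule equivclp_trans)

lemma mut_equiv_step: "mutation_step P Q \<Longrightarrow> mut_equiv P Q"
  by (rule r_into_equivclp)

lemma GL2Z_equivalent_mut_equiv:
  assumes "GL2Z_equivalent P Q" "tpolygon P"
  shows "mut_equiv P Q" "tpolygon Q"
proof -
  obtain a b c d where d: "\<bar>a * d - b * c\<bar> = 1" and Q: "Q = gl a b c d ` P"
    using assms(1) unfolding GL2Z_gl by blast
  have f: "fano_polygon P" "empty_residual_basket P" using assms(2) by (auto simp: tpolygon_def)
  have "GL2Z_equivalent P Q" unfolding GL2Z_gl using d Q by blast
  then show "mut_equiv P Q" using f(1) fano_gl[OF d f(1)] Q by (intro mut_equiv_step) (simp add: mutation_step_def)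
  show "tpolygon Q" using fano_gl[OF d f(1)] basket_gl[OF d f] Q by (simp add: tpolygon_def)
qed

lemma tpolygon_edge_mutation:
  assumes T: "tpolygon P" and e: "edat P w r p k"
  shows "edge_mutation P w r p k" "tpolygon (mutc w (snd w, - fst w) P)" "mut_equiv P (mutc w (snd w, - fst w) P)"
proof -
  have f: "fano_polygon P" "empty_residual_basket P" using T by (auto simp: tpolygon_def)
  have "r \<le> k" using edat_T[OF f e] e by (intro zdvd_imp_le) (auto simp: edat_def)
  then show em: "edge_mutation P w r p k" using f e by unfold_locales auto
  have bas: "empty_residual_basket P" by (rule f(2))
  interpret edge_mutation P w r p k by (rule em)
  show "tpolygon (mutc w (snd w, - fst w) P)" using fano_mutc basket_mutc[OF bas] by (simp add: tpolygon_def)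
  show "mut_equiv P (mutc w (snd w, - fst w) P)" by (rule mut_equiv_step[OF step])
qed

lemma descent:
  assumes "tpolygon P"
  shows "\<exists>Q. tpolygon Q \<and> mut_equiv P Q \<and> unbeaten Q"
  using assms
proof (induction "card (P \<inter> lattice)" arbitrary: P rule: less_induct)
  case less
  show ?case
  proof (cases "unbeaten P")
    case True
    then show ?thesis using less.prems by (intro exI[of _ P]) simp
  next
    case False
    then obtain w r p k where e: "edat P w r p k" and top: "\<And>z. z \<in> P \<Longrightarrow> pt w \<bullet> z < of_int r"
      unfolding unbeaten_def by (meson not_le)
    define Q where "Q = mutc w (snd w, - fst w) P"
    interpret edge_mutation P w r p k by (rule tpolygon_edge_mutation(1)[OF less.prems e])
    have "card (Q \<inter> lattice) < card (P \<inter> lattice)" unfolding Q_def by (rule card_mutc[OF top])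
    moreover have "tpolygon Q" "mut_equiv P Q"
      using tpolygon_edge_mutation(2,3)[OF less.prems e] by (simp_all add: Q_def)
    ultimately show ?thesis using less.hyps mut_equiv_trans by blast
  qed
qed

section \<open>Polygons in a strip of width two\<close>

definition left_vertex :: "point set \<Rightarrow> bool" where
  "left_vertex P \<longleftrightarrow> (\<forall>z\<in>P. \<bar>fst z\<bar> \<le> 1) \<and> (\<forall>r p k. \<not> edat P (1, 0) r p k)"

text \<open>An edge on the line \<open>x = -1\<close> has height one, so a mutation removes one of
  its unit segments. The strip survives because the normals of its two sides are orthogonal to
  \<open>v\<close>. The recursion ends when only a vertex is left on that line.\<close>

lemma clear_left_edge:
  assumes "tpolygon P" "\<And>z. z \<in> P \<Longrightarrow> \<bar>fst z\<bar> \<le> 1"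
  shows "\<exists>Q. tpolygon Q \<and> mut_equiv P Q \<and> left_vertex Q"
  using assms
proof (induction "card {z \<in> P \<inter> lattice. pt (1, 0) \<bullet> z = - of_int 1}" arbitrary: P rule: less_induct)
  case less
  show ?case
  proof (cases "\<exists>r p k. edat P (1, 0) r p k")
    case False
    then have "left_vertex P" using less.prems(2) unfolding left_vertex_def by blast
    then show ?thesis using less.prems(1) by (intro exI[of _ P]) simp
  next
    case True
    then obtain r p k where e: "edat P (1, 0) r p k" by blast
    have "pt p \<in> P" "fst p = - r" "0 < r"
      using edat_start[OF e] edat_dot[OF e] e by (auto simp: minf_iff edat_def)
    then have r1: "r = 1" using less.prems(2)[of "pt p"] by simp
    define Q where "Q = mutc (1, 0) (snd (1 :: int, 0 :: int), - fst (1 :: int, 0 :: int)) P"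
    interpret edge_mutation P "(1, 0)" r p k by (rule tpolygon_edge_mutation(1)[OF less.prems(1) e])
    have TQ: "tpolygon Q" "mut_equiv P Q"
      using tpolygon_edge_mutation(2,3)[OF less.prems(1) e] by (simp_all add: Q_def)
    have strip: "\<bar>fst z\<bar> \<le> 1" if z: "z \<in> Q" for z
    proof -
      have "- 1 \<le> (- pt (1, 0)) \<bullet> z"
        by (rule mrel_dual1[OF mrel_mutc _ _ z[unfolded Q_def]]) (use less.prems(2) in \<open>auto simp: pt_inner abs_le_iff\<close>)
      moreover have "- 1 \<le> pt (1, 0) \<bullet> z"
        by (rule mrel_dual1[OF mrel_mutc _ _ z[unfolded Q_def]]) (use less.prems(2) in \<open>auto simp: pt_inner abs_le_iff\<close>)
      ultimately show ?thesis by (simp add: pt_inner abs_le_iff)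
    qed
    have inj: "inj (\<lambda>j. pt (fst p + j * snd (1 :: int, 0 :: int), snd p - j * fst (1 :: int, 0 :: int)))"
      by (auto simp: inj_def)
    have k0: "0 < k" using e by (simp add: edat_def)
    have "{z \<in> Q \<inter> lattice. pt (1, 0) \<bullet> z = - of_int 1} =
        (\<lambda>j. pt (fst p + j * snd (1 :: int, 0 :: int), snd p - j * fst (1 :: int, 0 :: int))) ` {0..k - 1}"
      using bottom_lattice unfolding Q_def r1 .
    then have cQ: "card {z \<in> Q \<inter> lattice. pt (1, 0) \<bullet> z = - of_int 1} = nat k"
      using k0 by (simp only: card_image[OF inj_on_subset[OF inj subset_UNIV]]) simp
    have "{z \<in> P \<inter> lattice. pt (1, 0) \<bullet> z = - of_int 1} = minf (pt (1, 0)) P \<inter> lattice"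
      using edat_minf_iff[OF e] r1 by auto
    then have "card {z \<in> P \<inter> lattice. pt (1, 0) \<bullet> z = - of_int 1} = nat (k + 1)"
      using k0 unfolding edat_lattice[OF e] by (simp only: card_image[OF inj_on_subset[OF inj subset_UNIV]]) simp
    then have "card {z \<in> Q \<inter> lattice. pt (1, 0) \<bullet> z = - of_int 1} < card {z \<in> P \<inter> lattice. pt (1, 0) \<bullet> z = - of_int 1}"
      using cQ k0 by simp
    then show ?thesis using less.hyps[OF _ TQ(1) strip] mut_equiv_trans[OF TQ(2)] by blast
  qed
qed

lemma strip_extreme:
  assumes f: "fano_polygon P" and s: "\<And>z. z \<in> P \<Longrightarrow> \<bar>fst z\<bar> \<le> 1" and x: "x extreme_point_of P"
  obtains q where "x = pt q" "pt q \<in> P" "coprime (fst q) (snd q)" "fst q = -1 \<or> fst q = 0 \<or> fst q = 1"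
proof -
  have "x \<in> primitive_points" by (rule fanoD(8)[OF f x])
  then obtain q where q: "x = pt q" "coprime (fst q) (snd q)" unfolding primitive_points_eq by blast
  have qP: "pt q \<in> P" using x q by (simp add: extreme_point_of_def)
  have "\<bar>real_of_int (fst q)\<bar> \<le> 1" using s[OF qP] by simp
  then have "fst q = -1 \<or> fst q = 0 \<or> fst q = 1" by linarith
  then show ?thesis using that q qP by blast
qed

lemma extreme_negative:
  assumes f: "fano_polygon P" and u: "pt u \<noteq> 0"
  obtains x where "x extreme_point_of P" "pt u \<bullet> x < 0"
proof -
  obtain z where z: "z \<in> P" "pt u \<bullet> z < 0" using fano_pos[OF f u] by blast
  have "\<exists>x. x extreme_point_of P \<and> pt u \<bullet> x < 0"
  proof (rule ccontr)
    assume "\<not> ?thesis"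
    then have "0 \<le> pt u \<bullet> x" if "x extreme_point_of P" for x using that by (meson not_le)
    then have "0 \<le> pt u \<bullet> z" by (rule fano_hull_ge[OF f z(1)])
    then show False using z by simp
  qed
  then show ?thesis using that by blast
qed

locale strip =
  fixes P :: "point set"
  assumes T: "tpolygon P" and lv: "left_vertex P" and left: "pt (-1, 0) \<in> P"
begin

lemma f: "fano_polygon P" and bas: "empty_residual_basket P"
  using T by (auto simp: tpolygon_def)

lemma width: "z \<in> P \<Longrightarrow> \<bar>fst z\<bar> \<le> 1"
  using lv by (simp add: left_vertex_def)

lemma left_unique:
  assumes z: "z \<in> P" "fst z = -1"
  shows "z = pt (-1, 0)"
proof (rule ccontr)
  assume ne: "z \<noteq> pt (-1, 0)"
  have "x \<in> minf (pt (1, 0)) P" if "x \<in> P" "fst x = -1" for x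
    using that width by (force simp: minf_iff pt_inner abs_le_iff)
  then have "z \<in> minf (pt (1, 0)) P" "pt (-1, 0) \<in> minf (pt (1, 0)) P" using z left by auto
  moreover have "coprime (fst (1 :: int, 0 :: int)) (snd (1 :: int, 0 :: int))" by simp
  ultimately obtain r p k where "edat P (1, 0) r p k" using edat_of_minf[OF f _ _ _ ne, of "(1, 0)"] by blast
  then show False using lv unfolding left_vertex_def by blast
qed

definition column :: "int set" where "column = {y. pt (1, y) \<in> P}"

lemma finite_column: "finite column"
proof -
  have "(\<lambda>y. pt (1, y)) ` column \<subseteq> P \<inter> lattice" by (auto simp: column_def)
  then have "finite ((\<lambda>y. pt (1, y)) ` column)"
    using finite_lattice_bounded[OF compact_imp_bounded[OF fanoD(2)[OF f]]] finite_subset by blast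
  then show ?thesis by (rule finite_imageD) (auto simp: inj_on_def)
qed

lemma extreme_cases:
  assumes x: "x extreme_point_of P"
  shows "x = pt (-1, 0) \<or> x = pt (0, 1) \<or> x = pt (0, -1) \<or> (\<exists>y\<in>column. x = pt (1, y))"
proof -
  obtain q where q: "x = pt q" "pt q \<in> P" "coprime (fst q) (snd q)" "fst q = -1 \<or> fst q = 0 \<or> fst q = 1"
    by (rule strip_extreme[OF f width x])
  from q(4) show ?thesis
  proof (elim disjE)
    assume "fst q = -1"
    then show ?thesis using left_unique[OF q(2)] q(1) by simp
  next
    assume 0: "fst q = 0"
    then have "\<bar>snd q\<bar> = 1" using q(3) by simp
    then have "snd q = 1 \<or> snd q = -1" by linarith
    then have "q = (0, 1) \<or> q = (0, -1)" using 0 by (simp add: prod_eq_iff)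
    then show ?thesis using q(1) by blast
  next
    assume "fst q = 1"
    then have "q = (1, snd q)" by (simp add: prod_eq_iff)
    then have "snd q \<in> column" "x = pt (1, snd q)" using q(1,2) by (simp_all add: column_def)
    then show ?thesis by blast
  qed
qed

lemma column_nonempty: "column \<noteq> {}"
proof -
  have "pt (-1, 0) \<noteq> 0" by (simp add: pt_def zero_prod_def)
  then obtain x where x: "x extreme_point_of P" "pt (-1, 0) \<bullet> x < 0" by (rule extreme_negative[OF f])
  show ?thesis using extreme_cases[OF x(1)] x(2) by (auto simp: pt_inner)
qed

definition hi :: int where "hi = Max column"
definition lo :: int where "lo = Min column"

lemma hi_in: "pt (1, hi) \<in> P" and lo_in: "pt (1, lo) \<in> P"
  using Max_in[OF finite_column column_nonempty] Min_in[OF finite_column column_nonempty]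
  by (simp_all add: hi_def lo_def column_def)

lemma column_bounds: "y \<in> column \<Longrightarrow> lo \<le> y \<and> y \<le> hi"
  using finite_column by (simp add: hi_def lo_def)

lemma lo_le_hi: "lo \<le> hi"
  using column_bounds[of hi] hi_in by (simp add: column_def)

lemma ge_on_extremes:
  assumes "c \<le> pt u \<bullet> pt (-1, 0)" "pt (0, 1) \<in> P \<Longrightarrow> c \<le> pt u \<bullet> pt (0, 1)"
    "pt (0, -1) \<in> P \<Longrightarrow> c \<le> pt u \<bullet> pt (0, -1)" "\<And>y. lo \<le> y \<Longrightarrow> y \<le> hi \<Longrightarrow> c \<le> pt u \<bullet> pt (1, y)" "z \<in> P"
  shows "c \<le> pt u \<bullet> z"
proof (rule fano_hull_ge[OF f assms(5)])
  fix x assume x: "x extreme_point_of P"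
  then have xP: "x \<in> P" by (simp add: extreme_point_of_def)
  from extreme_cases[OF x] show "c \<le> pt u \<bullet> x"
    using assms(1-4) xP column_bounds by auto
qed

text \<open>The segment from \<open>(-1, 0)\<close> to \<open>(1, hi)\<close> lies on the upper
  side; the assumption \<open>up\<close> keeps \<open>(0, 1)\<close> from lying above it. For odd
  \<open>hi\<close> this side has height \<open>hi\<close> and width 1, for
  \<open>hi = 2 * m\<close> it has height \<open>m\<close> and width at most 2, so the T-cone
  condition leaves 1, 2 and 4.\<close>

lemma top_edge:
  assumes h: "1 \<le> hi" and up: "pt (0, 1) \<in> P \<Longrightarrow> 2 \<le> hi"
  shows "hi = 1 \<or> hi = 2 \<or> hi = 4"
proof (cases "even hi")
  case False
  define w where "w = (hi, -2 :: int)"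
  have c: "coprime (fst w) (snd w)" using False by (simp add: w_def coprime_right_2_iff_odd)
  have ge: "of_int (- hi) \<le> pt w \<bullet> z" if z: "z \<in> P" for z
    by (rule ge_on_extremes[OF _ _ _ _ z]) (use h up in \<open>auto simp: pt_inner w_def\<close>)
  have "pt (-1, 0) \<in> minf (pt w) P" "pt (1, hi) \<in> minf (pt w) P"
    using ge left hi_in by (auto simp: minf_iff) (auto simp: pt_inner w_def)
  moreover have "pt (-1, 0) \<noteq> pt (1, hi)" by simp
  ultimately obtain r p k where e: "edat P w r p k" using edat_of_minf[OF f c] by blast
  have "pt (-1, 0) \<in> minf (pt w) P" by fact
  then have "pt w \<bullet> pt (-1, 0) = - of_int r" using edat_minf_iff[OF e] by blast
  then have r: "r = hi" unfolding dot_pt by (simp add: w_def)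
  have k0: "0 < k" using e by (simp add: edat_def)
  have "pt p \<in> P" using edat_start[OF e] by (simp add: minf_iff)
  then have 1: "\<bar>real_of_int (fst p)\<bar> \<le> 1" using width[of "pt p"] by simp
  have "pt (fst p + k * snd w, snd p - k * fst w) \<in> P" using edat_end(1)[OF e, of k] k0 by simp
  then have 2: "\<bar>real_of_int (fst p + k * snd w)\<bar> \<le> 1" using width by fastforce
  have "k \<le> 1" using 1 2 by (simp add: w_def)
  then have "k = 1" using k0 by simp
  then have "hi dvd 1" using edat_T[OF f bas e] r by simp
  then show ?thesis using h by simp
next
  case True
  then obtain m where m: "hi = 2 * m" by (elim evenE)
  define w where "w = (m, -1 :: int)"
  have m1: "1 \<le> m" using h m by simp
  have c: "coprime (fst w) (snd w)" by (simp add: w_def)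
  have ge: "of_int (- m) \<le> pt w \<bullet> z" if z: "z \<in> P" for z
    by (rule ge_on_extremes[OF _ _ _ _ z]) (use m1 m up in \<open>auto simp: pt_inner w_def\<close>)
  have "pt (-1, 0) \<in> minf (pt w) P" "pt (1, hi) \<in> minf (pt w) P"
    using ge left hi_in by (auto simp: minf_iff) (auto simp: pt_inner w_def m)
  moreover have "pt (-1, 0) \<noteq> pt (1, hi)" by simp
  ultimately obtain r p k where e: "edat P w r p k" using edat_of_minf[OF f c] by blast
  have "pt (-1, 0) \<in> minf (pt w) P" by fact
  then have "pt w \<bullet> pt (-1, 0) = - of_int r" using edat_minf_iff[OF e] by blast
  then have r: "r = m" unfolding dot_pt by (simp add: w_def)
  have k0: "0 < k" using e by (simp add: edat_def)
  have "pt p \<in> P" using edat_start[OF e] by (simp add: minf_iff)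
  then have 1: "\<bar>real_of_int (fst p)\<bar> \<le> 1" using width[of "pt p"] by simp
  have "pt (fst p + k * snd w, snd p - k * fst w) \<in> P" using edat_end(1)[OF e, of k] k0 by simp
  then have 2: "\<bar>real_of_int (fst p + k * snd w)\<bar> \<le> 1" using width by fastforce
  have "k \<le> 2" using 1 2 by (simp add: w_def)
  moreover have "m dvd k" using edat_T[OF f bas e] r by simp
  ultimately have "m \<le> 2" using k0 zdvd_imp_le[of m k] by simp
  then have "m = 1 \<or> m = 2" using m1 by linarith
  then show ?thesis using m by auto
qed

text \<open>If \<open>(0, 1)\<close> is outside \<open>P\<close>, then \<open>hi\<close> is positive
  because some vertex lies above the axis. For \<open>hi = 2\<close> the midpoint of
  \<open>(-1, 0)\<close> and \<open>(1, hi)\<close>, and for \<open>hi = 4\<close> half of that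
  midpoint, would be \<open>(0, 1)\<close>.\<close>

lemma top_cases:
  shows "pt (0, 1) \<in> P \<and> (hi \<le> 2 \<or> hi = 4) \<or> pt (0, 1) \<notin> P \<and> hi = 1"
proof (cases "pt (0, 1) \<in> P")
  case True
  then show ?thesis using top_edge by linarith
next
  case False
  have h1: "1 \<le> hi"
  proof (rule ccontr)
    assume "\<not> 1 \<le> hi"
    have "pt (0, -1) \<noteq> 0" by (simp add: pt_def zero_prod_def)
    then obtain x where x: "x extreme_point_of P" "pt (0, -1) \<bullet> x < 0" by (rule extreme_negative[OF f])
    then have "x \<in> P" by (simp add: extreme_point_of_def)
    then show False using extreme_cases[OF x(1)] x(2) False column_bounds \<open>\<not> 1 \<le> hi\<close>
      by (fastforce simp: pt_inner)
  qed
  have mid: "(1 / 2) *\<^sub>R pt (-1, 0) + (1 / 2) *\<^sub>R pt (1, hi) \<in> P"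
    using fanoD(3)[OF f] left hi_in by (intro convexD) auto
  have "hi \<noteq> 2"
  proof
    assume "hi = 2"
    then have "(1 / 2) *\<^sub>R pt (-1, 0) + (1 / 2) *\<^sub>R pt (1, hi) = pt (0, 1)" by (simp add: pt_def)
    then show False using mid False by simp
  qed
  moreover have "hi \<noteq> 4"
  proof
    assume "hi = 4"
    then have "(1 / 2) *\<^sub>R ((1 / 2) *\<^sub>R pt (-1, 0) + (1 / 2) *\<^sub>R pt (1, hi)) + (1 / 2) *\<^sub>R 0 = pt (0, 1)" by (simp add: pt_def)
    moreover have "(1 / 2) *\<^sub>R ((1 / 2) *\<^sub>R pt (-1, 0) + (1 / 2) *\<^sub>R pt (1, hi)) + (1 / 2) *\<^sub>R 0 \<in> P"
      by (rule convexD[OF fanoD(3)[OF f] mid fanoD(5)[OF f]]) auto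
    ultimately show False using False by simp
  qed
  ultimately show ?thesis using top_edge[OF h1] False by auto
qed

lemma P_eq:
  "P = hull2 ([(-1, 0), (1, lo), (1, hi)] @ (if pt (0, 1) \<in> P then [(0, 1)] else []) @
     (if pt (0, -1) \<in> P then [(0, -1)] else []))" (is "P = hull2 ?V")
proof
  show "hull2 ?V \<subseteq> P" unfolding hull2_def
    using left hi_in lo_in fanoD(3)[OF f] by (intro hull_minimal) auto
  have "{x. x extreme_point_of P} \<subseteq> hull2 ?V"
  proof
    fix x assume "x \<in> {x. x extreme_point_of P}"
    then have x: "x extreme_point_of P" by simp
    then have xP: "x \<in> P" by (simp add: extreme_point_of_def)
    have inV: "pt q \<in> hull2 ?V" if "q \<in> set ?V" for q unfolding hull2_def using that by (intro hull_inc) auto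
    from extreme_cases[OF x] show "x \<in> hull2 ?V"
    proof (elim disjE bexE)
      fix y assume y: "y \<in> column" "x = pt (1, y)"
      have b: "lo \<le> y" "y \<le> hi" using column_bounds[OF y(1)] by auto
      show ?thesis
      proof (cases "lo = hi")
        case True
        then show ?thesis using b y inV[of "(1, hi)"] by auto
      next
        case False
        then have lt: "lo < hi" using lo_le_hi by simp
        define t where "t = (of_int (y - lo) :: real) / of_int (hi - lo)"
        have t: "0 \<le> t" "t \<le> 1" using b lt by (auto simp: t_def divide_simps)
        have "t * of_int (hi - lo) = of_int (y - lo)" using lt by (simp add: t_def)
        then have "pt (1, y) = (1 - t) *\<^sub>R pt (1, lo) + t *\<^sub>R pt (1, hi)"
          by (simp add: prod_eq_iff algebra_simps)
        moreover have "\<dots> \<in> hull2 ?V"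
          using t inV[of "(1, lo)"] inV[of "(1, hi)"] by (intro convexD) (auto simp: hull2_def)
        ultimately show ?thesis using y by simp
      qed
    qed (use inV xP in auto)
  qed
  then show "P \<subseteq> hull2 ?V"
    by (subst fanoD(9)[OF f]) (rule hull_minimal, auto simp: hull2_def)
qed

end

text \<open>Through this reflection the possibilities for the upper side carry over to the lower
  one.\<close>

lemma reflect_hi:
  assumes s: "strip P"
  shows "strip (gl 1 0 0 (-1) ` P)" "strip.hi (gl 1 0 0 (-1) ` P) = - strip.lo P"
    "pt (0, 1) \<in> gl 1 0 0 (-1) ` P \<longleftrightarrow> pt (0, -1) \<in> P"
proof -
  interpret strip P by (rule s)
  define Q where "Q = gl 1 0 0 (-1) ` P"
  have d: "\<bar>1 * (-1) - 0 * 0\<bar> = (1 :: int)" by simp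
  have mem: "pt (x, y) \<in> Q \<longleftrightarrow> pt (x, - y) \<in> P" for x y
  proof -
    have "gl 1 0 0 (-1) (pt (x, - y)) = pt (x, y)" by (simp add: gli_def)
    then show ?thesis unfolding Q_def using inj_image_mem_iff[OF inj_gl[OF d], of "pt (x, - y)" P] by simp
  qed
  show sQ: "strip (gl 1 0 0 (-1) ` P)" unfolding Q_def[symmetric]
  proof
    show "tpolygon Q" unfolding Q_def using GL2Z_equivalent_mut_equiv(2)[OF GL2Z_equivalentI[OF d] T] .
    have "\<not> edat Q (1, 0) r p k" for r p k
    proof
      assume "edat Q (1, 0) r p k"
      then obtain p' where "edat P (gli 1 0 0 (-1) (1, 0)) r p' k" unfolding Q_def by (rule edat_gl[OF d f])
      then have "edat P (1, 0) r p' k" by (simp add: gli_def)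
      then show False using lv unfolding left_vertex_def by blast
    qed
    moreover have "\<bar>fst z\<bar> \<le> 1" if "z \<in> Q" for z using that width by (auto simp: Q_def gl_def)
    ultimately show "left_vertex Q" unfolding left_vertex_def by blast
    show "pt (-1, 0) \<in> Q" using mem[of "-1" 0] left by simp
  qed
  have "strip.column Q = uminus ` column"
    unfolding strip.column_def[OF sQ[folded Q_def]] column_def using mem by (force simp: image_iff)
  then show "strip.hi (gl 1 0 0 (-1) ` P) = - strip.lo P" unfolding Q_def[symmetric]
    strip.hi_def[OF sQ[folded Q_def]] lo_def
    using finite_column column_nonempty by (simp add: minus_Min_eq_Max)
  show "pt (0, 1) \<in> gl 1 0 0 (-1) ` P \<longleftrightarrow> pt (0, -1) \<in> P" using mem[of 0 1] by (simp add: Q_def)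
qed

text \<open>The right hand column reaches from \<open>(1, - b)\<close> to \<open>(1, a)\<close>; the flags tell whether \<open>(0, 1)\<close> and
  \<open>(0, -1)\<close> belong to the polygon.\<close>

definition shape :: "int \<Rightarrow> int \<Rightarrow> bool \<Rightarrow> bool \<Rightarrow> (int \<times> int) list" where
  "shape a b t u = [(-1, 0), (1, - b), (1, a)] @ (if t then [(0, 1)] else []) @ (if u then [(0, -1)] else [])"

definition side_ok :: "int \<Rightarrow> bool \<Rightarrow> bool" where
  "side_ok a t \<longleftrightarrow> (if t then a \<le> 2 \<or> a = 4 else a = 1)"

text \<open>Both \<open>a\<close> and \<open>b\<close> are at most 4 by \<open>side_ok\<close>, and
  \<open>- b \<le> a\<close> then bounds them below by -4, so the search range is complete.\<close>

definition shapes :: "(int \<times> int) list list" where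
  "shapes = map (\<lambda>(a, b, t, u). shape a b t u)
     (filter (\<lambda>(a, b, t, u). - b \<le> a \<and> side_ok a t \<and> side_ok b u)
       (List.product [-4..4] (List.product [-4..4] (List.product [True, False] [True, False]))))"

lemma strip_shapes:
  assumes s: "strip P"
  shows "\<exists>V\<in>set shapes. P = hull2 V"
proof -
  interpret strip P by (rule s)
  define a b t u where "a = hi" and "b = - lo" and "t \<longleftrightarrow> pt (0, 1) \<in> P" and "u \<longleftrightarrow> pt (0, -1) \<in> P"
  have V: "P = hull2 (shape a b t u)" using P_eq by (simp add: shape_def a_def b_def t_def u_def)
  have ok: "side_ok a t" "side_ok b u"
    using top_cases strip.top_cases[OF reflect_hi(1)[OF s]]
    unfolding reflect_hi(2,3)[OF s] side_ok_def a_def b_def t_def u_def by auto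
  have ab: "- b \<le> a" using lo_le_hi by (simp add: a_def b_def)
  have "a \<le> 4" "b \<le> 4" using ok by (auto simp: side_ok_def split: if_splits)
  then have mem: "a \<in> set [-4..4]" "b \<in> set [-4..4]" using ab by auto
  then have "(a, b, t, u) \<in> set (filter (\<lambda>(a, b, t, u). - b \<le> a \<and> side_ok a t \<and> side_ok b u)
       (List.product [-4..4] (List.product [-4..4] (List.product [True, False] [True, False]))))"
    unfolding set_filter set_product
  proof (intro CollectI conjI SigmaI mem)
    show "t \<in> set [True, False]" "u \<in> set [True, False]" by auto
    show "case (a, b, t, u) of (a, b, t, u) \<Rightarrow> - b \<le> a \<and> side_ok a t \<and> side_ok b u"
      using ab ok by simp
  qed
  then have "(\<lambda>(a, b, t, u). shape a b t u) (a, b, t, u) \<in> set shapes"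
    unfolding shapes_def set_map by (rule imageI)
  then have "shape a b t u \<in> set shapes" by simp
  then show ?thesis using V by blast
qed

theorem normal_form:
  assumes "tpolygon P"
  shows "\<exists>V\<in>set (triangles @ shapes). mut_equiv P (hull2 V)"
proof -
  obtain Q where Q: "tpolygon Q" "mut_equiv P Q" "unbeaten Q" using descent[OF assms] by blast
  then obtain R where R: "GL2Z_equivalent Q R" "strip_or_triangle R"
    using unbeaten_normal_form[of Q] by (auto simp: tpolygon_def)
  have TR: "tpolygon R" and PR: "mut_equiv P R"
    using GL2Z_equivalent_mut_equiv[OF R(1) Q(1)] mut_equiv_trans[OF Q(2)] by blast+
  from R(2) consider "\<And>z. z \<in> R \<Longrightarrow> \<bar>fst z\<bar> \<le> 1" | V where "V \<in> set triangles" "R = hull2 V"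
    unfolding strip_or_triangle_def by blast
  then show ?thesis
  proof cases
    case 2
    then show ?thesis using PR by auto
  next
    case 1
    obtain S where S: "tpolygon S" "mut_equiv R S" "left_vertex S" using clear_left_edge[OF TR 1] by blast
    have fS: "fano_polygon S" using S(1) by (simp add: tpolygon_def)
    have wS: "\<bar>fst z\<bar> \<le> 1" if "z \<in> S" for z using S(3) that by (simp add: left_vertex_def)
    have "pt (1, 0) \<noteq> 0" by (simp add: pt_def zero_prod_def)
    then obtain x where x: "x extreme_point_of S" "pt (1, 0) \<bullet> x < 0" by (rule extreme_negative[OF fS])
    obtain q where q: "x = pt q" "pt q \<in> S" "fst q = -1 \<or> fst q = 0 \<or> fst q = 1"
      by (rule strip_extreme[OF fS wS x(1)])
    then have q1: "fst q = -1" using x(2) by (auto simp: pt_inner)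
    \<comment> \<open>This shear moves the left vertex \<open>(-1, snd q)\<close> to
      \<open>(-1, 0)\<close>.\<close>
    define U where "U = gl 1 0 (snd q) 1 ` S"
    have d: "\<bar>1 * 1 - 0 * snd q\<bar> = (1 :: int)" by simp
    have gU: "GL2Z_equivalent S U" unfolding U_def by (rule GL2Z_equivalentI[OF d])
    have "strip U"
    proof
      show "tpolygon U" by (rule GL2Z_equivalent_mut_equiv(2)[OF gU S(1)])
      have "\<not> edat U (1, 0) r p k" for r p k
      proof
        assume "edat U (1, 0) r p k"
        then obtain p' where "edat S (gli 1 (snd q) 0 1 (1, 0)) r p' k" unfolding U_def by (rule edat_gl[OF d fS])
        then have "edat S (1, 0) r p' k" by (simp add: gli_def)
        then show False using S(3) unfolding left_vertex_def by blast
      qed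
      moreover have "\<bar>fst z\<bar> \<le> 1" if "z \<in> U" for z using that wS by (auto simp: U_def gl_def)
      ultimately show "left_vertex U" unfolding left_vertex_def by blast
      have "gl 1 0 (snd q) 1 (pt q) \<in> U" unfolding U_def using q(2) by (rule imageI)
      then show "pt (-1, 0) \<in> U" using q1 by (simp add: gli_def)
    qed
    then obtain V where V: "V \<in> set shapes" "U = hull2 V" using strip_shapes by blast
    have "mut_equiv P U"
      using PR S(2) GL2Z_equivalent_mut_equiv(1)[OF gU S(1)] mut_equiv_trans by blast
    then show ?thesis using V by auto
  qed
qed

section \<open>Checking mutations of explicit polygons\<close>

definition cyc :: "(int \<times> int) list \<Rightarrow> ((int \<times> int) \<times> (int \<times> int)) list" where
  "cyc V = zip V (rotate1 V)"

definition det2 :: "int \<times> int \<Rightarrow> int \<times> int \<Rightarrow> int" where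
  "det2 p q = fst p * snd q - snd p * fst q"

definition dot2 :: "int \<times> int \<Rightarrow> int \<times> int \<Rightarrow> int" where
  "dot2 u z = fst u * fst z + snd u * snd z"

text \<open>Inner normal of the edge that runs counterclockwise from \<open>p\<close> to
  \<open>q\<close>, not divided by its content. On the edge it takes the value
  \<open>- det2 p q\<close>.\<close>

definition nrm :: "int \<times> int \<Rightarrow> int \<times> int \<Rightarrow> int \<times> int" where
  "nrm p q = (snd p - snd q, fst q - fst p)"

definition in_poly :: "(int \<times> int) list \<Rightarrow> int \<times> int \<Rightarrow> bool" where
  "in_poly V z \<longleftrightarrow> list_all (\<lambda>(p, q). - det2 p q \<le> dot2 (nrm p q) z) (cyc V)"

text \<open>As every vertex satisfies all edge inequalities, the cycle winds around the origin only once.\<close>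

definition ccw :: "(int \<times> int) list \<Rightarrow> bool" where
  "ccw V \<longleftrightarrow> V \<noteq> [] \<and> list_all (\<lambda>(p, q). 0 < det2 p q) (cyc V) \<and> list_all (in_poly V) V \<and>
     list_all (\<lambda>p. gcd (fst p) (snd p) = 1) V"

lemma cyc_mem: "(p, q) \<in> set (cyc V) \<Longrightarrow> p \<in> set V \<and> q \<in> set V"
  unfolding cyc_def by (metis set_rotate1 set_zip_leftD set_zip_rightD)

lemma cyc_succ: "p \<in> set V \<Longrightarrow> \<exists>q. (p, q) \<in> set (cyc V)"
proof -
  assume "p \<in> set V"
  then obtain i where i: "i < length V" "V ! i = p" by (auto simp: in_set_conv_nth)
  then have "(V ! i, rotate1 V ! i) \<in> set (zip V (rotate1 V))" unfolding set_zip by auto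
  then show ?thesis unfolding cyc_def i(2) by (rule exI)
qed

lemma nrm_values: "dot2 (nrm p q) p = - det2 p q" "dot2 (nrm p q) q = - det2 p q"
  by (simp_all add: dot2_def nrm_def det2_def algebra_simps)

lemma pt_dot2: "pt u \<bullet> pt z = of_int (dot2 u z)"
  by (simp add: pt_inner_pt dot2_def)

text \<open>Here \<open>f p\<close> is the determinant of \<open>p\<close> and \<open>z\<close>. If
  no step of the cycle led from nonnegative to nonpositive values, some set of vertices closed under
  successors would have constant sign. On it \<open>g\<close>, the cotangent of the angle from
  \<open>p\<close> to \<open>z\<close>, increases strictly at each step, which is impossible at its
  maximum.\<close>

lemma cyclic_cover:
  fixes z :: point
  assumes V: "V \<noteq> []" "\<And>p q. (p, q) \<in> set (cyc V) \<Longrightarrow> 0 < det2 p q" and z: "z \<noteq> 0"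
  defines "f \<equiv> \<lambda>p. of_int (fst p) * snd z - of_int (snd p) * fst z"
  obtains p q where "(p, q) \<in> set (cyc V)" "0 \<le> f p" "f q \<le> 0"
proof -
  have "\<exists>p q. (p, q) \<in> set (cyc V) \<and> 0 \<le> f p \<and> f q \<le> 0"
  proof (rule ccontr)
    assume no: "\<not> ?thesis"
    define g where "g = (\<lambda>p. (pt p \<bullet> z) / f p)"
    have mono: "g p < g q" if pq: "(p, q) \<in> set (cyc V)" and s: "0 < f p * f q" for p q
    proof -
      have "(pt p \<bullet> z) * f q - (pt q \<bullet> z) * f p = - ((fst z)\<^sup>2 + (snd z)\<^sup>2) * of_int (det2 p q)"
        by (simp add: f_def pt_inner det2_def algebra_simps power2_eq_square)
      moreover have "0 < (fst z)\<^sup>2 + (snd z)\<^sup>2" using z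
        by (simp add: sum_power2_gt_zero_iff prod_eq_iff)
      ultimately have lt: "(pt p \<bullet> z) * f q < (pt q \<bullet> z) * f p"
        using V(2)[OF pq] by (simp add: mult_pos_pos) (smt (verit) mult_pos_pos of_int_0_less_iff mult_minus_left)
      have ne: "f p \<noteq> 0" "f q \<noteq> 0" using s by auto
      have "g q - g p = ((pt q \<bullet> z) * f p - (pt p \<bullet> z) * f q) / (f p * f q)"
        using ne by (simp add: g_def field_simps)
      then have "0 < g q - g p" using lt s by simp
      then show ?thesis by simp
    qed
    have max: False if A: "A \<subseteq> set V" "A \<noteq> {}" and cl: "\<And>p q. p \<in> A \<Longrightarrow> (p, q) \<in> set (cyc V) \<Longrightarrow> q \<in> A \<and> 0 < f p * f q" for A
    proof -
      have "finite A" using A(1) finite_subset by blast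
      then have fin: "finite (g ` A)" "g ` A \<noteq> {}" using A(2) by auto
      obtain p where p': "p \<in> A" "Max (g ` A) = g p" using Max_in[OF fin] by (rule imageE)
      have p: "p \<in> A" "\<And>q. q \<in> A \<Longrightarrow> g q \<le> g p"
        using p' Max_ge[OF fin(1)] by (auto simp flip: p'(2))
      obtain q where q: "(p, q) \<in> set (cyc V)" using cyc_succ p(1) A(1) by blast
      then show False using cl[OF p(1) q] mono[OF q] p(2)[of q] by force
    qed
    show False
    proof (cases "\<exists>p\<in>set V. 0 \<le> f p")
      case True
      then obtain p0 where p0: "p0 \<in> set V" "0 \<le> f p0" by blast
      obtain q0 where q0: "(p0, q0) \<in> set (cyc V)" using cyc_succ[OF p0(1)] by blast
      show False
      proof (rule max[of "{p \<in> set V. 0 < f p}"])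
        have "0 < f q0" using no q0 p0(2) by (meson not_le)
        then show "{p \<in> set V. 0 < f p} \<noteq> {}" using cyc_mem[OF q0] by blast
        fix p q assume p: "p \<in> {p \<in> set V. 0 < f p}" and pq: "(p, q) \<in> set (cyc V)"
        then have "0 < f q" using no by (metis (mono_tags, lifting) mem_Collect_eq less_imp_le not_le)
        then show "q \<in> {p \<in> set V. 0 < f p} \<and> 0 < f p * f q" using p cyc_mem[OF pq] by simp
      qed auto
    next
      case False
      show False
      proof (rule max[of "set V"])
        show "set V \<noteq> {}" using V(1) by simp
        fix p q assume p: "p \<in> set V" and pq: "(p, q) \<in> set (cyc V)"
        have "f p < 0" "f q < 0" using False p cyc_mem[OF pq] by force+
        then show "q \<in> set V \<and> 0 < f p * f q" using cyc_mem[OF pq] by (simp add: mult_neg_neg)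
      qed auto
    qed
  qed
  then show ?thesis using that by blast
qed

text \<open>The cones over consecutive vertices cover the plane, and in such a cone the edge
  inequality says that the sum of the two coordinates is at most one. The origin belongs to the hull
  because the negative of a vertex lies in one of the cones too.\<close>

lemma ccw_hull:
  assumes V: "ccw V"
  shows "z \<in> hull2 V \<longleftrightarrow> (\<forall>p q. (p, q) \<in> set (cyc V) \<longrightarrow> - of_int (det2 p q) \<le> pt (nrm p q) \<bullet> z)"
proof
  have ne: "V \<noteq> []" and pos: "\<And>p q. (p, q) \<in> set (cyc V) \<Longrightarrow> 0 < det2 p q"
    and ins: "\<And>x. x \<in> set V \<Longrightarrow> in_poly V x"
    using V by (auto simp: ccw_def list_all_iff)
  have hullV: "pt p \<in> hull2 V" if "p \<in> set V" for p unfolding hull2_def using that by (intro hull_inc) auto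
  have cvx: "convex (hull2 V)" by (simp add: hull2_def)
  have cone: "\<exists>p q \<alpha> \<beta>. (p, q) \<in> set (cyc V) \<and> 0 \<le> \<alpha> \<and> 0 \<le> \<beta> \<and> z = \<alpha> *\<^sub>R pt p + \<beta> *\<^sub>R pt q" if z: "z \<noteq> 0" for z
  proof -
    obtain p q where pq: "(p, q) \<in> set (cyc V)" and s: "0 \<le> of_int (fst p) * snd z - of_int (snd p) * fst z"
      "of_int (fst q) * snd z - of_int (snd q) * fst z \<le> 0"
      using cyclic_cover[OF ne pos z] by blast
    define D where "D = real_of_int (det2 p q)"
    define \<alpha> \<beta> where "\<alpha> = - (of_int (fst q) * snd z - of_int (snd q) * fst z) / D"
      and "\<beta> = (of_int (fst p) * snd z - of_int (snd p) * fst z) / D"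
    have D: "0 < D" using pos[OF pq] by (simp add: D_def)
    have "\<alpha> * D = - (of_int (fst q) * snd z - of_int (snd q) * fst z)"
      "\<beta> * D = of_int (fst p) * snd z - of_int (snd p) * fst z" using D by (simp_all add: \<alpha>_def \<beta>_def)
    then have "D * (\<alpha> * x + \<beta> * y) = - (of_int (fst q) * snd z - of_int (snd q) * fst z) * x +
        (of_int (fst p) * snd z - of_int (snd p) * fst z) * y" for x y
      by (metis (no_types) distrib_left mult.assoc mult.commute)
    then have "D * fst z = D * (\<alpha> * of_int (fst p) + \<beta> * of_int (fst q))"
      "D * snd z = D * (\<alpha> * of_int (snd p) + \<beta> * of_int (snd q))"
      by (simp_all add: D_def det2_def) (simp_all add: algebra_simps)
    then have "z = \<alpha> *\<^sub>R pt p + \<beta> *\<^sub>R pt q" using D by (simp add: prod_eq_iff)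
    moreover have "0 \<le> \<alpha>" "0 \<le> \<beta>" using s D by (simp_all add: \<alpha>_def \<beta>_def divide_nonpos_pos)
    ultimately show ?thesis using pq by blast
  qed
  have zero: "0 \<in> hull2 V"
  proof -
    obtain v where v: "v \<in> set V" using ne by (meson hd_in_set)
    obtain w where "(v, w) \<in> set (cyc V)" using cyc_succ[OF v] by blast
    then have "v \<noteq> (0, 0)" using pos[of v w] by (auto simp: det2_def)
    then have "- pt v \<noteq> 0" by (cases v) (auto simp: pt_def zero_prod_def)
    then obtain p q \<alpha> \<beta> where pq: "(p, q) \<in> set (cyc V)" "0 \<le> \<alpha>" "0 \<le> \<beta>" "- pt v = \<alpha> *\<^sub>R pt p + \<beta> *\<^sub>R pt q"
      using cone by blast
    define s where "s = 1 + \<alpha> + \<beta>"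
    have s: "0 < s" using pq by (simp add: s_def)
    have "(1 / s) *\<^sub>R pt v + (\<alpha> / s) *\<^sub>R pt p + (\<beta> / s) *\<^sub>R pt q \<in> hull2 V"
    proof -
      have sub: "convex hull {pt v, pt p, pt q} \<subseteq> hull2 V"
        using hullV v cyc_mem[OF pq(1)] cvx by (intro hull_minimal) auto
      have one: "1 / s + \<alpha> / s + \<beta> / s = 1" using s by (simp add: s_def flip: add_divide_distrib)
      have nn: "0 \<le> 1 / s" "0 \<le> \<alpha> / s" "0 \<le> \<beta> / s" using s pq by simp_all
      have "(1 / s) *\<^sub>R pt v + (\<alpha> / s) *\<^sub>R pt p + (\<beta> / s) *\<^sub>R pt q \<in> convex hull {pt v, pt p, pt q}"
        unfolding convex_hull_3 using one nn by blast
      then show ?thesis using sub by blast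
    qed
    also have "(1 / s) *\<^sub>R pt v + (\<alpha> / s) *\<^sub>R pt p + (\<beta> / s) *\<^sub>R pt q = (1 / s) *\<^sub>R (pt v + (\<alpha> *\<^sub>R pt p + \<beta> *\<^sub>R pt q))"
      by (simp add: scaleR_add_right)
    also have "\<dots> = 0" unfolding pq(4)[symmetric] by simp
    finally show ?thesis .
  qed
  show "z \<in> hull2 V" if h: "\<forall>p q. (p, q) \<in> set (cyc V) \<longrightarrow> - of_int (det2 p q) \<le> pt (nrm p q) \<bullet> z"
  proof (cases "z = 0")
    case True then show ?thesis using zero by simp
  next
    case False
    then obtain p q \<alpha> \<beta> where pq: "(p, q) \<in> set (cyc V)" "0 \<le> \<alpha>" "0 \<le> \<beta>" "z = \<alpha> *\<^sub>R pt p + \<beta> *\<^sub>R pt q"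
      using cone by blast
    have "pt (nrm p q) \<bullet> z = - ((\<alpha> + \<beta>) * of_int (det2 p q))"
      unfolding pq(4) inner_add_right inner_scaleR_right pt_dot2 nrm_values by (simp add: algebra_simps)
    then have "(\<alpha> + \<beta>) * of_int (det2 p q) \<le> 1 * of_int (det2 p q)" using h[rule_format, OF pq(1)] by simp
    then have ab: "\<alpha> + \<beta> \<le> 1" using pos[OF pq(1)] by (simp add: mult_le_cancel_right)
    have sub: "convex hull {0, pt p, pt q} \<subseteq> hull2 V"
      using hullV cyc_mem[OF pq(1)] cvx zero by (intro hull_minimal) auto
    have "(1 - \<alpha> - \<beta>) *\<^sub>R 0 + \<alpha> *\<^sub>R pt p + \<beta> *\<^sub>R pt q \<in> convex hull {0, pt p, pt q}"
    proof -
      have "1 - \<alpha> - \<beta> + \<alpha> + \<beta> = 1" "0 \<le> 1 - \<alpha> - \<beta>" using ab by simp_all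
      then show ?thesis unfolding convex_hull_3 using pq(2,3) by blast
    qed
    then show ?thesis using sub pq(4) by auto
  qed
  show "\<forall>p q. (p, q) \<in> set (cyc V) \<longrightarrow> - of_int (det2 p q) \<le> pt (nrm p q) \<bullet> z" if z: "z \<in> hull2 V"
  proof (intro allI impI)
    fix p q assume pq: "(p, q) \<in> set (cyc V)"
    show "- of_int (det2 p q) \<le> pt (nrm p q) \<bullet> z"
    proof (rule hull_ge[OF _ z[unfolded hull2_def]])
      fix s assume "s \<in> pt ` set V"
      then obtain x where x: "s = pt x" "x \<in> set V" by blast
      then have "- det2 p q \<le> dot2 (nrm p q) x" using ins[OF x(2)] pq by (auto simp: in_poly_def list_all_iff)
      then have "of_int (- det2 p q) \<le> (of_int (dot2 (nrm p q) x) :: real)" by (simp only: of_int_le_iff)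
      then show "- of_int (det2 p q) \<le> pt (nrm p q) \<bullet> s" by (simp add: x pt_dot2)
    qed
  qed
qed

lemma in_poly_hull:
  assumes "ccw V" "in_poly V x"
  shows "pt x \<in> hull2 V"
  unfolding ccw_hull[OF assms(1)]
proof (intro allI impI)
  fix p q assume "(p, q) \<in> set (cyc V)"
  then have "- det2 p q \<le> dot2 (nrm p q) x" using assms(2) by (auto simp: in_poly_def list_all_iff)
  then have "of_int (- det2 p q) \<le> (of_int (dot2 (nrm p q) x) :: real)" by (simp only: of_int_le_iff)
  then show "- of_int (det2 p q) \<le> pt (nrm p q) \<bullet> pt x" by (simp add: pt_dot2)
qed

lemma fano_ccw:
  assumes V: "ccw V"
  shows "fano_polygon (hull2 V)"
  unfolding fano_polygon_def
proof (intro conjI subsetI)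
  show "polytope (hull2 V)" unfolding hull2_def polytope_def by blast
  fix x assume "x \<in> {x. x extreme_point_of hull2 V}"
  then have "x \<in> pt ` set V" using extreme_point_of_convex_hull unfolding hull2_def by blast
  then show "x \<in> primitive_points"
    using V by (auto simp: ccw_def list_all_iff primitive_points_eq coprime_iff_gcd_eq_1)
next
  define U where "U = (\<Inter>(p, q)\<in>set (cyc V). {z. - real_of_int (det2 p q) < pt (nrm p q) \<bullet> z})"
  have "open U" unfolding U_def by (intro open_INT) (auto intro: open_halfspace_gt)
  moreover have "U \<subseteq> hull2 V" unfolding U_def using ccw_hull[OF V] by fastforce
  moreover have "0 \<in> U" unfolding U_def using V by (auto simp: ccw_def list_all_iff)
  ultimately show "0 \<in> interior (hull2 V)" using interiorI by blast
qed

definition shift :: "int \<times> int \<Rightarrow> int \<Rightarrow> int \<times> int \<Rightarrow> int \<times> int" where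
  "shift w c z = (fst z + c * snd w, snd z - c * fst w)"

text \<open>The support function of a mutation in direction \<open>u\<close> equals the one of the original polygon in this direction.\<close>

definition lift_normal :: "int \<times> int \<Rightarrow> int \<times> int \<Rightarrow> int \<times> int" where
  "lift_normal w u = (let d = fst u * snd w - snd u * fst w in
     if 0 \<le> d then u else (fst u + d * fst w, snd u + d * snd w))"

text \<open>After the tests that \<open>w\<close> is normal to an edge and that the assumption
  \<open>slope\<close> of \<open>mutable\<close> holds at the vertices, the last two conditions
  yield the two inclusions: the points of \<open>V'\<close> are generators of the mutation, and each
  edge inequality of \<open>V'\<close> lifts to one that holds on \<open>V\<close>.\<close>

definition step_ok :: "(int \<times> int) list \<Rightarrow> int \<times> int \<Rightarrow> (int \<times> int) list \<Rightarrow> bool" where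
  "step_ok V w V' \<longleftrightarrow> gcd (fst w) (snd w) = 1 \<and>
     list_ex (\<lambda>(p, q). dot2 w p = dot2 w q \<and> list_all (\<lambda>x. dot2 w p \<le> dot2 w x) V) (cyc V) \<and>
     list_all (\<lambda>x. dot2 w x < 0 \<longrightarrow> in_poly V (shift w (- dot2 w x) x) \<or> in_poly V (shift w (dot2 w x) x)) V \<and>
     list_all (\<lambda>y. (dot2 w y \<le> 0 \<longrightarrow> in_poly V y \<and> in_poly V (shift w (- dot2 w y) y)) \<and>
       (0 \<le> dot2 w y \<longrightarrow> in_poly V y \<or> in_poly V (shift w (- dot2 w y) y))) V' \<and>
     list_all (\<lambda>(p, q). list_all (\<lambda>x. - det2 p q \<le> dot2 (lift_normal w (nrm p q)) x) V) (cyc V')"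

lemma step_ok_sound:
  assumes V: "ccw V" "ccw V'" and ok: "step_ok V w V'"
  shows "mutation_step (hull2 V) (hull2 V')"
proof -
  define v where "v = (snd w, - fst w)"
  define P where "P = hull2 V"
  have ok1: "gcd (fst w) (snd w) = 1"
    and ok2: "list_ex (\<lambda>(p, q). dot2 w p = dot2 w q \<and> list_all (\<lambda>x. dot2 w p \<le> dot2 w x) V) (cyc V)"
    and ok3: "\<forall>x\<in>set V. dot2 w x < 0 \<longrightarrow> in_poly V (shift w (- dot2 w x) x) \<or> in_poly V (shift w (dot2 w x) x)"
    and ok4: "\<forall>y\<in>set V'. (dot2 w y \<le> 0 \<longrightarrow> in_poly V y \<and> in_poly V (shift w (- dot2 w y) y)) \<and>
       (0 \<le> dot2 w y \<longrightarrow> in_poly V y \<or> in_poly V (shift w (- dot2 w y) y))"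
    and ok5: "list_all (\<lambda>(p, q). list_all (\<lambda>x. - det2 p q \<le> dot2 (lift_normal w (nrm p q)) x) V) (cyc V')"
    using ok unfolding step_ok_def list_all_iff[of _ V] list_all_iff[of _ V'] by blast+
  have cw: "coprime (fst w) (snd w)" using ok1 by (simp add: coprime_iff_gcd_eq_1)
  have shpt: "pt (shift w c z) = pt z + of_int c *\<^sub>R pt v" for c z by (simp add: shift_def v_def pt_def)
  have fP: "fano_polygon P" unfolding P_def by (rule fano_ccw[OF V(1)])
  have inV: "pt x \<in> P" if "in_poly V x" for x unfolding P_def by (rule in_poly_hull[OF V(1) that])
  have sgn: "pt w \<bullet> pt x \<le> 0 \<longleftrightarrow> dot2 w x \<le> 0" "0 \<le> pt w \<bullet> pt x \<longleftrightarrow> 0 \<le> dot2 w x"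
    "pt w \<bullet> pt x < 0 \<longleftrightarrow> dot2 w x < 0" for x by (simp_all add: pt_dot2)
  interpret mutable P w v
  proof
    show "fano_polygon P" by (rule fP)
    show "coprime (fst v) (snd v)" using cw by (simp add: v_def coprime_commute)
    show "pt w \<bullet> pt v = 0" by (simp add: v_def pt_inner)
    fix x assume x: "x extreme_point_of P" "pt w \<bullet> x < 0"
    then obtain y where y: "x = pt y" "y \<in> set V"
      using extreme_point_of_convex_hull unfolding P_def hull2_def by blast
    then have "dot2 w y < 0" using x(2) sgn(3) by blast
    then have "in_poly V (shift w (- dot2 w y) y) \<or> in_poly V (shift w (dot2 w y) y)"
      using ok3 y(2) by blast
    then have "pt (shift w (- dot2 w y) y) \<in> P \<or> pt (shift w (dot2 w y) y) \<in> P" using inV by blast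
    then show "x - (pt w \<bullet> x) *\<^sub>R pt v \<in> P \<or> x + (pt w \<bullet> x) *\<^sub>R pt v \<in> P"
      by (simp add: shpt y pt_dot2)
  qed
  have "hull2 V' = mutc w v P"
  proof
    have "pt ` set V' \<subseteq> mgen w v P"
    proof
      fix z assume "z \<in> pt ` set V'"
      then obtain y where y: "z = pt y" "y \<in> set V'" by blast
      then have "(dot2 w y \<le> 0 \<longrightarrow> in_poly V y \<and> in_poly V (shift w (- dot2 w y) y)) \<and>
       (0 \<le> dot2 w y \<longrightarrow> in_poly V y \<or> in_poly V (shift w (- dot2 w y) y))" using ok4 by blast
      then have "(dot2 w y \<le> 0 \<longrightarrow> pt y \<in> P \<and> pt (shift w (- dot2 w y) y) \<in> P) \<and>
       (0 \<le> dot2 w y \<longrightarrow> pt y \<in> P \<or> pt (shift w (- dot2 w y) y) \<in> P)" using inV by blast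
      then show "z \<in> mgen w v P" unfolding mgen_def y sgn by (simp add: shpt pt_dot2)
    qed
    then show "hull2 V' \<subseteq> mutc w v P" unfolding hull2_def mutc_def by (rule hull_mono)
    show "mutc w v P \<subseteq> hull2 V'"
    proof
      fix z assume z: "z \<in> mutc w v P"
      show "z \<in> hull2 V'" unfolding ccw_hull[OF V(2)]
      proof (intro allI impI)
        fix p q assume pq: "(p, q) \<in> set (cyc V')"
        define u where "u = nrm p q"
        define d where "d = fst u * snd w - snd u * fst w"
        define u' where "u' = lift_normal w u"
        have u'_eq: "u' = (if 0 \<le> d then u else (fst u + d * fst w, snd u + d * snd w))"
          by (simp add: u'_def d_def lift_normal_def Let_def)
        have "list_all (\<lambda>x. - det2 p q \<le> dot2 u' x) V"
          using ok5 pq unfolding u'_def u_def list_all_iff[of _ "cyc V'"] by blast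
        then have c: "- of_int (det2 p q) \<le> pt u' \<bullet> x" if x: "x \<in> pt ` set V" for x
        proof -
          obtain y where y: "x = pt y" "y \<in> set V" using x by blast
          then have "- det2 p q \<le> dot2 u' y" using \<open>list_all _ V\<close> by (simp add: list_all_iff)
          then have "of_int (- det2 p q) \<le> (of_int (dot2 u' y) :: real)" by (simp only: of_int_le_iff)
          then show ?thesis by (simp add: y pt_dot2)
        qed
        have cP: "- of_int (det2 p q) \<le> pt u' \<bullet> x" if "x \<in> P" for x
          by (rule hull_ge[OF c that[unfolded P_def hull2_def]])
        have uv: "pt u \<bullet> pt v = of_int d" by (simp add: d_def v_def pt_inner)
        show "- of_int (det2 p q) \<le> pt (nrm p q) \<bullet> z"
        proof (cases "0 \<le> d")
          case True
          then have "u' = u" by (simp add: u'_eq)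
          then show ?thesis using mrel_dual1[OF mrel_mutc _ cP z] uv True by (simp add: u_def)
        next
          case False
          then have u': "pt u' = pt u + of_int d *\<^sub>R pt w" by (simp add: u'_eq pt_def)
          have u'v: "pt u' \<bullet> pt v = of_int d" using uv wv by (simp add: u' inner_add_left)
          have "- of_int (det2 p q) \<le> (pt u' - (pt u' \<bullet> pt v) *\<^sub>R pt w) \<bullet> z"
            by (rule mrel_dual2[OF mrel_mutc _ cP z]) (use u'v False in auto)
          then show ?thesis unfolding u'v by (simp add: u' u_def)
        qed
      qed
    qed
  qed
  moreover have "mutation_of P (mutc w v P)"
  proof -
    obtain p q where pq: "(p, q) \<in> set (cyc V)" "dot2 w p = dot2 w q" "\<And>x. x \<in> set V \<Longrightarrow> dot2 w p \<le> dot2 w x"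
      using ok2 by (auto simp: list_ex_iff list_all_iff)
    have mem: "p \<in> set V" "q \<in> set V" using cyc_mem[OF pq(1)] by auto
    have ge: "of_int (dot2 w p) \<le> pt w \<bullet> x" if "x \<in> P" for x
    proof (rule hull_ge[OF _ that[unfolded P_def hull2_def]])
      fix s assume "s \<in> pt ` set V"
      then show "of_int (dot2 w p) \<le> pt w \<bullet> s" using pq(3) by (auto simp: pt_dot2)
    qed
    have "pt p \<in> minf (pt w) P" "pt q \<in> minf (pt w) P"
      using ge pq(2) hull_inc[of "pt p" "pt ` set V" convex] hull_inc[of "pt q" "pt ` set V" convex] mem
      unfolding minf_iff by (auto simp: P_def hull2_def pt_dot2)
    moreover have "p \<noteq> q"
    proof
      assume "p = q"
      then show False using V(1) pq(1) by (auto simp: ccw_def list_all_iff det2_def)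
    qed
    then have "pt p \<noteq> pt q" by simp
    ultimately obtain r p' k where "edat P w r p' k" using edat_of_minf[OF fP cw, of "pt p" "pt q"] by blast
    then show ?thesis by (rule mutation_of_mutc)
  qed
  ultimately show ?thesis
    unfolding mutation_step_def using fP fano_ccw[OF V(2)] by (simp add: P_def)
qed

section \<open>The ten classes\<close>

text \<open>The vertices are listed in counterclockwise order, as \<open>ccw\<close>
  demands.\<close>

definition reps :: "(int \<times> int) list list" where
  "reps =
    [[(1, 0), (0, 1), (-1, -1)],
     [(1, 0), (0, 1), (-1, 0), (0, -1)],
     [(1, 0), (0, 1), (-1, -1), (0, -1)],
     [(1, 0), (1, 1), (0, 1), (-1, -1), (0, -1)],
     [(1, 0), (1, 1), (0, 1), (-1, 0), (-1, -1), (0, -1)],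
     [(1, 1), (-1, 1), (-1, 0), (0, -1), (1, -1)],
     [(1, 1), (-1, 1), (-1, -1), (1, -1)],
     [(1, 1), (-2, 1), (1, -2)],
     [(1, 2), (-1, 2), (-1, -2), (1, -2)],
     [(1, 3), (-2, 3), (1, -6)]]"

lemma representatives_eq: "representatives = map hull2 reps"
  by (simp add: representatives_def reps_def hull2_def pt_def)

lemma reps_ccw: "list_all ccw reps"
  unfolding reps_def by code_simp

fun chain_ok :: "(int \<times> int) list \<Rightarrow> ((int \<times> int) \<times> (int \<times> int) list) list \<Rightarrow> bool" where
  "chain_ok V [] = True"
| "chain_ok V ((w, U) # S) = (ccw U \<and> step_ok V w U \<and> chain_ok U S)"

fun chain_end :: "(int \<times> int) list \<Rightarrow> ((int \<times> int) \<times> (int \<times> int) list) list \<Rightarrow> (int \<times> int) list" where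
  "chain_end V [] = V"
| "chain_end V ((w, U) # S) = chain_end U S"

text \<open>A normal form \<open>V\<close> may contain repetitions and points that are not vertices,
  and it need not be in cyclic order. The list \<open>H\<close> arranges enough of its points
  counterclockwise, and the two containment tests ensure that the hulls agree.\<close>

definition certificate_ok where
  "certificate_ok V C \<longleftrightarrow> (case C of (H, S, (a, b, c, d), i) \<Rightarrow>
     ccw H \<and> list_all (\<lambda>p. p \<in> set V) H \<and> list_all (in_poly H) V \<and> chain_ok H S \<and>
     \<bar>a * d - b * c\<bar> = 1 \<and> i < length reps \<and>
     set (map (gli a b c d) (chain_end H S)) = set (reps ! i))"

text \<open>For each normal form a certificate consists of its vertices, a chain of mutations, and a
  unimodular matrix taking the last polygon to a representative.\<close>

definition certificates where
  "certificates =
    [([(-2, 1), (1, -2), (1, 1)], [], (1, 0, 0, 1), 7),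
     ([(-4, 3), (2, -3), (2, 3)], [((0, -1), [(-1, -3), (2, -3), (2, 3), (-1, 3)]),
      ((-1, 0), [(-1, -3), (2, -3), (2, 1), (-1, 4)]), ((-1, 0), [(-1, -3), (2, -3), (2, -1),
      (-1, 5)]), ((-1, 0), [(-1, -3), (2, -3), (-1, 6)])], (-1, 0, 3, 1), 9),
     ([(-3, 5), (2, -5), (2, 5)], [((-1, 0), [(-3, 5), (2, -5), (2, 3), (-3, 8)]),
      ((-1, -1), [(-1, -2), (2, -5), (2, 3), (-1, 3)]), ((-1, 0), [(-1, -2), (2, -5), (2, 1),
      (-1, 4)]), ((-1, 0), [(-1, -2), (2, -5), (2, -1), (-1, 5)]), ((-1, 0), [(-1, -2), (2, -5),
      (2, -3), (-1, 6)]), ((-1, 0), [(-1, -2), (2, -5), (-1, 7)])], (-1, 0, 4, 1), 9),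
     ([(-2, 3), (1, -3), (1, 3)], [((-1, 0), [(-2, 3), (1, -3), (1, 2), (-2, 5)]),
      ((-1, -1), [(-1, -1), (1, -3), (1, 2), (-1, 2)]), ((-1, 0), [(-1, -1), (1, -3), (1, 1),
      (-1, 3)])], (1, 0, 1, 1), 8),
     ([(-2, 3), (1, -6), (1, 3)], [], (1, 0, 0, 1), 9),
     ([(-3, 4), (1, -4), (1, 4)], [((-1, 0), [(-3, 4), (1, -4), (1, 3), (-3, 7)]),
      ((-1, -1), [(-2, -1), (1, -4), (1, 3), (-2, 3)]), ((1, 0), [(-2, 1), (1, -5), (1, 3), (-2, 3)]),
      ((1, 0), [(-2, 3), (1, -6), (1, 3)])], (1, 0, 0, 1), 9),
     ([(-3, 2), (1, -2), (1, 2)], [((0, -1), [(-1, -2), (1, -2), (1, 2), (-1, 2)])], (1, 0, 0, 1), 8),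
     ([(-5, 3), (1, -3), (1, 3)], [((0, -1), [(-2, -3), (1, -3), (1, 3), (-2, 3)]), ((1, 0), [(-2, -1),
      (1, -4), (1, 3), (-2, 3)]), ((1, 0), [(-2, 1), (1, -5), (1, 3), (-2, 3)]), ((1, 0), [(-2, 3),
      (1, -6), (1, 3)])], (1, 0, 0, 1), 9),
     ([(-1, 0), (1, -4), (0, 1)], [((2, 1), [(-1, 0), (1, -1), (0, 1)])], (1, 0, 1, 1), 0),
     ([(-1, 0), (1, -4), (1, -3), (0, 1)], [((2, 1), [(-1, 0), (0, -1), (1, -1), (0, 1)])], (1, 0, 1, 1), 2),
     ([(-1, 0), (1, -2), (0, 1)], [((1, 1), [(-1, 0), (0, -1), (1, 0), (0, 1)])], (1, 0, 0, 1), 1),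
     ([(-1, 0), (1, -4), (1, -2), (0, 1)], [((2, 1), [(-1, 0), (1, -2), (1, -1), (0, 1)]),
      ((1, 1), [(-1, 0), (0, -1), (1, -1), (1, 0), (0, 1)])], (1, 0, 1, 1), 3),
     ([(-1, 0), (0, -1), (1, -1), (0, 1)], [], (1, 0, 1, 1), 2),
     ([(-1, 0), (1, -1), (0, 1)], [], (1, 0, 1, 1), 0),
     ([(-1, 0), (1, -2), (1, -1), (0, 1)], [((1, 1), [(-1, 0), (0, -1), (1, -1), (1, 0),
      (0, 1)])], (1, 0, 1, 1), 3),
     ([(-1, 0), (1, -4), (1, -1), (0, 1)], [((-1, 0), [(-1, 0), (1, -4), (1, -2), (0, 1), (-1, 1)]),
      ((2, 1), [(-1, 0), (1, -2), (1, -1), (0, 1), (-1, 1)]), ((1, 1), [(-1, 0), (0, -1), (1, -1),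
      (1, 0), (0, 1), (-1, 1)])], (1, 0, 1, 1), 4),
     ([(-1, 0), (0, -1), (1, 0), (0, 1)], [], (1, 0, 0, 1), 1),
     ([(-1, 0), (0, -1), (1, -1), (1, 0), (0, 1)], [], (1, 0, 1, 1), 3),
     ([(-1, 0), (1, -1), (1, 0), (0, 1)], [], (0, 1, -1, 0), 2),
     ([(-1, 0), (1, -2), (1, 0), (0, 1)], [((-1, 0), [(-1, 0), (1, -2), (1, -1), (0, 1), (-1, 1)]),
      ((1, 1), [(-1, 0), (0, -1), (1, -1), (1, 0), (0, 1), (-1, 1)])], (1, 0, 1, 1), 4),
     ([(-1, 0), (1, -4), (1, 0), (0, 1)], [((-1, 0), [(-1, 0), (1, -4), (1, -1), (0, 1), (-1, 1)]),
      ((2, 1), [(-1, 0), (2, -3), (0, 1), (-1, 1)]), ((1, 1), [(-1, 0), (1, -2), (1, 0), (0, 1),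
      (-1, 1)])], (-1, -1, 1, 0), 5),
     ([(-1, 0), (0, -1), (1, 1), (0, 1)], [], (1, 0, 1, -1), 2),
     ([(-1, 0), (0, -1), (1, 1)], [], (1, -1, 1, 0), 0),
     ([(-1, 0), (0, -1), (1, 0), (1, 1), (0, 1)], [], (1, 0, 1, -1), 3),
     ([(-1, 0), (0, -1), (1, 0), (1, 1)], [], (0, 1, -1, 1), 2),
     ([(-1, 0), (0, -1), (1, -1), (1, 1), (0, 1)], [((-1, 0), [(-1, 0), (0, -1), (1, -1), (1, 0),
      (0, 1), (-1, 1)])], (1, 0, 1, 1), 4),
     ([(-1, 0), (1, -1), (1, 1), (0, 1)], [((-1, 0), [(-1, 0), (1, -1), (1, 0), (0, 1),
      (-1, 1)])], (1, 1, 1, 0), 3),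
     ([(-1, 0), (0, -1), (1, -1), (1, 1)], [((-1, 0), [(-1, 0), (0, -1), (1, -1), (1, 0),
      (-1, 1)])], (0, -1, 1, 0), 3),
     ([(-1, 0), (1, -1), (1, 1)], [((-1, 0), [(-1, 0), (1, -1), (1, 0), (-1, 1)])], (1, 1, 0, 1), 1),
     ([(-1, 0), (1, -2), (1, 1), (0, 1)], [((-1, 0), [(-1, 0), (1, -2), (1, 0), (0, 1),
      (-1, 1)])], (-1, -1, 1, 0), 5),
     ([(-1, 0), (1, -2), (1, 1)], [((-1, 0), [(-1, 0), (1, -2), (1, 0), (-1, 1)]), ((1, 1), [(-1, 0),
      (0, -1), (2, -1), (1, 0), (-1, 1)]), ((0, 1), [(-1, 0), (0, -1), (1, -1), (1, 0), (0, 1),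
      (-1, 1)])], (1, 0, 1, 1), 4),
     ([(-1, 0), (1, -4), (1, 1), (0, 1)], [((-1, 0), [(-1, 0), (1, -4), (1, 0), (0, 1), (-1, 1)]),
      ((-1, 0), [(-1, 0), (1, -4), (1, -1), (0, 1), (-1, 2)]), ((2, 1), [(-1, 0), (2, -3), (0, 1),
      (-1, 2)]), ((1, 1), [(-1, 0), (1, -2), (1, 0), (-1, 2)])], (1, 0, 1, 1), 6),
     ([(-1, 0), (1, -4), (1, 1)], [((-1, 0), [(-1, 0), (1, -4), (1, 0), (-1, 1)]), ((-1, 0), [(-1, 0),
      (1, -4), (1, -1), (-1, 2)]), ((2, 1), [(-1, 0), (2, -3), (1, -1), (-1, 2)]), ((1, 1), [(-1, 0),
      (1, -2), (1, -1), (0, 1), (-1, 2)])], (-1, -1, -1, 0), 5),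
     ([(-1, 0), (0, -1), (1, 2)], [((1, -1), [(-1, -2), (0, -1), (1, 2), (0, 1)])], (1, 0, -2, 1), 1),
     ([(-1, 0), (0, -1), (1, 1), (1, 2)], [((1, -1), [(-1, -2), (0, -1), (1, 1), (1, 2),
      (0, 1)])], (1, 0, -1, 1), 3),
     ([(-1, 0), (0, -1), (1, 0), (1, 2)], [((-1, 0), [(-1, 0), (0, -1), (1, 0), (1, 1), (-1, 1)]),
      ((0, -1), [(-1, -1), (0, -1), (1, 0), (1, 1), (0, 1), (-1, 0)])], (1, 0, 0, 1), 4),
     ([(-1, 0), (0, -1), (1, -1), (1, 2)], [((-1, 0), [(-1, 0), (0, -1), (1, -1), (1, 1),
      (-1, 1)])], (1, 0, 0, 1), 5),
     ([(-1, 0), (1, -1), (1, 2)], [((-1, 0), [(-1, 0), (1, -1), (1, 1), (-1, 1)]), ((0, -1), [(-1, 0),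
      (0, -1), (1, -1), (1, 1), (0, 1)]), ((-1, 0), [(-1, 0), (0, -1), (1, -1), (1, 0), (0, 1),
      (-1, 1)])], (1, 0, 1, 1), 4),
     ([(-1, 0), (1, -2), (1, 2)], [((-1, 0), [(-1, 0), (1, -2), (1, 1), (-1, 1)]), ((-1, 0), [(-1, 0),
      (1, -2), (1, 0), (-1, 2)])], (1, 0, 1, 1), 6),
     ([(-1, 0), (1, -4), (1, 2)], [((-1, 0), [(-1, 0), (1, -4), (1, 1), (-1, 1)]), ((-1, 0), [(-1, 0),
      (1, -4), (1, 0), (-1, 2)]), ((-1, 0), [(-1, 0), (1, -4), (1, -1), (-1, 3)]), ((2, 1), [(-1, 0),
      (2, -3), (-1, 3)])], (2, 1, -1, 0), 7),
     ([(-1, 0), (0, -1), (1, 4)], [((2, -1), [(-1, -3), (0, -1), (1, 4)])], (4, -1, 1, 0), 0),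
     ([(-1, 0), (0, -1), (1, 3), (1, 4)], [((2, -1), [(-1, -3), (0, -1), (1, 3),
      (1, 4)])], (-3, 1, -4, 1), 2),
     ([(-1, 0), (0, -1), (1, 2), (1, 4)], [((-1, 0), [(-1, 0), (0, -1), (1, 2), (1, 3), (-1, 1)]),
      ((1, -1), [(-1, -2), (0, -1), (1, 2), (1, 3), (0, 1)])], (1, 0, 3, -1), 3),
     ([(-1, 0), (0, -1), (1, 1), (1, 4)], [((-1, 0), [(-1, 0), (0, -1), (1, 1), (1, 3), (-1, 1)]),
      ((1, -1), [(-1, -2), (0, -1), (1, 1), (1, 3), (0, 1)]), ((-1, 0), [(-1, -2), (0, -1), (1, 1),
      (1, 2), (0, 1), (-1, -1)])], (1, 0, -1, 1), 4),
     ([(-1, 0), (0, -1), (1, 0), (1, 4)], [((-1, 0), [(-1, 0), (0, -1), (1, 0), (1, 3), (-1, 1)]),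
      ((-1, 0), [(-1, 0), (0, -1), (1, 0), (1, 2), (-1, 2)]), ((0, -1), [(-1, -1), (0, -1), (1, 0),
      (1, 2), (-1, 0)])], (1, 0, -1, 1), 5),
     ([(-1, 0), (0, -1), (1, -1), (1, 4)], [((-1, 0), [(-1, 0), (0, -1), (1, -1), (1, 3), (-1, 1)]),
      ((-1, 0), [(-1, 0), (0, -1), (1, -1), (1, 2), (-1, 2)]), ((0, -1), [(-1, -1), (1, -1), (1, 2),
      (-1, 0)]), ((-1, 0), [(-1, -1), (1, -1), (1, 1), (-1, 1)])], (1, 0, 0, 1), 6),
     ([(-1, 0), (1, -1), (1, 4)], [((-1, 0), [(-1, 0), (1, -1), (1, 3), (-1, 1)]), ((-1, 0), [(-1, 0),
      (1, -1), (1, 2), (-1, 2)]), ((0, -1), [(-1, 0), (0, -1), (1, -1), (1, 2)]), ((-1, 0), [(-1, 0),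
      (0, -1), (1, -1), (1, 1), (-1, 1)])], (1, 0, 0, 1), 5),
     ([(-1, 0), (1, -2), (1, 4)], [((-1, 0), [(-1, 0), (1, -2), (1, 3), (-1, 1)]), ((-1, 0), [(-1, 0),
      (1, -2), (1, 2), (-1, 2)]), ((-1, 0), [(-1, 0), (1, -2), (1, 1), (-1, 3)]), ((-1, -1), [(-2, 1),
      (1, -2), (1, 1)])], (1, 0, 0, 1), 7),
     ([(-1, 0), (1, -4), (1, 4)], [((-1, 0), [(-1, 0), (1, -4), (1, 3), (-1, 1)]), ((-1, 0), [(-1, 0),
      (1, -4), (1, 2), (-1, 2)]), ((-1, 0), [(-1, 0), (1, -4), (1, 1), (-1, 3)]), ((-1, 0), [(-1, 0),
      (1, -4), (1, 0), (-1, 4)])], (1, 0, 2, 1), 8)]"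

lemma chain_mut_equiv:
  assumes "ccw V" "chain_ok V S"
  shows "mut_equiv (hull2 V) (hull2 (chain_end V S)) \<and> ccw (chain_end V S)"
  using assms
proof (induction V S rule: chain_ok.induct)
  case (1 V)
  then show ?case by simp
next
  case (2 V w U S)
  then have "mutation_step (hull2 V) (hull2 U)" by (intro step_ok_sound) auto
  then show ?case using 2 mut_equiv_trans[OF r_into_equivclp] by simp
qed

lemma gl_hull2: "gl a b c d ` hull2 V = hull2 (map (gli a b c d) V)"
  by (simp add: hull2_def convex_hull_linear_image[OF linear_gl] image_image)

lemma certificate_sound:
  assumes "certificate_ok V C"
  shows "\<exists>i<length reps. mut_equiv (hull2 V) (hull2 (reps ! i))"
proof -
  obtain H S a b c d i where "C = (H, S, (a, b, c, d), i)" by (metis prod.exhaust)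
  then have H: "ccw H" "set H \<subseteq> set V" "\<And>x. x \<in> set V \<Longrightarrow> in_poly H x" "chain_ok H S"
    and M: "\<bar>a * d - b * c\<bar> = 1" "i < length reps"
      "set (map (gli a b c d) (chain_end H S)) = set (reps ! i)"
    using assms by (auto simp: certificate_ok_def list_all_iff)
  have HV: "hull2 V = hull2 H"
  proof
    show "hull2 V \<subseteq> hull2 H" using in_poly_hull[OF H(1) H(3)]
      unfolding hull2_def[of V] by (intro hull_minimal) (auto simp: hull2_def)
    show "hull2 H \<subseteq> hull2 V" unfolding hull2_def using H(2) by (intro hull_mono image_mono)
  qed
  define E where "E = hull2 (chain_end H S)"
  have E: "mut_equiv (hull2 V) E" "fano_polygon E"
    using chain_mut_equiv[OF H(1,4)] fano_ccw by (auto simp: HV E_def)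
  have R: "gl a b c d ` E = hull2 (reps ! i)"
    unfolding E_def gl_hull2 unfolding hull2_def M(3) ..
  have "ccw (reps ! i)" using reps_ccw M(2) by (simp add: list_all_length)
  then have "mutation_step E (hull2 (reps ! i))"
    unfolding mutation_step_def GL2Z_gl using E(2) fano_ccw R[symmetric] M(1) by blast
  then show ?thesis using mut_equiv_trans[OF E(1) r_into_equivclp] M(2) by blast
qed

lemma certificates_ok: "list_all2 certificate_ok (triangles @ shapes) certificates"
  by code_simp

lemma equivalent_to_representative:
  assumes "fano_polygon P" "empty_residual_basket P"
  shows "\<exists>i<10. mut_equiv P (representatives ! i)"
proof -
  have "tpolygon P" using assms by (simp add: tpolygon_def)
  then obtain V where V: "V \<in> set (triangles @ shapes)" "mut_equiv P (hull2 V)" using normal_form by blast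
  obtain C where "certificate_ok V C"
    using V(1) certificates_ok by (metis in_set_conv_nth list_all2_nthD)
  then obtain i where "i < length reps" "mut_equiv (hull2 V) (hull2 (reps ! i))" using certificate_sound by blast
  moreover have "length reps = 10" by (simp add: reps_def)
  ultimately show ?thesis using mut_equiv_trans[OF V(2)] by (auto simp: representatives_eq)
qed

section \<open>Residual baskets of the representatives\<close>

text \<open>The edge from \<open>p\<close> to \<open>q\<close> of height \<open>r\<close> and width \<open>k\<close> has \<open>det2 p q = r * k\<close>, and \<open>k\<close> is the content of
  \<open>nrm p q\<close>.\<close>

definition all_T :: "(int \<times> int) list \<Rightarrow> bool" where
  "all_T V \<longleftrightarrow> list_all (\<lambda>p. list_all (\<lambda>q. p = q \<or> list_ex (\<lambda>x. dot2 (nrm p q) x < - det2 p q) V \<or>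
     (gcd (fst (nrm p q)) (snd (nrm p q)))\<^sup>2 mod det2 p q = 0) V) V"

text \<open>Every edge of the hull starts and ends at listed points, so a test of all ordered pairs
  from \<open>V\<close> meets each edge with its height and width encoded in \<open>det2\<close> and
  \<open>nrm\<close>.\<close>

lemma edat_hull2:
  assumes f: "fano_polygon (hull2 V)" and e: "edat (hull2 V) w r p k"
  defines "q \<equiv> (fst p + k * snd w, snd p - k * fst w)"
  shows "p \<in> set V" "q \<in> set V" "nrm p q = (k * fst w, k * snd w)" "det2 p q = k * r"
proof -
  have "pt p extreme_point_of hull2 V" "pt q extreme_point_of hull2 V"
    unfolding q_def by (rule edat_ends_extreme[OF f e])+
  then have "pt p \<in> pt ` set V" "pt q \<in> pt ` set V"
    using extreme_point_of_convex_hull unfolding hull2_def by blast+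
  then show "p \<in> set V" "q \<in> set V" by (auto simp: inj_image_mem_iff)
  show "nrm p q = (k * fst w, k * snd w)" by (simp add: nrm_def q_def)
  have "det2 p q = - k * (fst w * fst p + snd w * snd p)" by (simp add: det2_def q_def algebra_simps)
  then show "det2 p q = k * r" unfolding edat_dot[OF e] by simp
qed

lemma all_T_basket:
  assumes f: "fano_polygon (hull2 V)" and T: "all_T V"
  shows "empty_residual_basket (hull2 V)"
proof (rule basketI[OF f])
  fix w r p k assume e: "edat (hull2 V) w r p k"
  define q where "q = (fst p + k * snd w, snd p - k * fst w)"
  note pq = edat_hull2[OF f e, folded q_def]
  have w: "coprime (fst w) (snd w)" and pos: "0 < k" "0 < r" using e by (auto simp: edat_def)
  have "\<not> dot2 (nrm p q) x < - det2 p q" if x: "x \<in> set V" for x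
  proof -
    have "pt x \<in> hull2 V" unfolding hull2_def using x by (intro hull_inc) auto
    then have "- r \<le> dot2 w x" using edat_ge_pt[OF e] by (simp add: dot2_def)
    then have "k * (- r) \<le> k * dot2 w x" using pos(1) by (intro mult_left_mono) auto
    then show ?thesis unfolding pq(3,4) by (simp add: dot2_def algebra_simps)
  qed
  moreover have "p \<noteq> q"
  proof
    assume "p = q"
    then have "k * r = 0" using pq(4) by (simp add: det2_def)
    then show False using pos by simp
  qed
  moreover have "p = q \<or> (\<exists>x\<in>set V. dot2 (nrm p q) x < - det2 p q) \<or>
     (gcd (fst (nrm p q)) (snd (nrm p q)))\<^sup>2 mod det2 p q = 0"
    using T pq(1,2) unfolding all_T_def list_all_iff list_ex_iff by blast
  ultimately have "(gcd (fst (nrm p q)) (snd (nrm p q)))\<^sup>2 mod det2 p q = 0" by blast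
  then have "(gcd (k * fst w) (k * snd w))\<^sup>2 mod (k * r) = 0" unfolding pq(3,4) by simp
  moreover have "gcd (k * fst w) (k * snd w) = k"
    using w pos(1) by (simp add: gcd_mult_left coprime_iff_gcd_eq_1[symmetric])
  ultimately have "k * r dvd k * k" by (auto simp: power2_eq_square)
  then show "r dvd k" using pos(1) by simp
qed

lemma reps_all_T: "list_all all_T reps"
  unfolding reps_def by code_simp

lemma representatives_empty_basket: "P \<in> set representatives \<Longrightarrow> fano_polygon P \<and> empty_residual_basket P"
  using reps_ccw reps_all_T fano_ccw all_T_basket by (auto simp: representatives_eq list_all_iff)

section \<open>Counting the polar lattice points of the representatives\<close>

definition polar_list :: "(int \<times> int) list \<Rightarrow> (int \<times> int) list" where
  "polar_list V = filter (\<lambda>u. list_all (\<lambda>p. - 1 \<le> dot2 u p) V) (List.product [-2..2] [-2..2])"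

lemma polar_hull2: "polar (hull2 V) = {u. \<forall>p\<in>set V. - 1 \<le> dot2 u p}"
proof (intro set_eqI iffI)
  fix u assume u: "u \<in> polar (hull2 V)"
  have "- 1 \<le> dot2 u p" if p: "p \<in> set V" for p
  proof -
    have "pt p \<in> hull2 V" unfolding hull2_def using p by (intro hull_inc) auto
    then have "- 1 \<le> pt u \<bullet> pt p" using u by (simp add: polar_def)
    then have "of_int (- 1) \<le> (of_int (dot2 u p) :: real)" by (simp add: pt_dot2)
    then show ?thesis by (simp only: of_int_le_iff)
  qed
  then show "u \<in> {u. \<forall>p\<in>set V. - 1 \<le> dot2 u p}" by simp
next
  fix u assume u: "u \<in> {u. \<forall>p\<in>set V. - 1 \<le> dot2 u p}"
  have "- 1 \<le> pt u \<bullet> z" if z: "z \<in> hull2 V" for z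
  proof (rule hull_ge[OF _ z[unfolded hull2_def]])
    fix s assume "s \<in> pt ` set V"
    then obtain p where p: "s = pt p" "p \<in> set V" by blast
    then have "- 1 \<le> dot2 u p" using u by simp
    then have "of_int (- 1) \<le> (of_int (dot2 u p) :: real)" by (simp only: of_int_le_iff)
    then show "- 1 \<le> pt u \<bullet> s" by (simp add: p pt_dot2)
  qed
  then show "u \<in> polar (hull2 V)" by (simp add: polar_def)
qed

text \<open>Justifies the finite search box. The bound 2 is attained: the polar polygon of the first
  representative has the vertices \<open>(-1, -1)\<close>, \<open>(2, -1)\<close> and
  \<open>(-1, 2)\<close>.\<close>

lemma reps_polar_bound:
  "\<forall>V\<in>set reps. (\<forall>p\<in>set V. - 1 \<le> dot2 (x, y) p) \<longrightarrow> - 2 \<le> x \<and> x \<le> 2 \<and> - 2 \<le> y \<and> y \<le> 2"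
  by (simp add: reps_def dot2_def; intro conjI impI; presburger)

lemma reps_polar:
  assumes "V \<in> set reps"
  shows "card (polar (hull2 V)) = length (polar_list V)"
proof -
  have "polar (hull2 V) = set (polar_list V)"
  proof (intro set_eqI iffI)
    fix u assume "u \<in> polar (hull2 V)"
    then have h: "\<forall>p\<in>set V. - 1 \<le> dot2 u p" by (simp add: polar_hull2)
    then have "- 2 \<le> fst u \<and> fst u \<le> 2 \<and> - 2 \<le> snd u \<and> snd u \<le> 2"
      using reps_polar_bound[of "fst u" "snd u", rule_format, OF assms] by simp
    then have "u \<in> set (List.product [-2..2] [-2..2])"
      unfolding set_product set_upto mem_Times_iff atLeastAtMost_iff by simp
    then show "u \<in> set (polar_list V)" unfolding polar_list_def set_filter list_all_iff using h by blast
  next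
    fix u assume "u \<in> set (polar_list V)"
    then show "u \<in> polar (hull2 V)"
      unfolding polar_hull2 polar_list_def set_filter list_all_iff by blast
  qed
  moreover have "distinct (polar_list V)" unfolding polar_list_def
    by (intro distinct_filter distinct_product distinct_upto)
  ultimately show ?thesis by (simp add: distinct_card)
qed

text \<open>These numbers exceed by one the degrees 9, 8, 8, 7, 6, 5, 4, 3, 2, 1 of the del Pezzo
  surfaces. The tie in degree 8 is between the polygon of a product of two projective lines and that
  of the projective plane blown up in one point.\<close>

lemma reps_polar_counts: "map (\<lambda>V. length (polar_list V)) reps = [10, 9, 9, 8, 7, 6, 5, 4, 3, 2]"
  by code_simp

section \<open>Parity of the edge normals of the representatives\<close>

lemma minf_hull2: "minf (pt u) (hull2 V) = convex hull (pt ` {p \<in> set V. \<forall>q\<in>set V. dot2 u p \<le> dot2 u q})"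
  (is "_ = convex hull (pt ` ?M)")
proof
  have le: "dot2 u p \<le> dot2 u q \<longleftrightarrow> pt u \<bullet> pt p \<le> pt u \<bullet> pt q" for p q by (simp add: pt_dot2)
  have inV: "pt p \<in> hull2 V" if "p \<in> set V" for p unfolding hull2_def using that by (intro hull_inc) auto
  have face: "minf (pt u) (hull2 V) face_of hull2 V" by (rule minf_face) (simp add: hull2_def)
  obtain S where S: "S \<subseteq> pt ` set V" "minf (pt u) (hull2 V) = convex hull S"
    using face_of_convex_hull_subset[OF _ face[unfolded hull2_def]] unfolding hull2_def
    by (metis List.finite_set finite_imageI finite_imp_compact)
  have "S \<subseteq> pt ` ?M"
  proof
    fix s assume s: "s \<in> S"
    then obtain p where p: "s = pt p" "p \<in> set V" using S(1) by blast
    have "s \<in> minf (pt u) (hull2 V)" unfolding S(2) using s by (rule hull_inc)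
    then have "\<forall>q\<in>set V. dot2 u p \<le> dot2 u q" unfolding le minf_iff p(1) using inV by blast
    then show "s \<in> pt ` ?M" using p by blast
  qed
  then show "minf (pt u) (hull2 V) \<subseteq> convex hull (pt ` ?M)" unfolding S(2) by (rule hull_mono)
  show "convex hull (pt ` ?M) \<subseteq> minf (pt u) (hull2 V)"
  proof (rule hull_minimal)
    show "convex (minf (pt u) (hull2 V))" by (rule face_of_imp_convex[OF face])
    show "pt ` ?M \<subseteq> minf (pt u) (hull2 V)"
    proof
      fix s assume "s \<in> pt ` ?M"
      then obtain p where p: "s = pt p" "p \<in> set V" "\<And>q. q \<in> set V \<Longrightarrow> dot2 u p \<le> dot2 u q" by blast
      have "pt u \<bullet> pt p \<le> pt u \<bullet> z" if z: "z \<in> hull2 V" for z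
      proof (rule hull_ge[OF _ z[unfolded hull2_def]])
        fix t assume "t \<in> pt ` set V"
        then show "pt u \<bullet> pt p \<le> pt u \<bullet> t" using p(3) le by blast
      qed
      then show "s \<in> minf (pt u) (hull2 V)" unfolding minf_iff p(1) using inV[OF p(2)] by blast
    qed
  qed
qed

text \<open>A minimising face is the hull of the listed points on it, so it has two distinct points
  if and only if two distinct listed points lie on it. The parity condition therefore concerns pairs
  from \<open>V\<close> only.\<close>

lemma even_normals_hull2:
  "even_normals (hull2 V) \<longleftrightarrow> (\<exists>c. \<not> (even (fst c) \<and> even (snd c)) \<and> (\<forall>u. \<forall>p\<in>set V. \<forall>q\<in>set V.
     p \<noteq> q \<and> (\<forall>x\<in>set V. dot2 u p \<le> dot2 u x \<and> dot2 u q \<le> dot2 u x) \<longrightarrow> even (dot2 u c)))"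
proof -
  have "(\<exists>x y. x \<in> minf (pt u) (hull2 V) \<and> y \<in> minf (pt u) (hull2 V) \<and> x \<noteq> y) \<longleftrightarrow>
    (\<exists>p\<in>set V. \<exists>q\<in>set V. p \<noteq> q \<and> (\<forall>x\<in>set V. dot2 u p \<le> dot2 u x \<and> dot2 u q \<le> dot2 u x))" for u
  proof
    assume "\<exists>x y. x \<in> minf (pt u) (hull2 V) \<and> y \<in> minf (pt u) (hull2 V) \<and> x \<noteq> y"
    then obtain x y where xy: "x \<in> minf (pt u) (hull2 V)" "y \<in> minf (pt u) (hull2 V)" "x \<noteq> y" by blast
    define M where "M = {p \<in> set V. \<forall>q\<in>set V. dot2 u p \<le> dot2 u q}"
    have xM: "x \<in> convex hull (pt ` M)" "y \<in> convex hull (pt ` M)" using xy unfolding minf_hull2 M_def by auto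
    then have "M \<noteq> {}" by auto
    then obtain p where p: "p \<in> M" by blast
    have "\<exists>q\<in>M. q \<noteq> p"
    proof (rule ccontr)
      assume "\<not> ?thesis"
      then have "M = {p}" using p by blast
      then show False using xM xy(3) by simp
    qed
    then show "\<exists>p\<in>set V. \<exists>q\<in>set V. p \<noteq> q \<and> (\<forall>x\<in>set V. dot2 u p \<le> dot2 u x \<and> dot2 u q \<le> dot2 u x)"
      using p unfolding M_def by blast
  next
    assume "\<exists>p\<in>set V. \<exists>q\<in>set V. p \<noteq> q \<and> (\<forall>x\<in>set V. dot2 u p \<le> dot2 u x \<and> dot2 u q \<le> dot2 u x)"
    then obtain p q where pq: "p \<in> set V" "q \<in> set V" "p \<noteq> q" "\<forall>x\<in>set V. dot2 u p \<le> dot2 u x \<and> dot2 u q \<le> dot2 u x"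
      by blast
    then have "pt p \<in> minf (pt u) (hull2 V)" "pt q \<in> minf (pt u) (hull2 V)" "pt p \<noteq> pt q"
      unfolding minf_hull2 by (auto intro!: hull_inc)
    then show "\<exists>x y. x \<in> minf (pt u) (hull2 V) \<and> y \<in> minf (pt u) (hull2 V) \<and> x \<noteq> y" by blast
  qed
  then have "(\<forall>x y. x \<in> minf (pt u) (hull2 V) \<and> y \<in> minf (pt u) (hull2 V) \<and> x \<noteq> y \<longrightarrow> B) \<longleftrightarrow>
    (\<forall>p\<in>set V. \<forall>q\<in>set V. p \<noteq> q \<and> (\<forall>x\<in>set V. dot2 u p \<le> dot2 u x \<and> dot2 u q \<le> dot2 u x) \<longrightarrow> B)" for u B
    by blast
  then show ?thesis unfolding even_normals_def by (simp add: dot2_def)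
qed

lemma even_normals_diamond: "even_normals (hull2 (reps ! 1))"
proof -
  have "even (dot2 u (1, 1))"
    if pq: "p \<in> set (reps ! 1)" "q \<in> set (reps ! 1)" "p \<noteq> q"
      "\<forall>x\<in>set (reps ! 1). dot2 u p \<le> dot2 u x \<and> dot2 u q \<le> dot2 u x" for u p q
  proof -
    have "dot2 u p = dot2 u q" using pq by (meson order_antisym)
    \<comment> \<open>Two distinct vertices of the diamond at which \<open>u\<close> is minimal are
      adjacent unless \<open>u\<close> is zero, so the coordinates of \<open>u\<close> agree up to
      sign. This is the reason for the choice \<open>c = (1, 1)\<close>.\<close>
    then have "fst u = snd u \<or> fst u = - snd u"
      using pq by (auto simp: reps_def dot2_def)
    then show ?thesis by (auto simp: dot2_def)
  qed
  then show ?thesis unfolding even_normals_hull2 by (intro exI[of _ "(1, 1)"]) auto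
qed

lemma not_even_normals: "\<not> even_normals (hull2 (reps ! 2))"
proof
  assume "even_normals (hull2 (reps ! 2))"
  then obtain c where c: "\<not> (even (fst c) \<and> even (snd c))"
    and h: "\<forall>u. \<forall>p\<in>set (reps ! 2). \<forall>q\<in>set (reps ! 2).
      p \<noteq> q \<and> (\<forall>x\<in>set (reps ! 2). dot2 u p \<le> dot2 u x \<and> dot2 u q \<le> dot2 u x) \<longrightarrow> even (dot2 u c)"
    unfolding even_normals_hull2 by (elim exE conjE)
  \<comment> \<open>Two edge normals of this polygon, \<open>(-1, -1)\<close> and
    \<open>(2, -1)\<close>, have the odd determinant 3. They span the dual lattice modulo 2, so no
    nonzero class \<open>c\<close> is orthogonal to both.\<close>
  have "even (dot2 (-1, -1) c)" by (rule h[rule_format, of "(1, 0)" "(0, 1)"]) (auto simp: reps_def dot2_def)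
  moreover have "even (dot2 (2, -1) c)" by (rule h[rule_format, of "(0, 1)" "(-1, -1)"]) (auto simp: reps_def dot2_def)
  ultimately show False using c by (auto simp: dot2_def)
qed

lemma representatives_inequivalent:
  assumes ij: "i < 10" "j < 10" and eq: "mut_equiv (representatives ! i) (representatives ! j)"
  shows "i = j"
proof -
  have len: "length reps = 10" by (simp add: reps_def)
  have rep: "representatives ! m = hull2 (reps ! m)" if "m < 10" for m using that len by (simp add: representatives_eq)
  have count: "card (polar (representatives ! m)) = [10, 9, 9, 8, 7, 6, 5, 4, 3, 2] ! m" if m: "m < 10" for m
    using m len reps_polar[of "reps ! m"] unfolding rep[OF m] reps_polar_counts[symmetric] by simp
  have "[10, 9, 9, 8, 7, 6, 5, 4, 3, 2] ! i = ([10, 9, 9, 8, 7, 6, 5, 4, 3, 2] ! j :: nat)"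
    using equivalence_invariants(1)[OF eq] count ij by simp
  moreover have "i \<in> {0, 1, 2, 3, 4, 5, 6, 7, 8, 9}" "j \<in> {0, 1, 2, 3, 4, 5, 6, 7, 8, 9}" using ij by auto
  ultimately have "i = j \<or> i = 1 \<and> j = 2 \<or> i = 2 \<and> j = 1" by auto
  then show ?thesis
    using equivalence_invariants(2)[OF eq] even_normals_diamond not_even_normals rep by auto
qed

theorem theorem5p6:
  shows "card (empty_basket_polygons // mutation_equivalence) = 10
    \<and> set representatives \<subseteq> empty_basket_polygons
    \<and> bij_betw (\<lambda>i. mutation_equivalence `` {representatives ! i}) {..<10}
        (empty_basket_polygons // mutation_equivalence)"
proof -
  let ?f = "\<lambda>i. mutation_equivalence `` {representatives ! i}"
  have sub: "set representatives \<subseteq> empty_basket_polygons"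
    using representatives_empty_basket by (auto simp: empty_basket_polygons_def)
  have mem: "representatives ! i \<in> empty_basket_polygons" if "i < 10" for i
  proof -
    have "length representatives = 10" by (simp add: representatives_def)
    then show ?thesis using sub that nth_mem[of i representatives] by (metis subsetD)
  qed
  then have fano: "fano_polygon (representatives ! i)" if "i < 10" for i
    using that by (simp add: empty_basket_polygons_def)
  have img: "?f i = mutation_equivalence `` {P}"
    if "i < 10" "fano_polygon P" "mut_equiv P (representatives ! i)" for i P
  proof -
    have "mut_equiv (representatives ! i) Q \<longleftrightarrow> mut_equiv P Q" for Q
      using equivclp_trans[OF that(3), of Q] equivclp_trans[OF equivclp_sym[OF that(3)], of Q] by (rule iffI)
    then show ?thesis unfolding mutation_equivalence_def Image_singleton
      using fano[OF that(1)] that(2) by simp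
  qed
  have bij: "bij_betw ?f {..<10} (empty_basket_polygons // mutation_equivalence)"
    unfolding bij_betw_def
  proof
    show "inj_on ?f {..<10}"
    proof
      fix i j :: nat assume ij: "i \<in> {..<10}" "j \<in> {..<10}" "?f i = ?f j"
      have "representatives ! j \<in> ?f j" using fano ij(2) by (simp add: mutation_equivalence_def)
      then have "mut_equiv (representatives ! i) (representatives ! j)"
        unfolding ij(3)[symmetric] by (simp add: mutation_equivalence_def)
      then show "i = j" using representatives_inequivalent ij(1,2) by simp
    qed
    show "?f ` {..<10} = empty_basket_polygons // mutation_equivalence"
    proof
      show "?f ` {..<10} \<subseteq> empty_basket_polygons // mutation_equivalence"
        using mem by (auto intro: quotientI)
      show "empty_basket_polygons // mutation_equivalence \<subseteq> ?f ` {..<10}"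
      proof
        fix C assume "C \<in> empty_basket_polygons // mutation_equivalence"
        then obtain P where P: "C = mutation_equivalence `` {P}" "fano_polygon P" "empty_residual_basket P"
          by (auto simp: quotient_def empty_basket_polygons_def)
        obtain i where i: "i < 10" "mut_equiv P (representatives ! i)"
          using equivalent_to_representative[OF P(2,3)] by blast
        then show "C \<in> ?f ` {..<10}" using img[OF i(1) P(2) i(2)] P(1) by blast
      qed
    qed
  qed
  moreover have "card (empty_basket_polygons // mutation_equivalence) = 10"
    using bij_betw_same_card[OF bij] by simp
  ultimately show ?thesis using sub by blast
qed

end
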